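(* Fix $h\ge 0$ and $D\in\mathbb{R}$. There exists $\beta'>0$ such that for every $\beta\in(0,\beta')$ the following holds. Fix an integer $n\ge1$ and nonnegative integers $\{m(k,l): 1\le k\le l\le n\}$, and put $m=\sum_{1\le k\le l\le n}m(k,l)$. Let $\{\eta_{k,l}: 1\le k\le l\le n\}$ be a centered jointly Gaussian family with covariances $$\mathrm{Cov}(\eta_{k,l},\eta_{k',l'})=\begin{cases}A_2^2\,\mathbf 1\{\{k,l\}=\{k',l'\}\}+|\{k,l\}\cap\{k',l'\}|\,A_1^2+A_0^2, & \text{if } k\neq l,\ k'\ne l',\\ B_1^2\,\mathbf 1\{|\{k,l\}\cap\{k',l'\}|=1\}+B_0^2, & \text{if } k=l,\ k'=l',\\ C_1^2\,\mathbf 1\{|\{k,l\}\cap\{k',l'\}|=1\}+C_0^2, & \text{if exactly one of the pairs has equal entries.}\end{cases}$$ Then $$\nu\Big(\prod_{1\le k\le l\le n}(R_{k,l}-Q_{k,l})^{m(k,l)}\Big)=\mathbb{E}\Big[\prod_{1\le k\le l\le n}\eta_{k,l}^{m(k,l)}\Big]+O\big(N^{-(m+1)/2}\big),$$ where the implied constant does not depend on $N$.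
   Context: Fix an integer $\mathcal S\ge1$ and $N\ge2$; let $\Sigma_N=\{0,\pm1,\dots,\pm\mathcal S\}^N$. For $\beta>0$, $h\ge0$, $D\in\mathbb R$ and i.i.d. standard Gaussians $(g_{i,j})_{1\le i<j\le N}$ (the disorder), the Ghatak–Sherrington Hamiltonian is $H_N(\sigma)=\frac{\beta}{\sqrt N}\sum_{i<j}g_{i,j}\sigma_i\sigma_j+D\sum_{i}\sigma_i^2+h\sum_i\sigma_i$ and the Gibbs measure on $\Sigma_N$ is $G(\sigma)=e^{H_N(\sigma)}/\sum_{\sigma'\in\Sigma_N}e^{H_N(\sigma')}$. Replicas $\sigma^1,\sigma^2,\dots$ are i.i.d. samples from $G$ given the disorder; $\langle\cdot\rangle$ denotes the average under the product Gibbs measure and $\nu(f)=\mathbb E\langle f\rangle$, with $\mathbb E$ the expectation over the disorder. Overlaps: $R_{k,l}=\frac1N\sum_{i=1}^N\sigma_i^k\sigma_i^l$ ($k=l$ gives the self-overlap). The numbers $p,q$: for $\eta\sim N(0,1)$ and $\phi:\{0,\pm1,\dots,\pm\mathcal S\}\to\mathbb R$ set $\langle\phi\rangle_\eta=\sum_s\phi(s)w_\eta(s)/\sum_sw_\eta(s)$ with $w_\eta(s)=\exp\big(\beta\sqrt q\,\eta s+hs+(D+\tfrac{\beta^2}{2}(p-q))s^2\big)$; $(p,q)$ is the solution (unique in the high-temperature regime) of $q=\mathbb E[\langle s\rangle_\eta^2]$, $p=\mathbb E[\langle s^2\rangle_\eta]$; these are the values around which $R_{1,2}$ and $R_{1,1}$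 concentrate ($\nu((R_{1,2}-q)^2)\le16\mathcal S^2/N$, $\nu((R_{1,1}-p)^2)\le 16\mathcal S^4/N$). Set $Q_{k,l}=q$ if $k\ne l$ and $Q_{k,l}=p$ if $k=l$. Constants: write $m_j=\langle s^j\rangle_\eta$ and let all expectations below be over $\eta$. $A=\mathbb E[(m_2-m_1^2)^2]$, $\mathcal D=\mathbb E[m_4-m_2^2]$, $F=\mathbb E[m_2^2-m_1^2m_2]$, $G=\mathbb E[m_1^2(m_2-m_1^2)]$, $\mathcal E=\mathbb E[m_1(m_3-m_1m_2)]$, $I_3=\mathbb E[m_1^4]-q^2$, $I_5=\mathbb E[m_1^2m_2]-pq$, $K_4=\mathbb E[m_2^2]-p^2$. $M_1=1-\beta^2(F-3G)$, $M_2=1-\frac{\beta^2}{2}\mathcal D$, $M_3=1-\beta^2(F-G)$, $M=M_1M_2+\beta^4\mathcal E^2$. Then $A_2^2=\frac{A}{N(1-\beta^2A)}$, $A_1^2=\frac{GM_2+\frac{\beta^2}{2}\mathcal E^2}{NMM_3}$, $B_1^2=\frac{\mathcal DM_1-2\beta^2\mathcal E^2}{NM}$, $C_1^2=\frac{\mathcal E}{NM}$, $A_0^2=\frac{\beta^2}{M}(\beta^2\mathcal EK_4+M_2I_5)C_1^2+\frac{2\beta^2}{M}(\beta^2\mathcal E(\mathcal E-I_5)+M_2(2G-I_3))A_1^2+\frac{\beta^2}{M}(\beta^2\mathcal EI_5+M_2I_3)A_2^2+\frac{1}{MN}(\beta^2\mathcal EI_5+M_2I_3)$, $B_0^2=\frac{\beta^2}{2M}(M_1K_4-\beta^2\mathcal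 EI_5)B_1^2+\frac{\beta^2}{M}(M_1(\mathcal E-I_5)-\beta^2\mathcal E(2G-I_3))C_1^2+\frac{1}{MN}(M_1K_4-\beta^2\mathcal EI_5)$, $C_0^2=\frac{\beta^2}{2M}(M_2I_5+\beta^2\mathcal EK_4)B_1^2+\frac{\beta^2}{M}(M_2(2G-I_3)+\beta^2\mathcal E(\mathcal E-I_5))C_1^2+\frac{1}{MN}(M_2I_5+\beta^2\mathcal EK_4)$. *)

theory Defs
  imports "HOL-Probability.Probability"
begin

definition Eg :: "(real \<Rightarrow> real) \<Rightarrow> real" where
  "Eg f = (LINT t|lborel. std_normal_density t * f t)"

definition spins :: "nat \<Rightarrow> int set" where
  "spins S = {- int S .. int S}"

definition configs :: "nat \<Rightarrow> nat \<Rightarrow> (nat \<Rightarrow> int) set" where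
  "configs S N = PiE {..<N} (\<lambda>_. spins S)"

definition dis_idx :: "nat \<Rightarrow> (nat \<times> nat) set" where
  "dis_idx N = {(i,j). i < j \<and> j < N}"

definition disorder :: "nat \<Rightarrow> (nat \<times> nat \<Rightarrow> real) measure" where
  "disorder N = PiM (dis_idx N) (\<lambda>_. density lborel std_normal_density)"

definition GS_H :: "real \<Rightarrow> real \<Rightarrow> real \<Rightarrow> nat \<Rightarrow> (nat \<times> nat \<Rightarrow> real) \<Rightarrow> (nat \<Rightarrow> int) \<Rightarrow> real" where
  "GS_H \<beta> h D N g \<sigma> =
     \<beta> / sqrt (real N) * (\<Sum>(i,j)\<in>dis_idx N. g (i,j) * of_int (\<sigma> i) * of_int (\<sigma> j))
     + D * (\<Sum>i<N. of_int (\<sigma> i) ^ 2) + h * (\<Sum>i<N. of_int (\<sigma> i))"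

definition gibbs :: "nat \<Rightarrow> real \<Rightarrow> real \<Rightarrow> real \<Rightarrow> nat \<Rightarrow> (nat \<times> nat \<Rightarrow> real) \<Rightarrow> (nat \<Rightarrow> int) \<Rightarrow> real" where
  "gibbs S \<beta> h D N g \<sigma> =
     exp (GS_H \<beta> h D N g \<sigma>) / (\<Sum>\<tau>\<in>configs S N. exp (GS_H \<beta> h D N g \<tau>))"

definition gibbs_avg :: "nat \<Rightarrow> real \<Rightarrow> real \<Rightarrow> real \<Rightarrow> nat \<Rightarrow> (nat \<times> nat \<Rightarrow> real) \<Rightarrow> nat
     \<Rightarrow> ((nat \<Rightarrow> nat \<Rightarrow> int) \<Rightarrow> real) \<Rightarrow> real" where
  "gibbs_avg S \<beta> h D N g n f =
     (\<Sum>\<sigma>\<in>PiE {1..n} (\<lambda>_. configs S N). f \<sigma> * (\<Prod>k\<in>{1..n}. gibbs S \<beta> h D N g (\<sigma> k)))"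

definition nu :: "nat \<Rightarrow> real \<Rightarrow> real \<Rightarrow> real \<Rightarrow> nat \<Rightarrow> nat \<Rightarrow> ((nat \<Rightarrow> nat \<Rightarrow> int) \<Rightarrow> real) \<Rightarrow> real" where
  "nu S \<beta> h D N n f = (\<integral>g. gibbs_avg S \<beta> h D N g n f \<partial>disorder N)"

definition overlap :: "nat \<Rightarrow> (nat \<Rightarrow> nat \<Rightarrow> int) \<Rightarrow> nat \<Rightarrow> nat \<Rightarrow> real" where
  "overlap N \<sigma> k l = (1 / real N) * (\<Sum>i<N. of_int (\<sigma> k i) * of_int (\<sigma> l i))"

definition Qpq :: "real \<Rightarrow> real \<Rightarrow> nat \<Rightarrow> nat \<Rightarrow> real" where
  "Qpq p q k l = (if k = l then p else q)"

definition pairs :: "nat \<Rightarrow> (nat \<times> nat) set" where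
  "pairs n = {(k,l). 1 \<le> k \<and> k \<le> l \<and> l \<le> n}"

definition wgt :: "nat \<Rightarrow> real \<Rightarrow> real \<Rightarrow> real \<Rightarrow> real \<Rightarrow> real \<Rightarrow> real \<Rightarrow> int \<Rightarrow> real" where
  "wgt S \<beta> h D p q t s =
     exp (\<beta> * sqrt q * t * of_int s + h * of_int s + (D + \<beta>\<^sup>2 / 2 * (p - q)) * of_int s ^ 2)"

definition mom :: "nat \<Rightarrow> real \<Rightarrow> real \<Rightarrow> real \<Rightarrow> real \<Rightarrow> real \<Rightarrow> nat \<Rightarrow> real \<Rightarrow> real" where
  "mom S \<beta> h D p q j t =
     (\<Sum>s\<in>spins S. of_int s ^ j * wgt S \<beta> h D p q t s) / (\<Sum>s\<in>spins S. wgt S \<beta> h D p q t s)"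

definition pq_fixed_point :: "nat \<Rightarrow> real \<Rightarrow> real \<Rightarrow> real \<Rightarrow> real \<Rightarrow> real \<Rightarrow> bool" where
  "pq_fixed_point S \<beta> h D p q \<longleftrightarrow>
     q = Eg (\<lambda>t. (mom S \<beta> h D p q 1 t)\<^sup>2) \<and> p = Eg (\<lambda>t. mom S \<beta> h D p q 2 t)"

context
  fixes S :: nat and \<beta> h D p q :: real
begin

private abbreviation "m j t \<equiv> mom S \<beta> h D p q j t"

definition "cA = Eg (\<lambda>t. (m 2 t - (m 1 t)\<^sup>2)\<^sup>2)"
definition "cD = Eg (\<lambda>t. m 4 t - (m 2 t)\<^sup>2)"
definition "cF = Eg (\<lambda>t. (m 2 t)\<^sup>2 - (m 1 t)\<^sup>2 * m 2 t)"
definition "cG = Eg (\<lambda>t. (m 1 t)\<^sup>2 * (m 2 t - (m 1 t)\<^sup>2))"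
definition "cE = Eg (\<lambda>t. m 1 t * (m 3 t - m 1 t * m 2 t))"
definition "cI3 = Eg (\<lambda>t. (m 1 t) ^ 4) - q\<^sup>2"
definition "cI5 = Eg (\<lambda>t. (m 1 t)\<^sup>2 * m 2 t) - p * q"
definition "cK4 = Eg (\<lambda>t. (m 2 t)\<^sup>2) - p\<^sup>2"
definition "cM1 = 1 - \<beta>\<^sup>2 * (cF - 3 * cG)"
definition "cM2 = 1 - \<beta>\<^sup>2 / 2 * cD"
definition "cM3 = 1 - \<beta>\<^sup>2 * (cF - cG)"
definition "cM = cM1 * cM2 + \<beta> ^ 4 * cE\<^sup>2"

definition A2sq :: "nat \<Rightarrow> real" where
  "A2sq N = cA / (real N * (1 - \<beta>\<^sup>2 * cA))"
definition A1sq :: "nat \<Rightarrow> real" where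
  "A1sq N = (cG * cM2 + \<beta>\<^sup>2 / 2 * cE\<^sup>2) / (real N * cM * cM3)"
definition B1sq :: "nat \<Rightarrow> real" where
  "B1sq N = (cD * cM1 - 2 * \<beta>\<^sup>2 * cE\<^sup>2) / (real N * cM)"
definition C1sq :: "nat \<Rightarrow> real" where
  "C1sq N = cE / (real N * cM)"
definition A0sq :: "nat \<Rightarrow> real" where
  "A0sq N =
     \<beta>\<^sup>2 / cM * (\<beta>\<^sup>2 * cE * cK4 + cM2 * cI5) * C1sq N
   + 2 * \<beta>\<^sup>2 / cM * (\<beta>\<^sup>2 * cE * (cE - cI5) + cM2 * (2 * cG - cI3)) * A1sq N
   + \<beta>\<^sup>2 / cM * (\<beta>\<^sup>2 * cE * cI5 + cM2 * cI3) * A2sq N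
   + 1 / (cM * real N) * (\<beta>\<^sup>2 * cE * cI5 + cM2 * cI3)"
definition B0sq :: "nat \<Rightarrow> real" where
  "B0sq N =
     \<beta>\<^sup>2 / (2 * cM) * (cM1 * cK4 - \<beta>\<^sup>2 * cE * cI5) * B1sq N
   + \<beta>\<^sup>2 / cM * (cM1 * (cE - cI5) - \<beta>\<^sup>2 * cE * (2 * cG - cI3)) * C1sq N
   + 1 / (cM * real N) * (cM1 * cK4 - \<beta>\<^sup>2 * cE * cI5)"
definition C0sq :: "nat \<Rightarrow> real" where
  "C0sq N =
     \<beta>\<^sup>2 / (2 * cM) * (cM2 * cI5 + \<beta>\<^sup>2 * cE * cK4) * B1sq N
   + \<beta>\<^sup>2 / cM * (cM2 * (2 * cG - cI3) + \<beta>\<^sup>2 * cE * (cE - cI5)) * C1sq N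
   + 1 / (cM * real N) * (cM2 * cI5 + \<beta>\<^sup>2 * cE * cK4)"

definition eta_cov :: "nat \<Rightarrow> nat \<times> nat \<Rightarrow> nat \<times> nat \<Rightarrow> real" where
  "eta_cov N kl kl' =
     (let (k,l) = kl; (k',l') = kl'; c = card ({k,l} \<inter> {k',l'}) in
      if k \<noteq> l \<and> k' \<noteq> l' then
        A2sq N * (if {k,l} = {k',l'} then 1 else 0) + real c * A1sq N + A0sq N
      else if k = l \<and> k' = l' then
        B1sq N * (if c = 1 then 1 else 0) + B0sq N
      else
        C1sq N * (if c = 1 then 1 else 0) + C0sq N)"

end

definition centered_gaussian_family ::
    "'a measure \<Rightarrow> 'i set \<Rightarrow> ('i \<Rightarrow> 'a \<Rightarrow> real) \<Rightarrow> ('i \<Rightarrow> 'i \<Rightarrow> real) \<Rightarrow> bool" where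
  "centered_gaussian_family M I X \<Sigma> \<longleftrightarrow>
     prob_space M \<and> finite I \<and> (\<forall>i\<in>I. X i \<in> borel_measurable M) \<and>
     (\<forall>c :: 'i \<Rightarrow> real.
        let v = (\<Sum>i\<in>I. \<Sum>j\<in>I. c i * c j * \<Sigma> i j) in
        distr M borel (\<lambda>x. \<Sum>i\<in>I. c i * X i x)
          = (if v = 0 then return borel 0 else density lborel (normal_density 0 (sqrt v))))"

end

theory Submission
  imports Defs
begin

text \<open>By polarization it suffices to treat \<open>\<nu>(Y\<^sup>r)\<close> for linear forms \<open>Y = (\<Sum>x. \<gamma> x * (R\<^sub>x - Q\<^sub>x))\<close> of the centred
  overlaps.  In \<open>\<nu>((R\<^sub>a\<^sub>b - Q\<^sub>a\<^sub>b) Y\<^sup>r)\<close> the overlap is an average over sites.  Each site is decoupled from the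
  others by a Gaussian interpolation, along which the derivative of a Gibbs average is computed by Gaussian
  integration by parts.  A crude use of this bounds all even moments of the centred overlaps, as a contraction
  for small \<open>\<beta>\<close>; a second order expansion then gives, up to order \<open>N\<close> to the power \<open>-(r+2)/2\<close>, a closed linear
  system for the quantities \<open>\<nu>((R\<^sub>a\<^sub>b - Q\<^sub>a\<^sub>b) Y\<^sup>r)\<close>, with right-hand side proportional to \<open>r \<nu>(Y\<^sup>r\<^sup>-\<^sup>1) / N\<close>.
  The claimed covariances solve the same system, which is stable for small \<open>\<beta>\<close>.  Hence
  \<open>\<nu>(Y\<^sup>r\<^sup>+\<^sup>1) = r Var(Y) \<nu>(Y\<^sup>r\<^sup>-\<^sup>1)\<close> to leading order, which is the recursion for the moments of a centred Gaussian.\<close>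

section \<open>Replica averages\<close>

text \<open>The threshold for \<open>\<beta>\<close> may depend neither on \<open>n\<close> nor on
  the exponents, although the number of replicas and the order of the moments are arbitrary. For the
  even moments this works because a power of a single overlap involves at most two replicas and the
  derivative along the path only multiplies it by one further overlap. For the linear system it
  works because a function of two replicas that treats fresh replicas alike splits into components
  coupled in blocks of size at most two. Polarization serves both sides. Expanding a power of one
  linear form at a site only needs the binomial formula, without the bookkeeping of a product over
  pairs. The Gaussian family of the statement is described through the laws of its linear
  combinations, so powers of these are the moments that are directly available. They require the
  claimed variance to be nonnegative, which is not visible from its formula and has to be extracted
  from the asymptotics.\<close>

definition depends_on :: "'i set \<Rightarrow> (('i \<Rightarrow> 'c) \<Rightarrow> 'b) \<Rightarrow> bool" where
  "depends_on A f \<longleftrightarrow> (\<forall>\<sigma> \<sigma>'. (\<forall>a\<in>A. \<sigma> a = \<sigma>' a) \<longrightarrow> f \<sigma> = f \<sigma>')"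

named_theorems dep_intros

lemma depends_on_mono: "depends_on A f \<Longrightarrow> A \<subseteq> B \<Longrightarrow> depends_on B f"
  unfolding depends_on_def by blast

lemma depends_on_const [dep_intros]: "depends_on A (\<lambda>_. x)"
  by (simp add: depends_on_def)

lemma depends_on_1 [dep_intros]: "a \<in> A \<Longrightarrow> depends_on A (\<lambda>\<sigma>. h (\<sigma> a))"
  by (simp add: depends_on_def)

lemma depends_on_2 [dep_intros]: "a \<in> A \<Longrightarrow> b \<in> A \<Longrightarrow> depends_on A (\<lambda>\<sigma>. h (\<sigma> a) (\<sigma> b))"
  by (simp add: depends_on_def)

lemma depends_on_comp: "depends_on A f \<Longrightarrow> depends_on A (\<lambda>\<sigma>. h (f \<sigma>))"
  unfolding depends_on_def by metis

lemma depends_on_binop: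
  "depends_on A f \<Longrightarrow> depends_on A g \<Longrightarrow> depends_on A (\<lambda>\<sigma>. h (f \<sigma>) (g \<sigma>))"
  unfolding depends_on_def by metis

lemmas depends_on_mult [dep_intros] = depends_on_binop[where h="(*)"]
lemmas depends_on_add [dep_intros] = depends_on_binop[where h="(+)"]
lemmas depends_on_diff [dep_intros] = depends_on_binop[where h="(-)"]

lemma depends_on_power [dep_intros]: "depends_on A f \<Longrightarrow> depends_on A (\<lambda>\<sigma>. f \<sigma> ^ n)"
  by (rule depends_on_comp)

lemma depends_on_abs [dep_intros]: "depends_on A f \<Longrightarrow> depends_on A (\<lambda>\<sigma>. \<bar>f \<sigma>\<bar>)"
  by (rule depends_on_comp)

lemma depends_on_sum [dep_intros]:
  "(\<And>i. i \<in> I \<Longrightarrow> depends_on A (f i)) \<Longrightarrow> depends_on A (\<lambda>\<sigma>. \<Sum>i\<in>I. f i \<sigma>)"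
  unfolding depends_on_def by (metis (no_types, lifting) sum.cong)

lemma depends_on_prod [dep_intros]:
  "(\<And>i. i \<in> I \<Longrightarrow> depends_on A (f i)) \<Longrightarrow> depends_on A (\<lambda>\<sigma>. \<Prod>i\<in>I. f i \<sigma>)"
  unfolding depends_on_def by (metis (no_types, lifting) prod.cong)

lemma depends_on_upd: "depends_on A f \<Longrightarrow> b \<notin> A \<Longrightarrow> f (\<sigma>(b := y)) = f \<sigma>"
  unfolding depends_on_def by (metis fun_upd_other)

text \<open>\<open>G\<close> need not be normalised: besides Gibbs weights it is used with bare
  Boltzmann factors, where the factorisation over sites is simplest. The index set \<open>B\<close>
  is arbitrary, so that replicas can be added freely.\<close>

definition ravg :: "'c set \<Rightarrow> ('c \<Rightarrow> real) \<Rightarrow> 'i set \<Rightarrow> (('i \<Rightarrow> 'c) \<Rightarrow> real) \<Rightarrow> real" where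
  "ravg \<Omega> G B f = (\<Sum>\<sigma>\<in>PiE B (\<lambda>_. \<Omega>). f \<sigma> * (\<Prod>k\<in>B. G (\<sigma> k)))"

lemma ravg_cong:
  "(\<And>\<sigma>. \<sigma> \<in> PiE B (\<lambda>_. \<Omega>) \<Longrightarrow> f \<sigma> = g \<sigma>) \<Longrightarrow> ravg \<Omega> G B f = ravg \<Omega> G B g"
  unfolding ravg_def by (rule sum.cong) auto

lemma ravg_add: "ravg \<Omega> G B (\<lambda>\<sigma>. f \<sigma> + g \<sigma>) = ravg \<Omega> G B f + ravg \<Omega> G B g"
  unfolding ravg_def by (simp add: distrib_right sum.distrib)

lemma ravg_diff: "ravg \<Omega> G B (\<lambda>\<sigma>. f \<sigma> - g \<sigma>) = ravg \<Omega> G B f - ravg \<Omega> G B g"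
  unfolding ravg_def by (simp add: left_diff_distrib sum_subtractf)

lemma ravg_cmult: "ravg \<Omega> G B (\<lambda>\<sigma>. c * f \<sigma>) = c * ravg \<Omega> G B f"
  unfolding ravg_def by (simp add: sum_distrib_left mult.assoc)

lemma ravg_sum: "ravg \<Omega> G B (\<lambda>\<sigma>. \<Sum>i\<in>I. f i \<sigma>) = (\<Sum>i\<in>I. ravg \<Omega> G B (f i))"
  unfolding ravg_def by (subst sum.swap) (simp add: sum_distrib_right)

lemma ravg_mono:
  assumes "\<And>y. y \<in> \<Omega> \<Longrightarrow> 0 \<le> G y"
    and "\<And>\<sigma>. \<sigma> \<in> PiE B (\<lambda>_. \<Omega>) \<Longrightarrow> f \<sigma> \<le> g \<sigma>"
  shows "ravg \<Omega> G B f \<le> ravg \<Omega> G B g"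
  unfolding ravg_def
  by (intro sum_mono mult_right_mono prod_nonneg ballI assms) (auto simp: PiE_def Pi_def)

lemma ravg_insert:
  assumes "finite B" "b \<notin> B"
  shows "ravg \<Omega> G (insert b B) f = ravg \<Omega> G B (\<lambda>\<sigma>. \<Sum>y\<in>\<Omega>. G y * f (\<sigma>(b := y)))"
proof -
  have "ravg \<Omega> G (insert b B) f =
      (\<Sum>(y,\<sigma>)\<in>\<Omega> \<times> PiE B (\<lambda>_. \<Omega>). f (\<sigma>(b := y)) * (\<Prod>k\<in>insert b B. G ((\<sigma>(b := y)) k)))"
    unfolding ravg_def PiE_insert_eq
    by (subst sum.reindex[OF inj_combinator[OF assms(2)]]) (auto simp: case_prod_unfold intro!: sum.cong)
  also have "\<dots> = (\<Sum>(y,\<sigma>)\<in>\<Omega> \<times> PiE B (\<lambda>_. \<Omega>). G y * f (\<sigma>(b := y)) * (\<Prod>k\<in>B. G (\<sigma> k)))"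
  proof (intro sum.cong refl, clarify)
    fix y \<sigma>
    have "(\<Prod>k\<in>insert b B. G ((\<sigma>(b := y)) k)) = G y * (\<Prod>k\<in>B. G ((\<sigma>(b := y)) k))"
      using assms by (subst prod.insert) auto
    also have "(\<Prod>k\<in>B. G ((\<sigma>(b := y)) k)) = (\<Prod>k\<in>B. G (\<sigma> k))"
      using assms by (intro prod.cong) auto
    finally show "f (\<sigma>(b := y)) * (\<Prod>k\<in>insert b B. G ((\<sigma>(b := y)) k))
        = G y * f (\<sigma>(b := y)) * (\<Prod>k\<in>B. G (\<sigma> k))" by simp
  qed
  also have "\<dots> = (\<Sum>\<sigma>\<in>PiE B (\<lambda>_. \<Omega>). \<Sum>y\<in>\<Omega>. G y * f (\<sigma>(b := y)) * (\<Prod>k\<in>B. G (\<sigma> k)))"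
    by (subst sum.cartesian_product[symmetric], subst sum.swap) simp
  finally show ?thesis by (simp add: ravg_def sum_distrib_right)
qed

lemma ravg_indep:
  assumes B: "finite B" "b \<in> B" and f: "depends_on (B - {b}) f" and G: "sum G \<Omega> = 1"
  shows "ravg \<Omega> G B (\<lambda>\<sigma>. f \<sigma> * h (\<sigma> b)) = ravg \<Omega> G B f * (\<Sum>y\<in>\<Omega>. G y * h y)"
proof -
  have Bi: "B = insert b (B - {b})" using B by auto
  have u: "f (\<sigma>(b := y)) = f \<sigma>" for \<sigma> y by (rule depends_on_upd[OF f]) simp
  have "ravg \<Omega> G B (\<lambda>\<sigma>. f \<sigma> * h (\<sigma> b))
      = ravg \<Omega> G (B - {b}) (\<lambda>\<sigma>. (\<Sum>y\<in>\<Omega>. G y * h y) * f \<sigma>)"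
    by (subst Bi, subst ravg_insert) (use B in \<open>simp_all add: u sum_distrib_left mult_ac\<close>)
  moreover have "ravg \<Omega> G B f = ravg \<Omega> G (B - {b}) (\<lambda>\<sigma>. (\<Sum>y\<in>\<Omega>. G y) * f \<sigma>)"
    by (subst Bi, subst ravg_insert) (use B in \<open>simp_all add: u sum_distrib_right\<close>)
  ultimately show ?thesis by (simp add: ravg_cmult G)
qed

text \<open>Replicas outside the support of \<open>f\<close> are summed out one at a time, each
  contributing total weight one. This is what allows fresh replicas to be introduced at
  will.\<close>

lemma ravg_marginal:
  assumes "finite B" "A \<subseteq> B" and f: "depends_on A f" and G: "sum G \<Omega> = 1"
  shows "ravg \<Omega> G B f = ravg \<Omega> G A f"
proof -
  have "finite C \<Longrightarrow> C \<inter> A = {} \<Longrightarrow> ravg \<Omega> G (A \<union> C) f = ravg \<Omega> G A f" for C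
  proof (induction C rule: finite_induct)
    case (insert c C)
    have "finite A" using assms finite_subset by blast
    have "ravg \<Omega> G (insert c (A \<union> C)) f = ravg \<Omega> G (A \<union> C) (\<lambda>\<sigma>. (\<Sum>y\<in>\<Omega>. G y * f \<sigma>))"
      using insert \<open>finite A\<close> depends_on_upd[OF f, of c] by (subst ravg_insert) auto
    then show ?case using insert by (simp add: sum_distrib_right[symmetric] G)
  qed simp
  moreover have "A \<union> (B - A) = B" using assms by auto
  ultimately show ?thesis using assms(1) by (metis Diff_disjoint Int_commute finite_Diff)
qed

lemma ravg_const:
  fixes B :: "'i set"
  assumes "finite B" and "sum G \<Omega> = 1"
  shows "ravg \<Omega> G B (\<lambda>_. x) = x"
proof -
  have "ravg \<Omega> G B (\<lambda>_. x) = ravg \<Omega> G ({} :: 'i set) (\<lambda>_. x)"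
    using assms by (intro ravg_marginal) (auto intro: dep_intros)
  then show ?thesis by (simp add: ravg_def)
qed

text \<open>Two replicas outside the support of \<open>f\<close> enter only through their own Gibbs averages, so
  their labels are irrelevant.\<close>

lemma ravg_relabel1:
  assumes "finite B" "A \<subseteq> B" "depends_on A f" "sum G \<Omega> = 1"
    and "k \<in> A" "b \<in> B - A" "b' \<in> B - A"
  shows "ravg \<Omega> G B (\<lambda>\<sigma>. h (\<sigma> k) (\<sigma> b) * f \<sigma>) = ravg \<Omega> G B (\<lambda>\<sigma>. h (\<sigma> k) (\<sigma> b') * f \<sigma>)"
proof -
  have *: "ravg \<Omega> G B (\<lambda>\<sigma>. h (\<sigma> k) (\<sigma> b) * f \<sigma>)
    = ravg \<Omega> G A (\<lambda>\<sigma>. (\<Sum>y\<in>\<Omega>. G y * h (\<sigma> k) y) * f \<sigma>)" if b: "b \<in> B - A" for b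
  proof -
    have u: "f (\<sigma>(b := y)) = f \<sigma>" for \<sigma> y by (rule depends_on_upd[OF assms(3)]) (use b in auto)
    have [simp]: "k \<noteq> b" using b assms by auto
    have "ravg \<Omega> G B (\<lambda>\<sigma>. h (\<sigma> k) (\<sigma> b) * f \<sigma>) = ravg \<Omega> G (insert b A) (\<lambda>\<sigma>. h (\<sigma> k) (\<sigma> b) * f \<sigma>)"
      using assms b by (intro ravg_marginal depends_on_mult depends_on_mono[OF assms(3)]) (auto intro: dep_intros)
    also have "\<dots> = ravg \<Omega> G A (\<lambda>\<sigma>. (\<Sum>y\<in>\<Omega>. G y * h (\<sigma> k) y) * f \<sigma>)"
      using b assms finite_subset[OF assms(2,1)]
      by (subst ravg_insert) (auto simp: u sum_distrib_right mult.assoc)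
    finally show ?thesis .
  qed
  show ?thesis using *[OF assms(6)] *[OF assms(7)] by simp
qed

lemma ravg_relabel_diag:
  assumes "finite B" "A \<subseteq> B" "depends_on A f" "sum G \<Omega> = 1"
    and "b \<in> B - A" "b' \<in> B - A"
  shows "ravg \<Omega> G B (\<lambda>\<sigma>. h (\<sigma> b) * f \<sigma>) = ravg \<Omega> G B (\<lambda>\<sigma>. h (\<sigma> b') * f \<sigma>)"
proof -
  have *: "ravg \<Omega> G B (\<lambda>\<sigma>. h (\<sigma> b) * f \<sigma>) = ravg \<Omega> G B f * (\<Sum>y\<in>\<Omega>. G y * h y)" if "b \<in> B - A" for b
    using that assms ravg_indep[of B b f G \<Omega> h]
        by (simp add: mult.commute depends_on_mono[of A] subset_Diff_insert)
  show ?thesis using *[OF assms(5)] *[OF assms(6)] by simp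
qed

lemma ravg_relabel2:
  assumes "finite B" "A \<subseteq> B" "depends_on A f" "sum G \<Omega> = 1"
    and "b \<in> B - A" "c \<in> B - A" "b \<noteq> c" "b' \<in> B - A" "c' \<in> B - A" "b' \<noteq> c'"
  shows "ravg \<Omega> G B (\<lambda>\<sigma>. h (\<sigma> b) (\<sigma> c) * f \<sigma>) = ravg \<Omega> G B (\<lambda>\<sigma>. h (\<sigma> b') (\<sigma> c') * f \<sigma>)"
proof -
  have *: "ravg \<Omega> G B (\<lambda>\<sigma>. h (\<sigma> b) (\<sigma> c) * f \<sigma>)
    = ravg \<Omega> G A (\<lambda>\<sigma>. (\<Sum>x\<in>\<Omega>. \<Sum>y\<in>\<Omega>. G x * G y * h x y) * f \<sigma>)"
    if b: "b \<in> B - A" "c \<in> B - A" "b \<noteq> c" for b c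
  proof -
    have u: "f (\<sigma>(d := y)) = f \<sigma>" if "d \<in> B - A" for \<sigma> y d
      by (rule depends_on_upd[OF assms(3)]) (use that in auto)
    have fA: "finite A" using finite_subset[OF assms(2,1)] .
    have "ravg \<Omega> G B (\<lambda>\<sigma>. h (\<sigma> b) (\<sigma> c) * f \<sigma>)
        = ravg \<Omega> G (insert c (insert b A)) (\<lambda>\<sigma>. h (\<sigma> b) (\<sigma> c) * f \<sigma>)"
      using assms b by (intro ravg_marginal depends_on_mult depends_on_mono[OF assms(3)]) (auto intro: dep_intros)
    also have "\<dots> = ravg \<Omega> G (insert b A) (\<lambda>\<sigma>. (\<Sum>y\<in>\<Omega>. G y * h (\<sigma> b) y) * f \<sigma>)"
      using b fA by (subst ravg_insert) (auto simp: u sum_distrib_right mult.assoc)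
    also have "\<dots> = ravg \<Omega> G A (\<lambda>\<sigma>. (\<Sum>x\<in>\<Omega>. \<Sum>y\<in>\<Omega>. G x * G y * h x y) * f \<sigma>)"
      using b fA by (subst ravg_insert) (auto simp: u sum_distrib_right sum_distrib_left mult.assoc)
    finally show ?thesis .
  qed
  show ?thesis using *[OF assms(5-7)] *[OF assms(8-10)] by simp
qed

definition gibbs_weight :: "'c set \<Rightarrow> ('c \<Rightarrow> real) \<Rightarrow> 'c \<Rightarrow> real" where
  "gibbs_weight \<Omega> H y = exp (H y) / (\<Sum>x\<in>\<Omega>. exp (H x))"

lemma partition_pos: "finite \<Omega> \<Longrightarrow> \<Omega> \<noteq> {} \<Longrightarrow> 0 < (\<Sum>x\<in>\<Omega>. exp (H x :: real))"
  by (intro sum_pos) auto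

lemma gibbs_weight_nonneg: "0 \<le> gibbs_weight \<Omega> H y"
  by (simp add: gibbs_weight_def sum_nonneg)

lemma sum_gibbs_weight: "finite \<Omega> \<Longrightarrow> \<Omega> \<noteq> {} \<Longrightarrow> sum (gibbs_weight \<Omega> H) \<Omega> = 1"
  using partition_pos[of \<Omega> H] by (simp add: gibbs_weight_def sum_divide_distrib[symmetric])

abbreviation gavg where "gavg \<Omega> H \<equiv> ravg \<Omega> (gibbs_weight \<Omega> H)"

lemma gavg_eq:
  assumes "finite B"
  shows "gavg \<Omega> H B f = (\<Sum>\<sigma>\<in>PiE B (\<lambda>_. \<Omega>). f \<sigma> * exp (\<Sum>k\<in>B. H (\<sigma> k))) / (\<Sum>x\<in>\<Omega>. exp (H x)) ^ card B"
  using assms by (simp add: ravg_def gibbs_weight_def prod_dividef exp_sum sum_divide_distrib)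

lemma abs_gavg_le:
  assumes "finite \<Omega>" "\<Omega> \<noteq> {}" "finite B"
    and "\<And>\<sigma>. \<sigma> \<in> PiE B (\<lambda>_. \<Omega>) \<Longrightarrow> \<bar>f \<sigma>\<bar> \<le> K"
  shows "\<bar>gavg \<Omega> H B f\<bar> \<le> K"
proof -
  have c: "gavg \<Omega> H B (\<lambda>_. x) = x" for x by (rule ravg_const) (use assms sum_gibbs_weight in auto)
  have "gavg \<Omega> H B f \<le> gavg \<Omega> H B (\<lambda>_. K)" "gavg \<Omega> H B (\<lambda>_. -K) \<le> gavg \<Omega> H B f"
    by (intro ravg_mono gibbs_weight_nonneg; use assms(4) in force)+
  then show ?thesis by (simp add: c)
qed

text \<open>Quotient rule for a numerator over the partition function to the power
  \<open>card A\<close>. The denominator contributes \<open>card A\<close> times the Gibbs mean of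
  \<open>H'\<close>, and independence turns this product of averages into one average with an
  additional replica \<open>s\<close>.\<close>

lemma gavg_has_derivative:
  fixes f :: "('i \<Rightarrow> 'c) \<Rightarrow> real" and H' :: "'c \<Rightarrow> real"
  assumes \<Omega>: "finite \<Omega>" "\<Omega> \<noteq> {}" and B: "finite B" "A \<subseteq> B" "s \<in> B - A" and f: "depends_on A f"
    and H: "\<And>y. y \<in> \<Omega> \<Longrightarrow> ((\<lambda>t. H t y) has_real_derivative H' y) (at t within T)"
  shows "((\<lambda>t. gavg \<Omega> (H t) B f) has_real_derivative
     gavg \<Omega> (H t) B (\<lambda>\<sigma>. f \<sigma> * ((\<Sum>a\<in>A. H' (\<sigma> a)) - card A * H' (\<sigma> s)))) (at t within T)"
proof -
  have fA: "finite A" using finite_subset B by blast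
  define Z where "Z t = (\<Sum>x\<in>\<Omega>. exp (H t x))" for t
  define Z' where "Z' = (\<Sum>x\<in>\<Omega>. exp (H t x) * H' x)"
  define P where "P t = (\<Sum>\<sigma>\<in>PiE A (\<lambda>_. \<Omega>). f \<sigma> * exp (\<Sum>k\<in>A. H t (\<sigma> k)))" for t
  define P' where "P' = (\<Sum>\<sigma>\<in>PiE A (\<lambda>_. \<Omega>). f \<sigma> * (exp (\<Sum>k\<in>A. H t (\<sigma> k)) * (\<Sum>k\<in>A. H' (\<sigma> k))))"
  have Zp: "Z u > 0" for u unfolding Z_def by (rule partition_pos[OF \<Omega>])
  have w1: "sum (gibbs_weight \<Omega> (H u)) \<Omega> = 1" for u by (rule sum_gibbs_weight[OF \<Omega>])
  have m: "gavg \<Omega> (H u) B f = P u / Z u ^ card A" for u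
    using ravg_marginal[OF B(1,2) f w1[of u]] gavg_eq[OF fA] by (simp add: P_def Z_def)
  have dZ: "(Z has_real_derivative Z') (at t within T)"
    unfolding Z_def[abs_def] Z'_def by (rule DERIV_sum, rule DERIV_chain2[OF DERIV_exp], rule H)
  have dP: "(P has_real_derivative P') (at t within T)"
    unfolding P_def[abs_def] P'_def
    by (rule DERIV_sum, rule DERIV_cmult, rule DERIV_chain2[OF DERIV_exp], rule DERIV_sum, rule H) (auto simp:
        PiE_def Pi_def)
  have "((\<lambda>u. P u / Z u ^ card A) has_real_derivative
      (P' / Z t ^ card A - card A * (P t / Z t ^ card A) * (Z' / Z t))) (at t within T)"
  proof (cases "card A")
    case 0
    then show ?thesis using dP by simp
  next
    case (Suc n)
    have "((\<lambda>u. Z u ^ Suc n) has_real_derivative Suc n * (Z' * Z t ^ n)) (at t within T)"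
      using DERIV_power[OF dZ, of "Suc n"] by simp
    from DERIV_divide[OF dP this] have "((\<lambda>u. P u / Z u ^ Suc n) has_real_derivative
        (P' * Z t ^ Suc n - P t * (Suc n * (Z' * Z t ^ n))) / (Z t ^ Suc n * Z t ^ Suc n)) (at t within T)"
      using Zp[of t] by (metis less_irrefl power_not_zero)
    moreover have "(P' * Z t ^ Suc n - P t * (Suc n * (Z' * Z t ^ n))) / (Z t ^ Suc n * Z t ^ Suc n)
        = P' / Z t ^ Suc n - Suc n * (P t / Z t ^ Suc n) * (Z' / Z t)"
      using Zp[of t] by (simp add: field_simps)
    ultimately show ?thesis by (simp only: Suc)
  qed
  moreover have "gavg \<Omega> (H t) B (\<lambda>\<sigma>. f \<sigma> * ((\<Sum>a\<in>A. H' (\<sigma> a)) - card A * H' (\<sigma> s)))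
     = P' / Z t ^ card A - card A * (P t / Z t ^ card A) * (Z' / Z t)"
  proof -
    have d: "depends_on A (\<lambda>\<sigma>. f \<sigma> * (\<Sum>a\<in>A. H' (\<sigma> a)))" using f
        by (intro depends_on_mult depends_on_sum depends_on_1)
    have "gavg \<Omega> (H t) B (\<lambda>\<sigma>. f \<sigma> * ((\<Sum>a\<in>A. H' (\<sigma> a)) - card A * H' (\<sigma> s)))
      = gavg \<Omega> (H t) B (\<lambda>\<sigma>. f \<sigma> * (\<Sum>a\<in>A. H' (\<sigma> a))) - card A * gavg \<Omega> (H t) B (\<lambda>\<sigma>. f \<sigma> * H' (\<sigma> s))"
      by (subst ravg_cmult[symmetric], subst ravg_diff[symmetric], rule ravg_cong) (simp add: algebra_simps)
    also have "gavg \<Omega> (H t) B (\<lambda>\<sigma>. f \<sigma> * (\<Sum>a\<in>A. H' (\<sigma> a))) = P' / Z t ^ card A"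
      using ravg_marginal[OF B(1,2) d w1[of t]] by (simp add: gavg_eq[OF fA] P'_def Z_def mult_ac)
    also have "gavg \<Omega> (H t) B (\<lambda>\<sigma>. f \<sigma> * H' (\<sigma> s)) = gavg \<Omega> (H t) B f * (\<Sum>y\<in>\<Omega>. gibbs_weight \<Omega> (H t) y * H' y)"
      using B by (intro ravg_indep w1 depends_on_mono[OF f]) auto
    also have "(\<Sum>y\<in>\<Omega>. gibbs_weight \<Omega> (H t) y * H' y) = Z' / Z t"
      by (simp add: gibbs_weight_def Z'_def Z_def sum_divide_distrib)
    finally show ?thesis by (simp add: m)
  qed
  ultimately show ?thesis unfolding m by (simp only:)
qed

section \<open>Gaussian integration by parts and interpolation\<close>

abbreviation std_gauss :: "real measure" where
  "std_gauss \<equiv> density lborel (\<lambda>x. ennreal (std_normal_density x))"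

lemma prob_space_std_gauss: "prob_space std_gauss"
  by (rule prob_space_normal_density) simp

lemma integral_std_gauss:
  fixes f :: "real \<Rightarrow> real"
  assumes "f \<in> borel_measurable borel"
  shows "integral\<^sup>L std_gauss f = (\<integral>x. std_normal_density x * f x \<partial>lborel)"
  using assms by (subst integral_density) auto

lemma integrable_std_gauss_iff:
  fixes f :: "real \<Rightarrow> real"
  assumes "f \<in> borel_measurable borel"
  shows "integrable std_gauss f \<longleftrightarrow> integrable lborel (\<lambda>x. std_normal_density x * f x)"
  using assms by (subst integrable_density) auto

lemma std_normal_density_limits:
  "(std_normal_density \<longlongrightarrow> 0) at_top" "(std_normal_density \<longlongrightarrow> 0) at_bot"
proof -
  have *: "(std_normal_density \<longlongrightarrow> 0) F" if "filterlim (\<lambda>x::real. x * x) at_top F" for F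
  proof -
    have "filterlim (\<lambda>x::real. x * x * (1/2)) at_top F"
      using that by (subst mult.commute) (rule filterlim_tendsto_pos_mult_at_top[OF tendsto_const], auto)
    then have "filterlim (\<lambda>x::real. - (x * x * (1/2))) at_bot F"
      by (simp add: filterlim_uminus_at_top)
    then have "((\<lambda>x::real. exp (- (x * x * (1/2)))) \<longlongrightarrow> 0) F"
      by (rule filterlim_compose[OF exp_at_bot])
    then have "((\<lambda>x::real. (1 / sqrt (2 * pi)) * exp (- (x * x * (1/2)))) \<longlongrightarrow> 0) F"
      by (rule tendsto_mult_right_zero)
    then show ?thesis
      by (simp add: std_normal_density_def[abs_def] power2_eq_square)
  qed
  show "(std_normal_density \<longlongrightarrow> 0) at_top"
    by (rule *) (intro filterlim_at_top_mult_at_top filterlim_ident)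
  show "(std_normal_density \<longlongrightarrow> 0) at_bot"
    by (rule *) (use filterlim_pow_at_bot_even[of 2 "\<lambda>x::real. x" at_bot] filterlim_ident in \<open>auto simp: power2_eq_square\<close>)
qed

text \<open>Integrate the derivative of \<open>std_normal_density x * f x\<close> over the line: the
  boundary terms vanish because \<open>f\<close> is bounded, and differentiating the density gives
  the factor \<open>- x\<close>.\<close>

lemma stein_std_gauss:
  fixes f f' :: "real \<Rightarrow> real"
  assumes d: "\<And>x. (f has_real_derivative f' x) (at x)"
    and c: "continuous_on UNIV f'"
    and b: "\<And>x. \<bar>f x\<bar> \<le> K" "\<And>x. \<bar>f' x\<bar> \<le> K"
  shows "(\<integral>x. x * f x \<partial>std_gauss) = (\<integral>x. f' x \<partial>std_gauss)"
proof -
  let ?p = "std_normal_density"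
  have cf: "continuous_on UNIV f"
    using d by (meson DERIV_isCont continuous_at_imp_continuous_on)
  have mf [measurable]: "f \<in> borel_measurable borel" "f' \<in> borel_measurable borel"
    using cf c by (auto intro: borel_measurable_continuous_onI)
  have K: "0 \<le> K" using b(1)[of 0] by linarith
  have i1: "integrable lborel (\<lambda>x. ?p x * (x * f x))"
  proof (rule Bochner_Integration.integrable_bound)
    show "integrable lborel (\<lambda>x. K * (?p x * \<bar>x\<bar> ^ 1))"
      by (intro integrable_mult_right integrable_std_normal_moment_abs)
    have "\<bar>?p x * (x * f x)\<bar> \<le> \<bar>K * (?p x * \<bar>x\<bar>)\<bar>" for x
      using mult_mono[OF b(1)[of x] order_refl, of "?p x * \<bar>x\<bar>"] K by (simp add: abs_mult mult_ac)
    then show "AE x in lborel. norm (?p x * (x * f x)) \<le> norm (K * (?p x * \<bar>x\<bar> ^ 1))" by simp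
  qed simp
  have i2: "integrable lborel (\<lambda>x. ?p x * f' x)"
  proof (rule Bochner_Integration.integrable_bound)
    show "integrable lborel (\<lambda>x. K * (?p x * \<bar>x\<bar> ^ 0))"
      by (intro integrable_mult_right integrable_std_normal_moment_abs)
    have "\<bar>?p x * f' x\<bar> \<le> \<bar>K * ?p x\<bar>" for x
      using mult_mono[OF b(2)[of x] order_refl, of "?p x"] K by (simp add: abs_mult mult_ac)
    then show "AE x in lborel. norm (?p x * f' x) \<le> norm (K * (?p x * \<bar>x\<bar> ^ 0))" by simp
  qed simp
  have dp: "(?p has_real_derivative (- x * ?p x)) (at x)" for x
    unfolding std_normal_density_def
    by (rule derivative_eq_intros refl | simp)+
  have dF: "((\<lambda>x. ?p x * f x) has_real_derivative (?p x * f' x - ?p x * (x * f x))) (at x)" for x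
    using DERIV_mult[OF dp d, of x] by (simp add: algebra_simps)
  have lim: "((\<lambda>x. ?p x * f x) \<longlongrightarrow> 0) F" if "(?p \<longlongrightarrow> 0) F" for F
  proof (rule tendsto_0_le)
    show "(?p \<longlongrightarrow> 0) F" by fact
    show "\<forall>\<^sub>F x in F. norm (?p x * f x) \<le> norm (?p x) * K"
      using b(1) by (intro always_eventually) (auto simp: abs_mult intro: mult_left_mono)
  qed
  have "(LBINT x=-\<infinity>..\<infinity>. (?p x * f' x - ?p x * (x * f x))) = 0 - 0"
  proof (rule interval_integral_FTC_integrable[where F="\<lambda>x. ?p x * f x"])
    show "((\<lambda>x. ?p x * f x) has_vector_derivative (?p x * f' x - ?p x * (x * f x))) (at x)" for x
      using dF by (simp add: has_real_derivative_iff_has_vector_derivative)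
    show "isCont (\<lambda>x. ?p x * f' x - ?p x * (x * f x)) x" for x
      using cf c dp[THEN DERIV_isCont]
      by (intro continuous_intros) (auto simp: continuous_on_eq_continuous_at)
    show "set_integrable lborel (einterval (-\<infinity>) \<infinity>) (\<lambda>x. ?p x * f' x - ?p x * (x * f x))"
      using i1 i2 by (simp add: set_integrable_def einterval_def)
    show "(((\<lambda>x. ?p x * f x) \<circ> real_of_ereal) \<longlongrightarrow> 0) (at_right (-\<infinity>))"
      using lim[OF std_normal_density_limits(2)] by (simp add: ereal_tendsto_simps)
    show "(((\<lambda>x. ?p x * f x) \<circ> real_of_ereal) \<longlongrightarrow> 0) (at_left \<infinity>)"
      using lim[OF std_normal_density_limits(1)] by (simp add: ereal_tendsto_simps)
  qed simp
  then have "(\<integral>x. ?p x * f' x - ?p x * (x * f x) \<partial>lborel) = 0"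
    by (simp add: interval_lebesgue_integral_def set_lebesgue_integral_def einterval_def)
  then show ?thesis using i1 i2 by (simp add: integral_std_gauss)
qed

abbreviation gauss_PiM :: "'e set \<Rightarrow> ('e \<Rightarrow> real) measure" where
  "gauss_PiM E \<equiv> PiM E (\<lambda>_. std_gauss)"

interpretation gauss_product: product_prob_space "\<lambda>_. std_gauss" E for E
  using prob_space_std_gauss by (intro product_prob_spaceI)

lemma prob_space_gauss_PiM: "prob_space (gauss_PiM E)"
  by (rule prob_space_PiM) (rule prob_space_std_gauss)

lemma integrable_gauss_coord:
  assumes "finite E" "e \<in> E"
  shows "integrable (gauss_PiM E) (\<lambda>g. \<bar>g e\<bar>)"
proof -
  have "integrable std_gauss (\<lambda>x. \<bar>x\<bar>)"
    using integrable_std_normal_moment_abs[of 1] by (subst integrable_std_gauss_iff) auto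
  then have "integrable (distr (gauss_PiM E) std_gauss (\<lambda>g. g e)) (\<lambda>x. \<bar>x\<bar>)"
    using gauss_product.PiM_component[OF assms(2)] by simp
  then show ?thesis
    by (subst (asm) integrable_distr_eq) (use assms in auto)
qed

text \<open>Fubini isolates the coordinate \<open>e\<close>; with the other coordinates frozen the
  one-dimensional identity applies. Since \<open>F\<close> is bounded, integrability follows from
  the first absolute moment of \<open>g e\<close>.\<close>

lemma stein_gauss_PiM:
  fixes F F' :: "('e \<Rightarrow> real) \<Rightarrow> real"
  assumes E: "finite E" "e \<in> E"
    and m [measurable]: "F \<in> borel_measurable (gauss_PiM E)" "F' \<in> borel_measurable (gauss_PiM E)"
    and b: "\<And>g. \<bar>F g\<bar> \<le> K" "\<And>g. \<bar>F' g\<bar> \<le> K"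
    and d: "\<And>g x. ((\<lambda>x. F (g(e := x))) has_real_derivative F' (g(e := x))) (at x)"
    and c: "\<And>g. continuous_on UNIV (\<lambda>x. F' (g(e := x)))"
  shows "integrable (gauss_PiM E) (\<lambda>g. g e * F g)"
    and "(\<integral>g. g e * F g \<partial>gauss_PiM E) = (\<integral>g. F' g \<partial>gauss_PiM E)"
proof -
  have K: "0 \<le> K" using b(1)[of undefined] by linarith
  have [measurable]: "(\<lambda>g. g e) \<in> borel_measurable (gauss_PiM E)"
    using E measurable_component_singleton[of e E "\<lambda>_. std_gauss"] by simp
  show i1: "integrable (gauss_PiM E) (\<lambda>g. g e * F g)"
  proof (rule Bochner_Integration.integrable_bound)
    show "integrable (gauss_PiM E) (\<lambda>g. K * \<bar>g e\<bar>)"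
      using integrable_gauss_coord[OF E] by simp
    have "\<bar>g e * F g\<bar> \<le> \<bar>K * \<bar>g e\<bar>\<bar>" for g
      using mult_mono[OF b(1)[of g] order_refl, of "\<bar>g e\<bar>"] K by (simp add: abs_mult mult_ac)
    then show "AE g in gauss_PiM E. norm (g e * F g) \<le> norm (K * \<bar>g e\<bar>)" by simp
  qed simp
  have i2: "integrable (gauss_PiM E) F'"
    by (rule finite_measure.integrable_const_bound[OF prob_space.axioms(1)[OF prob_space_gauss_PiM], where B=K])
        (simp_all add: b)
  have "(\<integral>g. g e * F g \<partial>gauss_PiM E)
      = (\<integral>g. (\<integral>x. x * F (g(e := x)) \<partial>std_gauss) \<partial>gauss_PiM (E - {e}))"
    using gauss_product.product_integral_insert[of "E - {e}" e "\<lambda>g. g e * F g"] E i1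
    by (simp add: insert_absorb)
  also have "\<dots> = (\<integral>g. (\<integral>x. F' (g(e := x)) \<partial>std_gauss) \<partial>gauss_PiM (E - {e}))"
    by (intro Bochner_Integration.integral_cong refl stein_std_gauss[where K=K] b d c)
  also have "\<dots> = (\<integral>g. F' g \<partial>gauss_PiM E)"
    using gauss_product.product_integral_insert[of "E - {e}" e F'] E i2
    by (simp add: insert_absorb)
  finally show "(\<integral>g. g e * F g \<partial>gauss_PiM E) = (\<integral>g. F' g \<partial>gauss_PiM E)" .
qed

text \<open>The mean value theorem bounds every difference quotient by \<open>w\<close>, so
  dominated convergence along sequences applies. Domination is only asked on an interval around
  \<open>t\<close>, because the derivatives it is used for may blow up at the ends of the unit
  interval.\<close>

lemma has_derivative_under_integral:
  fixes f f' :: "real \<Rightarrow> 'a \<Rightarrow> real"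
  assumes t: "a < t" "t < b"
    and d: "\<And>s x. a < s \<Longrightarrow> s < b \<Longrightarrow> x \<in> space M \<Longrightarrow>
      ((\<lambda>s. f s x) has_real_derivative f' s x) (at s)"
    and w: "\<And>s x. a < s \<Longrightarrow> s < b \<Longrightarrow> x \<in> space M \<Longrightarrow> \<bar>f' s x\<bar> \<le> w x" "integrable M w"
    and i: "\<And>s. a < s \<Longrightarrow> s < b \<Longrightarrow> integrable M (f s)"
    and m: "f' t \<in> borel_measurable M"
  shows "((\<lambda>s. \<integral>x. f s x \<partial>M) has_real_derivative (\<integral>x. f' t x \<partial>M)) (at t)"
proof -
  have "((\<lambda>s. ((\<integral>x. f s x \<partial>M) - (\<integral>x. f t x \<partial>M)) / (s - t)) \<longlongrightarrow> (\<integral>x. f' t x \<partial>M))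
      (at t within {a<..<b})"
    unfolding tendsto_at_iff_sequentially comp_def
  proof (intro allI impI)
    fix X :: "nat \<Rightarrow> real" assume X: "\<forall>n. X n \<in> {a<..<b} - {t}" "X \<longlonglongrightarrow> t"
    then have X1: "a < X n" "X n < b" "X n \<noteq> t" for n by auto
    have "(\<lambda>n. \<integral>x. (f (X n) x - f t x) / (X n - t) \<partial>M) \<longlonglongrightarrow> (\<integral>x. f' t x \<partial>M)"
    proof (rule integral_dominated_convergence[where w=w])
      show "(\<lambda>x. (f (X n) x - f t x) / (X n - t)) \<in> borel_measurable M" for n
        using i[OF X1(1,2)[of n]] i[OF t] by (intro borel_measurable_divide borel_measurable_diff) auto
      show "AE x in M. (\<lambda>n. (f (X n) x - f t x) / (X n - t)) \<longlonglongrightarrow> f' t x"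
      proof (rule AE_I2)
        fix x assume "x \<in> space M"
        then have "((\<lambda>s. (f s x - f t x) / (s - t)) \<longlongrightarrow> f' t x) (at t within {a<..<b})"
          using d[OF t] by (auto simp: has_field_derivative_iff intro: tendsto_within_subset)
        then show "(\<lambda>n. (f (X n) x - f t x) / (X n - t)) \<longlonglongrightarrow> f' t x"
          using X unfolding tendsto_at_iff_sequentially comp_def by blast
      qed
      show "AE x in M. norm ((f (X n) x - f t x) / (X n - t)) \<le> w x" for n
      proof (rule AE_I2)
        fix x assume x: "x \<in> space M"
        have "norm (f (X n) x - f t x) \<le> w x * norm (X n - t)"
          by (rule field_differentiable_bound[of "{a<..<b}" "\<lambda>s. f s x" "\<lambda>s. f' s x"])
            (use x t X1 d w in \<open>auto intro: has_field_derivative_at_within\<close>)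
        then show "norm ((f (X n) x - f t x) / (X n - t)) \<le> w x"
          using X1(3)[of n] by (simp add: divide_le_eq)
      qed
    qed (use m w in auto)
    moreover have "(\<integral>x. (f (X n) x - f t x) / (X n - t) \<partial>M)
        = ((\<integral>x. f (X n) x \<partial>M) - (\<integral>x. f t x \<partial>M)) / (X n - t)" for n
      using i[OF X1(1,2)[of n]] i[OF t] by simp
    ultimately show "(\<lambda>n. ((\<integral>x. f (X n) x \<partial>M) - (\<integral>x. f t x \<partial>M)) / (X n - t)) \<longlonglongrightarrow> (\<integral>x. f' t x \<partial>M)"
      by (simp only:)
  qed
  then have "((\<lambda>s. \<integral>x. f s x \<partial>M) has_real_derivative (\<integral>x. f' t x \<partial>M)) (at t within {a<..<b})"
    by (simp add: has_field_derivative_iff)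
  then show ?thesis using t by (simp add: at_within_open[of t "{a<..<b}"])
qed

text \<open>Supplies continuity up to the endpoints of the interpolation, where differentiability
  may fail, so that mean value arguments can start at \<open>t = 0\<close>.\<close>

lemma (in prob_space) continuous_on_expectation:
  fixes f :: "real \<Rightarrow> 'a \<Rightarrow> real"
  assumes c: "\<And>x. continuous_on T (\<lambda>s. f s x)"
    and b: "\<And>s x. \<bar>f s x\<bar> \<le> K" and m: "\<And>s. f s \<in> borel_measurable M"
  shows "continuous_on T (\<lambda>s. expectation (f s))"
  unfolding continuous_on_sequentially comp_def
proof (intro ballI allI impI)
  fix a X assume a: "a \<in> T" and X: "(\<forall>n. X n \<in> T) \<and> X \<longlonglongrightarrow> a"
  show "(\<lambda>n. expectation (f (X n))) \<longlonglongrightarrow> expectation (f a)"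
  proof (rule integral_dominated_convergence[where w="\<lambda>_. K"])
    show "AE x in M. (\<lambda>n. f (X n) x) \<longlonglongrightarrow> f a x"
      using c a X unfolding continuous_on_sequentially comp_def by blast
  qed (simp_all add: m b)
qed

text \<open>Differentiating a Gibbs average of a function of the replicas in \<open>A\<close> introduces a fresh
  replica \<open>s\<close>: each replica in \<open>A\<close> contributes once and \<open>s\<close> with weight \<open>- card A\<close>.\<close>

definition cumul :: "'i set \<Rightarrow> 'i \<Rightarrow> 'i \<Rightarrow> real" where
  "cumul A s a = (if a \<in> A then 1 else if a = s then - real (card A) else 0)"

lemma sum_cumul:
  assumes "finite B" "A \<subseteq> B" "s \<in> B - A"
  shows "(\<Sum>a\<in>B. cumul A s a * x a) = (\<Sum>a\<in>A. x a) - card A * (x s :: real)"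
proof -
  have fA: "finite A" using assms finite_subset by blast
  have "(\<Sum>a\<in>B. cumul A s a * x a) = (\<Sum>a\<in>insert s A. cumul A s a * x a)"
    using assms by (intro sum.mono_neutral_right) (auto simp: cumul_def)
  also have "\<dots> = cumul A s s * x s + (\<Sum>a\<in>A. cumul A s a * x a)"
    using assms fA by (intro sum.insert) auto
  also have "(\<Sum>a\<in>A. cumul A s a * x a) = (\<Sum>a\<in>A. x a)"
    by (intro sum.cong) (auto simp: cumul_def)
  finally show ?thesis using assms by (simp add: cumul_def)
qed

lemma abs_cumul_le: "\<bar>cumul A s a\<bar> \<le> real (card A) + 1"
  by (simp add: cumul_def)

lemma gavg_continuous_on:
  assumes "finite \<Omega>" "\<Omega> \<noteq> {}" "finite B" "\<And>y. y \<in> \<Omega> \<Longrightarrow> continuous_on T (\<lambda>t. H t y)"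
  shows "continuous_on T (\<lambda>t. gavg \<Omega> (H t) B f)"
proof -
  have "(\<Sum>x\<in>\<Omega>. exp (H t x)) \<noteq> 0" for t using partition_pos[OF assms(1,2), of "H t"] by linarith
  then show ?thesis
    unfolding gavg_eq[OF assms(3)] using assms by (intro continuous_intros) (auto simp: PiE_def Pi_def)
qed

lemma finite_abs_bound:
  fixes f :: "'c \<Rightarrow> real"
  assumes "finite X"
  obtains K where "\<And>x. x \<in> X \<Longrightarrow> \<bar>f x\<bar> \<le> K"
proof
  fix x assume "x \<in> X"
  then show "\<bar>f x\<bar> \<le> Max (insert 0 ((\<lambda>x. \<bar>f x\<bar>) ` X))"
    using assms by (intro Max_ge) auto
qed

text \<open>The variances \<open>r0 e + r1 e * t\<close> may vanish at the endpoints, where the square root is not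
  differentiable: the derivative is only taken for \<open>0 < t < 1\<close>.\<close>

locale gaussian_interpolation =
  fixes \<Omega> :: "'c set" and E :: "'e set" and a :: "'e \<Rightarrow> 'c \<Rightarrow> real"
    and U V :: "'c \<Rightarrow> real" and r0 r1 :: "'e \<Rightarrow> real"
  assumes finite_\<Omega>: "finite \<Omega>" and \<Omega>_ne: "\<Omega> \<noteq> {}" and finite_E: "finite E"
    and var_pos: "\<And>e t. e \<in> E \<Longrightarrow> 0 < t \<Longrightarrow> t < 1 \<Longrightarrow> 0 < r0 e + r1 e * t"
begin

definition Ham :: "real \<Rightarrow> ('e \<Rightarrow> real) \<Rightarrow> 'c \<Rightarrow> real" where
  "Ham t g y = U y + t * V y + (\<Sum>e\<in>E. sqrt (r0 e + r1 e * t) * g e * a e y)"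

definition gauss_path :: "real \<Rightarrow> 'i set \<Rightarrow> (('i \<Rightarrow> 'c) \<Rightarrow> real) \<Rightarrow> real" where
  "gauss_path t B f = (\<integral>g. gavg \<Omega> (Ham t g) B f \<partial>gauss_PiM E)"

lemma sum_weight [simp]: "sum (gibbs_weight \<Omega> H) \<Omega> = 1"
  by (rule sum_gibbs_weight[OF finite_\<Omega> \<Omega>_ne])

lemma gavg_bound:
  fixes f :: "('i \<Rightarrow> 'c) \<Rightarrow> real"
  assumes "finite B" obtains K where "\<And>H. \<bar>gavg \<Omega> H B f\<bar> \<le> K"
proof -
  have "finite (PiE B (\<lambda>_. \<Omega>))" using assms finite_\<Omega> by (intro finite_PiE)
  then obtain K where "\<And>\<sigma>. \<sigma> \<in> PiE B (\<lambda>_. \<Omega>) \<Longrightarrow> \<bar>f \<sigma>\<bar> \<le> K" using finite_abs_bound by metis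
  then show ?thesis using that[of K] abs_gavg_le[OF finite_\<Omega> \<Omega>_ne assms] by blast
qed

lemma measurable_gavg [measurable]:
  assumes "finite B"
  shows "(\<lambda>g. gavg \<Omega> (Ham t g) B f) \<in> borel_measurable (gauss_PiM E)"
proof -
  have [measurable]: "(\<lambda>g. g e) \<in> borel_measurable (gauss_PiM E)" if "e \<in> E" for e
    using that measurable_component_singleton[of e E "\<lambda>_. std_gauss"] by simp
  show ?thesis unfolding gavg_eq[OF assms] Ham_def by measurable
qed

lemma integrable_gavg:
  assumes "finite B" shows "integrable (gauss_PiM E) (\<lambda>g. gavg \<Omega> (Ham t g) B f)"
proof -
  obtain K where "\<And>H. \<bar>gavg \<Omega> H B f\<bar> \<le> K" using gavg_bound[OF assms] by metis
  then show ?thesis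
    by (intro finite_measure.integrable_const_bound[OF prob_space.axioms(1)[OF prob_space_gauss_PiM], where B=K]
        measurable_gavg assms) auto
qed

lemma gauss_path_add: "finite B \<Longrightarrow> gauss_path t B (\<lambda>\<sigma>. f \<sigma> + g \<sigma>) = gauss_path t B f + gauss_path t B g"
  unfolding gauss_path_def by (simp add: ravg_add integrable_gavg)

lemma gauss_path_diff: "finite B \<Longrightarrow> gauss_path t B (\<lambda>\<sigma>. f \<sigma> - g \<sigma>) = gauss_path t B f - gauss_path t B g"
  unfolding gauss_path_def by (simp add: ravg_diff integrable_gavg)

lemma gauss_path_cmult: "gauss_path t B (\<lambda>\<sigma>. c * f \<sigma>) = c * gauss_path t B f"
  unfolding gauss_path_def by (simp add: ravg_cmult)

lemma gauss_path_sum: "finite B \<Longrightarrow> gauss_path t B (\<lambda>\<sigma>. \<Sum>i\<in>I. f i \<sigma>) = (\<Sum>i\<in>I. gauss_path t B (f i))"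
  unfolding gauss_path_def by (simp add: ravg_sum integrable_gavg)

lemma gauss_path_mono:
  assumes "finite B" "\<And>\<sigma>. \<sigma> \<in> PiE B (\<lambda>_. \<Omega>) \<Longrightarrow> f \<sigma> \<le> g \<sigma>"
  shows "gauss_path t B f \<le> gauss_path t B g"
  unfolding gauss_path_def
  by (intro integral_mono integrable_gavg assms(1) ravg_mono gibbs_weight_nonneg assms(2))

lemma gauss_path_cong:
  "(\<And>\<sigma>. \<sigma> \<in> PiE B (\<lambda>_. \<Omega>) \<Longrightarrow> f \<sigma> = g \<sigma>) \<Longrightarrow> gauss_path t B f = gauss_path t B g"
  unfolding gauss_path_def by (intro Bochner_Integration.integral_cong refl ravg_cong)

lemma gauss_path_const: "finite B \<Longrightarrow> gauss_path t B (\<lambda>_. x) = x"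
  unfolding gauss_path_def
  by (simp add: ravg_const prob_space.prob_space[OF prob_space_gauss_PiM])

lemma gauss_path_marginal:
  "finite B \<Longrightarrow> A \<subseteq> B \<Longrightarrow> depends_on A f \<Longrightarrow> gauss_path t B f = gauss_path t A f"
  unfolding gauss_path_def by (intro Bochner_Integration.integral_cong refl ravg_marginal) auto

lemma abs_gauss_path_le: "finite B \<Longrightarrow> \<bar>gauss_path t B f\<bar> \<le> gauss_path t B (\<lambda>\<sigma>. \<bar>f \<sigma>\<bar>)"
  using gauss_path_mono[of B f "\<lambda>\<sigma>. \<bar>f \<sigma>\<bar>" t] gauss_path_mono[of B "\<lambda>\<sigma>. -1 * \<bar>f \<sigma>\<bar>" f t]
  unfolding gauss_path_cmult by (simp add: abs_le_iff minus_le_iff)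

lemma gauss_path_continuous:
  assumes "finite B"
  shows "continuous_on T (\<lambda>t. gauss_path t B f)"
proof -
  obtain K where "\<And>H. \<bar>gavg \<Omega> H B f\<bar> \<le> K" using gavg_bound[OF assms] by metis
  then show ?thesis unfolding gauss_path_def
    by (intro prob_space.continuous_on_expectation[OF prob_space_gauss_PiM, where K=K]
        gavg_continuous_on finite_\<Omega> \<Omega>_ne assms measurable_gavg)
      (auto simp: Ham_def intro!: continuous_intros)
qed

lemma Ham_deriv_t:
  assumes "0 < t" "t < 1"
  shows "((\<lambda>t. Ham t g y) has_real_derivative
      V y + (\<Sum>e\<in>E. r1 e / (2 * sqrt (r0 e + r1 e * t)) * g e * a e y)) (at t)"
proof -
  have "((\<lambda>t. sqrt (r0 e + r1 e * t) * g e * a e y) has_real_derivative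
      r1 e / (2 * sqrt (r0 e + r1 e * t)) * g e * a e y) (at t)" if "e \<in> E" for e
  proof -
    have "((\<lambda>t. sqrt (r0 e + r1 e * t)) has_real_derivative inverse (sqrt (r0 e + r1 e * t)) / 2 * r1 e) (at t)"
      by (rule DERIV_chain2[where f=sqrt and g="\<lambda>t. r0 e + r1 e
          * t", OF DERIV_real_sqrt[OF var_pos[OF that assms]]]) (auto intro!: derivative_eq_intros)
    then show ?thesis
      by (intro DERIV_cmult_right) (simp add: field_simps)
  qed
  then have "((\<lambda>t. \<Sum>e\<in>E. sqrt (r0 e + r1 e * t) * g e * a e y) has_real_derivative
      (\<Sum>e\<in>E. r1 e / (2 * sqrt (r0 e + r1 e * t)) * g e * a e y)) (at t)"
    by (rule DERIV_sum)
  moreover have "((\<lambda>t. U y + t * V y) has_real_derivative V y) (at t)"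
    by (auto intro!: derivative_eq_intros)
  ultimately show ?thesis unfolding Ham_def by (rule DERIV_add[rotated])
qed

lemma Ham_upd:
  assumes "e \<in> E"
  shows "Ham t (g(e := x)) y = Ham t (g(e := 0)) y + x * (sqrt (r0 e + r1 e * t) * a e y)"
proof -
  have "(\<Sum>e'\<in>E. sqrt (r0 e' + r1 e' * t) * (g(e := x)) e' * a e' y)
      = (\<Sum>e'\<in>E. sqrt (r0 e' + r1 e' * t) * (g(e := 0)) e' * a e' y
          + (if e' = e then x * (sqrt (r0 e + r1 e * t) * a e y) else 0))"
    by (intro sum.cong) auto
  also have "\<dots> = (\<Sum>e'\<in>E. sqrt (r0 e' + r1 e' * t) * (g(e := 0)) e' * a e' y)
      + x * (sqrt (r0 e + r1 e * t) * a e y)"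
    using assms finite_E by (simp add: sum.distrib)
  finally show ?thesis by (simp add: Ham_def)
qed

lemma gauss_path_stein:
  fixes f :: "('i \<Rightarrow> 'c) \<Rightarrow> real"
  assumes e: "e \<in> E" and B: "finite B" "A \<subseteq> B" "s \<in> B - A" and f: "depends_on A f"
  shows "integrable (gauss_PiM E) (\<lambda>g. g e * gavg \<Omega> (Ham t g) B f)"
    and "(\<integral>g. g e * gavg \<Omega> (Ham t g) B f \<partial>gauss_PiM E)
      = sqrt (r0 e + r1 e * t) * gauss_path t B (\<lambda>\<sigma>. f \<sigma> * (\<Sum>b\<in>B. cumul A s b * a e (\<sigma> b)))"
proof -
  let ?r = "sqrt (r0 e + r1 e * t)"
  define f' where "f' \<sigma> = f \<sigma> * ((\<Sum>b\<in>A. ?r * a e (\<sigma> b)) - card A * (?r * a e (\<sigma> s)))" for \<sigma>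
  obtain K1 where K1: "\<And>H. \<bar>gavg \<Omega> H B f\<bar> \<le> K1" using gavg_bound[OF B(1)] by metis
  obtain K2 where K2: "\<And>H. \<bar>gavg \<Omega> H B f'\<bar> \<le> K2" using gavg_bound[OF B(1)] by metis
  have d: "((\<lambda>x. gavg \<Omega> (Ham t (g(e := x))) B f) has_real_derivative gavg \<Omega> (Ham t (g(e := x))) B f') (at x)"
      for g x
    unfolding f'_def
    by (rule gavg_has_derivative[OF finite_\<Omega> \<Omega>_ne B f])
      (subst Ham_upd[OF e], auto intro!: derivative_eq_intros)
  have c: "continuous_on UNIV (\<lambda>x. gavg \<Omega> (Ham t (g(e := x))) B f')" for g
    by (rule gavg_continuous_on[OF finite_\<Omega> \<Omega>_ne B(1)])
      (subst Ham_upd[OF e], auto intro!: continuous_intros)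
  note stein = stein_gauss_PiM[OF finite_E e measurable_gavg[OF B(1)] measurable_gavg[OF B(1)],
      where K="max K1 K2", OF _ _ d c]
  show "integrable (gauss_PiM E) (\<lambda>g. g e * gavg \<Omega> (Ham t g) B f)"
    using K1 K2 by (intro stein(1)) (simp_all add: le_max_iff_disj)
  have "(\<integral>g. g e * gavg \<Omega> (Ham t g) B f \<partial>gauss_PiM E) = gauss_path t B f'"
    unfolding gauss_path_def using K1 K2 by (intro stein(2)) (simp_all add: le_max_iff_disj)
  also have "\<dots> = gauss_path t B (\<lambda>\<sigma>. ?r * (f \<sigma> * (\<Sum>b\<in>B. cumul A s b * a e (\<sigma> b))))"
    by (rule gauss_path_cong) (simp add: f'_def sum_cumul[OF B] sum_distrib_left right_diff_distrib mult_ac)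
  finally show "(\<integral>g. g e * gavg \<Omega> (Ham t g) B f \<partial>gauss_PiM E)
      = ?r * gauss_path t B (\<lambda>\<sigma>. f \<sigma> * (\<Sum>b\<in>B. cumul A s b * a e (\<sigma> b)))"
    by (simp add: gauss_path_cmult)
qed

text \<open>Differentiating in \<open>t\<close> brings down
  \<open>r1 e / (2 * sqrt (r0 e + r1 e * t)) * g e\<close> and the fresh replica \<open>s\<close>.
  The result depends on \<open>insert s A\<close>, so integration by parts against
  \<open>g e\<close> needs a second fresh replica \<open>s'\<close>; it returns a factor
  \<open>sqrt (r0 e + r1 e * t)\<close>. The square roots cancel, and the final formula has no
  singularity at the endpoints.\<close>

theorem gauss_path_has_derivative:
  fixes f :: "('i \<Rightarrow> 'c) \<Rightarrow> real"
  assumes t: "0 < t" "t < 1" and B: "finite B" "A \<subseteq> B" "s \<in> B - A" "s' \<in> B - A" "s \<noteq> s'"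
    and f: "depends_on A f"
  shows "((\<lambda>t. gauss_path t B f) has_real_derivative
     (\<Sum>k\<in>B. \<Sum>l\<in>B. cumul A s k * cumul (insert s A) s' l / 2 *
        gauss_path t B (\<lambda>\<sigma>. f \<sigma> * ((\<Sum>e\<in>E. r1 e * a e (\<sigma> k) * a e (\<sigma> l)) + (if k = l then 2 * V (\<sigma> k) else 0)))))
     (at t)"
proof -
  let ?c = "cumul A s" and ?c' = "cumul (insert s A) s'"
  let ?r = "\<lambda>e t. sqrt (r0 e + r1 e * t)"
  define L where "L e \<sigma> = (\<Sum>k\<in>B. ?c k * a e (\<sigma> k))" for e \<sigma>
  define L' where "L' e \<sigma> = (\<Sum>k\<in>B. ?c' k * a e (\<sigma> k))" for e \<sigma>
  define LV where "LV \<sigma> = (\<Sum>k\<in>B. ?c k * V (\<sigma> k))" for \<sigma>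
  define D where "D t g = gavg \<Omega> (Ham t g) B (\<lambda>\<sigma>. f \<sigma> * LV \<sigma>)
      + (\<Sum>e\<in>E. r1 e / (2 * ?r e t) * (g e * gavg \<Omega> (Ham t g) B (\<lambda>\<sigma>. f \<sigma> * L e \<sigma>)))" for t g
  have d: "((\<lambda>t. gavg \<Omega> (Ham t g) B f) has_real_derivative D t g) (at t)" if t: "0 < t" "t < 1" for t g
  proof -
    define H' where "H' y = V y + (\<Sum>e\<in>E. r1 e / (2 * ?r e t) * g e * a e y)" for y
    have "((\<lambda>t. gavg \<Omega> (Ham t g) B f) has_real_derivative
        gavg \<Omega> (Ham t g) B (\<lambda>\<sigma>. f \<sigma> * ((\<Sum>k\<in>A. H' (\<sigma> k)) - card A * H' (\<sigma> s)))) (at t)"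
      unfolding H'_def by (rule gavg_has_derivative[OF finite_\<Omega> \<Omega>_ne B(1-3) f Ham_deriv_t[OF t]])
    also have "gavg \<Omega> (Ham t g) B (\<lambda>\<sigma>. f \<sigma> * ((\<Sum>k\<in>A. H' (\<sigma> k)) - card A * H' (\<sigma> s))) =
       gavg \<Omega> (Ham t g) B (\<lambda>\<sigma>. f \<sigma> * LV \<sigma> + (\<Sum>e\<in>E. (r1 e / (2 * ?r e t) * g e) * (f \<sigma> * L e \<sigma>)))"
    proof (rule ravg_cong)
      fix \<sigma>
      have "(\<Sum>k\<in>A. H' (\<sigma> k)) - card A * H' (\<sigma> s) = (\<Sum>k\<in>B. ?c k * H' (\<sigma> k))"
        by (rule sum_cumul[OF B(1-3), symmetric])
      also have "\<dots> = LV \<sigma> + (\<Sum>e\<in>E. r1 e / (2 * ?r e t) * g e * L e \<sigma>)"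
      proof -
        have "(\<Sum>k\<in>B. ?c k * (\<Sum>e\<in>E. r1 e / (2 * ?r e t) * g e * a e (\<sigma> k)))
            = (\<Sum>k\<in>B. \<Sum>e\<in>E. r1 e / (2 * ?r e t) * g e * (?c k * a e (\<sigma> k)))"
          by (simp add: sum_distrib_left mult_ac)
        also have "\<dots> = (\<Sum>e\<in>E. r1 e / (2 * ?r e t) * g e * L e \<sigma>)"
          unfolding L_def sum_distrib_left by (rule sum.swap)
        finally show ?thesis
          by (simp add: H'_def LV_def distrib_left sum.distrib)
      qed
      finally show "f \<sigma> * ((\<Sum>k\<in>A. H' (\<sigma> k)) - card A * H' (\<sigma> s))
         = f \<sigma> * LV \<sigma> + (\<Sum>e\<in>E. (r1 e / (2 * ?r e t) * g e) * (f \<sigma> * L e \<sigma>))"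
        by (simp add: distrib_left sum_distrib_left mult_ac)
    qed
    also have "\<dots> = D t g"
      unfolding D_def ravg_add ravg_sum ravg_cmult by (simp add: mult.assoc)
    finally show ?thesis .
  qed
  have dep1: "depends_on (insert s A) (\<lambda>\<sigma>. f \<sigma> * L e \<sigma>)" for e
    unfolding L_def sum_cumul[OF B(1-3)] using depends_on_mono[OF f, of "insert s A"]
    by (intro depends_on_mult depends_on_diff depends_on_sum depends_on_1 depends_on_const) auto
  have iD: "integrable (gauss_PiM E) (\<lambda>g. g e * gavg \<Omega> (Ham t g) B (\<lambda>\<sigma>. f \<sigma> * L e \<sigma>))" if "e \<in> E" for e t
    using gauss_path_stein(1)[OF that B(1) _ _ dep1] B by auto
  have iD': "(\<integral>g. g e * gavg \<Omega> (Ham t g) B (\<lambda>\<sigma>. f \<sigma> * L e \<sigma>) \<partial>gauss_PiM E)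
      = ?r e t * gauss_path t B (\<lambda>\<sigma>. f \<sigma> * L e \<sigma> * L' e \<sigma>)" if "e \<in> E" for e t
    unfolding L'_def using gauss_path_stein(2)[OF that B(1) _ _ dep1] B by auto
  \<comment> \<open>Between \<open>t / 2\<close> and \<open>(1 + t) / 2\<close> the variances stay
    away from zero, so the prefactors are bounded by compactness.\<close>
  have "\<exists>w. integrable (gauss_PiM E) w \<and> (\<forall>s g. t/2 < s \<longrightarrow> s < (1+t)/2 \<longrightarrow> \<bar>D s g\<bar> \<le> w g)"
  proof -
    obtain K0 where K0: "\<And>H. \<bar>gavg \<Omega> H B (\<lambda>\<sigma>. f \<sigma> * LV \<sigma>)\<bar> \<le> K0" using gavg_bound[OF B(1)] by metis
    have "\<exists>K. \<forall>H. \<bar>gavg \<Omega> H B (\<lambda>\<sigma>. f \<sigma> * L e \<sigma>)\<bar> \<le> K" for e using gavg_bound[OF B(1)] by metis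
    then obtain K where K: "\<And>e H. \<bar>gavg \<Omega> H B (\<lambda>\<sigma>. f \<sigma> * L e \<sigma>)\<bar> \<le> K e" by metis
    have "\<exists>M. \<forall>s\<in>{t/2..(1+t)/2}. \<bar>r1 e / (2 * ?r e s)\<bar> \<le> M" if "e \<in> E" for e
    proof -
      have "0 < r0 e + r1 e * s" if "s \<in> {t/2..(1+t)/2}" for s
        using var_pos[OF \<open>e \<in> E\<close>, of s] that t by auto
      then have "continuous_on {t/2..(1+t)/2} (\<lambda>s. r1 e / (2 * ?r e s))"
        by (intro continuous_intros) force
      then have "compact ((\<lambda>s. r1 e / (2 * ?r e s)) ` {t/2..(1+t)/2})"
        by (intro compact_continuous_image) auto
      then have "bounded ((\<lambda>s. r1 e / (2 * ?r e s)) ` {t/2..(1+t)/2})"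
        by (rule compact_imp_bounded)
      then obtain M where "\<forall>x\<in>(\<lambda>s. r1 e / (2 * ?r e s)) ` {t/2..(1+t)/2}. norm x \<le> M"
        unfolding bounded_iff by blast
      then have "\<forall>s\<in>{t/2..(1+t)/2}. \<bar>r1 e / (2 * ?r e s)\<bar> \<le> M" unfolding real_norm_def
          by (intro ballI) (erule bspec, erule imageI)
      then show ?thesis ..
    qed
    then obtain M where M: "\<forall>e\<in>E. \<forall>s\<in>{t/2..(1+t)/2}. \<bar>r1 e / (2 * ?r e s)\<bar> \<le> M e"
      using bchoice[of E "\<lambda>e M. \<forall>s\<in>{t/2..(1+t)/2}. \<bar>r1 e / (2 * ?r e s)\<bar> \<le> M"] by blast
    show ?thesis
    proof (intro exI[of _ "\<lambda>g. K0 + (\<Sum>e\<in>E. M e * (\<bar>g e\<bar> * K e))"] conjI allI impI)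
      show "integrable (gauss_PiM E) (\<lambda>g. K0 + (\<Sum>e\<in>E. M e * (\<bar>g e\<bar> * K e)))"
        using integrable_gauss_coord[OF finite_E] prob_space.axioms(1)[OF prob_space_gauss_PiM]
        by (intro Bochner_Integration.integrable_add Bochner_Integration.integrable_sum
            integrable_mult_right integrable_mult_left finite_measure.integrable_const) auto
      fix s g assume s: "t/2 < s" "s < (1+t)/2"
      have "\<bar>r1 e / (2 * ?r e s) * (g e * gavg \<Omega> (Ham s g) B (\<lambda>\<sigma>. f \<sigma> * L e \<sigma>))\<bar> \<le> M e * (\<bar>g e\<bar> * K e)"
        if "e \<in> E" for e
      proof -
        have m: "\<bar>r1 e / (2 * ?r e s)\<bar> \<le> M e" using M that s by auto
        show ?thesis unfolding abs_mult[of "r1 e / (2 * ?r e s)"]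
        proof (rule mult_mono[OF m])
          show "\<bar>g e * gavg \<Omega> (Ham s g) B (\<lambda>\<sigma>. f \<sigma> * L e \<sigma>)\<bar> \<le> \<bar>g e\<bar> * K e"
            unfolding abs_mult by (intro mult_left_mono K) auto
        qed (use m in linarith, simp)
      qed
      then show "\<bar>D s g\<bar> \<le> K0 + (\<Sum>e\<in>E. M e * (\<bar>g e\<bar> * K e))"
        unfolding D_def using K0[of "Ham s g"]
        by (intro abs_triangle_ineq[THEN order_trans] add_mono sum_abs[THEN order_trans] sum_mono) auto
    qed
  qed
  then obtain w where w: "integrable (gauss_PiM E) w" "\<And>s g. t/2 < s \<Longrightarrow> s < (1+t)/2 \<Longrightarrow> \<bar>D s g\<bar> \<le> w g"
    by blast
  have iDt: "integrable (gauss_PiM E) (D t)" for t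
    unfolding D_def by (intro Bochner_Integration.integrable_add Bochner_Integration.integrable_sum
      integrable_mult_right integrable_gavg[OF B(1)] iD)
  have "((\<lambda>t. gauss_path t B f) has_real_derivative (\<integral>g. D t g \<partial>gauss_PiM E)) (at t)"
    unfolding gauss_path_def
    by (rule has_derivative_under_integral[where a="t/2" and b="(1+t)/2" and w=w])
      (use t in \<open>auto intro!: d w integrable_gavg[OF B(1)] borel_measurable_integrable[OF iDt]\<close>)
  also have "(\<integral>g. D t g \<partial>gauss_PiM E) = gauss_path t B (\<lambda>\<sigma>. f \<sigma> * LV \<sigma>)
      + (\<Sum>e\<in>E. r1 e / (2 * ?r e t) * (?r e t * gauss_path t B (\<lambda>\<sigma>. f \<sigma> * L e \<sigma> * L' e \<sigma>)))"
    unfolding D_def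
    by (simp add: integrable_gavg[OF B(1)] iD iD' Bochner_Integration.integrable_sum
        Bochner_Integration.integral_add Bochner_Integration.integral_sum gauss_path_def)
  also have "\<dots> = gauss_path t B (\<lambda>\<sigma>. f \<sigma> * LV \<sigma>)
      + (\<Sum>e\<in>E. r1 e / 2 * gauss_path t B (\<lambda>\<sigma>. f \<sigma> * L e \<sigma> * L' e \<sigma>))"
    using var_pos[OF _ t, THEN less_imp_neq] by (intro arg_cong2[where f="(+)"] refl sum.cong) simp
  also have "\<dots> = gauss_path t B (\<lambda>\<sigma>. f \<sigma> * LV \<sigma> + (\<Sum>e\<in>E. r1 e / 2 * (f \<sigma> * L e \<sigma> * L' e \<sigma>)))"
    by (simp only: gauss_path_add[OF B(1)] gauss_path_sum[OF B(1)] gauss_path_cmult)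
  also have "\<dots> = gauss_path t B (\<lambda>\<sigma>. \<Sum>k\<in>B. \<Sum>l\<in>B. ?c k * ?c' l / 2 *
      (f \<sigma> * ((\<Sum>e\<in>E. r1 e * a e (\<sigma> k) * a e (\<sigma> l)) + (if k = l then 2 * V (\<sigma> k) else 0))))"
  proof (rule gauss_path_cong)
    fix \<sigma>
    \<comment> \<open>The second coefficient is one on \<open>insert s A\<close> and the first
      vanishes off it. Hence the single sum of the \<open>V\<close> terms can be stored on the
      diagonal of the double sum.\<close>
    have cc: "?c k * ?c' k = ?c k" for k
      using B by (auto simp: cumul_def)
    have "(\<Sum>k\<in>B. \<Sum>l\<in>B. ?c k * ?c' l / 2 * (f \<sigma> * (if k = l then 2 * V (\<sigma> k) else 0)))
       = (\<Sum>k\<in>B. \<Sum>l\<in>B. (if l = k then ?c k * ?c' k * (f \<sigma> * V (\<sigma> k)) else 0))"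
      by (intro sum.cong refl) auto
    also have "\<dots> = f \<sigma> * LV \<sigma>"
      using B(1) by (simp add: LV_def cc sum_distrib_left mult_ac)
    finally have 1: "(\<Sum>k\<in>B. \<Sum>l\<in>B. ?c k * ?c' l / 2 * (f \<sigma> * (if k = l then 2 * V (\<sigma> k) else 0)))
       = f \<sigma> * LV \<sigma>" .
    have "(\<Sum>k\<in>B. \<Sum>l\<in>B. ?c k * ?c' l / 2 * (f \<sigma> * (\<Sum>e\<in>E. r1 e * a e (\<sigma> k) * a e (\<sigma> l))))
      = (\<Sum>e\<in>E. \<Sum>k\<in>B. \<Sum>l\<in>B. r1 e / 2 * (f \<sigma> * (?c k * a e (\<sigma> k)) * (?c' l * a e (\<sigma> l))))"
    proof -
      have "(\<Sum>k\<in>B. \<Sum>l\<in>B. ?c k * ?c' l / 2 * (f \<sigma> * (\<Sum>e\<in>E. r1 e * a e (\<sigma> k) * a e (\<sigma> l))))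
        = (\<Sum>k\<in>B. \<Sum>l\<in>B. \<Sum>e\<in>E. r1 e / 2 * (f \<sigma> * (?c k * a e (\<sigma> k)) * (?c' l * a e (\<sigma> l))))"
        by (simp add: sum_distrib_left mult_ac)
      also have "\<dots> = (\<Sum>k\<in>B. \<Sum>e\<in>E. \<Sum>l\<in>B. r1 e / 2 * (f \<sigma> * (?c k * a e (\<sigma> k)) * (?c' l * a e (\<sigma> l))))"
        by (intro sum.cong refl sum.swap)
      also have "\<dots> = (\<Sum>e\<in>E. \<Sum>k\<in>B. \<Sum>l\<in>B. r1 e / 2 * (f \<sigma> * (?c k * a e (\<sigma> k)) * (?c' l * a e (\<sigma> l))))"
        by (rule sum.swap)
      finally show ?thesis .
    qed
    also have "\<dots> = (\<Sum>e\<in>E. r1 e / 2 * (f \<sigma> * L e \<sigma> * L' e \<sigma>))"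
      unfolding L_def L'_def mult.assoc[of "f \<sigma>"] sum_product by (simp add: sum_distrib_left mult_ac)
    finally show "f \<sigma> * LV \<sigma> + (\<Sum>e\<in>E. r1 e / 2 * (f \<sigma> * L e \<sigma> * L' e \<sigma>)) =
      (\<Sum>k\<in>B. \<Sum>l\<in>B. ?c k * ?c' l / 2 *
      (f \<sigma> * ((\<Sum>e\<in>E. r1 e * a e (\<sigma> k) * a e (\<sigma> l)) + (if k = l then 2 * V (\<sigma> k) else 0))))"
      using 1 by (simp add: distrib_left sum.distrib)
  qed
  finally show ?thesis by (simp only: gauss_path_sum[OF B(1)] gauss_path_cmult)
qed

end

section \<open>The cavity path\<close>

definition site_free :: "nat \<Rightarrow> (('i \<Rightarrow> nat \<Rightarrow> int) \<Rightarrow> real) \<Rightarrow> bool" where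
  "site_free c f \<longleftrightarrow> (\<forall>\<sigma> s. f (\<lambda>k. (\<sigma> k)(c := s k)) = f \<sigma>)"

text \<open>Summing out one replica preserves the product form of the integrand: its spins off
  \<open>c\<close> are absorbed in \<open>f\<close>, its spin at \<open>c\<close> in
  \<open>\<phi>\<close>. The induction over replicas therefore keeps \<open>f\<close> and
  \<open>\<phi>\<close> arbitrary.\<close>

lemma ravg_product:
  fixes f :: "('i \<Rightarrow> nat \<Rightarrow> int) \<Rightarrow> real" and \<phi> :: "('i \<Rightarrow> int) \<Rightarrow> real"
  assumes "finite B" "c \<notin> I" "finite I" "finite X"
    and G: "\<And>y. G y = G1 y * G2 (y c)" "\<And>y s. G1 (y(c := s)) = G1 y"
    and "site_free c f" "depends_on B \<phi>"
  shows "ravg (PiE (insert c I) (\<lambda>_. X)) G B (\<lambda>\<sigma>. f \<sigma> * \<phi> (\<lambda>k. \<sigma> k c))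
    = ravg (PiE I (\<lambda>_. X)) G1 B f * ravg X G2 B \<phi>"
  using assms(1,7,8)
proof (induction B arbitrary: f \<phi> rule: finite_induct)
  case empty
  then have "\<phi> (\<lambda>k. undefined c) = \<phi> (\<lambda>_. undefined)" by (simp add: depends_on_def)
  then show ?case by (simp add: ravg_def)
next
  case (insert b B)
  let ?\<Omega> = "PiE (insert c I) (\<lambda>_. X)" and ?\<Omega>' = "PiE I (\<lambda>_. X)"
  define f1 where "f1 \<sigma> = (\<Sum>y\<in>?\<Omega>'. G1 y * f (\<sigma>(b := y)))" for \<sigma>
  define \<phi>1 :: "('i \<Rightarrow> int) \<Rightarrow> real" where "\<phi>1 s = (\<Sum>x\<in>X. G2 x * \<phi> (s(b := x)))" for s
  have sf: "f (\<lambda>k. (\<sigma> k)(c := s k)) = f \<sigma>" for \<sigma> s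
    using insert.prems(1) unfolding site_free_def by blast
  have sf1: "f (\<sigma>(b := y(c := x))) = f (\<sigma>(b := y))" for \<sigma> y x
  proof -
    have "f (\<sigma>(b := y(c := x))) = f (\<lambda>k. ((\<sigma>(b := y)) k)(c := (if k = b then x else \<sigma> k c)))"
      by (rule arg_cong[where f=f]) auto
    then show ?thesis by (simp only: sf)
  qed
  have free: "site_free c f1"
    unfolding site_free_def f1_def
  proof (intro allI sum.cong refl)
    fix \<sigma> s y
    have "f ((\<lambda>k. (\<sigma> k)(c := s k))(b := y)) = f (\<lambda>k. ((\<sigma>(b := y)) k)(c := (if k = b then y c else s k)))"
      by (rule arg_cong[where f=f]) auto
    then show "G1 y * f ((\<lambda>k. (\<sigma> k)(c := s k))(b := y)) = G1 y * f (\<sigma>(b := y))" by (simp only: sf)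
  qed
  have dep: "depends_on B \<phi>1"
    unfolding depends_on_def \<phi>1_def
  proof (intro allI impI sum.cong refl)
    fix s s' :: "'i \<Rightarrow> int" and x assume "\<forall>a\<in>B. s a = s' a"
    then have "\<phi> (s(b := x)) = \<phi> (s'(b := x))"
      using insert.prems(2) unfolding depends_on_def by auto
    then show "G2 x * \<phi> (s(b := x)) = G2 x * \<phi> (s'(b := x))" by simp
  qed
  have "ravg ?\<Omega> G (insert b B) (\<lambda>\<sigma>. f \<sigma> * \<phi> (\<lambda>k. \<sigma> k c)) = ravg ?\<Omega> G B (\<lambda>\<sigma>. f1 \<sigma> * \<phi>1 (\<lambda>k. \<sigma> k c))"
  proof (subst ravg_insert[OF insert.hyps(1,2)], rule ravg_cong)
    fix \<sigma> :: "'i \<Rightarrow> nat \<Rightarrow> int"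
    have "(\<lambda>k. (\<sigma>(b := y)) k c) = (\<lambda>k. \<sigma> k c)(b := y c)" for y by auto
    then have "(\<Sum>y\<in>?\<Omega>. G y * (f (\<sigma>(b := y)) * \<phi> (\<lambda>k. (\<sigma>(b := y)) k c)))
        = (\<Sum>y\<in>?\<Omega>. G1 y * G2 (y c) * (f (\<sigma>(b := y)) * \<phi> ((\<lambda>k. \<sigma> k c)(b := y c))))"
      by (simp add: G)
    also have "\<dots> = (\<Sum>(x,y)\<in>X \<times> ?\<Omega>'. G1 y * G2 x * (f (\<sigma>(b := y)) * \<phi> ((\<lambda>k. \<sigma> k c)(b := x))))"
      unfolding PiE_insert_eq
      by (subst sum.reindex[OF inj_combinator[OF assms(2)]])
        (auto simp: case_prod_unfold G sf1 intro!: sum.cong)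
    also have "\<dots> = f1 \<sigma> * \<phi>1 (\<lambda>k. \<sigma> k c)"
      unfolding f1_def \<phi>1_def sum_product
      by (subst sum.cartesian_product[symmetric], subst sum.swap) (simp add: mult_ac)
    finally show "(\<Sum>y\<in>?\<Omega>. G y * (f (\<sigma>(b := y)) * \<phi> (\<lambda>k. (\<sigma>(b := y)) k c))) = f1 \<sigma> * \<phi>1 (\<lambda>k. \<sigma> k c)" .
  qed
  also have "\<dots> = ravg ?\<Omega>' G1 B f1 * ravg X G2 B \<phi>1" by (rule insert.IH[OF free dep])
  finally show ?case
    by (simp add: ravg_insert[OF insert.hyps(1,2)] f1_def[abs_def] \<phi>1_def[abs_def])
qed

lemma ravg_prod:
  assumes "finite B"
  shows "ravg X G B (\<lambda>s. \<Prod>a\<in>B. h a (s a)) = (\<Prod>a\<in>B. \<Sum>y\<in>X. G y * h a y)"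
  using assms
proof (induction B rule: finite_induct)
  case (insert b B)
  have "ravg X G (insert b B) (\<lambda>s. \<Prod>a\<in>insert b B. h a (s a))
      = ravg X G B (\<lambda>s. (\<Sum>y\<in>X. G y * h b y) * (\<Prod>a\<in>B. h a (s a)))"
  proof (subst ravg_insert[OF insert.hyps(1,2)], rule ravg_cong)
    fix s
    have "(\<Prod>a\<in>insert b B. h a ((s(b := y)) a)) = h b y * (\<Prod>a\<in>B. h a (s a))" for y
      using insert.hyps by (subst prod.insert) (auto intro!: prod.cong)
    then show "(\<Sum>y\<in>X. G y * (\<Prod>a\<in>insert b B. h a ((s(b := y)) a)))
        = (\<Sum>y\<in>X. G y * h b y) * (\<Prod>a\<in>B. h a (s a))"
      by (simp add: sum_distrib_right mult.assoc)
  qed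
  then show ?case using insert by (simp add: ravg_cmult)
qed (simp add: ravg_def)

section \<open>The spin system and its interpolation at one site\<close>

lemma finite_spins [simp]: "finite (spins S)" and spins_ne [simp]: "spins S \<noteq> {}"
  by (auto simp: spins_def)

lemma abs_spin_le: "s \<in> spins S \<Longrightarrow> \<bar>real_of_int s\<bar> \<le> real S"
  by (auto simp: spins_def abs_if)

lemma finite_configs [simp]: "finite (configs S N)" and configs_ne [simp]: "configs S N \<noteq> {}"
  by (auto simp: configs_def PiE_eq_empty_iff intro: finite_PiE)

lemma finite_dis_idx [simp]: "finite (dis_idx N)"
  by (rule finite_subset[of _ "{..<N} \<times> {..<N}"]) (auto simp: dis_idx_def)

lemma spare_notin_dis_idx [simp]: "(0,0) \<notin> dis_idx N"
  by (simp add: dis_idx_def)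

lemma sum_edges_at_site:
  fixes x :: "nat \<Rightarrow> real"
  assumes "c < N"
  shows "(\<Sum>(i,j) | (i,j) \<in> dis_idx N \<and> (c = i \<or> c = j). x i * x j) = x c * (\<Sum>i\<in>{..<N}-{c}. x i)"
  unfolding sum_distrib_left
  by (rule sum.reindex_bij_witness[where i="\<lambda>i. (min i c, max i c)" and j="\<lambda>(i,j). if i = c then j else i"])
    (use assms in \<open>auto simp: dis_idx_def min_def max_def\<close>)

locale GS =
  fixes S :: nat and \<beta> h D p q :: real
  assumes beta_pos: "0 < \<beta>" and beta_le1: "\<beta> \<le> 1" and fixed_point: "pq_fixed_point S \<beta> h D p q"
begin

text \<open>At \<open>t = 1\<close> the path below is the original Hamiltonian, at \<open>t = 0\<close> the site \<open>c\<close> is decoupled from the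
  others and sees the Gaussian field of the fixed point equations for \<open>(p, q)\<close>.  The Gaussian of this
  field is carried by the spare index \<open>(0,0)\<close>, which is not an edge.\<close>

abbreviation "idx N \<equiv> insert (0,0) (dis_idx N)"

definition coupling :: "nat \<Rightarrow> nat \<Rightarrow> nat \<times> nat \<Rightarrow> (nat \<Rightarrow> int) \<Rightarrow> real" where
  "coupling N c e y = (if e = (0,0) then \<beta> * sqrt q * of_int (y c)
     else \<beta> / sqrt (real N) * (of_int (y (fst e)) * of_int (y (snd e))))"

text \<open>This carries the quadratic term of the decoupled site, with the correction
  \<open>\<beta>\<^sup>2 / 2 * (p - q)\<close> from \<open>wgt\<close>; \<open>fieldV\<close>
  removes the correction linearly in \<open>t\<close>, in step with the variance of the spare
  Gaussian.\<close>

definition fieldU :: "nat \<Rightarrow> nat \<Rightarrow> (nat \<Rightarrow> int) \<Rightarrow> real" where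
  "fieldU N c y = \<beta>\<^sup>2 / 2 * (p - q) * of_int (y c) ^ 2
     + D * (\<Sum>i<N. of_int (y i) ^ 2) + h * (\<Sum>i<N. of_int (y i))"

definition fieldV :: "nat \<Rightarrow> (nat \<Rightarrow> int) \<Rightarrow> real" where
  "fieldV c y = - (\<beta>\<^sup>2 / 2 * (p - q) * of_int (y c) ^ 2)"

text \<open>Together with \<open>var1\<close> this gives the edges at \<open>c\<close> variance
  \<open>t\<close>, all other edges variance one and the spare Gaussian variance
  \<open>1 - t\<close>.\<close>

definition var0 :: "nat \<Rightarrow> nat \<times> nat \<Rightarrow> real" where
  "var0 c e = (if e = (0,0) then 1 else if c = fst e \<or> c = snd e then 0 else 1)"

definition var1 :: "nat \<Rightarrow> nat \<times> nat \<Rightarrow> real" where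
  "var1 c e = (if e = (0,0) then -1 else if c = fst e \<or> c = snd e then 1 else 0)"

lemma interpolation:
  "gaussian_interpolation (configs S N) (idx N) (var0 c) (var1 c)"
  by unfold_locales (auto simp: var0_def var1_def)

definition HamPath :: "nat \<Rightarrow> nat \<Rightarrow> real \<Rightarrow> (nat \<times> nat \<Rightarrow> real) \<Rightarrow> (nat \<Rightarrow> int) \<Rightarrow> real" where
  "HamPath N c = gaussian_interpolation.Ham (idx N) (coupling N c) (fieldU N c) (fieldV c) (var0 c) (var1 c)"

definition nu_path :: "nat \<Rightarrow> nat \<Rightarrow> real \<Rightarrow> nat set \<Rightarrow> ((nat \<Rightarrow> nat \<Rightarrow> int) \<Rightarrow> real) \<Rightarrow> real" where
  "nu_path N c t B f = gaussian_interpolation.gauss_path (configs S N) (idx N) (coupling N c)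
     (fieldU N c) (fieldV c) (var0 c) (var1 c) t B f"

lemma nu_path_add: "finite B \<Longrightarrow> nu_path N c t B (\<lambda>\<sigma>. f \<sigma> + g \<sigma>) = nu_path N c t B f + nu_path N c t B g"
  unfolding nu_path_def by (rule gaussian_interpolation.gauss_path_add[OF interpolation])

lemma nu_path_diff: "finite B \<Longrightarrow> nu_path N c t B (\<lambda>\<sigma>. f \<sigma> - g \<sigma>) = nu_path N c t B f - nu_path N c t B g"
  unfolding nu_path_def by (rule gaussian_interpolation.gauss_path_diff[OF interpolation])

lemma nu_path_cmult: "nu_path N c t B (\<lambda>\<sigma>. x * f \<sigma>) = x * nu_path N c t B f"
  unfolding nu_path_def by (rule gaussian_interpolation.gauss_path_cmult[OF interpolation])

lemma nu_path_sum: "finite B \<Longrightarrow> nu_path N c t B (\<lambda>\<sigma>. \<Sum>i\<in>I. f i \<sigma>) = (\<Sum>i\<in>I. nu_path N c t B (f i))"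
  unfolding nu_path_def by (rule gaussian_interpolation.gauss_path_sum[OF interpolation])

lemma nu_path_mono: "finite B \<Longrightarrow> (\<And>\<sigma>. \<sigma> \<in> PiE B (\<lambda>_. configs S N) \<Longrightarrow> f \<sigma> \<le> g \<sigma>)
    \<Longrightarrow> nu_path N c t B f \<le> nu_path N c t B g"
  unfolding nu_path_def by (rule gaussian_interpolation.gauss_path_mono[OF interpolation])

lemma nu_path_cong: "(\<And>\<sigma>. \<sigma> \<in> PiE B (\<lambda>_. configs S N) \<Longrightarrow> f \<sigma> = g \<sigma>) \<Longrightarrow> nu_path N c t B f = nu_path N c t B g"
  unfolding nu_path_def by (rule gaussian_interpolation.gauss_path_cong[OF interpolation])

lemma nu_path_const: "finite B \<Longrightarrow> nu_path N c t B (\<lambda>_. x) = x"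
  unfolding nu_path_def by (rule gaussian_interpolation.gauss_path_const[OF interpolation])

lemma nu_path_marginal: "finite B \<Longrightarrow> A \<subseteq> B \<Longrightarrow> depends_on A f \<Longrightarrow> nu_path N c t B f = nu_path N c t A f"
  unfolding nu_path_def by (rule gaussian_interpolation.gauss_path_marginal[OF interpolation])

lemma abs_nu_path_le: "finite B \<Longrightarrow> \<bar>nu_path N c t B f\<bar> \<le> nu_path N c t B (\<lambda>\<sigma>. \<bar>f \<sigma>\<bar>)"
  unfolding nu_path_def by (rule gaussian_interpolation.abs_gauss_path_le[OF interpolation])

lemma nu_path_continuous: "finite B \<Longrightarrow> continuous_on T (\<lambda>t. nu_path N c t B f)"
  unfolding nu_path_def by (rule gaussian_interpolation.gauss_path_continuous[OF interpolation])

lemma nu_path_eq: "nu_path N c t B f = (\<integral>g. gavg (configs S N) (HamPath N c t g) B f \<partial>gauss_PiM (idx N))"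
  unfolding nu_path_def HamPath_def by (rule gaussian_interpolation.gauss_path_def[OF interpolation])

lemma HamPath_eq: "HamPath N c t g y = fieldU N c y + t * fieldV c y
    + (\<Sum>e\<in>idx N. sqrt (var0 c e + var1 c e * t) * g e * coupling N c e y)"
  unfolding HamPath_def by (rule gaussian_interpolation.Ham_def[OF interpolation])

text \<open>Omitting site \<open>c\<close> without renormalising keeps the difference from the
  centred overlap at exactly one spin product over \<open>N\<close>, while at \<open>t = 0\<close>
  the quantity is decoupled from the spins at \<open>c\<close>.\<close>

definition ov_cavity :: "nat \<Rightarrow> nat \<Rightarrow> nat \<Rightarrow> nat \<Rightarrow> (nat \<Rightarrow> nat \<Rightarrow> int) \<Rightarrow> real" where
  "ov_cavity N c k l \<sigma> = (1 / real N) * (\<Sum>i\<in>{..<N} - {c}. of_int (\<sigma> k i) * of_int (\<sigma> l i)) - Qpq p q k l"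

lemma q_nonneg: "0 \<le> q"
proof -
  have "q = Eg (\<lambda>t. (mom S \<beta> h D p q 1 t)\<^sup>2)" using fixed_point by (simp add: pq_fixed_point_def)
  also have "\<dots> \<ge> 0" unfolding Eg_def by (intro Bochner_Integration.integral_nonneg) simp
  finally show ?thesis .
qed

lemma sum_idx_split:
  fixes f :: "nat \<times> nat \<Rightarrow> real"
  shows "(\<Sum>e\<in>idx N. f e) = f (0,0) + (\<Sum>e\<in>dis_idx N. f e)"
  by (subst sum.insert) auto

text \<open>The edges at \<open>c\<close> yield the overlap over the remaining sites. The spare
  Gaussian, whose variance decreases, subtracts \<open>q\<close>; on the diagonal
  \<open>fieldV\<close> replaces \<open>q\<close> by \<open>p\<close>. The path is designed so that
  only a centred overlap, which is small, remains.\<close>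

lemma cavity_covariance:
  assumes "c < N"
  shows "(\<Sum>e\<in>idx N. var1 c e * coupling N c e (\<sigma> k) * coupling N c e (\<sigma> l)) + (if k
      = l then 2 * fieldV c (\<sigma> k) else 0)
    = \<beta>\<^sup>2 * (of_int (\<sigma> k c) * of_int (\<sigma> l c) * ov_cavity N c k l \<sigma>)"
proof -
  define x where "x i = real_of_int (\<sigma> k i) * real_of_int (\<sigma> l i)" for i
  have "(\<Sum>e\<in>dis_idx N. var1 c e * coupling N c e (\<sigma> k) * coupling N c e (\<sigma> l))
     = (\<Sum>(i,j)\<in>dis_idx N. if c = i \<or> c = j then \<beta>\<^sup>2 / real N * (x i * x j) else 0)"
  proof (intro sum.cong refl, clarify)
    fix i j assume "(i, j) \<in> dis_idx N"
    then have "(i, j) \<noteq> (0, 0)" by (metis spare_notin_dis_idx)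
    then show "var1 c (i,j) * coupling N c (i,j) (\<sigma> k) * coupling N c (i,j) (\<sigma> l)
       = (if c = i \<or> c = j then \<beta>\<^sup>2 / real N * (x i * x j) else 0)"
      by (auto simp: var1_def coupling_def x_def power2_eq_square)
  qed
  also have "\<dots> = (\<Sum>(i,j) | (i,j) \<in> dis_idx N \<and> (c = i \<or> c = j). \<beta>\<^sup>2 / real N * (x i * x j))"
    by (rule sum.mono_neutral_cong_right) (auto simp: case_prod_unfold)
  also have "\<dots> = \<beta>\<^sup>2 / real N * (\<Sum>(i,j) | (i,j) \<in> dis_idx N \<and> (c = i \<or> c = j). x i * x j)"
    by (simp add: sum_distrib_left case_prod_unfold)
  also have "\<dots> = \<beta>\<^sup>2 / real N * (x c * (\<Sum>i\<in>{..<N}-{c}. x i))"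
    by (simp only: sum_edges_at_site[OF assms])
  finally have 1: "(\<Sum>e\<in>dis_idx N. var1 c e * coupling N c e (\<sigma> k) * coupling N c e (\<sigma> l))
     = \<beta>\<^sup>2 / real N * (x c * (\<Sum>i\<in>{..<N}-{c}. x i))" .
  have 2: "var1 c (0,0) * coupling N c (0,0) (\<sigma> k) * coupling N c (0,0) (\<sigma> l) = - (\<beta>\<^sup>2 * q * x c)"
    using q_nonneg by (simp add: var1_def coupling_def x_def power2_eq_square)
  show ?thesis
    unfolding sum_idx_split 1 2
    by (auto simp: ov_cavity_def fieldV_def x_def Qpq_def power2_eq_square algebra_simps diff_divide_distrib)
qed

text \<open>Gaussian integration by parts differentiates the Gibbs average twice, so two fresh replicas
  \<open>s\<close> and \<open>s'\<close> appear.\<close>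

definition pair_coeff :: "nat set \<Rightarrow> nat \<Rightarrow> nat \<Rightarrow> nat \<Rightarrow> nat \<Rightarrow> real" where
  "pair_coeff A s s' k l = cumul A s k * cumul (insert s A) s' l / 2"

text \<open>The derivative of \<open>nu_path\<close> in \<open>t\<close>. Each summand carries one
  extra factor \<open>ov_cavity\<close>, which is the source of all gains in order.\<close>

definition drift :: "nat \<Rightarrow> nat \<Rightarrow> nat set \<Rightarrow> nat \<Rightarrow> nat \<Rightarrow> real \<Rightarrow> nat set \<Rightarrow> ((nat \<Rightarrow> nat \<Rightarrow> int) \<Rightarrow> real) \<Rightarrow> real" where
  "drift N c A s s' t B f = (\<Sum>k\<in>B. \<Sum>l\<in>B. pair_coeff A s s' k l * \<beta>\<^sup>2 *
      nu_path N c t B (\<lambda>\<sigma>. f \<sigma> * (of_int (\<sigma> k c) * of_int (\<sigma> l c) * ov_cavity N c k l \<sigma>)))"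

lemma nu_path_has_derivative:
  assumes "c < N" and t: "0 < t" "t < 1"
    and B: "finite B" "A \<subseteq> B" "s \<in> B - A" "s' \<in> B - A" "s \<noteq> s'" and f: "depends_on A f"
  shows "((\<lambda>t. nu_path N c t B f) has_real_derivative drift N c A s s' t B f) (at t)"
proof -
  have *: "nu_path N c t B (\<lambda>\<sigma>. f \<sigma> * (\<beta>\<^sup>2 * g \<sigma>)) = \<beta>\<^sup>2 * nu_path N c t B (\<lambda>\<sigma>. f \<sigma> * g \<sigma>)" for g
    by (simp add: nu_path_cmult[symmetric] mult.left_commute)
  have "((\<lambda>t. nu_path N c t B f) has_real_derivative
     (\<Sum>k\<in>B. \<Sum>l\<in>B. cumul A s k * cumul (insert s A) s' l / 2 *
        nu_path N c t B (\<lambda>\<sigma>. f \<sigma> * (\<beta>\<^sup>2 * (of_int (\<sigma> k c) * of_int (\<sigma> l c) * ov_cavity N c k l \<sigma>))))) (at t)"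
    unfolding nu_path_def cavity_covariance[OF assms(1), symmetric]
    by (rule gaussian_interpolation.gauss_path_has_derivative[OF interpolation t B f])
  then show ?thesis unfolding * drift_def pair_coeff_def by (simp add: mult.assoc)
qed

end

section \<open>The two endpoints of the cavity path\<close>

lemma ravg_exp: "ravg \<Omega> (\<lambda>y. exp (H y)) B f = (\<Sum>\<sigma>\<in>PiE B (\<lambda>_. \<Omega>). f \<sigma> * exp (\<Sum>k\<in>B. H (\<sigma> k)))" if "finite B"
  using that by (simp add: ravg_def exp_sum)

lemma ravg_exp_one:
  fixes B :: "'i set"
  assumes "finite B"
  shows "ravg \<Omega> (\<lambda>y. exp (H y)) B (\<lambda>_. 1) = (\<Sum>y\<in>\<Omega>. exp (H y)) ^ card B"
  using ravg_prod[OF assms, of \<Omega> "\<lambda>y. exp (H y)" "\<lambda>_ _. 1"] by simp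

text \<open>In this form numerator and denominator are unnormalised sums, to which
  \<open>ravg_product\<close> applies separately.\<close>

lemma gavg_ratio:
  assumes "finite B"
  shows "gavg \<Omega> H B f = ravg \<Omega> (\<lambda>y. exp (H y)) B f / ravg \<Omega> (\<lambda>y. exp (H y)) B (\<lambda>_. 1)"
  using assms by (simp add: gavg_eq ravg_exp_one ravg_exp)

lemma measure_std_gauss [simp]: "measure std_gauss UNIV = 1"
  using prob_space.prob_space[OF prob_space_std_gauss] by simp

context GS
begin

definition nuN :: "nat \<Rightarrow> nat set \<Rightarrow> ((nat \<Rightarrow> nat \<Rightarrow> int) \<Rightarrow> real) \<Rightarrow> real" where
  "nuN N B f = (\<integral>g. gavg (configs S N) (GS_H \<beta> h D N g) B f \<partial>disorder N)"

lemma nu_eq_nuN: "nu S \<beta> h D N n f = nuN N {1..n} f"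
proof -
  have "gibbs S \<beta> h D N g = gibbs_weight (configs S N) (GS_H \<beta> h D N g)" for g
    by (rule ext) (simp add: gibbs_def gibbs_weight_def)
  then show ?thesis by (simp add: nu_def nuN_def gibbs_avg_def ravg_def)
qed

lemma HamPath_1: "HamPath N c 1 g y = GS_H \<beta> h D N g y"
proof -
  have "(\<Sum>e\<in>dis_idx N. sqrt (var0 c e + var1 c e * 1) * g e * coupling N c e y)
      = (\<Sum>e\<in>dis_idx N. \<beta> / sqrt (real N) * (g e * of_int (y (fst e)) * of_int (y (snd e))))"
  proof (intro sum.cong refl)
    fix e assume "e \<in> dis_idx N"
    then have "e \<noteq> (0,0)" by (metis spare_notin_dis_idx)
    then show "sqrt (var0 c e + var1 c e * 1) * g e * coupling N c e y
      = \<beta> / sqrt (real N) * (g e * of_int (y (fst e)) * of_int (y (snd e)))"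
      by (simp add: var0_def var1_def coupling_def)
  qed
  then show ?thesis
    unfolding HamPath_eq sum_idx_split GS_H_def
    by (simp add: fieldU_def fieldV_def var0_def var1_def sum_distrib_left case_prod_unfold)
qed

lemma integrable_nu_path: "finite B \<Longrightarrow> integrable (gauss_PiM (idx N)) (\<lambda>g. gavg (configs S N) (HamPath N c t g) B
    f)"
  unfolding HamPath_def by (rule gaussian_interpolation.integrable_gavg[OF interpolation])

lemma integral_idx:
  fixes F :: "(nat \<times> nat \<Rightarrow> real) \<Rightarrow> real"
  assumes "integrable (gauss_PiM (idx N)) F"
  shows "(\<integral>g. F g \<partial>gauss_PiM (idx N)) = (\<integral>g. (\<integral>x. F (g((0,0) := x)) \<partial>std_gauss) \<partial>disorder N)"
  using gauss_product.product_integral_insert[of "dis_idx N" "(0,0)" F] assms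
  by (simp add: disorder_def)

text \<open>At \<open>t = 1\<close> the spare Gaussian has variance zero, so integrating it out
  leaves the original disorder.\<close>

lemma nu_path_1:
  assumes "finite B"
  shows "nu_path N c 1 B f = nuN N B f"
proof -
  have u: "GS_H \<beta> h D N (g((0,0) := x)) = GS_H \<beta> h D N g" for g x
  proof
    fix y
    have "(\<Sum>(i,j)\<in>dis_idx N. (g((0,0) := x)) (i,j) * of_int (y i) * of_int (y j))
       = (\<Sum>(i,j)\<in>dis_idx N. g (i,j) * real_of_int (y i) * of_int (y j))"
    proof (intro sum.cong refl, clarify)
      fix i j assume "(i,j) \<in> dis_idx N"
      then have "(i,j) \<noteq> (0,0)" by (metis spare_notin_dis_idx)
      then show "(g((0,0) := x)) (i,j) * of_int (y i) * of_int (y j)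
        = g (i,j) * real_of_int (y i) * of_int (y j)" by (metis fun_upd_other)
    qed
    then show "GS_H \<beta> h D N (g((0,0) := x)) y = GS_H \<beta> h D N g y"
      by (simp add: GS_H_def)
  qed
  have H: "HamPath N c 1 g = GS_H \<beta> h D N g" for g by (rule ext) (rule HamPath_1)
  have "nu_path N c 1 B f = (\<integral>g. (\<integral>x. gavg (configs S N) (HamPath N c 1 (g((0,0) := x))) B f \<partial>std_gauss)
      \<partial>disorder N)"
    unfolding nu_path_eq by (rule integral_idx[OF integrable_nu_path[OF assms]])
  then show ?thesis
    unfolding H u nuN_def by simp
qed

definition HamRest :: "nat \<Rightarrow> nat \<Rightarrow> (nat \<times> nat \<Rightarrow> real) \<Rightarrow> (nat \<Rightarrow> int) \<Rightarrow> real" where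
  "HamRest N c g y = (\<Sum>e\<in>dis_idx N. sqrt (var0 c e) * g e * coupling N c e y)
     + D * (\<Sum>i\<in>{..<N}-{c}. of_int (y i) ^ 2) + h * (\<Sum>i\<in>{..<N}-{c}. of_int (y i))"

text \<open>The exponent of \<open>wgt\<close>: a single spin in the random field
  \<open>z\<close>.\<close>

definition Ham1 :: "real \<Rightarrow> int \<Rightarrow> real" where
  "Ham1 z s = \<beta> * sqrt q * z * of_int s + h * of_int s + (D + \<beta>\<^sup>2 / 2 * (p - q)) * of_int s ^ 2"

lemma HamPath_0:
  assumes "c < N"
  shows "HamPath N c 0 g y = HamRest N c g y + Ham1 (g (0,0)) (y c)"
proof -
  have "(\<Sum>i<N. f i) = f c + (\<Sum>i\<in>{..<N}-{c}. f i)" for f :: "nat \<Rightarrow> real"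
    using assms by (simp add: sum.remove)
  then show ?thesis
    unfolding HamPath_eq sum_idx_split HamRest_def Ham1_def
    by (simp add: fieldU_def fieldV_def coupling_def var0_def algebra_simps)
qed

lemma HamRest_upd_site: "HamRest N c g (y(c := s)) = HamRest N c g y"
proof -
  have 1: "(\<Sum>e\<in>dis_idx N. sqrt (var0 c e) * g e * coupling N c e (y(c := s)))
      = (\<Sum>e\<in>dis_idx N. sqrt (var0 c e) * g e * coupling N c e y)"
  proof (intro sum.cong refl)
    fix e assume "e \<in> dis_idx N"
    then have "e \<noteq> (0,0)" by (metis spare_notin_dis_idx)
    then show "sqrt (var0 c e) * g e * coupling N c e (y(c := s)) = sqrt (var0 c e) * g e * coupling N c e y"
      by (auto simp: var0_def coupling_def)
  qed
  have 2: "(\<Sum>i\<in>{..<N}-{c}. f ((y(c := s)) i)) = (\<Sum>i\<in>{..<N}-{c}. f (y i))" for f :: "int \<Rightarrow> real"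
    by (intro sum.cong) auto
  show ?thesis
    unfolding HamRest_def 1 2[of "\<lambda>x. real_of_int x ^ 2"] 2[of real_of_int] ..
qed

lemma HamRest_upd_spare: "HamRest N c (g((0,0) := x)) = HamRest N c g"
proof
  fix y
  have "(\<Sum>e\<in>dis_idx N. sqrt (var0 c e) * (g((0,0) := x)) e * coupling N c e y)
      = (\<Sum>e\<in>dis_idx N. sqrt (var0 c e) * g e * coupling N c e y)"
  proof (intro sum.cong refl)
    fix e assume "e \<in> dis_idx N"
    then have "e \<noteq> (0,0)" by (metis spare_notin_dis_idx)
    then show "sqrt (var0 c e) * (g((0,0) := x)) e * coupling N c e y = sqrt (var0 c e) * g e * coupling N c e y"
      by simp
  qed
  then show "HamRest N c (g((0,0) := x)) y = HamRest N c g y" by (simp add: HamRest_def)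
qed

lemma gavg_HamPath_0:
  fixes f :: "(nat \<Rightarrow> nat \<Rightarrow> int) \<Rightarrow> real"
  assumes "c < N" "finite B" "site_free c f" "depends_on B \<phi>"
  shows "gavg (configs S N) (HamPath N c 0 g) B (\<lambda>\<sigma>. f \<sigma> * \<phi> (\<lambda>k. \<sigma> k c))
    = gavg (PiE ({..<N}-{c}) (\<lambda>_. spins S)) (HamRest N c g) B f * gavg (spins S) (Ham1 (g (0,0))) B \<phi>"
proof -
  have \<Omega>: "configs S N = PiE (insert c ({..<N}-{c})) (\<lambda>_. spins S)"
    using assms(1) by (simp add: configs_def insert_absorb)
  have r: "ravg (configs S N) (\<lambda>y. exp (HamPath N c 0 g y)) B (\<lambda>\<sigma>. f' \<sigma> * \<phi>' (\<lambda>k. \<sigma> k c))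
    = ravg (PiE ({..<N}-{c}) (\<lambda>_. spins S)) (\<lambda>y. exp (HamRest N c g y)) B f'
      * ravg (spins S) (\<lambda>s. exp (Ham1 (g (0,0)) s)) B \<phi>'"
    if "site_free c f'" "depends_on B \<phi>'" for f' \<phi>'
    unfolding \<Omega> using that assms(1,2)
    by (intro ravg_product) (auto simp: HamPath_0 HamRest_upd_site exp_add)
  have r1: "ravg (configs S N) (\<lambda>y. exp (HamPath N c 0 g y)) B (\<lambda>_. 1)
    = ravg (PiE ({..<N}-{c}) (\<lambda>_. spins S)) (\<lambda>y. exp (HamRest N c g y)) B (\<lambda>_. 1)
      * ravg (spins S) (\<lambda>s. exp (Ham1 (g (0,0)) s)) B (\<lambda>_. 1)"
    using r[of "\<lambda>_. 1" "\<lambda>_. 1"] by (simp add: site_free_def depends_on_const)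
  show ?thesis
    unfolding gavg_ratio[OF assms(2)] r[OF assms(3,4)] r1 by simp
qed

lemma gavg_Ham1:
  assumes "finite B"
  shows "gavg (spins S) (Ham1 z) B (\<lambda>s. \<Prod>a\<in>B. of_int (s a) ^ d a) = (\<Prod>a\<in>B. mom S \<beta> h D p q (d a) z)"
proof -
  have "(\<Sum>y\<in>spins S. gibbs_weight (spins S) (Ham1 z) y * of_int y ^ j) = mom S \<beta> h D p q j z" for j
    by (simp add: gibbs_weight_def Ham1_def mom_def wgt_def sum_divide_distrib mult_ac)
  then show ?thesis
    by (simp add: ravg_prod[OF assms, of "spins S" "gibbs_weight (spins S) (Ham1 z)" "\<lambda>a y. of_int y ^ d a"])
qed

text \<open>At \<open>t = 0\<close> the Hamiltonian splits between site \<open>c\<close> and the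
  rest. All replicas at \<open>c\<close> see the same spare Gaussian \<open>z\<close> and are
  independent given \<open>z\<close>, so the expectation over \<open>z\<close> stands outside the
  product of moments.\<close>

lemma nu_path_0:
  fixes f :: "(nat \<Rightarrow> nat \<Rightarrow> int) \<Rightarrow> real"
  assumes "c < N" "finite B" "site_free c f"
  shows "nu_path N c 0 B (\<lambda>\<sigma>. f \<sigma> * (\<Prod>a\<in>B. of_int (\<sigma> a c) ^ d a))
    = nu_path N c 0 B f * Eg (\<lambda>z. \<Prod>a\<in>B. mom S \<beta> h D p q (d a) z)"
proof -
  let ?P = "\<lambda>g. gavg (PiE ({..<N}-{c}) (\<lambda>_. spins S)) (HamRest N c g) B f"
  let ?Q = "\<lambda>z. \<Prod>a\<in>B. mom S \<beta> h D p q (d a) z"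
  have dep: "depends_on B (\<lambda>s :: nat \<Rightarrow> int. \<Prod>a\<in>B. of_int (s a) ^ d a :: real)"
    by (intro depends_on_prod depends_on_power depends_on_1)
  have 1: "gavg (configs S N) (HamPath N c 0 g) B (\<lambda>\<sigma>. f \<sigma> * (\<Prod>a\<in>B. of_int (\<sigma> a c) ^ d a))
      = ?P g * ?Q (g (0,0))" for g
    using gavg_HamPath_0[OF assms dep, of g] gavg_Ham1[OF assms(2), of "g (0,0)" d] by simp
  have 2: "gavg (configs S N) (HamPath N c 0 g) B f = ?P g" for g
    using gavg_HamPath_0[OF assms depends_on_const[where x="1::real"], of g]
      ravg_const[OF assms(2) sum_gibbs_weight[OF finite_spins spins_ne], of S "Ham1 (g (0,0))" 1]
    by simp
  have "nu_path N c 0 B (\<lambda>\<sigma>. f \<sigma> * (\<Prod>a\<in>B. of_int (\<sigma> a c) ^ d a))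
      = (\<integral>g. (\<integral>z. ?P g * ?Q z \<partial>std_gauss) \<partial>disorder N)"
    unfolding nu_path_eq using integral_idx[OF integrable_nu_path[OF assms(2)], of N c 0 "\<lambda>\<sigma>. f \<sigma>
        * (\<Prod>a\<in>B. of_int (\<sigma> a c) ^ d a)"]
    by (simp only: 1 HamRest_upd_spare fun_upd_same)
  also have "\<dots> = (\<integral>g. ?P g \<partial>disorder N) * (\<integral>z. ?Q z \<partial>std_gauss)"
    by simp
  also have "(\<integral>g. ?P g \<partial>disorder N) = nu_path N c 0 B f"
    unfolding nu_path_eq using integral_idx[OF integrable_nu_path[OF assms(2)], of N c 0 f]
    by (simp add: 2 HamRest_upd_spare)
  also have "(\<integral>z. ?Q z \<partial>std_gauss) = Eg ?Q"
    unfolding Eg_def mom_def wgt_def by (subst integral_std_gauss) (simp_all add: mult.commute)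
  finally show ?thesis .
qed

end

section \<open>A priori bounds and comparison along the path\<close>

lemma Eg_bound:
  assumes [measurable]: "f \<in> borel_measurable borel" and b: "\<And>t. \<bar>f t\<bar> \<le> K"
  shows "\<bar>Eg f\<bar> \<le> K"
proof -
  have K0: "0 \<le> K" using b[of 0] by linarith
  have "Eg f = (\<integral>t. f t \<partial>std_gauss)" unfolding Eg_def by (rule integral_std_gauss[symmetric]) simp
  also have "\<bar>\<dots>\<bar> \<le> (\<integral>t. \<bar>f t\<bar> \<partial>std_gauss)" by (rule integral_abs_bound)
  also have "\<dots> \<le> (\<integral>t. K \<partial>std_gauss)"
    by (intro integral_mono finite_measure.integrable_const_bound[OF prob_space.axioms(1)[OF
        prob_space_std_gauss], where B=K])
      (simp_all add: b K0)
  finally show ?thesis by simp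
qed

lemma measurable_mom [measurable]: "mom S \<beta> h D p q j \<in> borel_measurable borel"
  unfolding mom_def wgt_def by measurable

lemma abs_mom_le: "\<bar>mom S \<beta> h D p q j t\<bar> \<le> real S ^ j"
proof -
  let ?w = "wgt S \<beta> h D p q t"
  have Z: "0 < (\<Sum>s\<in>spins S. ?w s)" by (intro sum_pos) (auto simp: wgt_def)
  have "\<bar>\<Sum>s\<in>spins S. of_int s ^ j * ?w s\<bar> \<le> (\<Sum>s\<in>spins S. real S ^ j * ?w s)"
    by (rule sum_abs[THEN order_trans])
      (auto intro!: sum_mono mult_right_mono power_mono abs_spin_le simp: abs_mult power_abs wgt_def)
  then show ?thesis using Z
    by (simp add: mom_def abs_mult divide_le_eq sum_distrib_left[symmetric])
qed

context GS
begin

lemma abs_Qpq_le: "\<bar>Qpq p q k l\<bar> \<le> real S ^ 2"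
proof -
  have "\<bar>(mom S \<beta> h D p q 1 t)\<^sup>2\<bar> \<le> real S ^ 2" for t
    using abs_mom_le[of S \<beta> h D p q 1 t] power_mono[of "\<bar>mom S \<beta> h D p q 1 t\<bar>" "real S" 2] by simp
  then have "\<bar>q\<bar> \<le> real S ^ 2"
    using Eg_bound[of "\<lambda>t. (mom S \<beta> h D p q 1 t)\<^sup>2" "real S ^ 2"] fixed_point
    by (simp add: pq_fixed_point_def)
  moreover have "\<bar>p\<bar> \<le> real S ^ 2"
    using Eg_bound[of "mom S \<beta> h D p q 2" "real S ^ 2"] fixed_point abs_mom_le[of S \<beta> h D p q 2]
    by (simp add: pq_fixed_point_def)
  ultimately show ?thesis by (simp add: Qpq_def)
qed

definition ov :: "nat \<Rightarrow> nat \<Rightarrow> nat \<Rightarrow> (nat \<Rightarrow> nat \<Rightarrow> int) \<Rightarrow> real" where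
  "ov N k l \<sigma> = overlap N \<sigma> k l - Qpq p q k l"

definition spin_prod :: "nat \<Rightarrow> nat \<Rightarrow> nat \<Rightarrow> (nat \<Rightarrow> nat \<Rightarrow> int) \<Rightarrow> real" where
  "spin_prod c k l \<sigma> = of_int (\<sigma> k c) * of_int (\<sigma> l c)"

lemma ov_eq_ov_cavity: "c < N \<Longrightarrow> ov N k l \<sigma> = ov_cavity N c k l \<sigma> + spin_prod c k l \<sigma> / real N"
  unfolding ov_def ov_cavity_def spin_prod_def overlap_def
  by (subst sum.remove[of "{..<N}" c]) (simp_all add: distrib_left)

lemma ov_eq_avg: "0 < N \<Longrightarrow> ov N k l \<sigma> = (\<Sum>c<N. spin_prod c k l \<sigma> - Qpq p q k l) / real N"
  by (simp add: ov_def spin_prod_def overlap_def sum_subtractf diff_divide_distrib)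

lemma spin_mem:
  "\<sigma> \<in> PiE B (\<lambda>_. configs S N) \<Longrightarrow> k \<in> B \<Longrightarrow> c < N \<Longrightarrow> \<sigma> k c \<in> spins S"
  by (auto simp: configs_def PiE_def Pi_def)

lemma abs_spin_prod_le:
  assumes "\<sigma> \<in> PiE B (\<lambda>_. configs S N)" "k \<in> B" "l \<in> B" "c < N"
  shows "\<bar>spin_prod c k l \<sigma>\<bar> \<le> real S ^ 2"
  unfolding spin_prod_def abs_mult power2_eq_square
  using assms by (intro mult_mono abs_spin_le spin_mem[OF assms(1)]) auto

lemma abs_ov_cavity_le:
  assumes "\<sigma> \<in> PiE B (\<lambda>_. configs S N)" "k \<in> B" "l \<in> B" "c < N"
  shows "\<bar>ov_cavity N c k l \<sigma>\<bar> \<le> 2 * real S ^ 2"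
proof -
  have "\<bar>\<Sum>i\<in>{..<N} - {c}. of_int (\<sigma> k i) * of_int (\<sigma> l i) :: real\<bar> \<le> (\<Sum>i\<in>{..<N} - {c}. real S ^ 2)"
    using abs_spin_prod_le[OF assms(1-3)] by (intro sum_abs[THEN order_trans] sum_mono) (auto simp: spin_prod_def)
  also have "\<dots> \<le> real N * real S ^ 2" using assms(4) by (simp add: mult_right_mono)
  finally have "\<bar>(1 / real N) * (\<Sum>i\<in>{..<N} - {c}. of_int (\<sigma> k i) * of_int (\<sigma> l i))\<bar> \<le> real S ^ 2"
    using assms(4) by (simp add: abs_mult field_simps)
  then show ?thesis using abs_Qpq_le[of k l] unfolding ov_cavity_def by linarith
qed

lemma abs_ov_le:
  assumes "\<sigma> \<in> PiE B (\<lambda>_. configs S N)" "k \<in> B" "l \<in> B" "0 < N"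
  shows "\<bar>ov N k l \<sigma>\<bar> \<le> 3 * real S ^ 2"
proof -
  have "\<bar>spin_prod 0 k l \<sigma> / real N\<bar> \<le> real S ^ 2 / 1"
    unfolding abs_divide using abs_spin_prod_le[OF assms] assms(4) by (intro frac_le) auto
  then show ?thesis using abs_ov_cavity_le[OF assms] ov_eq_ov_cavity[OF assms(4), of k l \<sigma>] by linarith
qed

lemma depends_on_spin_prod: "k \<in> A \<Longrightarrow> l \<in> A \<Longrightarrow> depends_on A (spin_prod c k l)"
  unfolding spin_prod_def depends_on_def by simp

lemma depends_on_ov: "k \<in> A \<Longrightarrow> l \<in> A \<Longrightarrow> depends_on A (ov N k l)"
  unfolding ov_def overlap_def depends_on_def by simp

lemma depends_on_ov_cavity: "k \<in> A \<Longrightarrow> l \<in> A \<Longrightarrow> depends_on A (ov_cavity N c k l)"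
  unfolding ov_cavity_def depends_on_def by simp

lemma drift_eq: "drift N c A s s' t B f = (\<Sum>k\<in>B. \<Sum>l\<in>B. pair_coeff A s s' k l * \<beta>\<^sup>2 *
      nu_path N c t B (\<lambda>\<sigma>. f \<sigma> * (spin_prod c k l \<sigma> * ov_cavity N c k l \<sigma>)))"
  by (simp add: drift_def spin_prod_def)

lemma abs_pair_coeff_le:
  assumes "finite A" shows "\<bar>pair_coeff A s s' k l\<bar> \<le> (real (card A) + 2) ^ 2"
proof -
  have "\<bar>cumul A s k\<bar> \<le> real (card A) + 2" using abs_cumul_le[of A s k] by linarith
  moreover have "\<bar>cumul (insert s A) s' l\<bar> \<le> real (card A) + 2"
    using abs_cumul_le[of "insert s A" s' l] card_insert_le_m1[of _ A s] assms
    by (auto simp: card_insert_if split: if_splits)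
  ultimately have "\<bar>cumul A s k\<bar> * \<bar>cumul (insert s A) s' l\<bar> \<le> (real (card A) + 2) * (real (card A) + 2)"
    by (intro mult_mono) auto
  moreover have "0 \<le> \<bar>cumul A s k\<bar> * \<bar>cumul (insert s A) s' l\<bar>" by simp
  ultimately show ?thesis by (simp only: pair_coeff_def abs_mult abs_divide power2_eq_square)
qed

lemma abs_drift_le:
  assumes "finite A" "finite B" "c < N"
  shows "\<bar>drift N c A s s' t B f\<bar> \<le> \<beta>\<^sup>2 * ((real (card A) + 2) ^ 2 * real S ^ 2 *
     (\<Sum>k\<in>B. \<Sum>l\<in>B. nu_path N c t B (\<lambda>\<sigma>. \<bar>f \<sigma>\<bar> * \<bar>ov_cavity N c k l \<sigma>\<bar>)))"
proof -
  have "\<bar>pair_coeff A s s' k l * \<beta>\<^sup>2 * nu_path N c t B (\<lambda>\<sigma>. f \<sigma> * (spin_prod c k l \<sigma> * ov_cavity N c k l \<sigma>))\<bar>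
      \<le> \<beta>\<^sup>2 * ((real (card A) + 2) ^ 2 * real S ^ 2 * nu_path N c t B (\<lambda>\<sigma>. \<bar>f \<sigma>\<bar> * \<bar>ov_cavity N c k l \<sigma>\<bar>))"
    if "k \<in> B" "l \<in> B" for k l
  proof -
    have "\<bar>nu_path N c t B (\<lambda>\<sigma>. f \<sigma> * (spin_prod c k l \<sigma> * ov_cavity N c k l \<sigma>))\<bar>
        \<le> nu_path N c t B (\<lambda>\<sigma>. \<bar>f \<sigma> * (spin_prod c k l \<sigma> * ov_cavity N c k l \<sigma>)\<bar>)"
            by (rule abs_nu_path_le[OF assms(2)])
    also have "\<dots> \<le> nu_path N c t B (\<lambda>\<sigma>. real S ^ 2 * (\<bar>f \<sigma>\<bar> * \<bar>ov_cavity N c k l \<sigma>\<bar>))"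
    proof (rule nu_path_mono[OF assms(2)])
      fix \<sigma> assume "\<sigma> \<in> PiE B (\<lambda>_. configs S N)"
      from mult_right_mono[OF abs_spin_prod_le[OF this that assms(3)], of "\<bar>f \<sigma>\<bar> * \<bar>ov_cavity N c k l \<sigma>\<bar>"]
      show "\<bar>f \<sigma> * (spin_prod c k l \<sigma> * ov_cavity N c k l \<sigma>)\<bar> \<le> real S ^ 2 * (\<bar>f \<sigma>\<bar> * \<bar>ov_cavity N c k l \<sigma>\<bar>)"
        by (simp add: abs_mult mult_ac)
    qed
    finally have "\<bar>nu_path N c t B (\<lambda>\<sigma>. f \<sigma> * (spin_prod c k l \<sigma> * ov_cavity N c k l \<sigma>))\<bar>
        \<le> real S ^ 2 * nu_path N c t B (\<lambda>\<sigma>. \<bar>f \<sigma>\<bar> * \<bar>ov_cavity N c k l \<sigma>\<bar>)" by (simp add: nu_path_cmult)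
    then have "\<bar>pair_coeff A s s' k l\<bar> * \<bar>nu_path N c t B (\<lambda>\<sigma>. f \<sigma> * (spin_prod c k l \<sigma> * ov_cavity N c k l \<sigma>))\<bar>
      \<le> (real (card A) + 2) ^ 2 * (real S ^ 2 * nu_path N c t B (\<lambda>\<sigma>. \<bar>f \<sigma>\<bar> * \<bar>ov_cavity N c k l \<sigma>\<bar>))"
      by (intro mult_mono abs_pair_coeff_le assms) auto
    from mult_left_mono[OF this, of "\<beta>\<^sup>2"] show ?thesis by (simp add: abs_mult mult_ac)
  qed
  then have "\<bar>drift N c A s s' t B f\<bar> \<le> (\<Sum>k\<in>B. \<Sum>l\<in>B. \<beta>\<^sup>2 * ((real (card A) + 2) ^ 2 * real S ^ 2
      * nu_path N c t B (\<lambda>\<sigma>. \<bar>f \<sigma>\<bar> * \<bar>ov_cavity N c k l \<sigma>\<bar>)))"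
    unfolding drift_eq by (intro sum_abs[THEN order_trans] sum_mono) auto
  then show ?thesis by (simp add: sum_distrib_left)
qed

text \<open>One factor \<open>(real n + 2) ^ 2\<close> bounds the coefficients, another counts the
  pairs among \<open>n + 2\<close> replicas; \<open>2 * real S ^ 4\<close> comes from the spin
  product and the cavity overlap. The factor \<open>\<beta>\<^sup>2\<close> is dropped by
  \<open>beta2_le\<close>, so the constant is available before \<open>\<beta>\<close> is
  chosen.\<close>

definition Kcmp :: "nat \<Rightarrow> real" where
  "Kcmp n = 2 * (real n + 2) ^ 4 * real S ^ 4"

lemma Kcmp_nonneg: "0 \<le> Kcmp n" by (simp add: Kcmp_def)

lemma nu_path_nonneg:
  assumes "finite B" "\<And>\<sigma>. \<sigma> \<in> PiE B (\<lambda>_. configs S N) \<Longrightarrow> 0 \<le> f \<sigma>"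
  shows "0 \<le> nu_path N c t B f"
  using nu_path_mono[OF assms(1), where f="\<lambda>_. 0" and g=f and N=N and c=c
      and t=t] assms nu_path_const[OF assms(1), of N c t 0]
  by simp

lemma beta2_le: "0 \<le> x \<Longrightarrow> \<beta>\<^sup>2 * x \<le> x"
  using beta_pos beta_le1 by (intro mult_left_le_one_le) (auto simp: power_le_one)

lemma obtain_fresh2:
  assumes "finite (A :: nat set)" obtains s s' where "s \<notin> A" "s' \<notin> A" "s \<noteq> s'"
proof -
  obtain s where "s \<notin> A" using ex_new_if_finite[OF infinite_UNIV_nat assms] by blast
  moreover obtain s' where "s' \<notin> insert s A" using ex_new_if_finite[OF infinite_UNIV_nat, of "insert s A"] assms
      by blast
  ultimately show ?thesis using that[of s s'] by auto
qed

text \<open>A Gronwall argument: for nonnegative \<open>f\<close> the drift is at most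
  \<open>Kcmp (card A)\<close> times the average of \<open>f\<close>, so this average times
  \<open>exp (Kcmp (card A) * t)\<close> is nondecreasing. Moments at \<open>t = 1\<close> therefore
  control the whole path.\<close>

lemma nu_path_compare:
  assumes "c < N" "finite A" "depends_on A f" and t: "0 \<le> t" "t \<le> 1"
    and f: "\<And>\<sigma>. 0 \<le> f \<sigma>"
  shows "nu_path N c t A f \<le> exp (Kcmp (card A)) * nuN N A f"
proof -
  obtain s s' where s: "s \<notin> A" "s' \<notin> A" "s \<noteq> s'" using obtain_fresh2[OF assms(2)] by blast
  define B where "B = insert s (insert s' A)"
  have B: "finite B" "A \<subseteq> B" "s \<in> B - A" "s' \<in> B - A" "s \<noteq> s'" using s assms by (auto simp: B_def)
  have cB: "card B = card A + 2" using s assms by (simp add: B_def)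
  let ?K = "Kcmp (card A)"
  let ?g = "\<lambda>t. exp (?K * t) * nu_path N c t B f"
  have d: "\<bar>drift N c A s s' u B f\<bar> \<le> ?K * nu_path N c u B f" for u
  proof -
    have "nu_path N c u B (\<lambda>\<sigma>. \<bar>f \<sigma>\<bar> * \<bar>ov_cavity N c k l \<sigma>\<bar>)
        \<le> 2 * real S ^ 2 * nu_path N c u B f" if "k \<in> B" "l \<in> B" for k l
    proof -
      have "nu_path N c u B (\<lambda>\<sigma>. \<bar>f \<sigma>\<bar> * \<bar>ov_cavity N c k l \<sigma>\<bar>) \<le> nu_path N c u B (\<lambda>\<sigma>. 2 * real S ^ 2 * f \<sigma>)"
      proof (rule nu_path_mono[OF B(1)])
        fix \<sigma> assume "\<sigma> \<in> PiE B (\<lambda>_. configs S N)"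
        from mult_right_mono[OF abs_ov_cavity_le[OF this that assms(1)] f]
        show "\<bar>f \<sigma>\<bar> * \<bar>ov_cavity N c k l \<sigma>\<bar> \<le> 2 * real S ^ 2 * f \<sigma>" using f[of \<sigma>] by (simp add: mult.commute)
      qed
      then show ?thesis by (simp add: nu_path_cmult)
    qed
    then have "(\<Sum>k\<in>B. \<Sum>l\<in>B. nu_path N c u B (\<lambda>\<sigma>. \<bar>f \<sigma>\<bar> * \<bar>ov_cavity N c k l \<sigma>\<bar>))
        \<le> (\<Sum>k\<in>B. \<Sum>l\<in>B. 2 * real S ^ 2 * nu_path N c u B f)" by (intro sum_mono) auto
    also have "\<dots> = (real (card A) + 2) ^ 2 * (2 * real S ^ 2 * nu_path N c u B f)"
      by (simp add: cB power2_eq_square add.commute)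
    finally have "(real (card A) + 2) ^ 2 * real S ^ 2 * (\<Sum>k\<in>B. \<Sum>l\<in>B. nu_path N c u B (\<lambda>\<sigma>. \<bar>f \<sigma>\<bar>
        * \<bar>ov_cavity N c k l \<sigma>\<bar>))
       \<le> (real (card A) + 2) ^ 2 * real S ^ 2 * ((real (card A) + 2) ^ 2 * (2 * real S ^ 2 * nu_path N c u B f))"
      by (rule mult_left_mono) simp
    also have "\<dots> = ?K * nu_path N c u B f"
      by (simp add: Kcmp_def power2_eq_square power4_eq_xxxx mult_ac)
    finally have *: "(real (card A) + 2) ^ 2 * real S ^ 2 * (\<Sum>k\<in>B. \<Sum>l\<in>B. nu_path N c u B (\<lambda>\<sigma>. \<bar>f \<sigma>\<bar>
        * \<bar>ov_cavity N c k l \<sigma>\<bar>)) \<le> ?K * nu_path N c u B f" .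
    have "0 \<le> (real (card A) + 2) ^ 2 * real S ^ 2 * (\<Sum>k\<in>B. \<Sum>l\<in>B. nu_path N c u B (\<lambda>\<sigma>. \<bar>f \<sigma>\<bar>
        * \<bar>ov_cavity N c k l \<sigma>\<bar>))"
      by (intro mult_nonneg_nonneg sum_nonneg nu_path_nonneg[OF B(1)]) auto
    from order_trans[OF order_trans[OF abs_drift_le[OF assms(2) B(1) assms(1)] beta2_le[OF this]] *]
    show ?thesis .
  qed
  have "?g t \<le> ?g 1"
  proof (rule DERIV_nonneg_imp_increasing_open[OF t(2)])
    fix u assume u: "t < u" "u < 1"
    have "((\<lambda>t. exp (?K * t)) has_real_derivative ?K * exp (?K * u)) (at u)"
      by (auto intro!: derivative_eq_intros)
    from DERIV_mult[OF this nu_path_has_derivative[OF assms(1) _ u(2) B assms(3)]] u t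
    have "(?g has_real_derivative (?K * exp (?K * u) * nu_path N c u B f + drift N c A s s' u B f * exp (?K
        * u))) (at u)"
      by simp
    moreover have "0 \<le> ?K * exp (?K * u) * nu_path N c u B f + drift N c A s s' u B f * exp (?K * u)"
    proof -
      have "0 \<le> (?K * nu_path N c u B f + drift N c A s s' u B f) * exp (?K * u)" using d[of u] by auto
      then show ?thesis by (simp add: algebra_simps)
    qed
    ultimately show "\<exists>y. (?g has_real_derivative y) (at u) \<and> 0 \<le> y" by blast
  qed (intro continuous_intros nu_path_continuous B(1))
  moreover have "1 * nu_path N c t B f \<le> ?g t"
    using t Kcmp_nonneg f by (intro mult_right_mono nu_path_nonneg[OF B(1)]) auto
  ultimately have "nu_path N c t B f \<le> exp ?K * nu_path N c 1 B f" by simp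
  then show ?thesis
    unfolding nu_path_marginal[OF B(1,2) assms(3)] nu_path_1[OF assms(2)] .
qed

text \<open>\<open>x\<close> is a guess for the drift. The guess \<open>0\<close> gives the crude
  first order bounds, the drift at \<open>t = 0\<close> gives the second order expansion.\<close>

lemma nu_path_mvt:
  assumes "c < N" "0 \<le> r" "r \<le> t" "t \<le> 1"
    and B: "finite B" "A \<subseteq> B" "s \<in> B - A" "s' \<in> B - A" "s \<noteq> s'" "depends_on A f"
    and M: "\<And>u. 0 < u \<Longrightarrow> u < 1 \<Longrightarrow> \<bar>drift N c A s s' u B f - x\<bar> \<le> M"
  shows "\<bar>nu_path N c t B f - nu_path N c r B f - (t - r) * x\<bar> \<le> M"
proof (cases "r = t")
  case True
  then show ?thesis using order_trans[OF abs_ge_zero M[of "1/2"]] by simp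
next
  case False
  then have rt: "r < t" using assms by simp
  have "\<exists>l z. r < z \<and> z < t \<and> ((\<lambda>t. nu_path N c t B f) has_real_derivative l) (at z) \<and> nu_path N c t B f
      - nu_path N c r B f = (t - r) * l"
  proof (rule MVT[OF rt nu_path_continuous[OF B(1)]])
    fix u assume u: "r < u" "u < t"
    then have "0 < u" "u < 1" using assms(2,4) by auto
    from nu_path_has_derivative[OF assms(1) this B] show "(\<lambda>t. nu_path N c t B f) differentiable (at u)"
      unfolding real_differentiable_def by (rule exI)
  qed
  then obtain l z where z: "r < z" "z < t" "((\<lambda>t. nu_path N c t B f) has_real_derivative l) (at z)"
    "nu_path N c t B f - nu_path N c r B f = (t - r) * l" by blast
  have "l = drift N c A s s' z B f"
    using z assms by (intro DERIV_unique[OF z(3) nu_path_has_derivative[OF assms(1) _ _ B]]) auto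
  then have "\<bar>l - x\<bar> \<le> M" using M[of z] z assms by auto
  moreover have "\<bar>(t - r) * (l - x)\<bar> \<le> \<bar>l - x\<bar>"
    unfolding abs_mult using assms by (intro mult_left_le_one_le) auto
  ultimately show ?thesis unfolding z(4) by (simp add: algebra_simps)
qed

end

section \<open>Moment bounds for the centred overlaps\<close>

lemma power_add_bound:
  fixes x y :: real
  assumes "0 \<le> x" "0 \<le> y"
  shows "(x + y) ^ m \<le> 2 ^ m * (x ^ m + y ^ m)"
proof -
  have "(x + y) ^ m \<le> (2 * max x y) ^ m" using assms by (intro power_mono) auto
  also have "\<dots> = 2 ^ m * max x y ^ m" by (rule power_mult_distrib)
  also have "max x y ^ m \<le> x ^ m + y ^ m" using assms by (auto simp: max_def)
  finally show ?thesis by simp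
qed

lemma power_diff_bound:
  fixes a b :: real
  assumes "\<bar>a - b\<bar> \<le> \<delta>"
  shows "\<bar>a ^ Suc m - b ^ Suc m\<bar> \<le> real (Suc m) * 2 ^ m * \<delta> * (\<bar>a\<bar> ^ m + \<delta> ^ m)"
proof -
  have d0: "0 \<le> \<delta>" using assms abs_ge_zero[of "a - b"] by linarith
  have "\<bar>\<Sum>i<Suc m. b ^ (Suc m - Suc i) * a ^ i\<bar> \<le> (\<Sum>i<Suc m. (\<bar>a\<bar> + \<delta>) ^ m)"
  proof (rule sum_abs[THEN order_trans], rule sum_mono)
    fix i assume i: "i \<in> {..<Suc m}"
    have "\<bar>b\<bar> \<le> \<bar>a\<bar> + \<delta>" using assms by linarith
    then have "\<bar>b\<bar> ^ (Suc m - Suc i) * \<bar>a\<bar> ^ i \<le> (\<bar>a\<bar> + \<delta>) ^ (Suc m - Suc i) * (\<bar>a\<bar> + \<delta>) ^ i"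
      using d0 by (intro mult_mono power_mono) auto
    also have "\<dots> = (\<bar>a\<bar> + \<delta>) ^ m" using i by (simp add: power_add[symmetric])
    finally show "\<bar>b ^ (Suc m - Suc i) * a ^ i\<bar> \<le> (\<bar>a\<bar> + \<delta>) ^ m" by (simp add: abs_mult power_abs)
  qed
  also have "\<dots> = real (Suc m) * (\<bar>a\<bar> + \<delta>) ^ m" by simp
  also have "\<dots> \<le> real (Suc m) * (2 ^ m * (\<bar>a\<bar> ^ m + \<delta> ^ m))"
    using d0 by (intro mult_left_mono power_add_bound) auto
  finally have "\<bar>a - b\<bar> * \<bar>\<Sum>i<Suc m. b ^ (Suc m - Suc i) * a ^ i\<bar>
      \<le> \<delta> * (real (Suc m) * (2 ^ m * (\<bar>a\<bar> ^ m + \<delta> ^ m)))"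
    using assms d0 by (intro mult_mono) auto
  then show ?thesis
    by (subst power_diff_sumr2) (simp only: abs_mult mult_ac)
qed

lemma power_mult_le_sum:
  fixes x y :: real
  assumes "0 \<le> x" "0 \<le> y"
  shows "x ^ n * y \<le> x ^ Suc n + y ^ Suc n"
proof -
  have "x ^ n * y \<le> max x y ^ n * max x y" using assms by (intro mult_mono power_mono) auto
  also have "\<dots> = max x y ^ Suc n" by simp
  also have "\<dots> \<le> x ^ Suc n + y ^ Suc n" using assms by (auto simp: max_def)
  finally show ?thesis .
qed

text \<open>The multiplicity of replica \<open>a\<close> in the pair \<open>(k,l)\<close>, used as
  an exponent. It is two on a diagonal pair, which makes self-overlaps a case of the same
  formulas.\<close>

definition spin_count :: "nat \<Rightarrow> nat \<Rightarrow> nat \<Rightarrow> nat" where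
  "spin_count k l a = (if a = k then 1 else 0) + (if a = l then 1 else 0)"

lemma prod_spin_count:
  fixes x :: "nat \<Rightarrow> real"
  assumes "finite B" "k \<in> B" "l \<in> B"
  shows "(\<Prod>a\<in>B. x a ^ spin_count k l a) = x k * x l"
proof -
  have "(\<Prod>a\<in>B. x a ^ spin_count k l a) = (\<Prod>a\<in>B. (if a = k then x a else 1) * (if a = l then x a else 1))"
    by (intro prod.cong) (auto simp: spin_count_def)
  then show ?thesis using assms by (simp add: prod.distrib)
qed

context GS
begin

text \<open>This and the following rules for \<open>nuN\<close> are inherited from
  \<open>nu_path\<close> at \<open>t = 1\<close>, where the choice of the site is
  immaterial.\<close>

lemma nuN_add: "finite B \<Longrightarrow> nuN N B (\<lambda>\<sigma>. f \<sigma> + g \<sigma>) = nuN N B f + nuN N B g"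
  using nu_path_add[of B N 0 1 f g] by (simp add: nu_path_1)

lemma nuN_diff: "finite B \<Longrightarrow> nuN N B (\<lambda>\<sigma>. f \<sigma> - g \<sigma>) = nuN N B f - nuN N B g"
  using nu_path_diff[of B N 0 1 f g] by (simp add: nu_path_1)

lemma nuN_cmult: "finite B \<Longrightarrow> nuN N B (\<lambda>\<sigma>. x * f \<sigma>) = x * nuN N B f"
  using nu_path_cmult[of N 0 1 B x f] by (simp add: nu_path_1)

lemma nuN_sum: "finite B \<Longrightarrow> nuN N B (\<lambda>\<sigma>. \<Sum>i\<in>I. f i \<sigma>) = (\<Sum>i\<in>I. nuN N B (f i))"
  using nu_path_sum[of B N 0 1 f I] by (simp add: nu_path_1)

lemma nuN_mono:
  "finite B \<Longrightarrow> (\<And>\<sigma>. \<sigma> \<in> PiE B (\<lambda>_. configs S N) \<Longrightarrow> f \<sigma> \<le> g \<sigma>) \<Longrightarrow> nuN N B f \<le> nuN N B g"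
  using nu_path_mono[of B N f g 0 1] by (simp add: nu_path_1)

lemma nuN_cong:
  "finite B \<Longrightarrow> (\<And>\<sigma>. \<sigma> \<in> PiE B (\<lambda>_. configs S N) \<Longrightarrow> f \<sigma> = g \<sigma>) \<Longrightarrow> nuN N B f = nuN N B g"
  using nu_path_cong[of B N f g 0 1] by (simp add: nu_path_1)

lemma nuN_const: "finite B \<Longrightarrow> nuN N B (\<lambda>_. x) = x"
  using nu_path_const[of B N 0 1 x] by (simp add: nu_path_1)

lemma nuN_marginal: "finite B \<Longrightarrow> A \<subseteq> B \<Longrightarrow> depends_on A f \<Longrightarrow> nuN N B f = nuN N A f"
  using nu_path_marginal[of B A f N 0 1] finite_subset[of A B] by (simp add: nu_path_1)

lemma abs_nuN_le: "finite B \<Longrightarrow> \<bar>nuN N B f\<bar> \<le> nuN N B (\<lambda>\<sigma>. \<bar>f \<sigma>\<bar>)"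
  using abs_nu_path_le[of B N 0 1 f] by (simp add: nu_path_1)

lemma nuN_nonneg:
  "finite B \<Longrightarrow> (\<And>\<sigma>. \<sigma> \<in> PiE B (\<lambda>_. configs S N) \<Longrightarrow> 0 \<le> f \<sigma>) \<Longrightarrow> 0 \<le> nuN N B f"
  using nu_path_nonneg[of B N f 0 1] by (simp add: nu_path_1)

lemma sum_GS_weight: "sum (gibbs_weight (configs S N) H) (configs S N) = 1"
  by (rule sum_gibbs_weight) simp_all

text \<open>Both replicas lie outside the empty support of a constant factor, so
  \<open>ravg_relabel2\<close> moves them to \<open>1\<close> and \<open>2\<close>.\<close>

lemma nuN_pair:
  assumes "finite R" "k \<in> R" "l \<in> R" "k \<noteq> l"
  shows "nuN N R (\<lambda>\<sigma>. F (ov N k l \<sigma>)) = nuN N {1,2} (\<lambda>\<sigma>. F (ov N 1 2 \<sigma>))"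
proof -
  define g where "g y y' = F ((1 / real N) * (\<Sum>i<N. of_int (y i) * of_int (y' i)) - q)" for y y' :: "nat \<Rightarrow> int"
  have g: "F (ov N k l \<sigma>) = g (\<sigma> k) (\<sigma> l) * 1" if "k \<noteq> l" for k l \<sigma>
    using that by (simp add: g_def ov_def overlap_def Qpq_def)
  have g12: "F (ov N 1 2 \<sigma>) = g (\<sigma> 1) (\<sigma> 2) * 1" for \<sigma> by (rule g) simp
  let ?R = "R \<union> {1,2}"
  have "nuN N R (\<lambda>\<sigma>. F (ov N k l \<sigma>)) = nuN N ?R (\<lambda>\<sigma>. F (ov N k l \<sigma>))"
    using assms by (intro nuN_marginal[symmetric] depends_on_comp[where h=F] depends_on_ov) auto
  also have "\<dots> = nuN N ?R (\<lambda>\<sigma>. F (ov N 1 2 \<sigma>))"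
    unfolding nuN_def g[OF assms(4)] g12 using assms
    by (intro Bochner_Integration.integral_cong refl ravg_relabel2[where A="{}"])
      (simp_all add: sum_GS_weight depends_on_const)
  also have "\<dots> = nuN N {1,2} (\<lambda>\<sigma>. F (ov N 1 2 \<sigma>))"
    using assms by (intro nuN_marginal depends_on_comp[where h=F] depends_on_ov) auto
  finally show ?thesis .
qed

lemma nuN_diag:
  assumes "finite R" "k \<in> R"
  shows "nuN N R (\<lambda>\<sigma>. F (ov N k k \<sigma>)) = nuN N {1,2} (\<lambda>\<sigma>. F (ov N 1 1 \<sigma>))"
proof -
  define g where "g y = F ((1 / real N) * (\<Sum>i<N. of_int (y i) * of_int (y i)) - p)" for y :: "nat \<Rightarrow> int"
  have g: "F (ov N k k \<sigma>) = g (\<sigma> k) * 1" for k \<sigma>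
    by (simp add: g_def ov_def overlap_def Qpq_def)
  let ?R = "R \<union> {1,2}"
  have "nuN N R (\<lambda>\<sigma>. F (ov N k k \<sigma>)) = nuN N ?R (\<lambda>\<sigma>. F (ov N k k \<sigma>))"
    using assms by (intro nuN_marginal[symmetric] depends_on_comp[where h=F] depends_on_ov) auto
  also have "\<dots> = nuN N ?R (\<lambda>\<sigma>. F (ov N 1 1 \<sigma>))"
    unfolding nuN_def g using assms
    by (intro Bochner_Integration.integral_cong refl ravg_relabel_diag[where A="{}"])
      (simp_all add: sum_GS_weight depends_on_const)
  also have "\<dots> = nuN N {1,2} (\<lambda>\<sigma>. F (ov N 1 1 \<sigma>))"
    using assms by (intro nuN_marginal depends_on_comp[where h=F] depends_on_ov) auto
  finally show ?thesis .
qed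

lemma mom_0 [simp]: "mom S \<beta> h D p q 0 t = 1"
proof -
  have "0 < (\<Sum>s\<in>spins S. wgt S \<beta> h D p q t s)" by (intro sum_pos) (auto simp: wgt_def)
  then show ?thesis by (simp add: mom_def)
qed

text \<open>The fixed point equations for \<open>p\<close> and \<open>q\<close> enter here: they
  make the centering of the overlaps the exact mean of the spin products at the decoupled
  site.\<close>

lemma Eg_mom_spin_count:
  assumes "finite B" "k \<in> B" "l \<in> B"
  shows "Eg (\<lambda>z. \<Prod>a\<in>B. mom S \<beta> h D p q (spin_count k l a) z) = Qpq p q k l"
proof (cases "k = l")
  case True
  have "(\<Prod>a\<in>B. mom S \<beta> h D p q (spin_count k l a) z) = (\<Prod>a\<in>B. if a = k then mom S \<beta> h D p q 2 z else 1)" for z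
    using True by (intro prod.cong) (auto simp: spin_count_def numeral_2_eq_2)
  then show ?thesis using assms True fixed_point by (simp add: Qpq_def pq_fixed_point_def)
next
  case False
  have "(\<Prod>a\<in>B. mom S \<beta> h D p q (spin_count k l a) z)
      = (\<Prod>a\<in>B. (if a = k then mom S \<beta> h D p q 1 z else 1) * (if a = l then mom S \<beta> h D p q 1 z else 1))" for z
    using False by (intro prod.cong) (auto simp: spin_count_def)
  then show ?thesis using assms False fixed_point
    by (simp add: Qpq_def pq_fixed_point_def prod.distrib power2_eq_square)
qed

lemma site_free_ov_cavity: "site_free c (ov_cavity N c k l)"
  unfolding site_free_def ov_cavity_def by (auto intro!: sum.cong)

lemma site_free_comp: "site_free c f \<Longrightarrow> site_free c (\<lambda>\<sigma>. F (f \<sigma>))"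
  unfolding site_free_def by simp

text \<open>This removes the zeroth order term of every cavity expansion.\<close>

lemma nu_path_0_centered:
  assumes "c < N" "finite B" "site_free c f" "k \<in> B" "l \<in> B"
  shows "nu_path N c 0 B (\<lambda>\<sigma>. (spin_prod c k l \<sigma> - Qpq p q k l) * f \<sigma>) = 0"
proof -
  have "nu_path N c 0 B (\<lambda>\<sigma>. f \<sigma> * spin_prod c k l \<sigma>) = nu_path N c 0 B f * Qpq p q k l"
    using nu_path_0[OF assms(1-3), of "spin_count k l"] unfolding Eg_mom_spin_count[OF assms(2,4,5)]
      prod_spin_count[OF assms(2,4,5)] spin_prod_def by simp
  moreover have "(\<lambda>\<sigma>. (spin_prod c k l \<sigma> - Qpq p q k l) * f \<sigma>) = (\<lambda>\<sigma>. f \<sigma> * spin_prod c k l \<sigma> - Qpq p q k l * f \<sigma>)"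
    by (auto simp: algebra_simps)
  ultimately show ?thesis by (simp add: nu_path_diff[OF assms(2)] nu_path_cmult)
qed

text \<open>\<open>\<beta>\<^sup>2 * Kmom\<close> is the contraction factor in the induction on even moments; it must not
  depend on the order of the moment.\<close>

definition Kmom :: real where
  "Kmom = 2048 * real S ^ 4 * exp (Kcmp 4)"

text \<open>Every overlap has the law of \<open>ov N 1 2\<close> or of \<open>ov N 1 1\<close>. The
  drift mixes the two kinds, so the induction runs on their sum.\<close>

definition Y :: "nat \<Rightarrow> nat \<Rightarrow> real" where
  "Y N i = nuN N {1,2} (\<lambda>\<sigma>. ov N 1 2 \<sigma> ^ (2*i)) + nuN N {1,2} (\<lambda>\<sigma>. ov N 1 1 \<sigma> ^ (2*i))"

lemma nuN_even_power_le_Y: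
  assumes "finite R" "k \<in> R" "l \<in> R"
  shows "nuN N R (\<lambda>\<sigma>. ov N k l \<sigma> ^ (2*i)) \<le> Y N i"
proof -
  have "0 \<le> nuN N {1,2} (\<lambda>\<sigma>. ov N a b \<sigma> ^ (2*i))" for a b by (rule nuN_nonneg) auto
  then show ?thesis
    using nuN_pair[OF assms, where F="\<lambda>x. x ^ (2*i)" and N=N] nuN_diag[OF assms(1,2), where F="\<lambda>x. x ^ (2*i)"
        and N=N]
    by (cases "k = l") (auto simp: Y_def)
qed

text \<open>Chosen once for the powers \<open>2 * i + 1\<close> and \<open>2 * i + 2\<close>: the
  leading factors come from \<open>power_diff_bound\<close> at the larger power, and
  \<open>1 + 3 * (real S)\<^sup>2\<close> absorbs one surplus factor, bounded trivially.\<close>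

definition Cpw :: "nat \<Rightarrow> real" where
  "Cpw i = real (2*i+2) * 2 ^ (2*i+1) * (real S)\<^sup>2 * (1 + 3 * (real S)\<^sup>2) * (1 + (real S)\<^sup>2 ^ (2*i))"

lemma Cpw_nonneg: "0 \<le> Cpw i" by (simp add: Cpw_def)

text \<open>The two overlaps differ by at most \<open>(real S)\<^sup>2 / real N\<close>. Both errors
  are expressed through the power \<open>2 * i\<close> only, so that an induction on moments can
  treat them as known.\<close>

lemma ov_cavity_ov_bounds:
  assumes \<sigma>: "\<sigma> \<in> PiE B (\<lambda>_. configs S N)" and k: "k \<in> B" "l \<in> B" and c: "c < N"
  shows "\<bar>ov N k l \<sigma> ^ (2*i+1) - ov_cavity N c k l \<sigma> ^ (2*i+1)\<bar>
      \<le> Cpw i / real N * (ov N k l \<sigma> ^ (2*i) + (1 / real N) ^ i)"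
    and "ov_cavity N c k l \<sigma> ^ (2*i+2) \<le> ov N k l \<sigma> ^ (2*i+2) + Cpw i / real N * (ov N k l \<sigma> ^ (2*i)
        + (1 / real N) ^ i)"
proof -
  let ?a = "ov N k l \<sigma>" and ?b = "ov_cavity N c k l \<sigma>" and ?s = "(real S)\<^sup>2"
  define \<delta> where "\<delta> = ?s / real N"
  have N: "real N \<ge> 1" using c by simp
  have d: "\<bar>?a - ?b\<bar> \<le> \<delta>"
    using abs_spin_prod_le[OF \<sigma> k c] N by (simp add: ov_eq_ov_cavity[OF c] \<delta>_def abs_divide divide_right_mono)
  have d0: "0 \<le> \<delta>" by (simp add: \<delta>_def)
  have ds: "\<delta> \<le> ?s" using N frac_le[of ?s ?s 1 "real N"] by (simp add: \<delta>_def)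
  have a: "\<bar>?a\<bar> \<le> 3 * ?s" using c by (intro abs_ov_le[OF \<sigma> k]) auto
  \<comment> \<open>Half of the powers of \<open>1 / real N\<close> is given away, leaving the
    expected size of a moment of order \<open>2 * i\<close>.\<close>
  have dn: "\<delta> ^ (2*i) \<le> ?s ^ (2*i) * (1 / real N) ^ i"
  proof -
    have "(1 / real N) ^ (2*i) \<le> (1 / real N) ^ i" using N by (intro power_decreasing) auto
    then have "?s ^ (2*i) * (1 / real N) ^ (2*i) \<le> ?s ^ (2*i) * (1 / real N) ^ i" by (rule mult_left_mono) simp
    then show ?thesis by (simp add: \<delta>_def power_divide)
  qed
  define X where "X = ?a ^ (2*i) + (1 / real N) ^ i"
  have X0: "0 \<le> X" by (simp add: X_def)
  have s1: "\<bar>?a\<bar> ^ (2*i) + \<delta> ^ (2*i) \<le> (1 + ?s ^ (2*i)) * X"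
  proof -
    have "\<bar>?a\<bar> ^ (2*i) = ?a ^ (2*i)" by (simp add: power_mult)
    moreover have "0 \<le> ?s ^ (2*i) * ?a ^ (2*i)" "0 \<le> (1 / real N) ^ i" by simp_all
    moreover have "(1 + ?s ^ (2*i)) * X = ?a ^ (2*i) + (1 / real N) ^ i + ?s ^ (2*i) * ?a ^ (2*i)
        + ?s ^ (2*i) * (1 / real N) ^ i" by (simp add: X_def algebra_simps)
    ultimately show ?thesis using dn by linarith
  qed
  have s2: "\<bar>?a\<bar> ^ (2*i+1) + \<delta> ^ (2*i+1) \<le> 3 * ?s * ((1 + ?s ^ (2*i)) * X)"
  proof -
    have "\<bar>?a\<bar> ^ (2*i+1) + \<delta> ^ (2*i+1) \<le> 3 * ?s * \<bar>?a\<bar> ^ (2*i) + 3 * ?s * \<delta> ^ (2*i)"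
      using a ds d0 by (auto intro!: add_mono mult_right_mono)
    also have "\<dots> = 3 * ?s * (\<bar>?a\<bar> ^ (2*i) + \<delta> ^ (2*i))" by (simp add: distrib_left)
    also have "\<dots> \<le> 3 * ?s * ((1 + ?s ^ (2*i)) * X)" using s1 by (intro mult_left_mono) auto
    finally show ?thesis .
  qed
  have "\<bar>?a ^ Suc (2*i) - ?b ^ Suc (2*i)\<bar> \<le> real (Suc (2*i)) * 2 ^ (2*i) * \<delta> * (\<bar>?a\<bar> ^ (2*i) + \<delta> ^ (2*i))"
    by (rule power_diff_bound[OF d])
  also have "\<dots> \<le> real (2*i+2) * 2 ^ (2*i+1) * \<delta> * ((1 + 3 * ?s) * ((1 + ?s ^ (2*i)) * X))"
  proof (intro mult_mono order_refl)
    have "(1 + ?s ^ (2*i)) * X \<le> (1 + 3 * ?s) * ((1 + ?s ^ (2*i)) * X)"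
      using mult_right_mono[of 1 "1 + 3 * ?s" "(1 + ?s ^ (2*i)) * X"] X0 by simp
    with s1 show "\<bar>?a\<bar> ^ (2*i) + \<delta> ^ (2*i) \<le> (1 + 3 * ?s) * ((1 + ?s ^ (2*i)) * X)" by linarith
  qed (use d0 in auto)
  also have "\<dots> = Cpw i / real N * X" by (simp add: Cpw_def \<delta>_def mult_ac)
  finally show "\<bar>?a ^ (2*i+1) - ?b ^ (2*i+1)\<bar> \<le> Cpw i / real N * (?a ^ (2*i) + (1 / real N) ^ i)"
    by (simp add: X_def)
  have "\<bar>?a ^ Suc (2*i+1) - ?b ^ Suc (2*i+1)\<bar>
      \<le> real (Suc (2*i+1)) * 2 ^ (2*i+1) * \<delta> * (\<bar>?a\<bar> ^ (2*i+1) + \<delta> ^ (2*i+1))"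
    by (rule power_diff_bound[OF d])
  also have "\<dots> \<le> real (2*i+2) * 2 ^ (2*i+1) * \<delta> * ((1 + 3 * ?s) * ((1 + ?s ^ (2*i)) * X))"
  proof (intro mult_mono order_refl)
    have "3 * ?s * ((1 + ?s ^ (2*i)) * X) \<le> (1 + 3 * ?s) * ((1 + ?s ^ (2*i)) * X)"
      using mult_right_mono[of "3 * ?s" "1 + 3 * ?s" "(1 + ?s ^ (2*i)) * X"] X0 by simp
    with s2 show "\<bar>?a\<bar> ^ (2*i+1) + \<delta> ^ (2*i+1) \<le> (1 + 3 * ?s) * ((1 + ?s ^ (2*i)) * X)" by linarith
  qed (use d0 in auto)
  also have "\<dots> = Cpw i / real N * X" by (simp add: Cpw_def \<delta>_def mult_ac)
  finally have "\<bar>?a ^ (2*i+2) - ?b ^ (2*i+2)\<bar> \<le> Cpw i / real N * X" by simp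
  then show "?b ^ (2*i+2) \<le> ?a ^ (2*i+2) + Cpw i / real N * (?a ^ (2*i) + (1 / real N) ^ i)"
    unfolding X_def by linarith
qed

end

lemma sum_power_bound:
  fixes x :: "'i \<Rightarrow> real"
  assumes "finite J" "\<And>j. j \<in> J \<Longrightarrow> 0 \<le> x j"
  shows "(\<Sum>j\<in>J. x j) ^ Suc n \<le> real (card J) ^ Suc n * (\<Sum>j\<in>J. x j ^ Suc n)"
proof (cases "J = {}")
  case False
  define m where "m = Max (x ` J)"
  have "m \<in> x ` J" unfolding m_def using assms False by (intro Max_in) auto
  then obtain j where j: "j \<in> J" "x j = m" by blast
  have le: "x i \<le> m" if "i \<in> J" for i unfolding m_def using assms that by (intro Max_ge) auto
  have "(\<Sum>j\<in>J. x j) \<le> real (card J) * m"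
    using sum_bounded_above[of J x m] le by simp
  then have "(\<Sum>j\<in>J. x j) ^ Suc n \<le> (real (card J) * m) ^ Suc n"
    using assms by (intro power_mono sum_nonneg) auto
  also have "\<dots> = real (card J) ^ Suc n * x j ^ Suc n" by (simp only: power_mult_distrib j)
  also have "\<dots> \<le> real (card J) ^ Suc n * (\<Sum>j\<in>J. x j ^ Suc n)"
    using assms j by (intro mult_left_mono member_le_sum) auto
  finally show ?thesis .
qed simp

context GS
begin

lemma ov_cavity_moment_le:
  assumes "c < N" "finite B" "k \<in> B" "l \<in> B"
  shows "nuN N B (\<lambda>\<sigma>. ov_cavity N c k l \<sigma> ^ (2*i+2)) \<le> Y N (Suc i) + Cpw i / real N * (Y N i + (1 / real N) ^ i)"
proof -
  have "nuN N B (\<lambda>\<sigma>. ov_cavity N c k l \<sigma> ^ (2*i+2))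
     \<le> nuN N B (\<lambda>\<sigma>. ov N k l \<sigma> ^ (2*i+2) + Cpw i / real N * (ov N k l \<sigma> ^ (2*i) + (1 / real N) ^ i))"
    by (rule nuN_mono[OF assms(2)], rule ov_cavity_ov_bounds(2)) (use assms in auto)
  also have "\<dots> = nuN N B (\<lambda>\<sigma>. ov N k l \<sigma> ^ (2*Suc i))
      + Cpw i / real N * (nuN N B (\<lambda>\<sigma>. ov N k l \<sigma> ^ (2*i)) + (1 / real N) ^ i)"
    by (simp only: nuN_add[OF assms(2)] nuN_cmult[OF assms(2)] nuN_const[OF assms(2)] mult_Suc_right add.commute)
  also have "\<dots> \<le> Y N (Suc i) + Cpw i / real N * (Y N i + (1 / real N) ^ i)"
    using Cpw_nonneg[of i]
    by (intro add_mono mult_left_mono nuN_even_power_le_Y assms(2-4)) auto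
  finally show ?thesis .
qed

text \<open>The overlap is replaced by the cavity overlap at the cost of lower moments. The
  resulting average vanishes at \<open>t = 0\<close>, hence is bounded by the drift, whose integrand
  has degree \<open>2 * i + 2\<close> in the overlaps and carries the factor
  \<open>\<beta>\<^sup>2\<close>.\<close>

lemma moment_site:
  fixes i :: nat
  assumes c: "c < N" and kl: "k \<in> {1,2}" "l \<in> {1,2}"
  defines "Z \<equiv> Y N (Suc i) + Cpw i / real N * (Y N i + (1 / real N) ^ i)"
  shows "nuN N {1,2} (\<lambda>\<sigma>. (spin_prod c k l \<sigma> - Qpq p q k l) * ov N k l \<sigma> ^ (2*i+1))
    \<le> \<beta>\<^sup>2 * (Kmom / 2) * Z + 2 * real S ^ 2 * (Cpw i / real N * (Y N i + (1 / real N) ^ i))"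
proof -
  let ?A = "{1,2} :: nat set" and ?B = "{1,2,3,4} :: nat set"
  let ?u = "\<lambda>\<sigma>. spin_prod c k l \<sigma> - Qpq p q k l"
  define f where "f \<sigma> = ?u \<sigma> * ov_cavity N c k l \<sigma> ^ (2*i+1)" for \<sigma>
  have klB: "k \<in> ?B" "l \<in> ?B" using kl by auto
  have u: "\<bar>?u \<sigma>\<bar> \<le> 2 * real S ^ 2" if "\<sigma> \<in> PiE B (\<lambda>_. configs S N)" "k \<in> B" "l \<in> B" for \<sigma> B
    using abs_spin_prod_le[OF that c] abs_Qpq_le[of k l] by linarith
  have df: "depends_on ?A f"
    unfolding f_def using kl by (intro depends_on_mult depends_on_diff depends_on_power depends_on_spin_prod
        depends_on_ov_cavity depends_on_const) auto
  have Z: "nu_path N c t ?B (\<lambda>\<sigma>. ov_cavity N c a b \<sigma> ^ (2*i+2)) \<le> exp (Kcmp 4) * Z"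
    if "a \<in> ?B" "b \<in> ?B" "0 \<le> t" "t \<le> 1" for a b t
  proof -
    have "nu_path N c t ?B (\<lambda>\<sigma>. ov_cavity N c a b \<sigma> ^ (2*i+2))
        \<le> exp (Kcmp (card ?B)) * nuN N ?B (\<lambda>\<sigma>. ov_cavity N c a b \<sigma> ^ (2*i+2))"
      using c that by (intro nu_path_compare depends_on_power depends_on_ov_cavity) (auto simp del: power_Suc
          simp: power_even_eq[of _ "Suc i", simplified])
    also have "\<dots> \<le> exp (Kcmp (card ?B)) * Z"
      unfolding Z_def using that by (intro mult_left_mono ov_cavity_moment_le c) auto
    also have "card ?B = 4" by simp
    finally show ?thesis .
  qed
  have dr: "\<bar>drift N c ?A 3 4 t ?B f - 0\<bar> \<le> \<beta>\<^sup>2 * (Kmom / 2) * Z" if t: "0 < t" "t < 1" for t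
  proof -
    have "nu_path N c t ?B (\<lambda>\<sigma>. \<bar>f \<sigma>\<bar> * \<bar>ov_cavity N c a b \<sigma>\<bar>) \<le> 4 * real S ^ 2 * (exp (Kcmp 4) * Z)"
      if ab: "a \<in> ?B" "b \<in> ?B" for a b
    proof -
      have "nu_path N c t ?B (\<lambda>\<sigma>. \<bar>f \<sigma>\<bar> * \<bar>ov_cavity N c a b \<sigma>\<bar>)
         \<le> nu_path N c t ?B (\<lambda>\<sigma>. 2 * real S ^ 2 * (ov_cavity N c k l \<sigma> ^ (2*i+2) + ov_cavity N c a b \<sigma> ^ (2*i+2)))"
      proof (rule nu_path_mono)
        fix \<sigma> assume \<sigma>: "\<sigma> \<in> PiE ?B (\<lambda>_. configs S N)"
        let ?x = "\<bar>ov_cavity N c k l \<sigma>\<bar>" and ?y = "\<bar>ov_cavity N c a b \<sigma>\<bar>"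
        have "\<bar>f \<sigma>\<bar> * ?y = \<bar>?u \<sigma>\<bar> * (?x ^ (2*i+1) * ?y)" by (simp add: f_def abs_mult power_abs mult_ac)
        also have "\<dots> \<le> 2 * real S ^ 2 * (?x ^ Suc (2*i+1) + ?y ^ Suc (2*i+1))"
          by (intro mult_mono u[OF \<sigma> klB] power_mult_le_sum) auto
        also have "?x ^ Suc (2*i+1) = ov_cavity N c k l \<sigma> ^ (2*i+2)"
          using power_even_abs[of "2*i+2"] by simp
        also have "?y ^ Suc (2*i+1) = ov_cavity N c a b \<sigma> ^ (2*i+2)"
          using power_even_abs[of "2*i+2"] by simp
        finally show "\<bar>f \<sigma>\<bar> * ?y \<le> 2 * real S ^ 2 * (ov_cavity N c k l \<sigma> ^ (2*i+2)
            + ov_cavity N c a b \<sigma> ^ (2*i+2))" .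
      qed simp
      also have "\<dots> = 2 * real S ^ 2 * (nu_path N c t ?B (\<lambda>\<sigma>. ov_cavity N c k l \<sigma> ^ (2*i+2))
          + nu_path N c t ?B (\<lambda>\<sigma>. ov_cavity N c a b \<sigma> ^ (2*i+2)))"
        unfolding nu_path_cmult by (subst nu_path_add) simp_all
      also have "\<dots> \<le> 2 * real S ^ 2 * (exp (Kcmp 4) * Z + exp (Kcmp 4) * Z)"
        using t ab klB by (intro mult_left_mono add_mono Z) auto
      finally show ?thesis by (simp add: mult_ac)
    qed
    then have "(\<Sum>a\<in>?B. \<Sum>b\<in>?B. nu_path N c t ?B (\<lambda>\<sigma>. \<bar>f \<sigma>\<bar> * \<bar>ov_cavity N c a b \<sigma>\<bar>))
       \<le> (\<Sum>a\<in>?B. \<Sum>b\<in>?B. 4 * real S ^ 2 * (exp (Kcmp 4) * Z))" by (intro sum_mono) auto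
    also have "\<dots> = 64 * real S ^ 2 * (exp (Kcmp 4) * Z)" by simp
    finally have "\<beta>\<^sup>2 * ((real (card ?A) + 2) ^ 2 * real S ^ 2 *
         (\<Sum>a\<in>?B. \<Sum>b\<in>?B. nu_path N c t ?B (\<lambda>\<sigma>. \<bar>f \<sigma>\<bar> * \<bar>ov_cavity N c a b \<sigma>\<bar>)))
       \<le> \<beta>\<^sup>2 * ((real (card ?A) + 2) ^ 2 * real S ^ 2 * (64 * real S ^ 2 * (exp (Kcmp 4) * Z)))"
      by (intro mult_left_mono) auto
    \<comment> \<open>Here \<open>16 * 64\<close> is half of \<open>2048\<close>; the other half
      pays for adding the two kinds of moments in \<open>moment_step\<close>.\<close>
    also have "\<dots> = \<beta>\<^sup>2 * (Kmom / 2) * Z" by (simp add: Kmom_def power4_eq_xxxx power2_eq_square)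
    finally show ?thesis
      using abs_drift_le[of ?A ?B c N 3 4 t f] c unfolding diff_0_right by (meson finite.intros order_trans)
  qed
  have "\<bar>nu_path N c 1 ?B f - nu_path N c 0 ?B f - (1 - 0) * 0\<bar> \<le> \<beta>\<^sup>2 * (Kmom / 2) * Z"
    by (rule nu_path_mvt[OF c _ _ _ _ _ _ _ _ df dr]) auto
  moreover have "nu_path N c 0 ?B f = 0"
    unfolding f_def using klB c by (intro nu_path_0_centered site_free_comp[OF site_free_ov_cavity]) auto
  moreover have "nu_path N c 1 ?B f = nuN N ?A f"
    using nuN_marginal[OF _ _ df, of ?B N] by (simp add: nu_path_1)
  ultimately have 1: "nuN N ?A f \<le> \<beta>\<^sup>2 * (Kmom / 2) * Z" by simp
  have "nuN N ?A (\<lambda>\<sigma>. ?u \<sigma> * ov N k l \<sigma> ^ (2*i+1))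
     \<le> nuN N ?A (\<lambda>\<sigma>. f \<sigma> + 2 * real S ^ 2 * (Cpw i / real N) * (ov N k l \<sigma> ^ (2*i) + (1 / real N) ^ i))"
  proof (rule nuN_mono)
    fix \<sigma> assume \<sigma>: "\<sigma> \<in> PiE ?A (\<lambda>_. configs S N)"
    have "?u \<sigma> * ov N k l \<sigma> ^ (2*i+1) - f \<sigma> = ?u \<sigma> * (ov N k l \<sigma> ^ (2*i+1) - ov_cavity N c k l \<sigma> ^ (2*i+1))"
      by (simp add: f_def algebra_simps)
    also have "\<dots> \<le> \<bar>?u \<sigma>\<bar> * \<bar>ov N k l \<sigma> ^ (2*i+1) - ov_cavity N c k l \<sigma> ^ (2*i+1)\<bar>"
      by (simp only: abs_mult[symmetric] abs_ge_self)
    also have "\<dots> \<le> 2 * real S ^ 2 * (Cpw i / real N * (ov N k l \<sigma> ^ (2*i) + (1 / real N) ^ i))"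
      using \<sigma> kl c by (intro mult_mono u ov_cavity_ov_bounds) auto
    finally show "?u \<sigma> * ov N k l \<sigma> ^ (2*i+1)
        \<le> f \<sigma> + 2 * real S ^ 2 * (Cpw i / real N) * (ov N k l \<sigma> ^ (2*i) + (1 / real N) ^ i)"
      by (simp add: mult.assoc)
  qed simp
  also have "\<dots> = nuN N ?A f + 2 * real S ^ 2 * (Cpw i / real N) * (nuN N ?A (\<lambda>\<sigma>. ov N k l \<sigma> ^ (2*i))
      + (1 / real N) ^ i)"
  proof -
    have F: "finite ?A" by simp
    show ?thesis by (simp only: nuN_add[OF F] nuN_cmult[OF F] nuN_const[OF F])
  qed
  also have "\<dots> \<le> \<beta>\<^sup>2 * (Kmom / 2) * Z + 2 * real S ^ 2 * (Cpw i / real N) * (Y N i + (1 / real N) ^ i)"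
    using 1 kl Cpw_nonneg[of i] by (intro add_mono mult_left_mono nuN_even_power_le_Y) auto
  finally show ?thesis by (simp only: mult.assoc)
qed

text \<open>One overlap factor is written as an average over sites. The resulting inequality has
  \<open>Y N (Suc i)\<close> on both sides; \<open>small\<close> makes its coefficient on the right
  at most one half, so that it can be absorbed.\<close>

lemma moment_step:
  assumes N: "0 < N" and small: "\<beta>\<^sup>2 * Kmom \<le> 1/2"
  shows "Y N (Suc i) \<le> (2 + 8 * real S ^ 2) * Cpw i / real N * (Y N i + (1 / real N) ^ i)"
proof -
  define W where "W = Cpw i / real N * (Y N i + (1 / real N) ^ i)"
  define Z where "Z = Y N (Suc i) + W"
  have *: "nuN N {1,2} (\<lambda>\<sigma>. ov N k l \<sigma> ^ (2 * Suc i)) \<le> \<beta>\<^sup>2 * (Kmom / 2) * Z + 2 * real S ^ 2 * W"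
    if kl: "k \<in> {1,2}" "l \<in> {1,2}" for k l
  proof -
    have F: "finite ({1,2} :: nat set)" by simp
    have "nuN N {1,2} (\<lambda>\<sigma>. ov N k l \<sigma> ^ (2 * Suc i))
       = nuN N {1,2} (\<lambda>\<sigma>. (1 / real N) * (\<Sum>c<N. (spin_prod c k l \<sigma> - Qpq p q k l) * ov N k l \<sigma> ^ (2*i+1)))"
    proof (rule nuN_cong[OF F])
      fix \<sigma>
      have "ov N k l \<sigma> ^ (2 * Suc i) = ov N k l \<sigma> * ov N k l \<sigma> ^ (2*i+1)" by simp
      also have "\<dots> = (1 / real N) * (\<Sum>c<N. (spin_prod c k l \<sigma> - Qpq p q k l) * ov N k l \<sigma> ^ (2*i+1))"
        by (subst ov_eq_avg[OF N]) (simp add: sum_distrib_right)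
      finally show "ov N k l \<sigma> ^ (2 * Suc i) = (1 / real N) * (\<Sum>c<N. (spin_prod c k l \<sigma> - Qpq p q k l)
          * ov N k l \<sigma> ^ (2*i+1))" .
    qed
    also have "\<dots> = (1 / real N) * (\<Sum>c<N. nuN N {1,2} (\<lambda>\<sigma>. (spin_prod c k l \<sigma> - Qpq p q k l)
        * ov N k l \<sigma> ^ (2*i+1)))"
      by (simp only: nuN_cmult[OF F] nuN_sum[OF F])
    also have "\<dots> \<le> (1 / real N) * (\<Sum>c<N. \<beta>\<^sup>2 * (Kmom / 2) * Z + 2 * real S ^ 2 * W)"
      unfolding Z_def W_def using kl by (intro mult_left_mono sum_mono moment_site) auto
    also have "\<dots> = \<beta>\<^sup>2 * (Kmom / 2) * Z + 2 * real S ^ 2 * W" using N by simp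
    finally show ?thesis .
  qed
  have Y0: "0 \<le> Y N j" for j
    unfolding Y_def by (intro add_nonneg_nonneg nuN_nonneg) auto
  have W0: "0 \<le> W" unfolding W_def using Y0 Cpw_nonneg by (intro mult_nonneg_nonneg) auto
  have "Y N (Suc i) \<le> 2 * (\<beta>\<^sup>2 * (Kmom / 2) * Z + 2 * real S ^ 2 * W)"
    unfolding Y_def using *[of 1 2] *[of 1 1] by simp
  also have "\<dots> = \<beta>\<^sup>2 * Kmom * Z + 4 * real S ^ 2 * W" by simp
  also have "\<dots> \<le> 1/2 * Z + 4 * real S ^ 2 * W"
    using Y0[of "Suc i"] W0 by (intro add_right_mono mult_right_mono small) (simp add: Z_def)
  also have "\<dots> = Y N (Suc i) / 2 + (W + 8 * real S ^ 2 * W) / 2" by (simp add: Z_def field_simps)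
  finally have Y2: "Y N (Suc i) \<le> Y N (Suc i) / 2 + (W + 8 * real S ^ 2 * W) / 2" .
  have half: "x \<le> x / 2 + y / 2 \<Longrightarrow> x \<le> y" for x y :: real by simp
  have "Y N (Suc i) \<le> W + 8 * real S ^ 2 * W" by (rule half[OF Y2])
  also have "\<dots> \<le> (2 + 8 * real S ^ 2) * W" using W0 by (simp add: distrib_right)
  finally show ?thesis by (simp add: W_def)
qed

end

text \<open>\<open>small1\<close> makes the moment induction a contraction. \<open>small2\<close>
  bounds the coefficients of the linear system, which are built from fourth moments of spins, and
  keeps the denominators of the covariances away from zero.\<close>

locale GS_small = GS +
  assumes small1: "\<beta>\<^sup>2 * Kmom \<le> 1/2" and small2: "\<beta>\<^sup>2 * real S ^ 4 \<le> 1/100"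
begin

lemma moment_bound: "\<exists>C. \<forall>N>0. Y N i \<le> C * (1 / real N) ^ i"
proof (induction i)
  case 0
  have "Y N 0 = 2" for N by (simp add: Y_def nuN_const)
  then show ?case by (intro exI[of _ 2]) simp
next
  case (Suc i)
  then obtain C where C: "\<And>N. N > 0 \<Longrightarrow> Y N i \<le> C * (1 / real N) ^ i" by blast
  let ?K = "(2 + 8 * real S ^ 2) * Cpw i"
  have "Y N (Suc i) \<le> ?K * (C + 1) * (1 / real N) ^ Suc i" if "N > 0" for N
  proof -
    have "Y N (Suc i) \<le> ?K / real N * (Y N i + (1 / real N) ^ i)" by (rule moment_step[OF that small1])
    also have "\<dots> \<le> ?K / real N * (C * (1 / real N) ^ i + (1 / real N) ^ i)"
      using C[OF that] Cpw_nonneg[of i] by (intro mult_left_mono add_right_mono) auto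
    also have "\<dots> = ?K * (C + 1) * (1 / real N) ^ Suc i" by (simp add: algebra_simps add_divide_distrib)
    finally show ?thesis .
  qed
  then show ?case by blast
qed

text \<open>The summand \<open>1 / sqrt (real N)\<close> makes \<open>1 / real N\<close> a quantity
  of second order pointwise and allows odd moments to be bounded by the next even ones.\<close>

definition rho :: "nat \<Rightarrow> nat set \<Rightarrow> (nat \<Rightarrow> nat \<Rightarrow> int) \<Rightarrow> real" where
  "rho N R \<sigma> = 1 / sqrt (real N) + (\<Sum>k\<in>R. \<Sum>l\<in>R. \<bar>ov N k l \<sigma>\<bar>)"

lemma rho_nonneg: "0 \<le> rho N R \<sigma>"
  by (auto simp: rho_def intro!: add_nonneg_nonneg sum_nonneg)

lemma rho_ge_scale: "1 / sqrt (real N) \<le> rho N R \<sigma>"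
  by (auto simp: rho_def intro!: sum_nonneg)

lemma rho_sq_ge: "1 / real N \<le> rho N R \<sigma> ^ 2"
  using power_mono[OF rho_ge_scale, of N 2 R \<sigma>] by (simp add: power_divide)

lemma abs_ov_le_rho:
  assumes "finite R" "k \<in> R" "l \<in> R" shows "\<bar>ov N k l \<sigma>\<bar> \<le> rho N R \<sigma>"
proof -
  have "\<bar>ov N k l \<sigma>\<bar> \<le> (\<Sum>l\<in>R. \<bar>ov N k l \<sigma>\<bar>)" using assms by (intro member_le_sum) auto
  also have "\<dots> \<le> (\<Sum>k\<in>R. \<Sum>l\<in>R. \<bar>ov N k l \<sigma>\<bar>)"
    using assms by (intro member_le_sum[where f="\<lambda>k. \<Sum>l\<in>R. \<bar>ov N k l \<sigma>\<bar>"]) (auto intro: sum_nonneg)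
  also have "\<dots> \<le> rho N R \<sigma>" by (simp add: rho_def)
  finally show ?thesis .
qed

lemma depends_on_rho: "depends_on R (rho N R)"
  unfolding rho_def[abs_def]
  by (intro depends_on_add depends_on_sum depends_on_abs depends_on_ov depends_on_const) auto

lemma rho_moment_even:
  assumes "finite R"
  shows "\<exists>C. \<forall>N>0. nuN N R (\<lambda>\<sigma>. rho N R \<sigma> ^ (2 * Suc i)) \<le> C * (1 / sqrt (real N)) ^ (2 * Suc i)"
proof -
  obtain C where C: "\<And>N. N > 0 \<Longrightarrow> Y N (Suc i) \<le> C * (1 / real N) ^ Suc i" using moment_bound by metis
  \<comment> \<open>\<open>None\<close> indexes the scale term, so that all summands of
    \<open>rho\<close> fall under \<open>sum_power_bound\<close>.\<close>
  define J where "J = insert None (Some ` (R \<times> R))"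
  have fJ: "finite J" using assms by (simp add: J_def)
  define x where "x N \<sigma> j = (case j of None \<Rightarrow> 1 / sqrt (real N) | Some (k,l) \<Rightarrow> \<bar>ov N k l \<sigma>\<bar>)" for N \<sigma> j
  have sumJ: "(\<Sum>j\<in>J. f j) = f None + (\<Sum>k\<in>R. \<Sum>l\<in>R. f (Some (k,l)))" for f :: "(nat \<times> nat) option \<Rightarrow> real"
    unfolding J_def using assms
    by (subst sum.insert) (auto simp: sum.reindex inj_on_def sum.cartesian_product)
  let ?M = "real (card J) ^ (2 * Suc i)"
  have sq: "(1 / sqrt (real N)) ^ (2 * Suc i) = (1 / real N) ^ Suc i" for N
    unfolding power_mult by (simp add: power_divide)
  have "nuN N R (\<lambda>\<sigma>. rho N R \<sigma> ^ (2 * Suc i))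
      \<le> ?M * (1 + real (card R) ^ 2 * C) * (1 / sqrt (real N)) ^ (2 * Suc i)"
    if N: "N > 0" for N
  proof -
    have "nuN N R (\<lambda>\<sigma>. rho N R \<sigma> ^ (2 * Suc i))
       \<le> nuN N R (\<lambda>\<sigma>. ?M * ((1 / real N) ^ Suc i + (\<Sum>k\<in>R. \<Sum>l\<in>R. ov N k l \<sigma> ^ (2 * Suc i))))"
    proof (rule nuN_mono[OF assms])
      fix \<sigma>
      have "rho N R \<sigma> = (\<Sum>j\<in>J. x N \<sigma> j)" by (simp add: sumJ rho_def x_def)
      moreover have "(\<Sum>j\<in>J. x N \<sigma> j) ^ Suc (2*i+1) \<le> real (card J) ^ Suc (2*i+1) * (\<Sum>j\<in>J. x N \<sigma> j ^ Suc (2*i+1))"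
        by (rule sum_power_bound[OF fJ]) (auto simp: x_def split: option.split)
      moreover have "(\<Sum>j\<in>J. x N \<sigma> j ^ Suc (2*i+1))
          = (1 / sqrt (real N)) ^ (2 * Suc i) + (\<Sum>k\<in>R. \<Sum>l\<in>R. \<bar>ov N k l \<sigma>\<bar> ^ (2 * Suc i))"
        unfolding sumJ by (simp add: x_def)
      moreover have "\<bar>ov N k l \<sigma>\<bar> ^ (2 * Suc i) = ov N k l \<sigma> ^ (2 * Suc i)" for k l
        by (simp only: power_mult power2_abs)
      ultimately show "rho N R \<sigma> ^ (2 * Suc i)
          \<le> ?M * ((1 / real N) ^ Suc i + (\<Sum>k\<in>R. \<Sum>l\<in>R. ov N k l \<sigma> ^ (2 * Suc i)))"
        unfolding sq by simp
    qed
    also have "\<dots> = ?M * ((1 / real N) ^ Suc i + (\<Sum>k\<in>R. \<Sum>l\<in>R. nuN N R (\<lambda>\<sigma>. ov N k l \<sigma> ^ (2 * Suc i))))"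
      by (simp only: nuN_cmult[OF assms] nuN_add[OF assms] nuN_const[OF assms] nuN_sum[OF assms])
    also have "\<dots> \<le> ?M * ((1 / real N) ^ Suc i + (\<Sum>k\<in>R. \<Sum>l\<in>R. C * (1 / real N) ^ Suc i))"
      using assms by (intro mult_left_mono add_left_mono sum_mono order_trans[OF nuN_even_power_le_Y C[OF N]]) auto
    also have "\<dots> = ?M * (1 + real (card R) ^ 2 * C) * (1 / sqrt (real N)) ^ (2 * Suc i)"
      unfolding sq by (simp add: power2_eq_square algebra_simps)
    finally show ?thesis .
  qed
  then show ?thesis by blast
qed

text \<open>For odd \<open>r\<close> the lower bound on \<open>rho\<close> gives
  \<open>1 \<le> sqrt (real N) * rho N R \<sigma>\<close>, which raises the power to the next even
  number.\<close>

lemma rho_moment: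
  assumes "finite R"
  shows "\<exists>C. \<forall>N>0. nuN N R (\<lambda>\<sigma>. rho N R \<sigma> ^ r) \<le> C * (1 / sqrt (real N)) ^ r"
proof (cases "even r")
  case True
  then obtain i where r: "r = 2 * i" by blast
  show ?thesis
  proof (cases i)
    case 0
    then show ?thesis using r nuN_const[OF assms] by (intro exI[of _ 1]) simp
  next
    case (Suc j)
    then show ?thesis unfolding r using rho_moment_even[OF assms] by blast
  qed
next
  case False
  then obtain i where r: "Suc r = 2 * Suc i" by (metis Suc_1 even_Suc evenE not0_implies_Suc mult_is_0
      nat.distinct(1))
  from rho_moment_even[OF assms, of i] obtain C where
    C: "\<And>N. N > 0 \<Longrightarrow> nuN N R (\<lambda>\<sigma>. rho N R \<sigma> ^ Suc r) \<le> C * (1 / sqrt (real N)) ^ Suc r"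
    unfolding r by blast
  have "nuN N R (\<lambda>\<sigma>. rho N R \<sigma> ^ r) \<le> C * (1 / sqrt (real N)) ^ r" if N: "N > 0" for N
  proof -
    have "nuN N R (\<lambda>\<sigma>. rho N R \<sigma> ^ r) \<le> nuN N R (\<lambda>\<sigma>. sqrt (real N) * rho N R \<sigma> ^ Suc r)"
    proof (rule nuN_mono[OF assms])
      fix \<sigma>
      have "1 \<le> sqrt (real N) * rho N R \<sigma>"
        using mult_left_mono[OF rho_ge_scale[of N R \<sigma>], of "sqrt (real N)"] N by simp
      from mult_right_mono[OF this, of "rho N R \<sigma> ^ r"]
      show "rho N R \<sigma> ^ r \<le> sqrt (real N) * rho N R \<sigma> ^ Suc r" using rho_nonneg[of N R \<sigma>] by (simp add: mult.assoc)
    qed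
    also have "\<dots> = sqrt (real N) * nuN N R (\<lambda>\<sigma>. rho N R \<sigma> ^ Suc r)" by (rule nuN_cmult[OF assms])
    also have "\<dots> \<le> sqrt (real N) * (C * (1 / sqrt (real N)) ^ Suc r)"
      using C[OF N] by (intro mult_left_mono) auto
    also have "\<dots> = C * (1 / sqrt (real N)) ^ r" using N by simp
    finally show ?thesis .
  qed
  then show ?thesis by blast
qed

end

section \<open>The cavity equation\<close>

locale GS_rep = GS_small + fixes n :: nat
begin

text \<open>The theorem concerns the replicas \<open>{1..n}\<close>.  The two further replicas of \<open>A\<close> occur in the linear system
  as representatives of fresh replicas, and two derivatives along the path introduce four more.\<close>

definition R :: "nat set" where "R = {1..n+6}"
definition A :: "nat set" where "A = {1..n+2}"

lemma finite_R [simp]: "finite R" and finite_A [simp]: "finite A" by (simp_all add: R_def A_def)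

text \<open>Orders are counted in powers of \<open>rho\<close>, which dominates every centred overlap as well as
  \<open>1 / sqrt N\<close>, and whose \<open>r\<close>-th moment is of order \<open>N\<close> to the power \<open>- r / 2\<close>.\<close>

definition ptw_order :: "nat \<Rightarrow> (nat \<Rightarrow> nat \<Rightarrow> (nat \<Rightarrow> nat \<Rightarrow> int) \<Rightarrow> real) \<Rightarrow> bool" where
  "ptw_order r f \<longleftrightarrow> (\<exists>C\<ge>0. \<forall>N c \<sigma>. c < N \<longrightarrow> \<sigma> \<in> PiE R (\<lambda>_. configs S N) \<longrightarrow> \<bar>f N c \<sigma>\<bar> \<le> C * rho N R \<sigma> ^ r)"

text \<open>The bound keeps the average of \<open>rho ^ r\<close> instead of its size in
  \<open>N\<close>, because pointwise estimates pass directly to averages; \<open>rho_moment\<close>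
  is applied only once, in \<open>cavity_equation\<close>. The constant is uniform in the site
  \<open>c\<close>.\<close>

definition avg_order :: "nat \<Rightarrow> (nat \<Rightarrow> nat \<Rightarrow> real) \<Rightarrow> bool" where
  "avg_order r X \<longleftrightarrow> (\<exists>C\<ge>0. \<forall>N c. c < N \<longrightarrow> \<bar>X N c\<bar> \<le> C * nuN N R (\<lambda>\<sigma>. rho N R \<sigma> ^ r))"

lemma ptw_order_I: "0 \<le> C \<Longrightarrow> (\<And>N c \<sigma>. c < N \<Longrightarrow> \<sigma> \<in> PiE R (\<lambda>_. configs S N) \<Longrightarrow> \<bar>f N c \<sigma>\<bar> \<le> C * rho N R \<sigma> ^ r)
    \<Longrightarrow> ptw_order r f"
  unfolding ptw_order_def by blast

lemma ptw_order_mult: "ptw_order r f \<Longrightarrow> ptw_order s g \<Longrightarrow> ptw_order (r + s) (\<lambda>N c \<sigma>. f N c \<sigma> * g N c \<sigma>)"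
  unfolding ptw_order_def
proof (elim exE conjE)
  fix C C' assume C: "0 \<le> C" "0 \<le> C'"
    "\<forall>N c \<sigma>. c < N \<longrightarrow> \<sigma> \<in> PiE R (\<lambda>_. configs S N) \<longrightarrow> \<bar>f N c \<sigma>\<bar> \<le> C * rho N R \<sigma> ^ r"
    "\<forall>N c \<sigma>. c < N \<longrightarrow> \<sigma> \<in> PiE R (\<lambda>_. configs S N) \<longrightarrow> \<bar>g N c \<sigma>\<bar> \<le> C' * rho N R \<sigma> ^ s"
  show "\<exists>C\<ge>0. \<forall>N c \<sigma>. c < N \<longrightarrow> \<sigma> \<in> PiE R (\<lambda>_. configs S N) \<longrightarrow> \<bar>f N c \<sigma> * g N c \<sigma>\<bar> \<le> C * rho N R \<sigma> ^ (r + s)"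
  proof (intro exI[of _ "C * C'"] conjI allI impI)
    fix N c \<sigma> assume *: "c < N" "\<sigma> \<in> PiE R (\<lambda>_. configs S N)"
    have "\<bar>f N c \<sigma>\<bar> * \<bar>g N c \<sigma>\<bar> \<le> (C * rho N R \<sigma> ^ r) * (C' * rho N R \<sigma> ^ s)"
      using * C rho_nonneg[of N R \<sigma>] by (intro mult_mono) auto
    then show "\<bar>f N c \<sigma> * g N c \<sigma>\<bar> \<le> C * C' * rho N R \<sigma> ^ (r + s)"
      by (simp add: abs_mult power_add mult_ac)
  qed (use C in auto)
qed

lemma ptw_order_add: "ptw_order r f \<Longrightarrow> ptw_order r g \<Longrightarrow> ptw_order r (\<lambda>N c \<sigma>. f N c \<sigma> + g N c \<sigma>)"
  unfolding ptw_order_def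
proof (elim exE conjE)
  fix C C' assume C: "0 \<le> C" "0 \<le> C'"
    "\<forall>N c \<sigma>. c < N \<longrightarrow> \<sigma> \<in> PiE R (\<lambda>_. configs S N) \<longrightarrow> \<bar>f N c \<sigma>\<bar> \<le> C * rho N R \<sigma> ^ r"
    "\<forall>N c \<sigma>. c < N \<longrightarrow> \<sigma> \<in> PiE R (\<lambda>_. configs S N) \<longrightarrow> \<bar>g N c \<sigma>\<bar> \<le> C' * rho N R \<sigma> ^ r"
  show "\<exists>C\<ge>0. \<forall>N c \<sigma>. c < N \<longrightarrow> \<sigma> \<in> PiE R (\<lambda>_. configs S N) \<longrightarrow> \<bar>f N c \<sigma> + g N c \<sigma>\<bar> \<le> C * rho N R \<sigma> ^ r"
  proof (intro exI[of _ "C + C'"] conjI allI impI)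
    fix N c \<sigma> assume *: "c < N" "\<sigma> \<in> PiE R (\<lambda>_. configs S N)"
    have "\<bar>f N c \<sigma>\<bar> \<le> C * rho N R \<sigma> ^ r" "\<bar>g N c \<sigma>\<bar> \<le> C' * rho N R \<sigma> ^ r" using * C by auto
    then show "\<bar>f N c \<sigma> + g N c \<sigma>\<bar> \<le> (C + C') * rho N R \<sigma> ^ r" by (simp add: distrib_right)
  qed (use C in auto)
qed

lemma ptw_order_bounded: "0 \<le> C \<Longrightarrow> (\<And>N c \<sigma>. c < N \<Longrightarrow> \<sigma> \<in> PiE R (\<lambda>_. configs S N) \<Longrightarrow> \<bar>f N c \<sigma>\<bar> \<le> C) \<Longrightarrow> ptw_order 0 f"
  by (rule ptw_order_I[of C]) auto

lemma ptw_order_const: "ptw_order 0 (\<lambda>N c \<sigma>. x)"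
  by (rule ptw_order_bounded[of "\<bar>x\<bar>"]) auto

lemma ptw_order_cmult: "ptw_order r f \<Longrightarrow> ptw_order r (\<lambda>N c \<sigma>. x * f N c \<sigma>)"
  using ptw_order_mult[OF ptw_order_const[of x], of r f] by simp

lemma ptw_order_diff: "ptw_order r f \<Longrightarrow> ptw_order r g \<Longrightarrow> ptw_order r (\<lambda>N c \<sigma>. f N c \<sigma> - g N c \<sigma>)"
  using ptw_order_add[OF _ ptw_order_cmult[of r g "-1"], of f] by simp

lemma ptw_order_zero: "ptw_order r (\<lambda>N c \<sigma>. 0)"
  by (rule ptw_order_I[of 0]) auto

lemma ptw_order_sum: "finite I \<Longrightarrow> (\<And>i. i \<in> I \<Longrightarrow> ptw_order r (f i)) \<Longrightarrow> ptw_order r (\<lambda>N c \<sigma>. \<Sum>i\<in>I. f i N c \<sigma>)"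
  by (induction I rule: finite_induct) (auto intro: ptw_order_add ptw_order_zero)

lemma ptw_order_power: "ptw_order 1 f \<Longrightarrow> ptw_order r (\<lambda>N c \<sigma>. f N c \<sigma> ^ r)"
proof (induction r)
  case (Suc r)
  then show ?case using ptw_order_mult[of 1 f r "\<lambda>N c \<sigma>. f N c \<sigma> ^ r"] by simp
qed (simp add: ptw_order_const)

lemma ptw_order_ov: "k \<in> R \<Longrightarrow> l \<in> R \<Longrightarrow> ptw_order 1 (\<lambda>N c. ov N k l)"
  using abs_ov_le_rho[OF finite_R] by (intro ptw_order_I[of 1]) auto

lemma ptw_order_spin_prod: "k \<in> R \<Longrightarrow> l \<in> R \<Longrightarrow> ptw_order 0 (\<lambda>N c. spin_prod c k l)"
  using abs_spin_prod_le by (intro ptw_order_bounded[of "real S ^ 2"]) auto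

lemma ptw_order_inverse_N: "ptw_order 2 (\<lambda>N c \<sigma>. 1 / real N)"
  using rho_sq_ge by (intro ptw_order_I[of 1]) auto

lemma ptw_order_inverse_N1: "ptw_order 1 (\<lambda>N c \<sigma>. 1 / real N)"
proof (rule ptw_order_I[of 1])
  fix N c :: nat and \<sigma> :: "nat \<Rightarrow> nat \<Rightarrow> int" assume "c < N"
  then have N: "1 \<le> real N" by simp
  have "sqrt (real N) \<le> real N" using N by (simp add: real_sqrt_le_iff[of "real N" "(real N)\<^sup>2", simplified]
      power2_eq_square)
  then have "1 / real N \<le> 1 / sqrt (real N)" using N by (intro divide_left_mono) auto
  then show "\<bar>1 / real N\<bar> \<le> 1 * rho N R \<sigma> ^ 1" using rho_ge_scale[of N R \<sigma>] by simp
qed simp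

lemma ptw_order_cong: "ptw_order r f \<Longrightarrow> (\<And>N c \<sigma>. c < N \<Longrightarrow> f N c \<sigma> = g N c \<sigma>) \<Longrightarrow> ptw_order r g"
  unfolding ptw_order_def by simp

lemma ptw_order_ov_cavity: "k \<in> R \<Longrightarrow> l \<in> R \<Longrightarrow> ptw_order 1 (\<lambda>N c. ov_cavity N c k l)"
proof -
  assume kl: "k \<in> R" "l \<in> R"
  have "ptw_order 1 (\<lambda>N c \<sigma>. ov N k l \<sigma> - spin_prod c k l \<sigma> * (1 / real N))"
    using ptw_order_diff[OF ptw_order_ov[OF kl] ptw_order_mult[OF ptw_order_spin_prod[OF kl]
        ptw_order_inverse_N1, unfolded add_0]] .
  then show ?thesis by (rule ptw_order_cong) (simp add: ov_eq_ov_cavity)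
qed

lemma avg_order_add: "avg_order r X \<Longrightarrow> avg_order r Z \<Longrightarrow> avg_order r (\<lambda>N c. X N c + Z N c)"
  unfolding avg_order_def
proof (elim exE conjE)
  let ?m = "\<lambda>N. nuN N R (\<lambda>\<sigma>. rho N R \<sigma> ^ r)"
  fix C C' assume C: "0 \<le> C" "0 \<le> C'"
    "\<forall>N c. c < N \<longrightarrow> \<bar>X N c\<bar> \<le> C * ?m N" "\<forall>N c. c < N \<longrightarrow> \<bar>Z N c\<bar> \<le> C' * ?m N"
  show "\<exists>C\<ge>0. \<forall>N c. c < N \<longrightarrow> \<bar>X N c + Z N c\<bar> \<le> C * ?m N"
  proof (intro exI[of _ "C + C'"] conjI allI impI)
    fix N c :: nat assume "c < N"
    then have "\<bar>X N c\<bar> \<le> C * ?m N" "\<bar>Z N c\<bar> \<le> C' * ?m N" using C by auto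
    then show "\<bar>X N c + Z N c\<bar> \<le> (C + C') * ?m N" by (simp add: distrib_right)
  qed (use C in auto)
qed

lemma avg_order_cmult: "avg_order r X \<Longrightarrow> avg_order r (\<lambda>N c. x * X N c)"
  unfolding avg_order_def
proof (elim exE conjE)
  let ?m = "\<lambda>N. nuN N R (\<lambda>\<sigma>. rho N R \<sigma> ^ r)"
  fix C assume C: "0 \<le> C" "\<forall>N c. c < N \<longrightarrow> \<bar>X N c\<bar> \<le> C * ?m N"
  show "\<exists>C\<ge>0. \<forall>N c. c < N \<longrightarrow> \<bar>x * X N c\<bar> \<le> C * ?m N"
    using C by (intro exI[of _ "\<bar>x\<bar> * C"]) (auto simp: abs_mult mult.assoc intro!: mult_left_mono)
qed

lemma avg_order_zero: "avg_order r (\<lambda>N c. 0)"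
  unfolding avg_order_def by (intro exI[of _ 0]) simp

lemma avg_order_diff: "avg_order r X \<Longrightarrow> avg_order r Z \<Longrightarrow> avg_order r (\<lambda>N c. X N c - Z N c)"
  using avg_order_add[OF _ avg_order_cmult[of r Z "-1"], of X] by simp

lemma avg_order_sum: "finite I \<Longrightarrow> (\<And>i. i \<in> I \<Longrightarrow> avg_order r (X i)) \<Longrightarrow> avg_order r (\<lambda>N c. \<Sum>i\<in>I. X i N c)"
  by (induction I rule: finite_induct) (auto intro: avg_order_add avg_order_zero)

lemma avg_order_cong: "avg_order r X \<Longrightarrow> (\<And>N c. c < N \<Longrightarrow> X N c = Z N c) \<Longrightarrow> avg_order r Z"
  unfolding avg_order_def by simp

lemma avg_order_nuN: "ptw_order r f \<Longrightarrow> avg_order r (\<lambda>N c. nuN N R (f N c))"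
  unfolding ptw_order_def avg_order_def
proof (elim exE conjE)
  fix C assume C: "0 \<le> C" "\<forall>N c \<sigma>. c < N \<longrightarrow> \<sigma> \<in> PiE R (\<lambda>_. configs S N) \<longrightarrow> \<bar>f N c \<sigma>\<bar> \<le> C * rho N R \<sigma> ^ r"
  show "\<exists>C\<ge>0. \<forall>N c. c < N \<longrightarrow> \<bar>nuN N R (f N c)\<bar> \<le> C * nuN N R (\<lambda>\<sigma>. rho N R \<sigma> ^ r)"
  proof (intro exI[of _ C] conjI allI impI)
    fix N c :: nat assume c: "c < N"
    have "\<bar>nuN N R (f N c)\<bar> \<le> nuN N R (\<lambda>\<sigma>. \<bar>f N c \<sigma>\<bar>)" by (rule abs_nuN_le) simp
    also have "\<dots> \<le> nuN N R (\<lambda>\<sigma>. C * rho N R \<sigma> ^ r)" using C c by (intro nuN_mono) auto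
    finally show "\<bar>nuN N R (f N c)\<bar> \<le> C * nuN N R (\<lambda>\<sigma>. rho N R \<sigma> ^ r)" by (simp add: nuN_cmult)
  qed (rule C)
qed

lemma avg_order_div_N: "avg_order r X \<Longrightarrow> avg_order (r + 2) (\<lambda>N c. X N c / real N)"
  unfolding avg_order_def
proof (elim exE conjE)
  fix C assume C: "0 \<le> C" "\<forall>N c. c < N \<longrightarrow> \<bar>X N c\<bar> \<le> C * nuN N R (\<lambda>\<sigma>. rho N R \<sigma> ^ r)"
  show "\<exists>C\<ge>0. \<forall>N c. c < N \<longrightarrow> \<bar>X N c / real N\<bar> \<le> C * nuN N R (\<lambda>\<sigma>. rho N R \<sigma> ^ (r+2))"
  proof (intro exI[of _ C] conjI allI impI)
    fix N c :: nat assume c: "c < N"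
    have "\<bar>X N c / real N\<bar> \<le> (1 / real N) * (C * nuN N R (\<lambda>\<sigma>. rho N R \<sigma> ^ r))"
      using C(2) c by (simp add: abs_divide divide_right_mono)
    also have "\<dots> = C * nuN N R (\<lambda>\<sigma>. (1 / real N) * rho N R \<sigma> ^ r)"
      by (subst nuN_cmult) simp_all
    also have "\<dots> \<le> C * nuN N R (\<lambda>\<sigma>. rho N R \<sigma> ^ (r+2))"
    proof (intro mult_left_mono nuN_mono finite_R C(1))
      fix \<sigma>
      show "(1 / real N) * rho N R \<sigma> ^ r \<le> rho N R \<sigma> ^ (r+2)"
        using mult_right_mono[OF rho_sq_ge[of N R \<sigma>], of "rho N R \<sigma> ^ r"] rho_nonneg[of N R \<sigma>]
        by (simp add: power_add power2_eq_square mult_ac)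
    qed
    finally show "\<bar>X N c / real N\<bar> \<le> C * nuN N R (\<lambda>\<sigma>. rho N R \<sigma> ^ (r+2))" .
  qed (rule C)
qed

text \<open>The comparison with the endpoint \<open>t = 1\<close> makes these bounds uniform along the whole path.\<close>

lemma nu_path_uniform_bound:
  assumes "ptw_order r f"
  shows "\<exists>C\<ge>0. \<forall>N c t. c < N \<longrightarrow> 0 \<le> t \<longrightarrow> t \<le> 1 \<longrightarrow> \<bar>nu_path N c t R (f N c)\<bar> \<le> C * nuN N R (\<lambda>\<sigma>. rho N R \<sigma> ^ r)"
proof -
  obtain C where C: "0 \<le> C" "\<And>N c \<sigma>. c < N \<Longrightarrow> \<sigma> \<in> PiE R (\<lambda>_. configs S N) \<Longrightarrow> \<bar>f N c \<sigma>\<bar> \<le> C * rho N R \<sigma> ^ r"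
    using assms unfolding ptw_order_def by blast
  show ?thesis
  proof (intro exI[of _ "C * exp (Kcmp (card R))"] conjI allI impI)
    fix N c :: nat and t :: real assume *: "c < N" "0 \<le> t" "t \<le> 1"
    have "\<bar>nu_path N c t R (f N c)\<bar> \<le> nu_path N c t R (\<lambda>\<sigma>. \<bar>f N c \<sigma>\<bar>)" by (rule abs_nu_path_le) simp
    also have "\<dots> \<le> nu_path N c t R (\<lambda>\<sigma>. C * rho N R \<sigma> ^ r)" using C * by (intro nu_path_mono) auto
    also have "\<dots> = C * nu_path N c t R (\<lambda>\<sigma>. rho N R \<sigma> ^ r)" by (rule nu_path_cmult)
    also have "\<dots> \<le> C * (exp (Kcmp (card R)) * nuN N R (\<lambda>\<sigma>. rho N R \<sigma> ^ r))"
      using * C by (intro mult_left_mono nu_path_compare depends_on_power depends_on_rho zero_le_power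
          rho_nonneg) auto
    finally show "\<bar>nu_path N c t R (f N c)\<bar> \<le> C * exp (Kcmp (card R)) * nuN N R (\<lambda>\<sigma>. rho N R \<sigma> ^ r)"
      by (simp add: mult.assoc)
  qed (use C in auto)
qed

text \<open>The factor \<open>ov_cavity\<close> inside the drift raises the order by one.\<close>

lemma drift_uniform_bound:
  assumes "ptw_order r f" "finite A'"
  shows "\<exists>C\<ge>0. \<forall>N c t. c < N \<longrightarrow> 0 \<le> t \<longrightarrow> t \<le> 1 \<longrightarrow>
     \<bar>drift N c A' s s' t R (f N c)\<bar> \<le> C * nuN N R (\<lambda>\<sigma>. rho N R \<sigma> ^ (r+1))"
proof -
  have "\<exists>C\<ge>0. \<forall>N c t. c < N \<longrightarrow> 0 \<le> t \<longrightarrow> t \<le> 1 \<longrightarrow>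
     \<bar>nu_path N c t R (\<lambda>\<sigma>. f N c \<sigma> * (spin_prod c k l \<sigma> * ov_cavity N c k l \<sigma>))\<bar>
         \<le> C * nuN N R (\<lambda>\<sigma>. rho N R \<sigma> ^ (r+1))"
    if "k \<in> R" "l \<in> R" for k l
    using nu_path_uniform_bound[OF ptw_order_mult[OF assms(1) ptw_order_mult[OF ptw_order_spin_prod[OF that]
        ptw_order_ov_cavity[OF that]]]] by simp
  then have "\<forall>x\<in>R\<times>R. \<exists>C\<ge>0. \<forall>N c t. c < N \<longrightarrow> 0 \<le> t \<longrightarrow> t \<le> 1 \<longrightarrow>
     \<bar>nu_path N c t R (\<lambda>\<sigma>. f N c \<sigma> * (spin_prod c (fst x) (snd x) \<sigma> * ov_cavity N c (fst x) (snd x) \<sigma>))\<bar>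
         \<le> C * nuN N R (\<lambda>\<sigma>. rho N R \<sigma> ^ (r+1))"
    by auto
  from bchoice[OF this] obtain C where C: "\<forall>x\<in>R\<times>R. 0 \<le> C x \<and> (\<forall>N c t. c < N \<longrightarrow> 0 \<le> t \<longrightarrow> t \<le> 1 \<longrightarrow>
     \<bar>nu_path N c t R (\<lambda>\<sigma>. f N c \<sigma> * (spin_prod c (fst x) (snd x) \<sigma> * ov_cavity N c (fst x) (snd x) \<sigma>))\<bar>
         \<le> C x * nuN N R (\<lambda>\<sigma>. rho N R \<sigma> ^ (r+1)))"
    by blast
  show ?thesis
  proof (intro exI[of _ "\<Sum>k\<in>R. \<Sum>l\<in>R. \<bar>pair_coeff A' s s' k l * \<beta>\<^sup>2\<bar> * C (k,l)"] conjI allI impI)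
    fix N c :: nat and t :: real assume *: "c < N" "0 \<le> t" "t \<le> 1"
    have "\<bar>drift N c A' s s' t R (f N c)\<bar>
       \<le> (\<Sum>k\<in>R. \<Sum>l\<in>R. \<bar>pair_coeff A' s s' k l * \<beta>\<^sup>2\<bar> * (C (k,l) * nuN N R (\<lambda>\<sigma>. rho N R \<sigma> ^ (r+1))))"
      unfolding drift_eq
    proof (intro order_trans[OF sum_abs] sum_mono)
      fix k l assume kl: "k \<in> R" "l \<in> R"
      with C * have "\<bar>nu_path N c t R (\<lambda>\<sigma>. f N c \<sigma> * (spin_prod c k l \<sigma> * ov_cavity N c k l \<sigma>))\<bar>
          \<le> C (k,l) * nuN N R (\<lambda>\<sigma>. rho N R \<sigma> ^ (r+1))"
        by auto
      then show "\<bar>pair_coeff A' s s' k l * \<beta>\<^sup>2 * nu_path N c t R (\<lambda>\<sigma>. f N c \<sigma> * (spin_prod c k l \<sigma>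
          * ov_cavity N c k l \<sigma>))\<bar>
        \<le> \<bar>pair_coeff A' s s' k l * \<beta>\<^sup>2\<bar> * (C (k,l) * nuN N R (\<lambda>\<sigma>. rho N R \<sigma> ^ (r+1)))"
        unfolding abs_mult[of "pair_coeff A' s s' k l * \<beta>\<^sup>2"] by (intro mult_left_mono) auto
    qed
    then show "\<bar>drift N c A' s s' t R (f N c)\<bar>
       \<le> (\<Sum>k\<in>R. \<Sum>l\<in>R. \<bar>pair_coeff A' s s' k l * \<beta>\<^sup>2\<bar> * C (k,l)) * nuN N R (\<lambda>\<sigma>. rho N R \<sigma> ^ (r+1))"
      by (simp add: sum_distrib_right mult.assoc)
  qed (use C in \<open>auto intro!: sum_nonneg mult_nonneg_nonneg\<close>)
qed

lemma first_order_uniform: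
  assumes f: "ptw_order r f" "\<And>N c. depends_on A' (f N c)" and A': "A' \<subseteq> R" "s \<in> R - A'" "s' \<in> R - A'" "s \<noteq> s'"
  shows "\<exists>C\<ge>0. \<forall>N c t. c < N \<longrightarrow> 0 \<le> t \<longrightarrow> t \<le> 1 \<longrightarrow>
     \<bar>nu_path N c t R (f N c) - nu_path N c 0 R (f N c)\<bar> \<le> C * nuN N R (\<lambda>\<sigma>. rho N R \<sigma> ^ (r+1))"
proof -
  have "finite A'" by (rule finite_subset[OF A'(1) finite_R])
  from drift_uniform_bound[OF f(1) this, of s s'] obtain C where C: "0 \<le> C"
    "\<And>N c t. c < N \<Longrightarrow> 0 \<le> t \<Longrightarrow> t \<le> 1 \<Longrightarrow> \<bar>drift N c A' s s' t R (f N c)\<bar> \<le> C * nuN N R (\<lambda>\<sigma>. rho N R \<sigma> ^ (r+1))"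
    by blast
  show ?thesis
  proof (intro exI[of _ C] conjI allI impI C(1))
    fix N c :: nat and t :: real assume *: "c < N" "0 \<le> t" "t \<le> 1"
    have "\<bar>nu_path N c t R (f N c) - nu_path N c 0 R (f N c) - (t - 0) * 0\<bar> \<le> C * nuN N R (\<lambda>\<sigma>. rho N R \<sigma> ^ (r+1))"
      using * C(2) by (intro nu_path_mvt[OF *(1) _ _ _ finite_R A' f(2)]) auto
    then show "\<bar>nu_path N c t R (f N c) - nu_path N c 0 R (f N c)\<bar> \<le> C * nuN N R (\<lambda>\<sigma>. rho N R \<sigma> ^ (r+1))" by simp
  qed
qed

lemma first_order:
  assumes "ptw_order r f" "\<And>N c. depends_on A' (f N c)" "A' \<subseteq> R" "s \<in> R - A'" "s' \<in> R - A'" "s \<noteq> s'"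
  shows "avg_order (r+1) (\<lambda>N c. nuN N R (f N c) - nu_path N c 0 R (f N c))"
proof -
  obtain C where C: "0 \<le> C" "\<And>N c t. c < N \<Longrightarrow> 0 \<le> t \<Longrightarrow> t \<le> 1 \<Longrightarrow>
     \<bar>nu_path N c t R (f N c) - nu_path N c 0 R (f N c)\<bar> \<le> C * nuN N R (\<lambda>\<sigma>. rho N R \<sigma> ^ (r+1))"
    using first_order_uniform[OF assms] by blast
  show ?thesis unfolding avg_order_def
    using C(1) C(2)[where t=1] by (intro exI[of _ C]) (simp add: nu_path_1)
qed

text \<open>With the drift at \<open>t = 0\<close> as guess in \<open>nu_path_mvt\<close>, the error
  is the variation of the drift along the path. Its summands have order \<open>r + 1\<close> and may
  involve \<open>s\<close> and \<open>s'\<close>, so their own first order expansion gains one more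
  power and needs two further fresh replicas \<open>u\<close> and \<open>u'\<close>.\<close>

lemma second_order:
  assumes f: "ptw_order r f" "\<And>N c. depends_on A' (f N c)" and A': "A' \<subseteq> R" "s \<in> R - A'" "s' \<in> R - A'" "s \<noteq> s'"
    and u: "u \<in> R - insert s (insert s' A')" "u' \<in> R - insert s (insert s' A')" "u \<noteq> u'"
  shows "avg_order (r+2) (\<lambda>N c. nuN N R (f N c) - nu_path N c 0 R (f N c) - drift N c A' s s' 0 R (f N c))"
proof -
  let ?A = "insert s (insert s' A')"
  let ?g = "\<lambda>k l N c \<sigma>. f N c \<sigma> * (spin_prod c k l \<sigma> * ov_cavity N c k l \<sigma>)"
  \<comment> \<open>For such pairs the summand may involve replicas outside \<open>?A\<close>, so
    that the expansion below would not apply; their coefficient vanishes.\<close>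
  have kap0: "pair_coeff A' s s' k l = 0" if "\<not> (k \<in> ?A \<and> l \<in> ?A)" for k l
    using that by (auto simp: pair_coeff_def cumul_def)
  have "\<forall>x\<in>?A\<times>?A. \<exists>C\<ge>0. \<forall>N c t. c < N \<longrightarrow> 0 \<le> t \<longrightarrow> t \<le> 1 \<longrightarrow>
     \<bar>nu_path N c t R (?g (fst x) (snd x) N c) - nu_path N c 0 R (?g (fst x) (snd x) N c)\<bar>
         \<le> C * nuN N R (\<lambda>\<sigma>. rho N R \<sigma> ^ (r+2))"
  proof
    fix x assume x: "x \<in> ?A \<times> ?A"
    then have kl: "fst x \<in> ?A" "snd x \<in> ?A" "fst x \<in> R" "snd x \<in> R" using A' by auto
    have "ptw_order (r+1) (?g (fst x) (snd x))"
      using ptw_order_mult[OF f(1) ptw_order_mult[OF ptw_order_spin_prod[OF kl(3,4)] ptw_order_ov_cavity[OF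
          kl(3,4)]]] by simp
    moreover have "depends_on ?A (?g (fst x) (snd x) N c)" for N c
      using kl by (intro depends_on_mult depends_on_spin_prod depends_on_ov_cavity depends_on_mono[OF f(2)]) auto
    ultimately show "\<exists>C\<ge>0. \<forall>N c t. c < N \<longrightarrow> 0 \<le> t \<longrightarrow> t \<le> 1 \<longrightarrow>
     \<bar>nu_path N c t R (?g (fst x) (snd x) N c) - nu_path N c 0 R (?g (fst x) (snd x) N c)\<bar>
         \<le> C * nuN N R (\<lambda>\<sigma>. rho N R \<sigma> ^ (r+2))"
      using first_order_uniform[of "r+1" "?g (fst x) (snd x)" ?A u u'] u A' by auto
  qed
  from bchoice[OF this] obtain C where C: "\<forall>x\<in>?A\<times>?A. 0 \<le> C x \<and> (\<forall>N c t. c < N \<longrightarrow> 0 \<le> t \<longrightarrow> t \<le> 1 \<longrightarrow>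
     \<bar>nu_path N c t R (?g (fst x) (snd x) N c) - nu_path N c 0 R (?g (fst x) (snd x) N c)\<bar>
         \<le> C x * nuN N R (\<lambda>\<sigma>. rho N R \<sigma> ^ (r+2)))"
    by blast
  define K where "K = (\<Sum>k\<in>R. \<Sum>l\<in>R. \<bar>pair_coeff A' s s' k l * \<beta>\<^sup>2\<bar> * \<bar>C (k,l)\<bar>)"
  have K0: "0 \<le> K" unfolding K_def by (intro sum_nonneg mult_nonneg_nonneg) auto
  have dr: "\<bar>drift N c A' s s' t R (f N c) - drift N c A' s s' 0 R (f N c)\<bar> \<le> K * nuN N R (\<lambda>\<sigma>. rho N R \<sigma> ^ (r+2))"
    if *: "c < N" "0 < t" "t < 1" for N c t
  proof -
    have eq: "drift N c A' s s' t R (f N c) - drift N c A' s s' 0 R (f N c)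
      = (\<Sum>k\<in>R. \<Sum>l\<in>R. pair_coeff A' s s' k l * \<beta>\<^sup>2 * (nu_path N c t R (?g k l N c) - nu_path N c 0 R (?g k l N c)))"
      unfolding drift_eq by (simp add: sum_subtractf right_diff_distrib)
    have "\<bar>drift N c A' s s' t R (f N c) - drift N c A' s s' 0 R (f N c)\<bar>
      \<le> (\<Sum>k\<in>R. \<Sum>l\<in>R. \<bar>pair_coeff A' s s' k l * \<beta>\<^sup>2\<bar> * (\<bar>C (k,l)\<bar> * nuN N R (\<lambda>\<sigma>. rho N R \<sigma> ^ (r+2))))"
      unfolding eq
    proof (intro order_trans[OF sum_abs] sum_mono)
      fix k l
      show "\<bar>pair_coeff A' s s' k l * \<beta>\<^sup>2 * (nu_path N c t R (?g k l N c) - nu_path N c 0 R (?g k l N c))\<bar>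
        \<le> \<bar>pair_coeff A' s s' k l * \<beta>\<^sup>2\<bar> * (\<bar>C (k,l)\<bar> * nuN N R (\<lambda>\<sigma>. rho N R \<sigma> ^ (r+2)))"
      proof (cases "k \<in> ?A \<and> l \<in> ?A")
        case True
        then have kl: "(k,l) \<in> ?A \<times> ?A" by auto
        have "\<bar>nu_path N c t R (?g k l N c) - nu_path N c 0 R (?g k l N c)\<bar>
            \<le> \<bar>C (k,l)\<bar> * nuN N R (\<lambda>\<sigma>. rho N R \<sigma> ^ (r+2))"
          using bspec[OF C kl] * by auto
        then show ?thesis unfolding abs_mult[of "pair_coeff A' s s' k l * \<beta>\<^sup>2"] by (intro mult_left_mono) auto
      next
        case False
        then show ?thesis using kap0[OF False] by simp
      qed
    qed
    also have "\<dots> = K * nuN N R (\<lambda>\<sigma>. rho N R \<sigma> ^ (r+2))"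
      unfolding K_def sum_distrib_right by (intro sum.cong refl mult.assoc[symmetric])
    finally show ?thesis .
  qed
  have "\<bar>nu_path N c 1 R (f N c) - nu_path N c 0 R (f N c) - (1 - 0) * drift N c A' s s' 0 R (f N c)\<bar>
      \<le> K * nuN N R (\<lambda>\<sigma>. rho N R \<sigma> ^ (r+2))" if "c < N" for N c
    by (rule nu_path_mvt[OF that _ _ _ finite_R A' f(2) dr[OF that]]) simp_all
  then show ?thesis unfolding avg_order_def using K0 by (intro exI[of _ K]) (simp add: nu_path_1)
qed

end

context GS
begin

text \<open>The covariance of \<open>\<sigma>\<^sup>k\<sigma>\<^sup>l\<close> and \<open>\<sigma>\<^sup>a\<sigma>\<^sup>b\<close> at the decoupled site.  The product runs over a set, so
  a repeated replica contributes one moment of higher order.\<close>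

definition corr :: "nat \<Rightarrow> nat \<Rightarrow> nat \<Rightarrow> nat \<Rightarrow> real" where
  "corr k l a b = Eg (\<lambda>z. \<Prod>x\<in>{k,l,a,b}. mom S \<beta> h D p q (spin_count k l x + spin_count a b x) z)
     - Qpq p q k l * Qpq p q a b"

lemma nu_path_0_corr:
  assumes "c < N" "finite B" "site_free c f" "k \<in> B" "l \<in> B" "a \<in> B" "b \<in> B"
  shows "nu_path N c 0 B (\<lambda>\<sigma>. (spin_prod c k l \<sigma> - Qpq p q k l) * (spin_prod c a b \<sigma> * f \<sigma>))
      = corr k l a b * nu_path N c 0 B f"
proof -
  let ?d = "\<lambda>x. spin_count k l x + spin_count a b x"
  have "(\<Prod>x\<in>B. mom S \<beta> h D p q (?d x) z) = (\<Prod>x\<in>{k,l,a,b}. mom S \<beta> h D p q (?d x) z)" for z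
    using assms by (intro prod.mono_neutral_right) (auto simp: spin_count_def)
  moreover have "(\<Prod>x\<in>B. real_of_int (\<sigma> x c) ^ ?d x) = spin_prod c k l \<sigma> * spin_prod c a b \<sigma>" for \<sigma>
    using assms by (simp add: power_add prod.distrib prod_spin_count spin_prod_def)
  ultimately have 1: "nu_path N c 0 B (\<lambda>\<sigma>. f \<sigma> * (spin_prod c k l \<sigma> * spin_prod c a b \<sigma>))
      = nu_path N c 0 B f * (corr k l a b + Qpq p q k l * Qpq p q a b)"
    using nu_path_0[OF assms(1-3), of ?d] by (simp add: corr_def)
  have 2: "nu_path N c 0 B (\<lambda>\<sigma>. f \<sigma> * spin_prod c a b \<sigma>) = nu_path N c 0 B f * Qpq p q a b"
    using nu_path_0[OF assms(1-3), of "spin_count a b"] unfolding Eg_mom_spin_count[OF assms(2,6,7)]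
      prod_spin_count[OF assms(2,6,7)] spin_prod_def by simp
  have "(\<lambda>\<sigma>. (spin_prod c k l \<sigma> - Qpq p q k l) * (spin_prod c a b \<sigma> * f \<sigma>))
      = (\<lambda>\<sigma>. f \<sigma> * (spin_prod c k l \<sigma> * spin_prod c a b \<sigma>) - Qpq p q k l * (f \<sigma> * spin_prod c a b \<sigma>))"
    by (auto simp: algebra_simps)
  then show ?thesis by (simp only: nu_path_diff[OF assms(2)] nu_path_cmult 1 2) (simp add: algebra_simps)
qed

end

section \<open>Cavity expansion for powers of a linear form\<close>

lemma finite_pairs [simp]: "finite (pairs n)"
  by (rule finite_subset[of _ "{1..n} \<times> {1..n}"]) (auto simp: pairs_def)

locale GS_form = GS_rep + fixes \<gamma> :: "nat \<times> nat \<Rightarrow> real"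
begin

text \<open>This is the linear form of the opening overview; the constant \<open>Y\<close> of the
  moment bounds is a different object.\<close>

definition lin_form :: "nat \<Rightarrow> (nat \<Rightarrow> nat \<Rightarrow> int) \<Rightarrow> real" where
  "lin_form N \<sigma> = (\<Sum>x\<in>pairs n. \<gamma> x * ov N (fst x) (snd x) \<sigma>)"

definition lin_form_cavity :: "nat \<Rightarrow> nat \<Rightarrow> (nat \<Rightarrow> nat \<Rightarrow> int) \<Rightarrow> real" where
  "lin_form_cavity N c \<sigma> = (\<Sum>x\<in>pairs n. \<gamma> x * ov_cavity N c (fst x) (snd x) \<sigma>)"

definition lin_form_site :: "nat \<Rightarrow> (nat \<Rightarrow> nat \<Rightarrow> int) \<Rightarrow> real" where
  "lin_form_site c \<sigma> = (\<Sum>x\<in>pairs n. \<gamma> x * spin_prod c (fst x) (snd x) \<sigma>)"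

lemma pairs_mem:
  assumes "x \<in> pairs n"
  shows "fst x \<in> {1..n}" "snd x \<in> {1..n}" "fst x \<in> A" "snd x \<in> A" "fst x \<in> R" "snd x \<in> R"
  using assms by (auto simp: pairs_def A_def R_def)

lemma A_sub_R: "A \<subseteq> R" by (auto simp: A_def R_def)

lemma lin_form_eq: "c < N \<Longrightarrow> lin_form N \<sigma> = lin_form_cavity N c \<sigma> + lin_form_site c \<sigma> * (1 / real N)"
  unfolding lin_form_def lin_form_cavity_def lin_form_site_def sum_distrib_right sum.distrib[symmetric]
  by (intro sum.cong refl) (simp add: ov_eq_ov_cavity distrib_left)

lemma ptw_order_lin_form: "ptw_order 1 (\<lambda>N c. lin_form N)"
  unfolding lin_form_def[abs_def] by (intro ptw_order_sum ptw_order_cmult ptw_order_ov pairs_mem) auto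

lemma ptw_order_lin_form_cavity: "ptw_order 1 (\<lambda>N c. lin_form_cavity N c)"
  unfolding lin_form_cavity_def[abs_def] by (intro ptw_order_sum ptw_order_cmult ptw_order_ov_cavity pairs_mem)
      auto

lemma ptw_order_lin_form_site: "ptw_order 0 (\<lambda>N c. lin_form_site c)"
  unfolding lin_form_site_def[abs_def] by (intro ptw_order_sum ptw_order_cmult ptw_order_spin_prod pairs_mem) auto

lemma depends_on_lin_form': "depends_on {1..n} (lin_form N)"
  unfolding lin_form_def[abs_def]
  by (intro depends_on_sum depends_on_mult depends_on_const depends_on_ov pairs_mem)

lemma depends_on_lin_form_cavity: "depends_on A (lin_form_cavity N c)"
  unfolding lin_form_cavity_def[abs_def]
  by (intro depends_on_sum depends_on_mult depends_on_const depends_on_ov_cavity pairs_mem)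

lemma site_free_lin_form_cavity: "site_free c (lin_form_cavity N c)"
  using site_free_ov_cavity[of c N] unfolding site_free_def lin_form_cavity_def by simp

lemma lin_form_power_diff: "ptw_order (r + 1) (\<lambda>N c \<sigma>. lin_form N \<sigma> ^ r - lin_form_cavity N c \<sigma> ^ r)"
proof (induction r)
  case (Suc r)
  have "ptw_order (Suc r + 1) (\<lambda>N c \<sigma>. lin_form N \<sigma> * (lin_form N \<sigma> ^ r - lin_form_cavity N c \<sigma> ^ r)
      + lin_form_site c \<sigma> * (1 / real N) * lin_form_cavity N c \<sigma> ^ r)"
    using ptw_order_mult[OF ptw_order_lin_form Suc] ptw_order_mult[OF ptw_order_mult[OF ptw_order_lin_form_site
        ptw_order_inverse_N] ptw_order_power[OF ptw_order_lin_form_cavity, of r]]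
    by (intro ptw_order_add) (simp_all only: add_0 add_Suc add_Suc_right numeral_2_eq_2 One_nat_def add_0_right)
  then show ?case by (rule ptw_order_cong) (simp add: lin_form_eq algebra_simps)
qed (simp add: ptw_order_zero)

text \<open>Binomial expansion in \<open>lin_form_site c \<sigma> * (1 / real N)\<close>, which has
  order two: one insertion has order \<open>r + 1\<close>, two insertions have order
  \<open>r + 2\<close>. The linear term must be kept, since it produces the right-hand side of the
  linear system.\<close>

lemma lin_form_power_taylor:
  "ptw_order (r + 2) (\<lambda>N c \<sigma>. lin_form N \<sigma> ^ r - lin_form_cavity N c \<sigma> ^ r - real r * (lin_form_site c \<sigma>
      * (1 / real N)) * lin_form_cavity N c \<sigma> ^ (r - 1))"
proof (induction r)
  case (Suc r)
  show ?case
  proof (cases r)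
    case 0
    show ?thesis unfolding 0
      by (rule ptw_order_cong[OF ptw_order_zero]) (simp add: lin_form_eq)
  next
    case (Suc r')
    let ?\<delta> = "\<lambda>N c \<sigma>. lin_form_site c \<sigma> * (1 / real N)"
    have d: "ptw_order 2 ?\<delta>" using ptw_order_mult[OF ptw_order_lin_form_site ptw_order_inverse_N]
        by (simp only: add_0)
    have "1 + (r + 2) = Suc r + 2" "2 + 2 + r' = Suc r + 2" using Suc by simp_all
    note i = ptw_order_mult[OF ptw_order_lin_form Suc.IH, unfolded this]
      ptw_order_cmult[OF ptw_order_mult[OF ptw_order_mult[OF d d] ptw_order_power[OF ptw_order_lin_form_cavity,
          of r']], of "real r", unfolded this]
    have main: "ptw_order (Suc r + 2) (\<lambda>N c \<sigma>. lin_form N \<sigma> * (lin_form N \<sigma> ^ r - lin_form_cavity N c \<sigma> ^ r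
        - real r * ?\<delta> N c \<sigma> * lin_form_cavity N c \<sigma> ^ (r - 1))
        + real r * (?\<delta> N c \<sigma> * ?\<delta> N c \<sigma> * lin_form_cavity N c \<sigma> ^ r'))"
      by (rule ptw_order_add[OF i])
    have gen: "(a + \<delta>) * ((a + \<delta>) ^ r - a ^ r - real r * \<delta> * a ^ (r - 1)) + real r * (\<delta> * \<delta> * a ^ r')
        = (a + \<delta>) ^ Suc r - a ^ Suc r - real (Suc r) * \<delta> * a ^ (Suc r - 1)" for a \<delta> :: real
      using Suc by (simp add: algebra_simps)
    show ?thesis
    proof (rule ptw_order_cong[OF main])
      fix N c :: nat and \<sigma> assume "c < N"
      show "lin_form N \<sigma> * (lin_form N \<sigma> ^ r - lin_form_cavity N c \<sigma> ^ r - real r * ?\<delta> N c \<sigma>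
          * lin_form_cavity N c \<sigma> ^ (r - 1))
        + real r * (?\<delta> N c \<sigma> * ?\<delta> N c \<sigma> * lin_form_cavity N c \<sigma> ^ r')
        = lin_form N \<sigma> ^ Suc r - lin_form_cavity N c \<sigma> ^ Suc r - real (Suc r) * ?\<delta> N c \<sigma>
            * lin_form_cavity N c \<sigma> ^ (Suc r - 1)"
        unfolding lin_form_eq[OF \<open>c < N\<close>] by (rule gen)
    qed
  qed
qed (simp add: ptw_order_zero)

text \<open>For fixed \<open>r\<close> the values \<open>W a b N r\<close> are the unknowns of the
  linear system; \<open>V N (r - 1)\<close> enters its right-hand side.\<close>

definition W :: "nat \<Rightarrow> nat \<Rightarrow> nat \<Rightarrow> nat \<Rightarrow> real" where
  "W a b N r = nuN N R (\<lambda>\<sigma>. ov N a b \<sigma> * lin_form N \<sigma> ^ r)"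

definition V :: "nat \<Rightarrow> nat \<Rightarrow> real" where
  "V N r = nuN N R (\<lambda>\<sigma>. lin_form N \<sigma> ^ r)"

definition U :: "nat \<Rightarrow> nat \<Rightarrow> nat \<Rightarrow> (nat \<Rightarrow> nat \<Rightarrow> int) \<Rightarrow> real" where
  "U k l c \<sigma> = spin_prod c k l \<sigma> - Qpq p q k l"

lemma ptw_order_U: "k \<in> R \<Longrightarrow> l \<in> R \<Longrightarrow> ptw_order 0 (\<lambda>N c. U k l c)"
  unfolding U_def[abs_def] by (intro ptw_order_diff ptw_order_spin_prod ptw_order_const)

lemma depends_on_U: "k \<in> B \<Longrightarrow> l \<in> B \<Longrightarrow> depends_on B (U k l c)"
  unfolding U_def[abs_def] by (intro depends_on_diff depends_on_spin_prod depends_on_const)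

abbreviation "fresh_coeff \<equiv> pair_coeff A (n+3) (n+4)"

lemma stars:
  "n + 3 \<in> R - A" "n + 4 \<in> R - A" "n + 3 \<noteq> n + 4"
  "n + 5 \<in> R - insert (n+3) (insert (n+4) A)" "n + 6 \<in> R - insert (n+3) (insert (n+4) A)" "n + 5 \<noteq> n + 6"
  "insert (n+3) (insert (n+4) A) \<subseteq> R"
  by (auto simp: R_def A_def)

text \<open>At \<open>t = 0\<close> the spins at \<open>c\<close> factor out of every summand, and
  only their covariance is left of them.\<close>

lemma drift_0_eq:
  assumes "c < N" "k \<in> R" "l \<in> R"
  shows "drift N c A (n+3) (n+4) 0 R (\<lambda>\<sigma>. U k l c \<sigma> * lin_form_cavity N c \<sigma> ^ r)
    = (\<Sum>a\<in>R. \<Sum>b\<in>R. fresh_coeff a b * \<beta>\<^sup>2 * corr k l a b * nu_path N c 0 R (\<lambda>\<sigma>. ov_cavity N c a b \<sigma>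
        * lin_form_cavity N c \<sigma> ^ r))"
  unfolding drift_eq
proof (intro sum.cong refl)
  fix a b assume ab: "a \<in> R" "b \<in> R"
  have sf: "site_free c (\<lambda>\<sigma>. ov_cavity N c a b \<sigma> * lin_form_cavity N c \<sigma> ^ r)"
    using site_free_ov_cavity[of c N a b] site_free_lin_form_cavity[of c N] unfolding site_free_def by simp
  have "nu_path N c 0 R (\<lambda>\<sigma>. U k l c \<sigma> * lin_form_cavity N c \<sigma> ^ r * (spin_prod c a b \<sigma> * ov_cavity N c a b \<sigma>))
    = nu_path N c 0 R (\<lambda>\<sigma>. (spin_prod c k l \<sigma> - Qpq p q k l) * (spin_prod c a b \<sigma> * (ov_cavity N c a b \<sigma>
        * lin_form_cavity N c \<sigma> ^ r)))"
    by (rule nu_path_cong) (simp add: U_def mult_ac)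
  also have "\<dots> = corr k l a b * nu_path N c 0 R (\<lambda>\<sigma>. ov_cavity N c a b \<sigma> * lin_form_cavity N c \<sigma> ^ r)"
    by (rule nu_path_0_corr[OF assms(1) finite_R sf assms(2,3) ab])
  finally show "fresh_coeff a b * \<beta>\<^sup>2 * nu_path N c 0 R (\<lambda>\<sigma>. U k l c \<sigma> * lin_form_cavity N c \<sigma> ^ r
      * (spin_prod c a b \<sigma> * ov_cavity N c a b \<sigma>))
    = fresh_coeff a b * \<beta>\<^sup>2 * corr k l a b * nu_path N c 0 R (\<lambda>\<sigma>. ov_cavity N c a b \<sigma> * lin_form_cavity N c \<sigma> ^ r)"
    by simp
qed

text \<open>Moving along the path and restoring site \<open>c\<close> each cost one order beyond
  \<open>r + 1\<close>. The factor \<open>fresh_coeff a b\<close> is kept because it vanishes for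
  pairs that involve the last two replicas of \<open>R\<close>, where no fresh replicas are left for
  the expansion.\<close>

lemma nu_path_0_to_W:
  assumes ab: "a \<in> R" "b \<in> R"
  shows "avg_order (r+2) (\<lambda>N c. fresh_coeff a b * (nu_path N c 0 R (\<lambda>\<sigma>. ov_cavity N c a b \<sigma>
      * lin_form_cavity N c \<sigma> ^ r) - W a b N r))"
proof (cases "a \<in> insert (n+3) (insert (n+4) A) \<and> b \<in> insert (n+3) (insert (n+4) A)")
  case False
  then have "fresh_coeff a b = 0" by (auto simp: pair_coeff_def cumul_def)
  then show ?thesis by (simp add: avg_order_zero)
next
  case True
  let ?f = "\<lambda>N c \<sigma>. ov_cavity N c a b \<sigma> * lin_form_cavity N c \<sigma> ^ r"
  have p: "ptw_order (r+1) ?f" using ptw_order_mult[OF ptw_order_ov_cavity[OF ab] ptw_order_power[OF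
      ptw_order_lin_form_cavity, of r]] by simp
  have "avg_order (r+1+1) (\<lambda>N c. nuN N R (?f N c) - nu_path N c 0 R (?f N c))"
  proof (rule first_order[OF p _ stars(7,4,5,6)])
    show "depends_on (insert (n+3) (insert (n+4) A)) (?f N c)" for N c
      using True by (intro depends_on_mult depends_on_power depends_on_ov_cavity depends_on_mono[OF
          depends_on_lin_form_cavity]) auto
  qed
  then have "avg_order (r+2) (\<lambda>N c. nuN N R (?f N c) - nu_path N c 0 R (?f N c))"
    by (simp only: add.assoc one_add_one)
  moreover have "avg_order (r+2) (\<lambda>N c. nuN N R (\<lambda>\<sigma>. ov N a b \<sigma> * (lin_form N \<sigma> ^ r - lin_form_cavity N c \<sigma> ^ r)
      + spin_prod c a b \<sigma> * (1 / real N) * lin_form_cavity N c \<sigma> ^ r))"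
  proof (intro avg_order_nuN ptw_order_add)
    show "ptw_order (r+2) (\<lambda>N c \<sigma>. ov N a b \<sigma> * (lin_form N \<sigma> ^ r - lin_form_cavity N c \<sigma> ^ r))"
      using ptw_order_mult[OF ptw_order_ov[OF ab] lin_form_power_diff[of r]]
          by (simp only: add.left_commute[of 1] one_add_one)
    show "ptw_order (r+2) (\<lambda>N c \<sigma>. spin_prod c a b \<sigma> * (1 / real N) * lin_form_cavity N c \<sigma> ^ r)"
      using ptw_order_mult[OF ptw_order_mult[OF ptw_order_spin_prod[OF ab] ptw_order_inverse_N]
          ptw_order_power[OF ptw_order_lin_form_cavity, of r]]
      by (simp only: add_0 add.commute[of 2])
  qed
  ultimately have "avg_order (r+2) (\<lambda>N c. -1 * (nuN N R (?f N c) - nu_path N c 0 R (?f N c)) -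
     nuN N R (\<lambda>\<sigma>. ov N a b \<sigma> * (lin_form N \<sigma> ^ r - lin_form_cavity N c \<sigma> ^ r) + spin_prod c a b \<sigma> * (1 / real N)
         * lin_form_cavity N c \<sigma> ^ r))"
    by (rule avg_order_diff[OF avg_order_cmult])
  then have "avg_order (r+2) (\<lambda>N c. nu_path N c 0 R (?f N c) - W a b N r)"
  proof (rule avg_order_cong)
    fix N c :: nat assume c: "c < N"
    have "nuN N R (\<lambda>\<sigma>. ov N a b \<sigma> * (lin_form N \<sigma> ^ r - lin_form_cavity N c \<sigma> ^ r) + spin_prod c a b \<sigma>
        * (1 / real N) * lin_form_cavity N c \<sigma> ^ r)
      = nuN N R (\<lambda>\<sigma>. ov N a b \<sigma> * lin_form N \<sigma> ^ r - ?f N c \<sigma>)"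
      by (rule nuN_cong) (simp_all add: ov_eq_ov_cavity[OF c] algebra_simps)
    then show "-1 * (nuN N R (?f N c) - nu_path N c 0 R (?f N c)) -
     nuN N R (\<lambda>\<sigma>. ov N a b \<sigma> * (lin_form N \<sigma> ^ r - lin_form_cavity N c \<sigma> ^ r) + spin_prod c a b \<sigma> * (1 / real N)
         * lin_form_cavity N c \<sigma> ^ r)
      = nu_path N c 0 R (?f N c) - W a b N r"
      by (simp add: nuN_diff W_def)
  qed
  then show ?thesis by (rule avg_order_cmult)
qed

text \<open>In the site equation this term carries a factor \<open>1 / real N\<close>, so its
  leading order suffices: the spins at \<open>c\<close> decouple and leave \<open>corr\<close>, and
  the power of the form becomes \<open>V\<close>.\<close>

lemma site_derivative_term:
  assumes kl: "k \<in> A" "l \<in> A"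
  shows "avg_order (Suc r) (\<lambda>N c. nuN N R (\<lambda>\<sigma>. U k l c \<sigma> * (lin_form_site c \<sigma> * lin_form_cavity N c \<sigma> ^ r))
     - (\<Sum>x\<in>pairs n. \<gamma> x * corr k l (fst x) (snd x)) * V N r)"
proof -
  have klR: "k \<in> R" "l \<in> R" using kl A_sub_R by auto
  let ?g = "\<lambda>x N c \<sigma>. U k l c \<sigma> * (spin_prod c (fst x) (snd x) \<sigma> * lin_form_cavity N c \<sigma> ^ r)"
  have 1: "avg_order (r+1) (\<lambda>N c. nuN N R (?g x N c) - nu_path N c 0 R (?g x N c))" if "x \<in> pairs n" for x
  proof (rule first_order[OF _ _ A_sub_R stars(1-3)])
    show "ptw_order r (?g x)"
      using ptw_order_mult[OF ptw_order_U[OF klR] ptw_order_mult[OF ptw_order_spin_prod ptw_order_power[OF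
          ptw_order_lin_form_cavity, of r]]] pairs_mem[OF that] by simp
    show "depends_on A (?g x N c)" for N c
      using kl pairs_mem[OF that]
      by (intro depends_on_mult depends_on_U depends_on_spin_prod depends_on_power depends_on_lin_form_cavity)
  qed
  have 2: "avg_order (r+1) (\<lambda>N c. nuN N R (\<lambda>\<sigma>. lin_form_cavity N c \<sigma> ^ r)
      - nu_path N c 0 R (\<lambda>\<sigma>. lin_form_cavity N c \<sigma> ^ r))"
    by (rule first_order[OF ptw_order_power[OF ptw_order_lin_form_cavity] depends_on_power[OF
        depends_on_lin_form_cavity] A_sub_R stars(1-3)])
  have 3: "avg_order (r+1) (\<lambda>N c. nuN N R (\<lambda>\<sigma>. lin_form N \<sigma> ^ r - lin_form_cavity N c \<sigma> ^ r))"
    by (rule avg_order_nuN[OF lin_form_power_diff])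
  have 4: "avg_order (r+1) (\<lambda>N c. nu_path N c 0 R (\<lambda>\<sigma>. lin_form_cavity N c \<sigma> ^ r) - V N r)"
  proof (rule avg_order_cong[OF avg_order_diff[OF avg_order_cmult[OF 2, of "-1"] 3]])
    show "-1 * (nuN N R (\<lambda>\<sigma>. lin_form_cavity N c \<sigma> ^ r) - nu_path N c 0 R (\<lambda>\<sigma>. lin_form_cavity N c \<sigma> ^ r))
        - nuN N R (\<lambda>\<sigma>. lin_form N \<sigma> ^ r - lin_form_cavity N c \<sigma> ^ r)
      = nu_path N c 0 R (\<lambda>\<sigma>. lin_form_cavity N c \<sigma> ^ r) - V N r" for N c
      by (simp add: nuN_diff V_def)
  qed
  have "avg_order (r+1) (\<lambda>N c. \<Sum>x\<in>pairs n. \<gamma> x * ((nuN N R (?g x N c) - nu_path N c 0 R (?g x N c))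
      + corr k l (fst x) (snd x) * (nu_path N c 0 R (\<lambda>\<sigma>. lin_form_cavity N c \<sigma> ^ r) - V N r)))"
    by (intro avg_order_sum avg_order_cmult avg_order_add 1 4) auto
  then have "avg_order (r+1) (\<lambda>N c. nuN N R (\<lambda>\<sigma>. U k l c \<sigma> * (lin_form_site c \<sigma> * lin_form_cavity N c \<sigma> ^ r))
     - (\<Sum>x\<in>pairs n. \<gamma> x * corr k l (fst x) (snd x)) * V N r)"
  proof (rule avg_order_cong)
    fix N c :: nat assume c: "c < N"
    have "nu_path N c 0 R (?g x N c) = corr k l (fst x) (snd x) * nu_path N c 0 R (\<lambda>\<sigma>. lin_form_cavity N c \<sigma> ^ r)"
      if "x \<in> pairs n" for x
      unfolding U_def using pairs_mem[OF that] klR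
      by (intro nu_path_0_corr c finite_R site_free_comp[OF site_free_lin_form_cavity])
    then have "(\<Sum>x\<in>pairs n. \<gamma> x * ((nuN N R (?g x N c) - nu_path N c 0 R (?g x N c))
      + corr k l (fst x) (snd x) * (nu_path N c 0 R (\<lambda>\<sigma>. lin_form_cavity N c \<sigma> ^ r) - V N r)))
      = (\<Sum>x\<in>pairs n. \<gamma> x * nuN N R (?g x N c) - \<gamma> x * corr k l (fst x) (snd x) * V N r)"
      by (intro sum.cong refl) (simp add: algebra_simps)
    also have "\<dots> = (\<Sum>x\<in>pairs n. \<gamma> x * nuN N R (?g x N c)) - (\<Sum>x\<in>pairs n. \<gamma> x * corr k l (fst x) (snd x)) * V N r"
      by (simp add: sum_subtractf sum_distrib_right)
    also have "(\<Sum>x\<in>pairs n. \<gamma> x * nuN N R (?g x N c)) = nuN N R (\<lambda>\<sigma>. \<Sum>x\<in>pairs n. \<gamma> x * ?g x N c \<sigma>)"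
      by (simp only: nuN_sum[OF finite_R] nuN_cmult[OF finite_R])
    also have "\<dots> = nuN N R (\<lambda>\<sigma>. U k l c \<sigma> * (lin_form_site c \<sigma> * lin_form_cavity N c \<sigma> ^ r))"
      by (rule nuN_cong) (simp_all add: lin_form_site_def sum_distrib_left sum_distrib_right mult_ac)
    finally show "(\<Sum>x\<in>pairs n. \<gamma> x * ((nuN N R (?g x N c) - nu_path N c 0 R (?g x N c))
      + corr k l (fst x) (snd x) * (nu_path N c 0 R (\<lambda>\<sigma>. lin_form_cavity N c \<sigma> ^ r) - V N r)))
      = nuN N R (\<lambda>\<sigma>. U k l c \<sigma> * (lin_form_site c \<sigma> * lin_form_cavity N c \<sigma> ^ r))
     - (\<Sum>x\<in>pairs n. \<gamma> x * corr k l (fst x) (snd x)) * V N r" .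
  qed
  then show ?thesis by simp
qed

text \<open>Four errors of order \<open>r + 2\<close> add up: the Taylor remainder, the second order
  path expansion, and the replacement by leading terms in the drift and in the linear Taylor term.
  Centering removes the value at \<open>t = 0\<close>.\<close>

lemma site_equation:
  assumes kl: "k \<in> A" "l \<in> A"
  shows "avg_order (r+2) (\<lambda>N c. nuN N R (\<lambda>\<sigma>. U k l c \<sigma> * lin_form N \<sigma> ^ r)
     - (\<Sum>a\<in>R. \<Sum>b\<in>R. fresh_coeff a b * \<beta>\<^sup>2 * corr k l a b * W a b N r)
     - real r / real N * ((\<Sum>x\<in>pairs n. \<gamma> x * corr k l (fst x) (snd x)) * V N (r - 1)))"
proof -
  have klR: "k \<in> R" "l \<in> R" using kl A_sub_R by auto
  let ?G = "(\<Sum>x\<in>pairs n. \<gamma> x * corr k l (fst x) (snd x))"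
  let ?f = "\<lambda>N c \<sigma>. U k l c \<sigma> * lin_form_cavity N c \<sigma> ^ r"
  let ?t = "\<lambda>N c \<sigma>. U k l c \<sigma> * (lin_form_site c \<sigma> * lin_form_cavity N c \<sigma> ^ (r - 1))"
  have 1: "avg_order (r+2) (\<lambda>N c. nuN N R (\<lambda>\<sigma>. U k l c \<sigma> * (lin_form N \<sigma> ^ r - lin_form_cavity N c \<sigma> ^ r
      - real r * (lin_form_site c \<sigma> * (1 / real N)) * lin_form_cavity N c \<sigma> ^ (r - 1))))"
    using avg_order_nuN[OF ptw_order_mult[OF ptw_order_U[OF klR] lin_form_power_taylor[of r]]] by simp
  have 2: "avg_order (r+2) (\<lambda>N c. nuN N R (?f N c) - nu_path N c 0 R (?f N c)
      - drift N c A (n+3) (n+4) 0 R (?f N c))"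
  proof (rule second_order[OF _ _ A_sub_R stars(1-6)])
    show "ptw_order r ?f" using ptw_order_mult[OF ptw_order_U[OF klR] ptw_order_power[OF
        ptw_order_lin_form_cavity, of r]] by simp
    show "depends_on A (?f N c)" for N c
      using kl by (intro depends_on_mult depends_on_U depends_on_power depends_on_lin_form_cavity)
  qed
  have 3: "avg_order (r+2) (\<lambda>N c. \<Sum>a\<in>R. \<Sum>b\<in>R. (\<beta>\<^sup>2 * corr k l a b) *
      (fresh_coeff a b * (nu_path N c 0 R (\<lambda>\<sigma>. ov_cavity N c a b \<sigma> * lin_form_cavity N c \<sigma> ^ r) - W a b N r)))"
    by (intro avg_order_sum avg_order_cmult nu_path_0_to_W finite_R)
  have 4: "avg_order (r+2) (\<lambda>N c. real r * ((nuN N R (?t N c) - ?G * V N (r-1)) / real N))"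
  \<comment> \<open>For \<open>r = 0\<close> the truncated \<open>r - 1\<close> is harmless, as the
    term carries the factor \<open>real r\<close>.\<close>
  proof (cases r)
    case (Suc r')
    have "avg_order (r + 2) (\<lambda>N c. (nuN N R (?t N c) - ?G * V N (r-1)) / real N)"
      using avg_order_div_N[OF site_derivative_term[OF kl, of r']] by (simp add: Suc)
    then show ?thesis by (rule avg_order_cmult)
  qed (simp add: avg_order_zero)
  show ?thesis
  proof (rule avg_order_cong[OF avg_order_add[OF avg_order_add[OF 1 2] avg_order_add[OF 3 4]]])
    fix N c :: nat assume c: "c < N"
    have e1: "nuN N R (\<lambda>\<sigma>. U k l c \<sigma> * (lin_form N \<sigma> ^ r - lin_form_cavity N c \<sigma> ^ r
      - real r * (lin_form_site c \<sigma> * (1 / real N)) * lin_form_cavity N c \<sigma> ^ (r - 1)))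
      = nuN N R (\<lambda>\<sigma>. U k l c \<sigma> * lin_form N \<sigma> ^ r) - nuN N R (?f N c) - (real r / real N) * nuN N R (?t N c)"
    proof -
      have "nuN N R (\<lambda>\<sigma>. U k l c \<sigma> * (lin_form N \<sigma> ^ r - lin_form_cavity N c \<sigma> ^ r
      - real r * (lin_form_site c \<sigma> * (1 / real N)) * lin_form_cavity N c \<sigma> ^ (r - 1)))
        = nuN N R (\<lambda>\<sigma>. (U k l c \<sigma> * lin_form N \<sigma> ^ r - ?f N c \<sigma>) - (real r / real N) * ?t N c \<sigma>)"
        by (rule nuN_cong) (simp_all add: algebra_simps)
      then show ?thesis by (simp only: nuN_diff[OF finite_R] nuN_cmult[OF finite_R])
    qed
    have e2: "nu_path N c 0 R (?f N c) = 0"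
      unfolding U_def using klR by (intro nu_path_0_centered c site_free_comp[OF site_free_lin_form_cavity]) auto
    have e3: "(\<Sum>a\<in>R. \<Sum>b\<in>R. (\<beta>\<^sup>2 * corr k l a b) *
      (fresh_coeff a b * (nu_path N c 0 R (\<lambda>\<sigma>. ov_cavity N c a b \<sigma> * lin_form_cavity N c \<sigma> ^ r) - W a b N r)))
      = drift N c A (n+3) (n+4) 0 R (?f N c) - (\<Sum>a\<in>R. \<Sum>b\<in>R. fresh_coeff a b * \<beta>\<^sup>2 * corr k l a b * W a b N r)"
      unfolding drift_0_eq[OF c klR] sum_subtractf[symmetric]
      by (intro sum.cong refl) (simp add: algebra_simps)
    \<comment> \<open>The intermediate averages telescope when the four error terms are
      added.\<close>
    have gen: "(x - y - \<rho> / z * t) + (y - 0 - d) + ((d - e) + \<rho> * ((t - g) / z)) = x - e - \<rho> / z * g"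
      for x y \<rho> z t d e g :: real
      by (simp add: diff_divide_distrib right_diff_distrib)
    show "nuN N R (\<lambda>\<sigma>. U k l c \<sigma> * (lin_form N \<sigma> ^ r - lin_form_cavity N c \<sigma> ^ r
      - real r * (lin_form_site c \<sigma> * (1 / real N)) * lin_form_cavity N c \<sigma> ^ (r - 1)))
      + (nuN N R (?f N c) - nu_path N c 0 R (?f N c) - drift N c A (n+3) (n+4) 0 R (?f N c))
      + ((\<Sum>a\<in>R. \<Sum>b\<in>R. (\<beta>\<^sup>2 * corr k l a b) *
      (fresh_coeff a b * (nu_path N c 0 R (\<lambda>\<sigma>. ov_cavity N c a b \<sigma> * lin_form_cavity N c \<sigma> ^ r) - W a b N r)))
      + real r * ((nuN N R (?t N c) - ?G * V N (r-1)) / real N))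
      = nuN N R (\<lambda>\<sigma>. U k l c \<sigma> * lin_form N \<sigma> ^ r)
     - (\<Sum>a\<in>R. \<Sum>b\<in>R. fresh_coeff a b * \<beta>\<^sup>2 * corr k l a b * W a b N r)
     - real r / real N * (?G * V N (r - 1))"
      unfolding e1 e2 e3 by (rule gen)
  qed
qed

text \<open>\<open>ov N k l\<close> is the average of \<open>U k l c\<close> over the sites, and the
  site equation holds with a constant independent of \<open>c\<close>. Then
  \<open>rho_moment\<close> turns orders into powers of \<open>N\<close>.\<close>

theorem cavity_equation:
  assumes kl: "k \<in> A" "l \<in> A"
  shows "\<exists>C. \<forall>N>0. \<bar>W k l N r
     - (\<Sum>a\<in>R. \<Sum>b\<in>R. fresh_coeff a b * \<beta>\<^sup>2 * corr k l a b * W a b N r)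
     - real r / real N * ((\<Sum>x\<in>pairs n. \<gamma> x * corr k l (fst x) (snd x)) * V N (r - 1))\<bar>
     \<le> C * (1 / sqrt (real N)) ^ (r+2)"
proof -
  let ?E = "\<lambda>N. (\<Sum>a\<in>R. \<Sum>b\<in>R. fresh_coeff a b * \<beta>\<^sup>2 * corr k l a b * W a b N r)"
  let ?F = "\<lambda>N. real r / real N * ((\<Sum>x\<in>pairs n. \<gamma> x * corr k l (fst x) (snd x)) * V N (r - 1))"
  obtain C where C: "0 \<le> C" "\<And>N c. c < N \<Longrightarrow> \<bar>nuN N R (\<lambda>\<sigma>. U k l c \<sigma> * lin_form N \<sigma> ^ r) - ?E N - ?F N\<bar>
      \<le> C * nuN N R (\<lambda>\<sigma>. rho N R \<sigma> ^ (r+2))"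
    using site_equation[OF kl, of r] unfolding avg_order_def by blast
  obtain C' where C': "\<And>N. N > 0 \<Longrightarrow> nuN N R (\<lambda>\<sigma>. rho N R \<sigma> ^ (r+2)) \<le> C' * (1 / sqrt (real N)) ^ (r+2)"
    using rho_moment[OF finite_R, of "r+2"] by blast
  have "\<bar>W k l N r - ?E N - ?F N\<bar> \<le> C * C' * (1 / sqrt (real N)) ^ (r+2)" if N: "N > 0" for N
  proof -
    have "W k l N r = nuN N R (\<lambda>\<sigma>. (1 / real N) * (\<Sum>c<N. U k l c \<sigma> * lin_form N \<sigma> ^ r))"
      unfolding W_def ov_eq_avg[OF N] U_def by (simp add: sum_distrib_right)
    also have "\<dots> = (1 / real N) * (\<Sum>c<N. nuN N R (\<lambda>\<sigma>. U k l c \<sigma> * lin_form N \<sigma> ^ r))"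
      by (simp only: nuN_cmult[OF finite_R] nuN_sum[OF finite_R])
    finally have eq: "W k l N r - ?E N - ?F N
        = (1 / real N) * (\<Sum>c<N. nuN N R (\<lambda>\<sigma>. U k l c \<sigma> * lin_form N \<sigma> ^ r) - ?E N - ?F N)"
      using N by (simp add: sum_subtractf right_diff_distrib)
    have "\<bar>\<Sum>c<N. nuN N R (\<lambda>\<sigma>. U k l c \<sigma> * lin_form N \<sigma> ^ r) - ?E N - ?F N\<bar>
        \<le> (\<Sum>c<N. C * nuN N R (\<lambda>\<sigma>. rho N R \<sigma> ^ (r+2)))"
      by (rule order_trans[OF sum_abs], rule sum_mono, rule C(2)) simp
    then have "\<bar>W k l N r - ?E N - ?F N\<bar> \<le> (1 / real N) * (\<Sum>c<N. C * nuN N R (\<lambda>\<sigma>. rho N R \<sigma> ^ (r+2)))"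
      unfolding eq abs_mult by (intro mult_mono) simp_all
    also have "(1 / real N) * (\<Sum>c<N. C * nuN N R (\<lambda>\<sigma>. rho N R \<sigma> ^ (r+2)))
        = C * nuN N R (\<lambda>\<sigma>. rho N R \<sigma> ^ (r+2))" using N by simp
    also have "\<dots> \<le> C * (C' * (1 / sqrt (real N)) ^ (r+2))" using C(1) C'[OF N] by (intro mult_left_mono)
    finally show ?thesis by (simp add: mult.assoc)
  qed
  then show ?thesis by blast
qed

end

section \<open>The linear system for the covariances\<close>

text \<open>All solution components are polynomials times the common factor
  \<open>k = i / (M^2 * M3)\<close>, which turns every equation of the linear system into a ring identity.\<close>

locale covariance_system =
  fixes b A G E D I3 I5 K4 i k :: real and M1 M2 M3 M a2 a1 b1 c1 a0 b0 c0 :: real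
  assumes M1: "M1 = 1 - b * (A - 2 * G)" and M2: "M2 = 1 - b / 2 * D" and M3: "M3 = 1 - b * A"
    and M: "M = M1 * M2 + b\<^sup>2 * E\<^sup>2"
    and k: "k = i / (M\<^sup>2 * M3)"
    and nz: "M \<noteq> 0" "M3 \<noteq> 0"
    and a2: "a2 = A * i / M3"
    and a1: "a1 = (G * M2 + b / 2 * E\<^sup>2) * i / (M * M3)"
    and b1: "b1 = (D * M1 - 2 * b * E\<^sup>2) * i / M"
    and c1: "c1 = E * i / M"
    and a0: "a0 = b / M * (b * E * K4 + M2 * I5) * c1 + 2 * b / M * (b * E * (E - I5) + M2 * (2 * G - I3)) * a1
      + b / M * (b * E * I5 + M2 * I3) * a2 + i / M * (b * E * I5 + M2 * I3)"
    and b0: "b0 = b / (2 * M) * (M1 * K4 - b * E * I5) * b1 + b / M * (M1 * (E - I5) - b * E * (2 * G - I3)) * c1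
      + i / M * (M1 * K4 - b * E * I5)"
    and c0: "c0 = b / (2 * M) * (M2 * I5 + b * E * K4) * b1 + b / M * (M2 * (2 * G - I3) + b * E * (E - I5)) * c1
      + i / M * (M2 * I5 + b * E * K4)"
begin

lemma M1': "M1 = M3 + 2 * b * G" by (simp add: M1 M3 field_simps)
lemma M': "M = (M3 + 2 * b * G) * M2 + b\<^sup>2 * E\<^sup>2" by (simp add: M M1')
lemma bA: "b * A = 1 - M3" by (simp add: M3)
lemma bD: "b * D = 2 - 2 * M2" by (simp add: M2)

lemma i_k: "i = M\<^sup>2 * M3 * k" using nz by (simp add: k)
lemma a2_k: "a2 = A * M\<^sup>2 * k" using nz by (simp add: a2 k)
lemma a1_k: "a1 = (G * M2 + b / 2 * E\<^sup>2) * M * k" using nz by (simp add: a1 k power2_eq_square)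
lemma c1_k: "c1 = E * M * M3 * k" using nz by (simp add: c1 k power2_eq_square)
lemma b1_k: "b1 = (D * M1 - 2 * b * E\<^sup>2) * M * M3 * k" using nz by (simp add: b1 k power2_eq_square)

text \<open>The combination \<open>b * a2 + i\<close> drives the equations for the rows of
  off-diagonal pairs, and \<open>b * A + M3 = 1\<close> collapses it to one monomial.
  \<open>bb1\<close> does the same for \<open>b * b1 / 2 + i\<close> and diagonal pairs.\<close>

lemma ba2: "b * a2 + i = M\<^sup>2 * k"
proof -
  have "b * a2 + i = (b * A + M3) * M\<^sup>2 * k" unfolding a2_k by (subst i_k) (simp add: field_simps)
  then show ?thesis by (simp add: bA)
qed

lemma bb1: "b * b1 / 2 + i = M1 * M * M3 * k"
proof -
  have "b * b1 / 2 + M\<^sup>2 * M3 * k = ((b * D) * M1 / 2 - b\<^sup>2 * E\<^sup>2 + M) * M * M3 * k"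
    unfolding b1_k by (simp add: power2_eq_square field_simps)
  also have "(b * D) * M1 / 2 - b\<^sup>2 * E\<^sup>2 + M = M1" unfolding bD by (simp add: M field_simps)
  finally show ?thesis unfolding i_k[symmetric] .
qed

lemma eq_a2: "a2 = b * A * a2 + A * i"
proof -
  have "b * A * a2 + A * i = A * (b * a2 + i)" by (simp add: field_simps)
  then show ?thesis unfolding ba2 by (simp add: a2_k)
qed

lemma eq_a1: "a1 = b * ((A - 2 * G) * a1 + E / 2 * c1 + G * a2) + G * i"
proof -
  have "M1 * a1 = b * E / 2 * c1 + G * (b * a2 + i)"
    unfolding ba2 a1_k c1_k M1' M' by (simp add: power2_eq_square field_simps)
  then show ?thesis by (simp add: M1 field_simps)
qed

lemma eq_c1: "c1 = b / 2 * (D * c1 - 4 * E * a1 + 2 * E * a2) + E * i"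
proof -
  have "M2 * c1 = - 2 * b * E * a1 + E * (b * a2 + i)"
    unfolding ba2 a1_k c1_k M' by (simp add: power2_eq_square field_simps)
  then show ?thesis by (simp add: M2 field_simps)
qed

text \<open>The mixed constants satisfy two sets of equations, depending on whether the expanded
  overlap is the diagonal one (\<open>eq_c1\<close>, \<open>eq_c0\<close>) or the off-diagonal one
  (\<open>eq_c1'\<close>, \<open>eq_c0'\<close>). Their compatibility reflects the symmetry of a
  covariance.\<close>

lemma eq_c1': "c1 = b * ((A - 2 * G) * c1 + E / 2 * b1) + E * i"
proof -
  have "M1 * c1 = E * (b * b1 / 2 + i)"
    unfolding bb1 c1_k by (simp add: field_simps)
  then show ?thesis by (simp add: M1 field_simps)
qed

lemma eq_b1: "b1 = b / 2 * (D * b1 - 4 * E * c1) + D * i"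
proof -
  have "M2 * b1 + 2 * b * E * c1 = (D * (M1 * M2 + b\<^sup>2 * E\<^sup>2) + 2 * b * E\<^sup>2 * (1 - M2 - (b * D) / 2)) * M * M3 * k"
    unfolding b1_k c1_k by (simp add: power2_eq_square field_simps)
  also have "\<dots> = D * (M\<^sup>2 * M3 * k)" unfolding bD M[symmetric] by (simp add: power2_eq_square)
  also have "\<dots> = D * i" by (simp add: i_k[symmetric])
  finally show ?thesis by (simp add: M2 field_simps)
qed

lemma a0_k: "a0 = (b * (b * E * K4 + M2 * I5) * E * M3
    + 2 * b * (b * E * (E - I5) + M2 * (2 * G - I3)) * (G * M2 + b / 2 * E\<^sup>2) + (b * E * I5 + M2 * I3) * M) * k"
proof -
  have "M * a0 = b * (b * E * K4 + M2 * I5) * c1 + 2 * b * (b * E * (E - I5) + M2 * (2 * G - I3)) * a1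
      + (b * E * I5 + M2 * I3) * (b * a2 + i)"
    unfolding a0 using nz by (simp add: field_simps)
  also have "\<dots> = M * ((b * (b * E * K4 + M2 * I5) * E * M3
    + 2 * b * (b * E * (E - I5) + M2 * (2 * G - I3)) * (G * M2 + b / 2 * E\<^sup>2) + (b * E * I5 + M2 * I3) * M) * k)"
    unfolding ba2 a1_k c1_k by (simp add: power2_eq_square field_simps)
  finally show ?thesis using nz by simp
qed

lemma b0_k: "b0 = ((M1 * K4 - b * E * I5) * M1 * M3 + b * (M1 * (E - I5) - b * E * (2 * G - I3)) * E * M3) * k"
proof -
  have "M * b0 = (M1 * K4 - b * E * I5) * (b * b1 / 2 + i) + b * (M1 * (E - I5) - b * E * (2 * G - I3)) * c1"
    unfolding b0 using nz by (simp add: field_simps)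
  also have "\<dots> = M * (((M1 * K4 - b * E * I5) * M1 * M3 + b * (M1 * (E - I5) - b * E * (2 * G - I3)) * E * M3)
      * k)"
    unfolding bb1 c1_k by (simp add: field_simps)
  finally show ?thesis using nz by simp
qed

lemma c0_k: "c0 = ((M2 * I5 + b * E * K4) * M1 * M3 + b * (M2 * (2 * G - I3) + b * E * (E - I5)) * E * M3) * k"
proof -
  have "M * c0 = (M2 * I5 + b * E * K4) * (b * b1 / 2 + i) + b * (M2 * (2 * G - I3) + b * E * (E - I5)) * c1"
    unfolding c0 using nz by (simp add: field_simps)
  also have "\<dots> = M * (((M2 * I5 + b * E * K4) * M1 * M3 + b * (M2 * (2 * G - I3) + b * E * (E - I5)) * E * M3)
      * k)"
    unfolding bb1 c1_k by (simp add: field_simps)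
  finally show ?thesis using nz by simp
qed

lemma eq_a0: "a0 = b / 2 * (2 * A * a0 - 4 * G * a0 + 2 * E * c0 + 2 * I3 * a2 + (8 * G - 4 * I3) * a1 + 2 * I5
    * c1) + I3 * i"
proof -
  have "M1 * a0 - b * E * c0 = I3 * (b * a2 + i) + 2 * b * (2 * G - I3) * a1 + b * I5 * c1"
    unfolding ba2 a1_k c1_k a0_k c0_k M1' M' by (simp add: power2_eq_square field_simps)
  then show ?thesis by (simp add: M1 field_simps)
qed

lemma eq_c0: "c0 = b / 2 * (D * c0 - 2 * E * a0 + 2 * I5 * a2 + (4 * E - 4 * I5) * a1 + 2 * K4 * c1) + I5 * i"
proof -
  have "M2 * c0 + b * E * a0 = I5 * (b * a2 + i) + 2 * b * (E - I5) * a1 + b * K4 * c1"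
    unfolding ba2 a1_k c1_k a0_k c0_k M1' M' by (simp add: power2_eq_square field_simps)
  then show ?thesis by (simp add: M2 field_simps)
qed

lemma eq_c0': "c0 = b / 2 * (2 * A * c0 - 4 * G * c0 + 2 * E * b0 + (4 * G - 2 * I3) * c1 + I5 * b1) + I5 * i"
proof -
  have "M1 * c0 - b * E * b0 = I5 * (b * b1 / 2 + i) + b * (2 * G - I3) * c1"
    unfolding bb1 c1_k c0_k b0_k M1' M' by (simp add: power2_eq_square field_simps)
  then show ?thesis by (simp add: M1 field_simps)
qed

lemma eq_b0: "b0 = b / 2 * (D * b0 - 2 * E * c0 + (2 * E - 2 * I5) * c1 + K4 * b1) + K4 * i"
proof -
  have "M2 * b0 + b * E * c0 = K4 * (b * b1 / 2 + i) + b * (E - I5) * c1"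
    unfolding bb1 c1_k c0_k b0_k M1' M' by (simp add: power2_eq_square field_simps)
  then show ?thesis by (simp add: M2 field_simps)
qed

end

section \<open>Site correlations in terms of the constants of the statement\<close>

lemma integrable_std_gauss_bounded:
  fixes f :: "real \<Rightarrow> real"
  assumes "f \<in> borel_measurable borel" "\<And>t. \<bar>f t\<bar> \<le> K"
  shows "integrable std_gauss f"
  by (rule finite_measure.integrable_const_bound[OF prob_space.axioms(1)[OF prob_space_std_gauss], where B=K])
    (use assms in auto)

lemma Eg_diff:
  assumes "f \<in> borel_measurable borel" "g \<in> borel_measurable borel" "\<And>t. \<bar>f t\<bar> \<le> K" "\<And>t. \<bar>g t\<bar> \<le> L"
  shows "Eg (\<lambda>t. f t - g t) = Eg f - Eg g"
proof -
  have "Eg u = (\<integral>t. u t \<partial>std_gauss)" if "u \<in> borel_measurable borel" for u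
    unfolding Eg_def by (rule integral_std_gauss[OF that, symmetric])
  then show ?thesis
    using assms integrable_std_gauss_bounded[OF assms(1,3)] integrable_std_gauss_bounded[OF assms(2,4)] by simp
qed

text \<open>The shape of a function of two replicas which does not distinguish between the replicas outside the
  support of \<open>T2\<close>, \<open>T1\<close>, \<open>S1\<close>; the diagonal is free.\<close>

definition pair_form :: "(nat \<Rightarrow> nat \<Rightarrow> real) \<Rightarrow> (nat \<Rightarrow> real) \<Rightarrow> real \<Rightarrow> (nat \<Rightarrow> real) \<Rightarrow> real \<Rightarrow> nat \<Rightarrow> nat \<Rightarrow> real" where
  "pair_form T2 T1 T0 S1 S0 a b = (if a = b then S1 a + S0 else T2 a b + T1 a + T1 b + T0)"

definition supp_in :: "nat set \<Rightarrow> (nat \<Rightarrow> nat \<Rightarrow> real) \<Rightarrow> (nat \<Rightarrow> real) \<Rightarrow> (nat \<Rightarrow> real) \<Rightarrow> bool" where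
  "supp_in B T2 T1 S1 \<longleftrightarrow> (\<forall>a b. T2 a b = T2 b a) \<and> (\<forall>a. T2 a a = 0) \<and>
     (\<forall>a b. a \<notin> B \<longrightarrow> T2 a b = 0) \<and> (\<forall>a. a \<notin> B \<longrightarrow> T1 a = 0 \<and> S1 a = 0)"

lemma supp_inD:
  assumes "supp_in B T2 T1 S1"
  shows "T2 a b = T2 b a" "T2 a a = 0" "a \<notin> B \<Longrightarrow> T2 a b = 0" "b \<notin> B \<Longrightarrow> T2 a b = 0"
    "a \<notin> B \<Longrightarrow> T1 a = 0" "a \<notin> B \<Longrightarrow> S1 a = 0"
  using assms unfolding supp_in_def by metis+

context GS
begin

text \<open>Sums over the fresh replicas telescope, so that only the centred parts
  \<open>T2\<close>, \<open>T1\<close>, \<open>S1\<close> of the two forms interact.\<close>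

lemma bilinear_pair_form:
  assumes B: "finite R" "A \<subseteq> R" "s \<in> R - A" "s' \<in> R - A" "s \<noteq> s'"
    and t: "supp_in A t2 t1 u1" and T: "supp_in A T2 T1 S1"
  shows "2 * (\<Sum>a\<in>R. \<Sum>b\<in>R. pair_coeff A s s' a b * (pair_form t2 t1 t0 u1 u0 a b * pair_form T2 T1 T0 S1 S0 a b))
    = (\<Sum>a\<in>A. \<Sum>b\<in>A. t2 a b * T2 a b) + 2 * (\<Sum>a\<in>A. \<Sum>b\<in>A. t2 a b * T1 b) + T0 * (\<Sum>a\<in>A. \<Sum>b\<in>A. t2 a b)
      + 2 * (\<Sum>a\<in>A. \<Sum>b\<in>A. t1 a * T2 a b) + t0 * (\<Sum>a\<in>A. \<Sum>b\<in>A. T2 a b)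
      + 2 * ((\<Sum>a\<in>A. t1 a) * (\<Sum>a\<in>A. T1 a)) - 4 * (\<Sum>a\<in>A. t1 a * T1 a)
      - 2 * t0 * (\<Sum>a\<in>A. T1 a) - 2 * T0 * (\<Sum>a\<in>A. t1 a)
      + (\<Sum>a\<in>A. u1 a * S1 a) + S0 * (\<Sum>a\<in>A. u1 a) + u0 * (\<Sum>a\<in>A. S1 a)"
proof -
  have fA: "finite A" using B finite_subset by blast
  let ?n = "real (card A)"
  define X where "X a b = pair_form t2 t1 t0 u1 u0 a b * pair_form T2 T1 T0 S1 S0 a b" for a b
  define x1 where "x1 a = (t1 a + t0) * (T1 a + T0)" for a
  note td = supp_inD[OF t] and Td = supp_inD[OF T]
  have sA: "s \<notin> A" "s' \<notin> A" using B by auto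
  have inner: "(\<Sum>b\<in>R. cumul (insert s A) s' b * X a b) = (\<Sum>b\<in>A. X a b) + X a s - (?n + 1) * X a s'" for a
    using B fA by (subst sum_cumul) (auto simp: sA)
  have "2 * (\<Sum>a\<in>R. \<Sum>b\<in>R. pair_coeff A s s' a b * X a b)
      = (\<Sum>a\<in>R. cumul A s a * (\<Sum>b\<in>R. cumul (insert s A) s' b * X a b))"
    by (simp add: pair_coeff_def sum_distrib_left mult_ac)
  also have "\<dots> = (\<Sum>a\<in>A. (\<Sum>b\<in>A. X a b) + X a s - (?n + 1) * X a s') - ?n * ((\<Sum>b\<in>A. X s b) + X s s - (?n + 1)
      * X s s')"
    unfolding inner by (rule sum_cumul[OF B(1-3)])
  \<comment> \<open>Against a replica of \<open>A\<close> both fresh replicas give the same entry,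
    so the weights \<open>1\<close> and \<open>- (?n + 1)\<close> combine to
    \<open>- ?n\<close>.\<close>
  also have "(\<Sum>a\<in>A. (\<Sum>b\<in>A. X a b) + X a s - (?n + 1) * X a s') = (\<Sum>a\<in>A. (\<Sum>b\<in>A. X a b) - ?n * x1 a)"
  proof (intro sum.cong refl)
    fix a assume "a \<in> A"
    then have "a \<noteq> s" "a \<noteq> s'" using sA by auto
    then have "X a s = x1 a" "X a s' = x1 a"
      using sA by (simp_all add: X_def x1_def pair_form_def td Td)
    then show "(\<Sum>b\<in>A. X a b) + X a s - (?n + 1) * X a s' = (\<Sum>b\<in>A. X a b) - ?n * x1 a"
      by (simp add: algebra_simps)
  qed
  also have "\<dots> = (\<Sum>a\<in>A. \<Sum>b\<in>A. X a b) - ?n * (\<Sum>a\<in>A. x1 a)"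
    by (simp add: sum_subtractf sum_distrib_left)
  also have "(\<Sum>b\<in>A. X s b) = (\<Sum>a\<in>A. x1 a)"
    using sA by (intro sum.cong refl) (auto simp: X_def x1_def pair_form_def td Td)
  also have "X s s = u0 * S0" using sA by (simp add: X_def pair_form_def td Td)
  also have "X s s' = t0 * T0" using sA B by (simp add: X_def pair_form_def td Td)
  \<comment> \<open>The off-diagonal formula is used for all pairs; the second sum corrects it on
    the diagonal, where \<open>t2\<close> and \<open>T2\<close> vanish.\<close>
  also have "(\<Sum>a\<in>A. \<Sum>b\<in>A. X a b) = (\<Sum>a\<in>A. \<Sum>b\<in>A. (t2 a b + t1 a + t1 b + t0) * (T2 a b + T1 a + T1 b + T0))
      + (\<Sum>a\<in>A. (u1 a + u0) * (S1 a + S0) - (2 * t1 a + t0) * (2 * T1 a + T0))"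
  proof -
    have "X a b = (t2 a b + t1 a + t1 b + t0) * (T2 a b + T1 a + T1 b + T0)
        + (if b = a then (u1 a + u0) * (S1 a + S0) - (2 * t1 a + t0) * (2 * T1 a + T0) else 0)" for a b
      by (simp add: X_def pair_form_def td Td)
    then show ?thesis using fA by (simp add: sum.distrib)
  qed
  also have "(\<Sum>a\<in>A. \<Sum>b\<in>A. (t2 a b + t1 a + t1 b + t0) * (T2 a b + T1 a + T1 b + T0))
    = (\<Sum>a\<in>A. \<Sum>b\<in>A. t2 a b * T2 a b) + 2 * (\<Sum>a\<in>A. \<Sum>b\<in>A. t2 a b * T1 b) + T0 * (\<Sum>a\<in>A. \<Sum>b\<in>A. t2 a b)
      + 2 * (\<Sum>a\<in>A. \<Sum>b\<in>A. t1 a * T2 a b) + t0 * (\<Sum>a\<in>A. \<Sum>b\<in>A. T2 a b)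
      + 2 * ((\<Sum>a\<in>A. t1 a) * (\<Sum>a\<in>A. T1 a)) + 2 * ?n * (\<Sum>a\<in>A. t1 a * T1 a)
      + 2 * ?n * (T0 * (\<Sum>a\<in>A. t1 a)) + 2 * ?n * (t0 * (\<Sum>a\<in>A. T1 a)) + ?n * ?n * (t0 * T0)"
  proof -
    have e: "(t2 a b + t1 a + t1 b + t0) * (T2 a b + T1 a + T1 b + T0)
      = t2 a b * T2 a b + t2 a b * T1 a + t2 a b * T1 b + T0 * t2 a b + t1 a * T2 a b + t1 b * T2 a b + t0 * T2 a b
        + t1 a * T1 b + t1 b * T1 a + (t1 a * T1 a + T0 * t1 a + t0 * T1 a) + (t1 b * T1 b + T0 * t1 b + t0
            * T1 b) + t0 * T0" for a b
      by (simp add: algebra_simps)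
    have 1: "(\<Sum>a\<in>A. \<Sum>b\<in>A. t2 a b * T1 a) = (\<Sum>a\<in>A. \<Sum>b\<in>A. t2 a b * T1 b)"
      by (subst sum.swap) (intro sum.cong refl arg_cong2[where f="(*)"] td(1))
    have 2: "(\<Sum>a\<in>A. \<Sum>b\<in>A. t1 b * T2 a b) = (\<Sum>a\<in>A. \<Sum>b\<in>A. t1 a * T2 a b)"
      by (subst sum.swap) (intro sum.cong refl arg_cong2[where f="(*)"] Td(1))
    have 3: "(\<Sum>a\<in>A. \<Sum>b\<in>A. t1 a * T1 b) = (\<Sum>a\<in>A. t1 a) * (\<Sum>a\<in>A. T1 a)"
      by (simp add: sum_product)
    have 4: "(\<Sum>a\<in>A. \<Sum>b\<in>A. t1 b * T1 a) = (\<Sum>a\<in>A. t1 a) * (\<Sum>a\<in>A. T1 a)"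
      by (subst sum.swap) (simp add: sum_product)
    have 5: "(\<Sum>a\<in>A. \<Sum>b\<in>A. t1 a * T1 a) = ?n * (\<Sum>a\<in>A. t1 a * T1 a)"
      "(\<Sum>a\<in>A. \<Sum>b\<in>A. T0 * t1 a) = ?n * (T0 * (\<Sum>a\<in>A. t1 a))"
      "(\<Sum>a\<in>A. \<Sum>b\<in>A. t0 * T1 a) = ?n * (t0 * (\<Sum>a\<in>A. T1 a))"
      "(\<Sum>a\<in>A. \<Sum>b\<in>A. t1 b * T1 b) = ?n * (\<Sum>a\<in>A. t1 a * T1 a)"
      "(\<Sum>a\<in>A. \<Sum>b\<in>A. T0 * t1 b) = ?n * (T0 * (\<Sum>a\<in>A. t1 a))"
      "(\<Sum>a\<in>A. \<Sum>b\<in>A. t0 * T1 b) = ?n * (t0 * (\<Sum>a\<in>A. T1 a))"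
      "(\<Sum>a\<in>A. \<Sum>b\<in>A. t0 * T0) = ?n * ?n * (t0 * T0)"
      "(\<Sum>a\<in>A. \<Sum>b\<in>A. T0 * t2 a b) = T0 * (\<Sum>a\<in>A. \<Sum>b\<in>A. t2 a b)"
      "(\<Sum>a\<in>A. \<Sum>b\<in>A. t0 * T2 a b) = t0 * (\<Sum>a\<in>A. \<Sum>b\<in>A. T2 a b)"
      by (simp_all add: sum_distrib_left)
    show ?thesis
      unfolding e sum.distrib 1 2 3 4 5 by simp
  qed
  also have "(\<Sum>a\<in>A. (u1 a + u0) * (S1 a + S0) - (2 * t1 a + t0) * (2 * T1 a + T0))
    = (\<Sum>a\<in>A. u1 a * S1 a) + S0 * (\<Sum>a\<in>A. u1 a) + u0 * (\<Sum>a\<in>A. S1 a) + ?n * (u0 * S0)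
      - 4 * (\<Sum>a\<in>A. t1 a * T1 a) - 2 * T0 * (\<Sum>a\<in>A. t1 a) - 2 * t0 * (\<Sum>a\<in>A. T1 a) - ?n * (t0 * T0)"
  proof -
    have e: "(u1 a + u0) * (S1 a + S0) - (2 * t1 a + t0) * (2 * T1 a + T0)
      = u1 a * S1 a + S0 * u1 a + u0 * S1 a + u0 * S0 - 4 * (t1 a * T1 a) - (2 * T0) * t1 a - (2 * t0) * T1 a
          - t0 * T0" for a
      by (simp add: algebra_simps)
    show ?thesis unfolding e sum.distrib sum_subtractf sum_distrib_left[symmetric] by simp
  qed
  also have "(\<Sum>a\<in>A. x1 a) = (\<Sum>a\<in>A. t1 a * T1 a) + T0 * (\<Sum>a\<in>A. t1 a) + t0 * (\<Sum>a\<in>A. T1 a) + ?n * (t0 * T0)"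
  proof -
    have e: "x1 a = t1 a * T1 a + T0 * t1 a + t0 * T1 a + t0 * T0" for a by (simp add: x1_def algebra_simps)
    show ?thesis unfolding e sum.distrib sum_distrib_left[symmetric] by simp
  qed
  finally show ?thesis unfolding X_def by (simp add: algebra_simps)
qed

abbreviation "kA \<equiv> cA S \<beta> h D p q"
abbreviation "kD \<equiv> cD S \<beta> h D p q"
abbreviation "kF \<equiv> cF S \<beta> h D p q"
abbreviation "kG \<equiv> cG S \<beta> h D p q"
abbreviation "kE \<equiv> cE S \<beta> h D p q"
abbreviation "kI3 \<equiv> cI3 S \<beta> h D p q"
abbreviation "kI5 \<equiv> cI5 S \<beta> h D p q"
abbreviation "kK4 \<equiv> cK4 S \<beta> h D p q"
abbreviation "mm \<equiv> mom S \<beta> h D p q"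

text \<open>\<open>X1\<close> to \<open>X5\<close> correspond to the ways of distributing four spins
  at a site over replicas: types 1111, 211, 22, 31 and 4.\<close>

definition "X1 = Eg (\<lambda>t. mm 1 t ^ 4)"
definition "X2 = Eg (\<lambda>t. mm 1 t ^ 2 * mm 2 t)"
definition "X3 = Eg (\<lambda>t. mm 2 t ^ 2)"
definition "X4 = Eg (\<lambda>t. mm 1 t * mm 3 t)"
definition "X5 = Eg (mm 4)"

lemma mm_prod_bound:
  assumes "\<And>t. \<bar>f t\<bar> \<le> real S ^ i" "\<And>t. \<bar>g t\<bar> \<le> real S ^ j"
  shows "\<bar>f t * g t\<bar> \<le> real S ^ (i + j)"
  unfolding abs_mult power_add by (intro mult_mono assms) auto

lemma mm_bounds:
  "\<bar>mm 1 t ^ 4\<bar> \<le> real S ^ 4" "\<bar>mm 1 t ^ 2 * mm 2 t\<bar> \<le> real S ^ 4" "\<bar>mm 2 t ^ 2\<bar> \<le> real S ^ 4"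
  "\<bar>mm 1 t * mm 3 t\<bar> \<le> real S ^ 4" "\<bar>mm 4 t\<bar> \<le> real S ^ 4"
proof -
  note b = abs_mom_le[of S \<beta> h D p q]
  have 2: "\<bar>mm 1 t * mm 1 t\<bar> \<le> real S ^ 2" for t
    using mm_prod_bound[of "mm 1" 1 "mm 1" 1 t, OF b b] by (simp only: one_add_one)
  show "\<bar>mm 1 t ^ 4\<bar> \<le> real S ^ 4"
    using mm_prod_bound[of "\<lambda>t. mm 1 t * mm 1 t" 2 "\<lambda>t. mm 1 t * mm 1 t" 2 t, OF 2 2]
    by (simp add: power4_eq_xxxx mult.assoc)
  show "\<bar>mm 1 t ^ 2 * mm 2 t\<bar> \<le> real S ^ 4"
    using mm_prod_bound[of "\<lambda>t. mm 1 t * mm 1 t" 2 "mm 2" 2 t, OF 2 b] by (simp add: power2_eq_square)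
  show "\<bar>mm 2 t ^ 2\<bar> \<le> real S ^ 4"
    using mm_prod_bound[of "mm 2" 2 "mm 2" 2 t, OF b b] by (simp add: power2_eq_square)
  show "\<bar>mm 1 t * mm 3 t\<bar> \<le> real S ^ 4"
    using mm_prod_bound[of "mm 1" 1 "mm 3" 3 t, OF b b] by simp
  show "\<bar>mm 4 t\<bar> \<le> real S ^ 4" by (rule b)
qed

lemma X_bounds: "\<bar>X1\<bar> \<le> real S ^ 4" "\<bar>X2\<bar> \<le> real S ^ 4" "\<bar>X3\<bar> \<le> real S ^ 4" "\<bar>X4\<bar> \<le> real S ^ 4" "\<bar>X5\<bar> \<le> real S ^ 4"
  unfolding X1_def X2_def X3_def X4_def X5_def by (intro Eg_bound mm_bounds; measurable)+

text \<open>Besides reducing everything to five expectations, this gives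
  \<open>kA = kF - kG\<close>, which brings \<open>cM1\<close> and \<open>cM3\<close> into the form
  required by \<open>covariance_system\<close>.\<close>

lemma constants_eq:
  "kD = X5 - X3" "kF = X3 - X2" "kG = X2 - X1" "kE = X4 - X2" "kA = kF - kG"
  "kI3 = X1 - q\<^sup>2" "kI5 = X2 - p * q" "kK4 = X3 - p\<^sup>2"
proof -
  show "kD = X5 - X3" unfolding cD_def X5_def X3_def
      by (rule Eg_diff[OF _ _ mm_bounds(5) mm_bounds(3)]; measurable)
  show F: "kF = X3 - X2" unfolding cF_def X2_def X3_def
      by (rule Eg_diff[OF _ _ mm_bounds(3) mm_bounds(2)]; measurable)
  have "kG = Eg (\<lambda>t. mm 1 t ^ 2 * mm 2 t - mm 1 t ^ 4)"
    unfolding cG_def by (intro arg_cong[where f=Eg] ext) (simp add: power2_eq_square power4_eq_xxxx algebra_simps)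
  also have "\<dots> = X2 - X1" unfolding X2_def X1_def by (rule Eg_diff[OF _ _ mm_bounds(2) mm_bounds(1)]; measurable)
  finally show G: "kG = X2 - X1" .
  have "kE = Eg (\<lambda>t. mm 1 t * mm 3 t - mm 1 t ^ 2 * mm 2 t)"
    unfolding cE_def by (intro arg_cong[where f=Eg] ext) (simp add: power2_eq_square algebra_simps)
  also have "\<dots> = X4 - X2" unfolding X2_def X4_def by (rule Eg_diff[OF _ _ mm_bounds(4) mm_bounds(2)]; measurable)
  finally show "kE = X4 - X2" .
  have "kA = Eg (\<lambda>t. (mm 2 t ^ 2 - mm 1 t ^ 2 * mm 2 t) - (mm 1 t ^ 2 * mm 2 t - mm 1 t ^ 4))"
    unfolding cA_def by (intro arg_cong[where f=Eg] ext) (simp add: power2_eq_square power4_eq_xxxx algebra_simps)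
  also have "\<dots> = Eg (\<lambda>t. mm 2 t ^ 2 - mm 1 t ^ 2 * mm 2 t) - Eg (\<lambda>t. mm 1 t ^ 2 * mm 2 t - mm 1 t ^ 4)"
  proof (rule Eg_diff[where K="2 * real S ^ 4" and L="2 * real S ^ 4"])
    show "\<bar>mm 2 t ^ 2 - mm 1 t ^ 2 * mm 2 t\<bar> \<le> 2 * real S ^ 4" for t
      using mm_bounds(2,3)[of t] by linarith
    show "\<bar>mm 1 t ^ 2 * mm 2 t - mm 1 t ^ 4\<bar> \<le> 2 * real S ^ 4" for t
      using mm_bounds(1,2)[of t] by linarith
  qed measurable
  also have "Eg (\<lambda>t. mm 2 t ^ 2 - mm 1 t ^ 2 * mm 2 t) = X3 - X2"
    unfolding X2_def X3_def by (rule Eg_diff[OF _ _ mm_bounds(3) mm_bounds(2)]; measurable)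
  also have "Eg (\<lambda>t. mm 1 t ^ 2 * mm 2 t - mm 1 t ^ 4) = X2 - X1"
    unfolding X2_def X1_def by (rule Eg_diff[OF _ _ mm_bounds(2) mm_bounds(1)]; measurable)
  finally show "kA = kF - kG" by (simp add: F G)
  show "kI3 = X1 - q\<^sup>2" by (simp add: cI3_def X1_def)
  show "kI5 = X2 - p * q" by (simp add: cI5_def X2_def)
  show "kK4 = X3 - p\<^sup>2" by (simp add: cK4_def X3_def)
qed

text \<open>The parameters of \<open>corr k l\<close> as a pair form. They are additive in the
  shared replicas: for two coinciding off-diagonal pairs the pieces sum to
  \<open>kA + 2 * kG + kI3\<close>.\<close>

definition "t2 k l a b = (if k \<noteq> l \<and> (a = k \<and> b = l \<or> a = l \<and> b = k) then kA else 0)"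
definition "t1 k l a = (if k \<noteq> l then (if a = k \<or> a = l then kG else 0) else (if a = k then kE else 0))"
definition "t0 k l = (if k \<noteq> l then kI3 else kI5)" for k l :: nat
definition "u1 k l a = (if k \<noteq> l then (if a = k \<or> a = l then kE else 0) else (if a = k then kD else 0))"
definition "u0 k l = (if k \<noteq> l then kI5 else kK4)" for k l :: nat

lemma corr_eq: "corr k l a b = pair_form (t2 k l) (t1 k l) (t0 k l) (u1 k l) (u0 k l) a b"
proof -
  have c: "corr k l a b =
    (if k = l then
       (if a = b then (if a = k then X5 else X3) - p * p else (if a = k \<or> b = k then X4 else X2) - p * q)
     else if a = b then (if a = k \<or> a = l then X4 else X2) - p * q
     else (if a = k \<and> b = l \<or> a = l \<and> b = k then X3 else if a = k \<or> a = l \<or> b = k \<or> b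
         = l then X2 else X1) - q * q)"
    unfolding corr_def X1_def X2_def X3_def X4_def X5_def
    by (simp add: spin_count_def Qpq_def numeral_eq_Suc mult_ac insert_commute)
  show ?thesis
    unfolding c pair_form_def t2_def t1_def t0_def u1_def u0_def constants_eq
    by (simp add: power2_eq_square)
qed

end

section \<open>Exact solution and stability of the linear system\<close>

context covariance_system
begin

text \<open>In the four \<open>solves\<close> lemmas \<open>x\<close> and \<open>y\<close> stand for
  indicators and counts of shared replicas. The difference of the two sides is affine in them, with
  the component equations as coefficients.\<close>

lemma solves_off_off:
  "a2 * x + a1 * y + a0 = b / 2 * (2 * A * (a2 * x + a1 * y + a0) + 2 * G * (a2 * y) + I3 * (2 * a2) + 4 * G
      * (2 * a1)
     - 4 * G * (a1 * y) - 2 * I3 * (2 * a1) - 4 * G * a0 + E * (c1 * y) + 2 * E * c0 + I5 * (2 * c1)) + (A * x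
         + G * y + I3) * i"
  (is "?l = ?r")
proof -
  have "?l - ?r = (a2 - (b * A * a2 + A * i)) * x + (a1 - (b * ((A - 2 * G) * a1 + E / 2 * c1 + G * a2) + G
      * i)) * y
     + (a0 - (b / 2 * (2 * A * a0 - 4 * G * a0 + 2 * E * c0 + 2 * I3 * a2 + (8 * G - 4 * I3) * a1 + 2 * I5 * c1)
         + I3 * i))"
    by (simp add: field_simps)
  then show ?thesis using eq_a2 eq_a1 eq_a0 by simp
qed

lemma solves_diag_off:
  "c1 * x + c0 = b / 2 * (2 * E * (a2 * x) + I5 * (2 * a2) + 2 * E * (2 * a1) - 4 * E * (a1 * x) - 2 * I5 * (2
      * a1)
     - 2 * E * a0 + D * (c1 * x) + D * c0 + K4 * (2 * c1)) + (E * x + I5) * i"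
  (is "?l = ?r")
proof -
  have "?l - ?r = (c1 - (b / 2 * (D * c1 - 4 * E * a1 + 2 * E * a2) + E * i)) * x
     + (c0 - (b / 2 * (D * c0 - 2 * E * a0 + 2 * I5 * a2 + (4 * E - 4 * I5) * a1 + 2 * K4 * c1) + I5 * i))"
    by (simp add: field_simps)
  then show ?thesis using eq_c1 eq_c0 by simp
qed

lemma solves_off_diag:
  "c1 * y + c0 = b / 2 * (2 * A * (c1 * y + c0) + 4 * G * c1 - 4 * G * (c1 * y) - 2 * I3 * c1 - 4 * G * c0
     + E * (b1 * y) + 2 * E * b0 + I5 * b1) + (E * y + I5) * i"
  (is "?l = ?r")
proof -
  have "?l - ?r = (c1 - (b * ((A - 2 * G) * c1 + E / 2 * b1) + E * i)) * y
     + (c0 - (b / 2 * (2 * A * c0 - 4 * G * c0 + 2 * E * b0 + (4 * G - 2 * I3) * c1 + I5 * b1) + I5 * i))"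
    by (simp add: field_simps)
  then show ?thesis using eq_c1' eq_c0' by simp
qed

lemma solves_diag_diag:
  "b1 * x + b0 = b / 2 * (2 * E * c1 - 4 * E * (c1 * x) - 2 * I5 * c1 - 2 * E * c0 + D * (b1 * x) + D * b0 + K4
      * b1) + (D * x + K4) * i"
  (is "?l = ?r")
proof -
  have "?l - ?r = (b1 - (b / 2 * (D * b1 - 4 * E * c1) + D * i)) * x
     + (b0 - (b / 2 * (D * b0 - 2 * E * c0 + (2 * E - 2 * I5) * c1 + K4 * b1) + K4 * i))"
    by (simp add: field_simps)
  then show ?thesis using eq_b1 eq_b0 by simp
qed

end

text \<open>Adding the two inequalities bounds three quarters of
  \<open>\<bar>x\<bar> + \<bar>z\<bar>\<close> by \<open>2 * (d + \<rho>)\<close>, and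
  \<open>8 / 3 \<le> 3\<close>.\<close>

lemma two_by_two_stability:
  fixes x z :: real
  assumes "\<bar>x - (\<alpha> * x + \<beta> * z + r)\<bar> \<le> d" "\<bar>z - (\<gamma> * z + \<kappa> * x + r')\<bar> \<le> d"
    and c: "\<bar>\<alpha>\<bar> \<le> 1/8" "\<bar>\<beta>\<bar> \<le> 1/8" "\<bar>\<gamma>\<bar> \<le> 1/8" "\<bar>\<kappa>\<bar> \<le> 1/8" and r: "\<bar>r\<bar> \<le> \<rho>" "\<bar>r'\<bar> \<le> \<rho>"
  shows "\<bar>x\<bar> \<le> 3 * (d + \<rho>)" "\<bar>z\<bar> \<le> 3 * (d + \<rho>)"
proof -
  have s: "\<bar>u * v\<bar> \<le> \<bar>v\<bar> / 8" if "\<bar>u\<bar> \<le> 1/8" for u v :: real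
    using mult_right_mono[OF that, of "\<bar>v\<bar>"] by (simp add: abs_mult)
  have "\<bar>x\<bar> \<le> d + \<bar>x\<bar> / 8 + \<bar>z\<bar> / 8 + \<rho>"
    using assms(1) s[OF c(1), of x] s[OF c(2), of z] r(1) by linarith
  moreover have "\<bar>z\<bar> \<le> d + \<bar>z\<bar> / 8 + \<bar>x\<bar> / 8 + \<rho>"
    using assms(2) s[OF c(3), of z] s[OF c(4), of x] r(2) by linarith
  ultimately have "\<bar>x\<bar> + \<bar>z\<bar> \<le> 3 * (d + \<rho>)" by argo
  then show "\<bar>x\<bar> \<le> 3 * (d + \<rho>)" "\<bar>z\<bar> \<le> 3 * (d + \<rho>)" using abs_ge_zero[of x] abs_ge_zero[of z] by linarith+
qed

context GS_form
begin

text \<open>Multiplied by \<open>\<beta>\<^sup>2\<close> this is the linear operator of the cavity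
  equation.\<close>

definition response :: "nat \<Rightarrow> nat \<Rightarrow> (nat \<Rightarrow> nat \<Rightarrow> real) \<Rightarrow> real" where
  "response k l w = (\<Sum>a\<in>R. \<Sum>b\<in>R. fresh_coeff a b * (corr k l a b * w a b))"

lemma sum_t2:
  assumes "k \<in> A" "l \<in> A" "k \<noteq> l"
  shows "(\<Sum>a\<in>A. \<Sum>b\<in>A. t2 k l a b * g a b) = kA * (g k l + g l k)"
proof -
  have "(\<Sum>a\<in>A. \<Sum>b\<in>A. t2 k l a b * g a b)
     = (\<Sum>a\<in>A. \<Sum>b\<in>A. (if b = l then (if a = k then kA * g a b else 0) else 0) + (if b = k then (if a
         = l then kA * g a b else 0) else 0))"
    using assms(3) by (intro sum.cong refl) (auto simp: t2_def)
  also have "\<dots> = kA * (g k l + g l k)"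
    using assms by (simp add: sum.distrib sum.delta distrib_left)
  finally show ?thesis .
qed

lemma sum_t1_off:
  assumes "k \<in> A" "l \<in> A" "k \<noteq> l"
  shows "(\<Sum>a\<in>A. t1 k l a * g a) = kG * (g k + g l)" "(\<Sum>a\<in>A. u1 k l a * g a) = kE * (g k + g l)"
proof -
  have "(\<Sum>a\<in>A. t1 k l a * g a) = (\<Sum>a\<in>A. (if a = k then kG * g a else 0) + (if a = l then kG * g a else 0))"
    using assms(3) by (intro sum.cong refl) (auto simp: t1_def)
  then show "(\<Sum>a\<in>A. t1 k l a * g a) = kG * (g k + g l)"
    using assms by (simp add: sum.distrib distrib_left)
  have "(\<Sum>a\<in>A. u1 k l a * g a) = (\<Sum>a\<in>A. (if a = k then kE * g a else 0) + (if a = l then kE * g a else 0))"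
    using assms(3) by (intro sum.cong refl) (auto simp: u1_def)
  then show "(\<Sum>a\<in>A. u1 k l a * g a) = kE * (g k + g l)"
    using assms by (simp add: sum.distrib distrib_left)
qed

lemma sum_t1_diag:
  assumes "k \<in> A"
  shows "(\<Sum>a\<in>A. t1 k k a * g a) = kE * g k" "(\<Sum>a\<in>A. u1 k k a * g a) = kD * g k"
proof -
  have "(\<Sum>a\<in>A. t1 k k a * g a) = (\<Sum>a\<in>A. (if a = k then kE * g a else 0))"
    by (intro sum.cong refl) (auto simp: t1_def)
  then show "(\<Sum>a\<in>A. t1 k k a * g a) = kE * g k" using assms by simp
  have "(\<Sum>a\<in>A. u1 k k a * g a) = (\<Sum>a\<in>A. (if a = k then kD * g a else 0))"
    by (intro sum.cong refl) (auto simp: u1_def)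
  then show "(\<Sum>a\<in>A. u1 k k a * g a) = kD * g k" using assms by simp
qed

lemma supp_corr: "k \<in> A \<Longrightarrow> l \<in> A \<Longrightarrow> supp_in A (t2 k l) (t1 k l) (u1 k l)"
  by (auto simp: supp_in_def t2_def t1_def u1_def)

text \<open>\<open>bilinear_pair_form\<close> with \<open>corr k l\<close> as the first form. Its
  centred parts are supported on \<open>k\<close> and \<open>l\<close>, so sums weighted by them
  become evaluations there.\<close>

lemma response_off:
  assumes "k \<in> A" "l \<in> A" "k \<noteq> l" and T: "supp_in A T2 T1 S1"
  shows "2 * response k l (pair_form T2 T1 T0 S1 S0) = 2 * kA * (T2 k l + T1 k + T1 l + T0)
     + 2 * kG * ((\<Sum>b\<in>A. T2 k b) + (\<Sum>b\<in>A. T2 l b)) + kI3 * (\<Sum>a\<in>A. \<Sum>b\<in>A. T2 a b) + 4 * kG * (\<Sum>a\<in>A. T1 a)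
     - 4 * kG * (T1 k + T1 l) - 2 * kI3 * (\<Sum>a\<in>A. T1 a) - 4 * kG * T0 + kE * (S1 k + S1 l) + 2 * kE * S0
     + kI5 * (\<Sum>a\<in>A. S1 a)"
proof -
  note sums = sum_t2[OF assms(1-3)] sum_t1_off[OF assms(1-3)]
  have s0: "(\<Sum>a\<in>A. \<Sum>b\<in>A. t2 k l a b) = 2 * kA" "(\<Sum>a\<in>A. t1 k l a) = 2 * kG" "(\<Sum>a\<in>A. u1 k l a) = 2 * kE"
    using sums(1)[of "\<lambda>_ _. 1"] sums(2)[of "\<lambda>_. 1"] sums(3)[of "\<lambda>_. 1"] by simp_all
  have s1: "(\<Sum>a\<in>A. \<Sum>b\<in>A. t1 k l a * T2 a b) = kG * ((\<Sum>b\<in>A. T2 k b) + (\<Sum>b\<in>A. T2 l b))"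
    unfolding sum_distrib_left[symmetric] by (rule sums(2))
  have "2 * response k l (pair_form T2 T1 T0 S1 S0) =
    (\<Sum>a\<in>A. \<Sum>b\<in>A. t2 k l a b * T2 a b) + 2 * (\<Sum>a\<in>A. \<Sum>b\<in>A. t2 k l a b * T1 b) + T0 * (\<Sum>a\<in>A. \<Sum>b\<in>A. t2 k l a b)
      + 2 * (\<Sum>a\<in>A. \<Sum>b\<in>A. t1 k l a * T2 a b) + t0 k l * (\<Sum>a\<in>A. \<Sum>b\<in>A. T2 a b)
      + 2 * ((\<Sum>a\<in>A. t1 k l a) * (\<Sum>a\<in>A. T1 a)) - 4 * (\<Sum>a\<in>A. t1 k l a * T1 a)
      - 2 * t0 k l * (\<Sum>a\<in>A. T1 a) - 2 * T0 * (\<Sum>a\<in>A. t1 k l a)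
      + (\<Sum>a\<in>A. u1 k l a * S1 a) + S0 * (\<Sum>a\<in>A. u1 k l a) + u0 k l * (\<Sum>a\<in>A. S1 a)"
    unfolding response_def corr_eq by (rule bilinear_pair_form[OF finite_R A_sub_R stars(1-3) supp_corr[OF
        assms(1,2)] T])
  then show ?thesis
    unfolding s0 s1 sums using assms(3) supp_inD(1)[OF T, of l k] by (simp add: t0_def u0_def algebra_simps)
qed

lemma response_diag:
  assumes "k \<in> A" and T: "supp_in A T2 T1 S1"
  shows "2 * response k k (pair_form T2 T1 T0 S1 S0) = 2 * kE * (\<Sum>b\<in>A. T2 k b) + kI5 * (\<Sum>a\<in>A. \<Sum>b\<in>A. T2 a b)
     + 2 * kE * (\<Sum>a\<in>A. T1 a) - 4 * kE * T1 k - 2 * kI5 * (\<Sum>a\<in>A. T1 a) - 2 * kE * T0 + kD * S1 k + kD * S0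
     + kK4 * (\<Sum>a\<in>A. S1 a)"
proof -
  note sums = sum_t1_diag[OF assms(1)]
  have s0: "(\<Sum>a\<in>A. t1 k k a) = kE" "(\<Sum>a\<in>A. u1 k k a) = kD"
    using sums(1)[of "\<lambda>_. 1"] sums(2)[of "\<lambda>_. 1"] by simp_all
  have s1: "(\<Sum>a\<in>A. \<Sum>b\<in>A. t1 k k a * T2 a b) = kE * (\<Sum>b\<in>A. T2 k b)"
    unfolding sum_distrib_left[symmetric] by (rule sums(1))
  have s2: "t2 k k a b = 0" for a b by (simp add: t2_def)
  have "2 * response k k (pair_form T2 T1 T0 S1 S0) =
    (\<Sum>a\<in>A. \<Sum>b\<in>A. t2 k k a b * T2 a b) + 2 * (\<Sum>a\<in>A. \<Sum>b\<in>A. t2 k k a b * T1 b) + T0 * (\<Sum>a\<in>A. \<Sum>b\<in>A. t2 k k a b)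
      + 2 * (\<Sum>a\<in>A. \<Sum>b\<in>A. t1 k k a * T2 a b) + t0 k k * (\<Sum>a\<in>A. \<Sum>b\<in>A. T2 a b)
      + 2 * ((\<Sum>a\<in>A. t1 k k a) * (\<Sum>a\<in>A. T1 a)) - 4 * (\<Sum>a\<in>A. t1 k k a * T1 a)
      - 2 * t0 k k * (\<Sum>a\<in>A. T1 a) - 2 * T0 * (\<Sum>a\<in>A. t1 k k a)
      + (\<Sum>a\<in>A. u1 k k a * S1 a) + S0 * (\<Sum>a\<in>A. u1 k k a) + u0 k k * (\<Sum>a\<in>A. S1 a)"
    unfolding response_def corr_eq by (rule bilinear_pair_form[OF finite_R A_sub_R stars(1-3) supp_corr[OF
        assms(1,1)] T])
  then show ?thesis
    unfolding s0 s1 sums s2 by (simp add: t0_def u0_def algebra_simps)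
qed

text \<open>The constants are at most two, for \<open>kA\<close> four, times
  \<open>real S ^ 4\<close>, and \<open>small2\<close> contributes the factor
  \<open>1 / 100\<close>.\<close>

lemma small_constants:
  "\<bar>\<beta>\<^sup>2 * kA\<bar> \<le> 1/25" "\<bar>\<beta>\<^sup>2 * kG\<bar> \<le> 1/50" "\<bar>\<beta>\<^sup>2 * kE\<bar> \<le> 1/50" "\<bar>\<beta>\<^sup>2 * kD\<bar> \<le> 1/50"
  "\<bar>\<beta>\<^sup>2 * kI3\<bar> \<le> 1/50" "\<bar>\<beta>\<^sup>2 * kI5\<bar> \<le> 1/50" "\<bar>\<beta>\<^sup>2 * kK4\<bar> \<le> 1/50"
proof -
  have *: "\<bar>\<beta>\<^sup>2 * x\<bar> \<le> y / 100" if "\<bar>x\<bar> \<le> y * real S ^ 4" "0 \<le> y" for x y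
  proof -
    have "\<bar>\<beta>\<^sup>2 * x\<bar> \<le> \<beta>\<^sup>2 * (y * real S ^ 4)" using that by (simp add: abs_mult mult_left_mono)
    also have "\<dots> = y * (\<beta>\<^sup>2 * real S ^ 4)" by simp
    also have "\<dots> \<le> y * (1/100)" by (intro mult_left_mono small2 that)
    finally show ?thesis by simp
  qed
  have Q: "\<bar>Qpq p q k l * Qpq p q k' l'\<bar> \<le> real S ^ 4" for k l k' l'
    using mult_mono[OF abs_Qpq_le[of k l] abs_Qpq_le[of k' l']]
        by (simp add: abs_mult power2_eq_square power4_eq_xxxx mult.assoc)
  have q: "\<bar>q\<^sup>2\<bar> \<le> real S ^ 4" "\<bar>p * q\<bar> \<le> real S ^ 4" "\<bar>p\<^sup>2\<bar> \<le> real S ^ 4"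
    using Q[of 0 1 0 1] Q[of 0 0 0 1] Q[of 0 0 0 0] by (simp_all add: Qpq_def power2_eq_square)
  show "\<bar>\<beta>\<^sup>2 * kA\<bar> \<le> 1/25"
  proof -
    have "\<bar>kA\<bar> \<le> 4 * real S ^ 4" using X_bounds unfolding constants_eq by linarith
    from *[OF this] show ?thesis by simp
  qed
  show "\<bar>\<beta>\<^sup>2 * kG\<bar> \<le> 1/50"
  proof -
    have "\<bar>kG\<bar> \<le> 2 * real S ^ 4" using X_bounds unfolding constants_eq by linarith
    from *[OF this] show ?thesis by simp
  qed
  show "\<bar>\<beta>\<^sup>2 * kE\<bar> \<le> 1/50"
  proof -
    have "\<bar>kE\<bar> \<le> 2 * real S ^ 4" using X_bounds unfolding constants_eq by linarith
    from *[OF this] show ?thesis by simp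
  qed
  show "\<bar>\<beta>\<^sup>2 * kD\<bar> \<le> 1/50"
  proof -
    have "\<bar>kD\<bar> \<le> 2 * real S ^ 4" using X_bounds unfolding constants_eq by linarith
    from *[OF this] show ?thesis by simp
  qed
  show "\<bar>\<beta>\<^sup>2 * kI3\<bar> \<le> 1/50"
  proof -
    have "\<bar>kI3\<bar> \<le> 2 * real S ^ 4" using X_bounds q unfolding constants_eq by linarith
    from *[OF this] show ?thesis by simp
  qed
  show "\<bar>\<beta>\<^sup>2 * kI5\<bar> \<le> 1/50"
  proof -
    have "\<bar>kI5\<bar> \<le> 2 * real S ^ 4" using X_bounds q unfolding constants_eq by linarith
    from *[OF this] show ?thesis by simp
  qed
  show "\<bar>\<beta>\<^sup>2 * kK4\<bar> \<le> 1/50"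
  proof -
    have "\<bar>kK4\<bar> \<le> 2 * real S ^ 4" using X_bounds q unfolding constants_eq by linarith
    from *[OF this] show ?thesis by simp
  qed
qed

lemma small_mult: "\<bar>x\<bar> \<le> y \<Longrightarrow> \<bar>x * z\<bar> \<le> y * \<bar>z :: real\<bar>"
  by (simp add: abs_mult mult_right_mono)

text \<open>The system is triangular (first \<open>T2\<close>, then \<open>(T1, S1)\<close>, then \<open>(T0, S0)\<close>), and the diagonal
  blocks do not involve \<open>n\<close>: this is why the smallness of \<open>\<beta>\<close> does not depend on \<open>n\<close>.\<close>

lemma stability:
  assumes T: "supp_in {1..n} T2 T1 S1"
    and err: "\<And>k l. k \<in> A \<Longrightarrow> l \<in> A \<Longrightarrow> \<bar>pair_form T2 T1 T0 S1 S0 k l - \<beta>\<^sup>2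
        * response k l (pair_form T2 T1 T0 S1 S0)\<bar> \<le> \<delta>"
    and kl: "k \<in> A" "l \<in> A"
  shows "\<bar>pair_form T2 T1 T0 S1 S0 k l\<bar> \<le> 50 * (real n + 4) ^ 2 * \<delta>"
proof -
  have supp: "supp_in A T2 T1 S1" using T by (auto simp: supp_in_def A_def)
  \<comment> \<open>\<open>n + 1\<close> and \<open>n + 2\<close> serve as fresh replicas:
    \<open>T2\<close>, \<open>T1\<close> and \<open>S1\<close> vanish there, so differences of
    equations against them isolate the components one after the other.\<close>
  have star: "n + 1 \<in> A" "n + 2 \<in> A" "n + 1 \<noteq> n + 2" by (auto simp: A_def)
  have z: "T1 (n+1) = 0" "T1 (n+2) = 0" "S1 (n+1) = 0" "\<And>b. T2 (n+1) b = 0" "\<And>b. T2 (n+2) b = 0" "\<And>b. T2 b (n+1)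
      = 0" "\<And>b. T2 b (n+2) = 0"
    by (simp_all add: supp_inD(3-6)[OF T])
  note z = z z[simplified]
  define PT where "PT = (\<Sum>a\<in>A. \<Sum>b\<in>A. T2 a b)"
  define Tt where "Tt = (\<Sum>a\<in>A. T1 a)"
  define St where "St = (\<Sum>a\<in>A. S1 a)"
  define P where "P k = (\<Sum>b\<in>A. T2 k b)" for k
  have d0: "0 \<le> \<delta>" using order_trans[OF abs_ge_zero err[OF kl]] .
  have Po: "P (n+1) = 0" "P (n+2) = 0" by (simp_all add: P_def z)
  note Po = Po Po[simplified]
  have off: "\<bar>T2 k l + T1 k + T1 l + T0 - \<beta>\<^sup>2 / 2 * (2 * kA * (T2 k l + T1 k + T1 l + T0)
     + 2 * kG * (P k + P l) + kI3 * PT + 4 * kG * Tt - 4 * kG * (T1 k + T1 l) - 2 * kI3 * Tt - 4 * kG * T0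
     + kE * (S1 k + S1 l) + 2 * kE * S0 + kI5 * St)\<bar> \<le> \<delta>" if "k \<in> A" "l \<in> A" "k \<noteq> l" for k l
  proof -
    have e: "\<beta>\<^sup>2 * response k l (pair_form T2 T1 T0 S1 S0)
        = \<beta>\<^sup>2 / 2 * (2 * response k l (pair_form T2 T1 T0 S1 S0))" by simp
    show ?thesis using err[OF that(1,2)] that(3)
      unfolding e response_off[OF that supp] P_def PT_def Tt_def St_def by (simp add: pair_form_def)
  qed
  have diag: "\<bar>S1 k + S0 - \<beta>\<^sup>2 / 2 * (2 * kE * P k + kI5 * PT + 2 * kE * Tt - 4 * kE * T1 k - 2 * kI5 * Tt - 2
      * kE * T0
     + kD * S1 k + kD * S0 + kK4 * St)\<bar> \<le> \<delta>" if "k \<in> A" for k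
  proof -
    have e: "\<beta>\<^sup>2 * response k k (pair_form T2 T1 T0 S1 S0)
        = \<beta>\<^sup>2 / 2 * (2 * response k k (pair_form T2 T1 T0 S1 S0))" by simp
    show ?thesis using err[OF that that]
      unfolding e response_diag[OF that supp] P_def PT_def Tt_def St_def by (simp add: pair_form_def)
  qed
  have T2b: "\<bar>T2 k l\<bar> \<le> 5 * \<delta>" for k l
  proof (cases "k \<in> {1..n} \<and> l \<in> {1..n} \<and> k \<noteq> l")
    case True
    then have m: "k \<in> A" "l \<in> A" "k \<noteq> l" "k \<noteq> n+1" "l \<noteq> n+2" "k \<noteq> n+2" "n+1 \<noteq> l" by (auto simp: A_def)
    have "\<bar>T2 k l - \<beta>\<^sup>2 * kA * T2 k l\<bar> \<le> 4 * \<delta>"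
    proof -
      define Xo where "Xo u = \<beta>\<^sup>2 / 2 * u" for u
      define g where "g k l = 2 * kA * (T2 k l + T1 k + T1 l + T0)
     + 2 * kG * (P k + P l) + kI3 * PT + 4 * kG * Tt - 4 * kG * (T1 k + T1 l) - 2 * kI3 * Tt - 4 * kG * T0
     + kE * (S1 k + S1 l) + 2 * kE * S0 + kI5 * St" for k l
      define f where "f k l = T2 k l + T1 k + T1 l + T0" for k l
      have o: "\<bar>f k l - Xo (g k l)\<bar> \<le> \<delta>" if "k \<in> A" "l \<in> A" "k \<noteq> l" for k l
        using off[OF that] by (simp only: f_def g_def Xo_def)
      \<comment> \<open>The mixed second difference, \<open>k\<close> against \<open>n + 1\<close>
        and \<open>l\<close> against \<open>n + 2\<close>, cancels all terms that depend on at most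
        one of the two indices.\<close>
      have 1: "f k l - f k (n+2) - f (n+1) l + f (n+1) (n+2) = T2 k l" by (simp add: f_def z)
      have gg: "g k l - g k (n+2) - g (n+1) l + g (n+1) (n+2) = 2 * kA * T2 k l"
        by (simp add: g_def z algebra_simps)
      have "Xo (g k l) - Xo (g k (n+2)) - Xo (g (n+1) l) + Xo (g (n+1) (n+2))
          = Xo (g k l - g k (n+2) - g (n+1) l + g (n+1) (n+2))"
        by (simp only: Xo_def right_diff_distrib distrib_left)
      then have 2: "Xo (g k l) - Xo (g k (n+2)) - Xo (g (n+1) l) + Xo (g (n+1) (n+2)) = \<beta>\<^sup>2 * kA * T2 k l"
        unfolding gg by (simp add: Xo_def)
      show ?thesis
        using o[OF m(1-3)] o[OF m(1) star(2) m(6)] o[OF star(1) m(2) m(7)] o[OF star] 1 2 by linarith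
    qed
    moreover have "\<bar>\<beta>\<^sup>2 * kA * T2 k l\<bar> \<le> 1/25 * \<bar>T2 k l\<bar>" by (rule small_mult[OF small_constants(1)])
    ultimately show ?thesis using d0 by linarith
  next
    case False
    then have "T2 k l = 0" using False supp_inD(2)[OF T, of k] supp_inD(3)[OF T, of k l] supp_inD(4)[OF T, of l
        k] by auto
    then show ?thesis using d0 by simp
  qed
  let ?c = "real n + 4"
  have cA: "real (card A) \<le> ?c" by (simp add: A_def)
  have Pb: "\<bar>P k\<bar> \<le> ?c * (5 * \<delta>)" for k
  proof -
    have "\<bar>P k\<bar> \<le> (\<Sum>b\<in>A. 5 * \<delta>)" unfolding P_def by (intro order_trans[OF sum_abs] sum_mono T2b)
    also have "\<dots> \<le> ?c * (5 * \<delta>)" using mult_right_mono[OF cA, of "5 * \<delta>"] d0 by simp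
    finally show ?thesis .
  qed
  have T1b: "\<bar>T1 k\<bar> \<le> 3 * ?c * \<delta>" "\<bar>S1 k\<bar> \<le> 3 * ?c * \<delta>" for k
  proof -
    have "\<bar>T1 k\<bar> \<le> 3 * ?c * \<delta> \<and> \<bar>S1 k\<bar> \<le> 3 * ?c * \<delta>"
    proof (cases "k \<in> {1..n}")
      case False
      then show ?thesis using supp_inD(5,6)[OF T False] d0 by simp
    next
      case True
      then have m: "k \<in> A" "k \<noteq> n+1" "k \<noteq> n+2" by (auto simp: A_def)
      \<comment> \<open>The first difference, \<open>(k, n + 1)\<close> against
        \<open>(n + 2, n + 1)\<close>, eliminates \<open>T0\<close>, \<open>S0\<close> and all sums
        over \<open>A\<close> that do not involve \<open>k\<close>.\<close>
      have e1: "\<bar>T1 k - ((\<beta>\<^sup>2 * kA - 2 * (\<beta>\<^sup>2 * kG)) * T1 k + (\<beta>\<^sup>2 * kE / 2) * S1 k + \<beta>\<^sup>2 * kG * P k)\<bar> \<le> 2 * \<delta>"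
      proof -
        have "T1 k - ((\<beta>\<^sup>2 * kA - 2 * (\<beta>\<^sup>2 * kG)) * T1 k + (\<beta>\<^sup>2 * kE / 2) * S1 k + \<beta>\<^sup>2 * kG * P k)
          = (T2 k (n+1) + T1 k + T1 (n+1) + T0 - \<beta>\<^sup>2 / 2 * (2 * kA * (T2 k (n+1) + T1 k + T1 (n+1) + T0)
     + 2 * kG * (P k + P (n+1)) + kI3 * PT + 4 * kG * Tt - 4 * kG * (T1 k + T1 (n+1)) - 2 * kI3 * Tt - 4 * kG * T0
     + kE * (S1 k + S1 (n+1)) + 2 * kE * S0 + kI5 * St))
          - (T2 (n+2) (n+1) + T1 (n+2) + T1 (n+1) + T0 - \<beta>\<^sup>2 / 2 * (2 * kA * (T2 (n+2) (n+1) + T1 (n+2)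
              + T1 (n+1) + T0)
     + 2 * kG * (P (n+2) + P (n+1)) + kI3 * PT + 4 * kG * Tt - 4 * kG * (T1 (n+2) + T1 (n+1)) - 2 * kI3 * Tt - 4
         * kG * T0
     + kE * (S1 (n+2) + S1 (n+1)) + 2 * kE * S0 + kI5 * St))"
          using supp_inD(6)[OF T, of "n+2"] by (simp add: z Po) (simp add: field_simps)?
        then show ?thesis using off[OF m(1) star(1) m(2)] off[OF star(2,1) star(3)[symmetric]] by linarith
      qed
      have e2: "\<bar>S1 k - ((\<beta>\<^sup>2 * kD / 2) * S1 k + (- 2 * (\<beta>\<^sup>2 * kE)) * T1 k + \<beta>\<^sup>2 * kE * P k)\<bar> \<le> 2 * \<delta>"
      proof -
        have "S1 k - ((\<beta>\<^sup>2 * kD / 2) * S1 k + (- 2 * (\<beta>\<^sup>2 * kE)) * T1 k + \<beta>\<^sup>2 * kE * P k)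
          = (S1 k + S0 - \<beta>\<^sup>2 / 2 * (2 * kE * P k + kI5 * PT + 2 * kE * Tt - 4 * kE * T1 k - 2 * kI5 * Tt - 2
              * kE * T0
     + kD * S1 k + kD * S0 + kK4 * St))
          - (S1 (n+1) + S0 - \<beta>\<^sup>2 / 2 * (2 * kE * P (n+1) + kI5 * PT + 2 * kE * Tt - 4 * kE * T1 (n+1) - 2 * kI5
              * Tt - 2 * kE * T0
     + kD * S1 (n+1) + kD * S0 + kK4 * St))"
          by (simp add: z Po field_simps)
        then show ?thesis using diag[OF m(1)] diag[OF star(1)] by linarith
      qed
      \<comment> \<open>The shape \<open>?c - 2\<close> leaves room for the error
        \<open>2 * \<delta>\<close> of the differences, so that the two add up to
        \<open>?c * \<delta>\<close>.\<close>
      have r: "\<bar>\<beta>\<^sup>2 * kG * P k\<bar> \<le> (?c - 2) * \<delta>" "\<bar>\<beta>\<^sup>2 * kE * P k\<bar> \<le> (?c - 2) * \<delta>"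
      proof -
        have c5: "1/50 * (?c * (5 * \<delta>)) \<le> (?c - 2) * \<delta>"
        proof -
          have c10: "1/10 * ?c \<le> ?c - 2" by simp
          have "1/50 * (?c * (5 * \<delta>)) = 1/10 * ?c * \<delta>" by simp
          also have "\<dots> \<le> (?c - 2) * \<delta>" by (rule mult_right_mono[OF c10 d0])
          finally show ?thesis .
        qed
        show "\<bar>\<beta>\<^sup>2 * kG * P k\<bar> \<le> (?c - 2) * \<delta>" "\<bar>\<beta>\<^sup>2 * kE * P k\<bar> \<le> (?c - 2) * \<delta>"
          using small_mult[OF small_constants(2), of "P k"] small_mult[OF small_constants(3), of "P k"] Pb[of k]
              c5 by linarith+
      qed
      have c: "\<bar>\<beta>\<^sup>2 * kA - 2 * (\<beta>\<^sup>2 * kG)\<bar> \<le> 1/8" "\<bar>\<beta>\<^sup>2 * kE / 2\<bar> \<le> 1/8" "\<bar>\<beta>\<^sup>2 * kD / 2\<bar> \<le> 1/8"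
        "\<bar>- 2 * (\<beta>\<^sup>2 * kE)\<bar> \<le> 1/8"
        using small_constants(1-4) by linarith+
      have "\<bar>T1 k\<bar> \<le> 3 * (2 * \<delta> + (?c - 2) * \<delta>)" "\<bar>S1 k\<bar> \<le> 3 * (2 * \<delta> + (?c - 2) * \<delta>)"
        by (rule two_by_two_stability[OF e1 e2 c r])+
      then show ?thesis by (simp add: algebra_simps)
    qed
    then show "\<bar>T1 k\<bar> \<le> 3 * ?c * \<delta>" "\<bar>S1 k\<bar> \<le> 3 * ?c * \<delta>" by auto
  qed
  let ?c2 = "?c * (?c * \<delta>)"
  have PTb: "\<bar>PT\<bar> \<le> 5 * ?c2"
  proof -
    have "\<bar>PT\<bar> \<le> (\<Sum>a\<in>A. ?c * (5 * \<delta>))"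
      unfolding PT_def P_def[symmetric] by (intro order_trans[OF sum_abs] sum_mono Pb)
    also have "\<dots> \<le> ?c * (?c * (5 * \<delta>))" using mult_right_mono[OF cA, of "?c * (5 * \<delta>)"] d0 by simp
    finally show ?thesis by simp
  qed
  have Ttb: "\<bar>Tt\<bar> \<le> 3 * ?c2" "\<bar>St\<bar> \<le> 3 * ?c2"
  proof -
    have "\<bar>Tt\<bar> \<le> (\<Sum>a\<in>A. 3 * ?c * \<delta>)" "\<bar>St\<bar> \<le> (\<Sum>a\<in>A. 3 * ?c * \<delta>)"
      unfolding Tt_def St_def by (intro order_trans[OF sum_abs] sum_mono T1b)+
    moreover have "(\<Sum>a\<in>A. 3 * ?c * \<delta>) \<le> ?c * (3 * ?c * \<delta>)" using mult_right_mono[OF cA, of "3 * ?c * \<delta>"] d0 by simp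
    moreover have "?c * (3 * ?c * \<delta>) = 3 * ?c2" by (simp only: mult_ac)
    ultimately show "\<bar>Tt\<bar> \<le> 3 * ?c2" "\<bar>St\<bar> \<le> 3 * ?c2" by linarith+
  qed
  have T0b: "\<bar>T0\<bar> \<le> 3 * (\<delta> + ?c2)" "\<bar>S0\<bar> \<le> 3 * (\<delta> + ?c2)"
  proof -
    \<comment> \<open>At fresh replicas only \<open>T0\<close>, \<open>S0\<close> and the total sums
      remain. The latter are already bounded and enter as an inhomogeneity, which accounts for the
      factor \<open>(real n + 4) ^ 2\<close>.\<close>
    let ?r = "\<beta>\<^sup>2 * kI3 * PT / 2 + 2 * (\<beta>\<^sup>2 * kG * Tt) - \<beta>\<^sup>2 * kI3 * Tt + \<beta>\<^sup>2 * kI5 * St / 2"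
    let ?r' = "\<beta>\<^sup>2 * kI5 * PT / 2 + \<beta>\<^sup>2 * kE * Tt - \<beta>\<^sup>2 * kI5 * Tt + \<beta>\<^sup>2 * kK4 * St / 2"
    have e1: "\<bar>T0 - ((\<beta>\<^sup>2 * kA - 2 * (\<beta>\<^sup>2 * kG)) * T0 + \<beta>\<^sup>2 * kE * S0 + ?r)\<bar> \<le> \<delta>"
    proof -
      have "T0 - ((\<beta>\<^sup>2 * kA - 2 * (\<beta>\<^sup>2 * kG)) * T0 + \<beta>\<^sup>2 * kE * S0 + ?r)
        = T2 (n+2) (n+1) + T1 (n+2) + T1 (n+1) + T0 - \<beta>\<^sup>2 / 2 * (2 * kA * (T2 (n+2) (n+1) + T1 (n+2) + T1 (n+1)
            + T0)
     + 2 * kG * (P (n+2) + P (n+1)) + kI3 * PT + 4 * kG * Tt - 4 * kG * (T1 (n+2) + T1 (n+1)) - 2 * kI3 * Tt - 4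
         * kG * T0
     + kE * (S1 (n+2) + S1 (n+1)) + 2 * kE * S0 + kI5 * St)"
        using supp_inD(6)[OF T, of "n+2"] by (simp add: z Po) (simp add: field_simps)?
      then show ?thesis using off[OF star(2,1) star(3)[symmetric]] by linarith
    qed
    have e2: "\<bar>S0 - (\<beta>\<^sup>2 * kD / 2 * S0 + (- (\<beta>\<^sup>2 * kE)) * T0 + ?r')\<bar> \<le> \<delta>"
    proof -
      have "S0 - (\<beta>\<^sup>2 * kD / 2 * S0 + (- (\<beta>\<^sup>2 * kE)) * T0 + ?r')
        = S1 (n+1) + S0 - \<beta>\<^sup>2 / 2 * (2 * kE * P (n+1) + kI5 * PT + 2 * kE * Tt - 4 * kE * T1 (n+1) - 2 * kI5
            * Tt - 2 * kE * T0
     + kD * S1 (n+1) + kD * S0 + kK4 * St)"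
        by (simp add: z Po field_simps)
      then show ?thesis using diag[OF star(1)] by linarith
    qed
    have c20: "0 \<le> ?c2" using d0 by simp
    have s: "\<bar>x * u\<bar> \<le> ?c2 / 10" if "\<bar>x\<bar> \<le> 1/50" "\<bar>u\<bar> \<le> 5 * ?c2" for x u
    proof -
      have "\<bar>x\<bar> * \<bar>u\<bar> \<le> 1/50 * (5 * ?c2)" using that by (intro mult_mono) auto
      also have "1/50 * (5 * ?c2) = ?c2 / 10" by simp
      finally show ?thesis unfolding abs_mult .
    qed
    have Tt5: "\<bar>Tt\<bar> \<le> 5 * ?c2" "\<bar>St\<bar> \<le> 5 * ?c2"
      using Ttb c20 by linarith+
    note sc = small_constants(2-7)
    have comb: "\<bar>x / 2 + 2 * y - z + w / 2\<bar> \<le> ?c2" "\<bar>x / 2 + y - z + w / 2\<bar> \<le> ?c2"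
      if "\<bar>x\<bar> \<le> ?c2 / 10" "\<bar>y\<bar> \<le> ?c2 / 10" "\<bar>z\<bar> \<le> ?c2 / 10" "\<bar>w\<bar> \<le> ?c2 / 10" for x y z w
      using that by linarith+
    have r: "\<bar>?r\<bar> \<le> ?c2" "\<bar>?r'\<bar> \<le> ?c2"
      by (intro comb s sc PTb Tt5)+
    have c: "\<bar>\<beta>\<^sup>2 * kA - 2 * (\<beta>\<^sup>2 * kG)\<bar> \<le> 1/8" "\<bar>\<beta>\<^sup>2 * kE\<bar> \<le> 1/8" "\<bar>\<beta>\<^sup>2 * kD / 2\<bar> \<le> 1/8"
        "\<bar>- (\<beta>\<^sup>2 * kE)\<bar> \<le> 1/8"
      using small_constants(1-4) by linarith+
    show "\<bar>T0\<bar> \<le> 3 * (\<delta> + ?c2)" "\<bar>S0\<bar> \<le> 3 * (\<delta> + ?c2)"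
      by (rule two_by_two_stability[OF e1 e2 c r])+
  qed
  have c1: "\<delta> \<le> ?c2" "?c * \<delta> \<le> ?c2"
  proof -
    have "1 * \<delta> \<le> ?c * \<delta>" using d0 by (intro mult_right_mono) auto
    moreover have "1 * (?c * \<delta>) \<le> ?c * (?c * \<delta>)" using d0 by (intro mult_right_mono) auto
    ultimately show "\<delta> \<le> ?c2" "?c * \<delta> \<le> ?c2" by linarith+
  qed
  have "\<bar>pair_form T2 T1 T0 S1 S0 k l\<bar> \<le> \<bar>T2 k l\<bar> + \<bar>T1 k\<bar> + \<bar>T1 l\<bar> + \<bar>T0\<bar> + \<bar>S1 k\<bar> + \<bar>S0\<bar>"
    unfolding pair_form_def by (cases "k = l") auto
  also have "\<dots> \<le> 50 * ?c2"
  proof -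
    have gen: "x + y + z + u + v + w \<le> 50 * e2"
      if "x \<le> 5 * \<delta>" "y \<le> 3 * e1" "z \<le> 3 * e1" "v \<le> 3 * e1" "u \<le> 3 * (\<delta> + e2)" "w \<le> 3 * (\<delta> + e2)"
        "\<delta> \<le> e2" "e1 \<le> e2" for x y z u v w e1 e2 :: real
      using that d0 by argo
    show ?thesis
      by (rule gen[OF T2b T1b(1)[unfolded mult.assoc] T1b(1)[unfolded mult.assoc] T1b(2)[unfolded mult.assoc]
          T0b c1])
  qed
  also have "50 * ?c2 = 50 * ?c ^ 2 * \<delta>" by (simp only: power2_eq_square mult_ac)
  finally show ?thesis .
qed

end

section \<open>Comparison of the overlap correlations with the claimed covariances\<close>

lemma pair_form_sum: "(\<Sum>x\<in>I. c x * pair_form (T2 x) (T1 x) (T0 x) (S1 x) (S0 x) a b)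
   = pair_form (\<lambda>a b. \<Sum>x\<in>I. c x * T2 x a b) (\<lambda>a. \<Sum>x\<in>I. c x * T1 x a) (\<Sum>x\<in>I. c x * T0 x)
      (\<lambda>a. \<Sum>x\<in>I. c x * S1 x a) (\<Sum>x\<in>I. c x * S0 x) a b"
  unfolding pair_form_def by (simp add: sum.distrib distrib_left)

lemma pair_form_diff: "pair_form T2 T1 T0 S1 S0 a b - c * pair_form T2' T1' T0' S1' S0' a b
   = pair_form (\<lambda>a b. T2 a b - c * T2' a b) (\<lambda>a. T1 a - c * T1' a) (T0 - c * T0') (\<lambda>a. S1 a - c * S1' a) (S0 - c
       * S0') a b"
  by (simp add: pair_form_def algebra_simps)

lemma supp_in_sum: "(\<And>x. x \<in> I \<Longrightarrow> supp_in B (T2 x) (T1 x) (S1 x)) \<Longrightarrow>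
   supp_in B (\<lambda>a b. \<Sum>x\<in>I. c x * T2 x a b) (\<lambda>a. \<Sum>x\<in>I. c x * T1 x a) (\<lambda>a. \<Sum>x\<in>I. c x * S1 x a)"
  unfolding supp_in_def by (auto intro!: sum.cong sum.neutral)

lemma supp_in_diff: "supp_in B T2 T1 S1 \<Longrightarrow> supp_in B T2' T1' S1' \<Longrightarrow>
   supp_in B (\<lambda>a b. T2 a b - c * T2' a b) (\<lambda>a. T1 a - c * T1' a) (\<lambda>a. S1 a - c * S1' a)"
  unfolding supp_in_def by auto

context GS_form
begin

text \<open>For a fixed pair \<open>x\<close> the covariances with all other pairs are a pair form.
  \<open>C2\<close>, \<open>C1\<close>, \<open>C0\<close>, \<open>D1\<close>, \<open>D0\<close> are
  its parameters, built like \<open>t2\<close>, \<open>t1\<close>, \<open>t0\<close>,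
  \<open>u1\<close>, \<open>u0\<close>.\<close>

definition C2 :: "nat \<Rightarrow> nat \<times> nat \<Rightarrow> nat \<Rightarrow> nat \<Rightarrow> real" where
  "C2 N x a b = (if fst x \<noteq> snd x \<and> (a = fst x \<and> b = snd x \<or> a = snd x \<and> b
      = fst x) then A2sq S \<beta> h D p q N else 0)"
definition C1 :: "nat \<Rightarrow> nat \<times> nat \<Rightarrow> nat \<Rightarrow> real" where
  "C1 N x a = (if fst x \<noteq> snd x then (if a = fst x \<or> a = snd x then A1sq S \<beta> h D p q N else 0)
     else (if a = fst x then C1sq S \<beta> h D p q N else 0))"
definition C0 :: "nat \<Rightarrow> nat \<times> nat \<Rightarrow> real" where
  "C0 N x = (if fst x \<noteq> snd x then A0sq S \<beta> h D p q N else C0sq S \<beta> h D p q N)"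
definition D1 :: "nat \<Rightarrow> nat \<times> nat \<Rightarrow> nat \<Rightarrow> real" where
  "D1 N x a = (if fst x \<noteq> snd x then (if a = fst x \<or> a = snd x then C1sq S \<beta> h D p q N else 0)
     else (if a = fst x then B1sq S \<beta> h D p q N else 0))"
definition D0 :: "nat \<Rightarrow> nat \<times> nat \<Rightarrow> real" where
  "D0 N x = (if fst x \<noteq> snd x then C0sq S \<beta> h D p q N else B0sq S \<beta> h D p q N)"

definition Cov :: "nat \<Rightarrow> nat \<times> nat \<Rightarrow> nat \<Rightarrow> nat \<Rightarrow> real" where
  "Cov N x = pair_form (C2 N x) (C1 N x) (C0 N x) (D1 N x) (D0 N x)"

lemma supp_Cov: "x \<in> pairs n \<Longrightarrow> supp_in {1..n} (C2 N x) (C1 N x) (D1 N x)"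
  using pairs_mem(1,2)[of x] unfolding supp_in_def C2_def C1_def D1_def by auto

lemma eta_cov_eq: "eta_cov S \<beta> h D p q N x z = Cov N z (fst x) (snd x)"
proof -
  obtain a b c d where x: "x = (a,b)" "z = (c,d)" by (cases x, cases z)
  have card: "card ({a,b} \<inter> {c,d}) = (if a = c \<or> a = d then 1 else 0) + (if b = c \<or> b
      = d then 1 else 0)" if "a \<noteq> b"
    using that by (auto simp: Int_insert_left)
  have card1: "card ({a,b} \<inter> {c,d}) = (if a = c \<or> a = d then 1 else 0)" if "a = b"
    using that by (auto simp: Int_insert_left)
  have card2: "card ({a,b} \<inter> {c,d}) = (if c = a \<or> c = b then 1 else 0)" if "c = d"
    using that by (auto simp: Int_insert_right)
  consider "a \<noteq> b" "c \<noteq> d" | "a = b" "c = d" | "a \<noteq> b" "c = d" | "a = b" "c \<noteq> d" by blast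
  then show ?thesis
  proof cases
    case 1
    then show ?thesis unfolding x eta_cov_def Let_def case_prod_conv card[OF 1(1)]
      by (auto simp: Cov_def pair_form_def C2_def C1_def C0_def doubleton_eq_iff)
  next
    case 2
    then show ?thesis unfolding x eta_cov_def Let_def case_prod_conv card1[OF 2(1)]
      by (auto simp: Cov_def pair_form_def D1_def D0_def)
  next
    case 3
    then show ?thesis unfolding x eta_cov_def Let_def case_prod_conv card2[OF 3(2)]
      by (auto simp: Cov_def pair_form_def C2_def C1_def C0_def)
  next
    case 4
    then show ?thesis unfolding x eta_cov_def Let_def case_prod_conv card1[OF 4(1)]
      by (auto simp: Cov_def pair_form_def D1_def D0_def)
  qed
qed

text \<open>Apart from unfolding, the point is that \<open>cM\<close> and \<open>cM3\<close> do not
  vanish: \<open>cM1\<close> and \<open>cM2\<close> are at least one half and the remaining term of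
  \<open>cM\<close> is nonnegative.\<close>

lemma covariance_system:
  assumes N: "N > 0"
  shows "covariance_system (\<beta>\<^sup>2) kA kG kE kD kI3 kI5 kK4 (1 / real N) ((1 / real N) / ((cM S \<beta> h D p q)\<^sup>2
      * cM3 S \<beta> h D p q))
    (cM1 S \<beta> h D p q) (cM2 S \<beta> h D p q) (cM3 S \<beta> h D p q) (cM S \<beta> h D p q)
    (A2sq S \<beta> h D p q N) (A1sq S \<beta> h D p q N) (B1sq S \<beta> h D p q N) (C1sq S \<beta> h D p q N)
    (A0sq S \<beta> h D p q N) (B0sq S \<beta> h D p q N) (C0sq S \<beta> h D p q N)"
proof -
  have M3: "cM3 S \<beta> h D p q = 1 - \<beta>\<^sup>2 * kA" by (simp add: cM3_def constants_eq(5))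
  have M1: "cM1 S \<beta> h D p q = 1 - \<beta>\<^sup>2 * (kA - 2 * kG)" by (simp add: cM1_def constants_eq(5))
  have b4: "\<beta> ^ 4 = (\<beta>\<^sup>2)\<^sup>2" by simp
  have M3nz: "cM3 S \<beta> h D p q \<noteq> 0" unfolding M3 using small_constants(1) by auto
  have "1/2 \<le> cM1 S \<beta> h D p q" unfolding M1 using small_constants(1,2) by (simp add: right_diff_distrib)
  moreover have "1/2 \<le> cM2 S \<beta> h D p q" unfolding cM2_def using small_constants(4) by simp
  ultimately have "0 < cM1 S \<beta> h D p q * cM2 S \<beta> h D p q" by (intro mult_pos_pos) linarith+
  moreover have "0 \<le> \<beta> ^ 4 * kE\<^sup>2" unfolding b4 by simp
  ultimately have Mnz: "cM S \<beta> h D p q \<noteq> 0" unfolding cM_def by linarith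
  show ?thesis
  proof
    show "A2sq S \<beta> h D p q N = kA * (1 / real N) / cM3 S \<beta> h D p q" by (simp add: A2sq_def M3)
    show "cM S \<beta> h D p q = cM1 S \<beta> h D p q * cM2 S \<beta> h D p q + (\<beta>\<^sup>2)\<^sup>2 * kE\<^sup>2" unfolding cM_def b4 ..
  qed (use M1 M3 M3nz Mnz in \<open>simp_all add: cM2_def A1sq_def B1sq_def C1sq_def A0sq_def B0sq_def C0sq_def\<close>)
qed

lemma sum_ind2:
  assumes "c \<in> A" "d \<in> A" "c \<noteq> d"
  shows "(\<Sum>a\<in>A. if a = c \<or> a = d then y else 0) = 2 * (y :: real)"
proof -
  have "(\<Sum>a\<in>A. if a = c \<or> a = d then y else 0) = (\<Sum>a\<in>A. (if a = c then y else 0) + (if a = d then y else 0))"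
    using assms(3) by (intro sum.cong) auto
  then show ?thesis using assms by (simp add: sum.distrib)
qed

text \<open>The exact counterpart of \<open>cavity_equation\<close> for the claimed covariances.
  Each of the two pairs is diagonal or not, which gives four cases, one for each
  \<open>solves\<close> lemma.\<close>

lemma Cov_solves:
  assumes N: "N > 0" and k: "k \<in> A" "l \<in> A" and x: "x \<in> pairs n"
  shows "Cov N x k l = \<beta>\<^sup>2 * response k l (Cov N x) + corr k l (fst x) (snd x) / real N"
proof -
  interpret cs: covariance_system "\<beta>\<^sup>2" kA kG kE kD kI3 kI5 kK4 "1 / real N" "(1 / real N) / ((cM S \<beta> h D p q)\<^sup>2
      * cM3 S \<beta> h D p q)"
    "cM1 S \<beta> h D p q" "cM2 S \<beta> h D p q" "cM3 S \<beta> h D p q" "cM S \<beta> h D p q"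
    "A2sq S \<beta> h D p q N" "A1sq S \<beta> h D p q N" "B1sq S \<beta> h D p q N" "C1sq S \<beta> h D p q N"
    "A0sq S \<beta> h D p q N" "B0sq S \<beta> h D p q N" "C0sq S \<beta> h D p q N"
    by (rule covariance_system[OF N])
  obtain c d where cd: "x = (c,d)" by (cases x)
  have cdA: "c \<in> A" "d \<in> A" using pairs_mem[OF x] cd by auto
  have supp: "supp_in A (C2 N x) (C1 N x) (D1 N x)" using supp_Cov[OF x, of N] by (auto simp: supp_in_def A_def)
  define ik where "ik k = (if k = c \<or> k = d then 1 else 0 :: real)" for k
  define ikl where "ikl = (if k = c \<and> l = d \<or> k = d \<and> l = c then 1 else 0 :: real)"
  have half: "\<beta>\<^sup>2 * L = \<beta>\<^sup>2 / 2 * (2 * L)" for L by simp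
  show ?thesis
  proof (cases "c = d")
    case False
    let ?a2 = "A2sq S \<beta> h D p q N" and ?a1 = "A1sq S \<beta> h D p q N" and ?a0 = "A0sq S \<beta> h D p q N"
      and ?c1 = "C1sq S \<beta> h D p q N" and ?c0 = "C0sq S \<beta> h D p q N"
    have C2r: "(\<Sum>b\<in>A. C2 N x k b) = ?a2 * ik k" for k
    proof -
      have "(\<Sum>b\<in>A. C2 N x k b) = (\<Sum>b\<in>A. (if b = d then (if k = c then ?a2 else 0) else 0) + (if b = c then (if k
          = d then ?a2 else 0) else 0))"
        using False by (intro sum.cong) (auto simp: C2_def cd)
      then show ?thesis using cdA False by (simp add: sum.distrib ik_def)
    qed
    have C2s: "(\<Sum>a\<in>A. \<Sum>b\<in>A. C2 N x a b) = 2 * ?a2"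
    proof -
      have "(\<Sum>a\<in>A. \<Sum>b\<in>A. C2 N x a b) = (\<Sum>a\<in>A. if a = c \<or> a = d then ?a2 else 0)"
        unfolding C2r by (intro sum.cong) (auto simp: ik_def)
      then show ?thesis using sum_ind2[OF cdA False] by simp
    qed
    have C1s: "(\<Sum>a\<in>A. C1 N x a) = 2 * ?a1" "(\<Sum>a\<in>A. D1 N x a) = 2 * ?c1"
      using False sum_ind2[OF cdA False] by (simp_all add: C1_def D1_def cd)
    have C1k: "C1 N x k = ?a1 * ik k" "D1 N x k = ?c1 * ik k" for k
      using False by (simp_all add: C1_def D1_def cd ik_def)
    have C0x: "C0 N x = ?a0" "D0 N x = ?c0" using False by (simp_all add: C0_def D0_def cd)
    show ?thesis
    proof (cases "k = l")
      case True
      have crr: "corr k k c d / real N = (kE * ik k + kI5) * (1 / real N)"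
        using False by (auto simp: corr_eq pair_form_def t2_def t1_def t0_def ik_def)
      have cov: "Cov N x k k = ?c1 * ik k + ?c0" by (simp add: Cov_def pair_form_def C1k C0x)
      have lam: "2 * response k k (Cov N x) = 2 * kE * (?a2 * ik k) + kI5 * (2 * ?a2) + 2 * kE * (2 * ?a1) - 4
          * kE * (?a1 * ik k)
          - 2 * kI5 * (2 * ?a1) - 2 * kE * ?a0 + kD * (?c1 * ik k) + kD * ?c0 + kK4 * (2 * ?c1)"
        using response_diag[OF k(1) supp, of "C0 N x" "D0 N x", folded Cov_def] unfolding C2s C1s
            unfolding C2r C1k[of k] C0x .
      show ?thesis
        unfolding True[symmetric] half[of "response k k (Cov N x)"] lam cov unfolding cd fst_conv snd_conv crr
        by (rule cs.solves_diag_off)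
    next
      case kl: False
      have crr: "corr k l c d / real N = (kA * ikl + kG * (ik k + ik l) + kI3) * (1 / real N)"
        using False kl by (auto simp: corr_eq pair_form_def t2_def t1_def t0_def ik_def ikl_def)
      have C2k: "C2 N x k l = ?a2 * ikl" using False by (simp add: C2_def cd ikl_def)
      have cov: "Cov N x k l = ?a2 * ikl + ?a1 * (ik k + ik l) + ?a0"
        using kl by (simp add: Cov_def pair_form_def C1k C0x C2k distrib_left)
      have lam: "2 * response k l (Cov N x) = 2 * kA * (?a2 * ikl + ?a1 * (ik k + ik l) + ?a0) + 2 * kG * (?a2
          * (ik k + ik l))
          + kI3 * (2 * ?a2) + 4 * kG * (2 * ?a1) - 4 * kG * (?a1 * (ik k + ik l)) - 2 * kI3 * (2 * ?a1) - 4 * kG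
              * ?a0
          + kE * (?c1 * (ik k + ik l)) + 2 * kE * ?c0 + kI5 * (2 * ?c1)"
        using response_off[OF k kl supp, of "C0 N x" "D0 N x", folded Cov_def] unfolding C2s C1s
            unfolding C2r C1k[of k] C1k[of l] C0x C2k
        by argo
      show ?thesis
        unfolding half[of "response k l (Cov N x)"] lam cov unfolding cd fst_conv snd_conv crr
        by (rule cs.solves_off_off)
    qed
  next
    case True
    let ?b1 = "B1sq S \<beta> h D p q N" and ?b0 = "B0sq S \<beta> h D p q N"
      and ?c1 = "C1sq S \<beta> h D p q N" and ?c0 = "C0sq S \<beta> h D p q N"
    have C2z: "C2 N x a b = 0" for a b using True by (simp add: C2_def cd)
    have C1s: "(\<Sum>a\<in>A. C1 N x a) = ?c1" "(\<Sum>a\<in>A. D1 N x a) = ?b1"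
      using True cdA by (simp_all add: C1_def D1_def cd)
    have C1k: "C1 N x k = ?c1 * ik k" "D1 N x k = ?b1 * ik k" for k
      using True by (simp_all add: C1_def D1_def cd ik_def)
    have C0x: "C0 N x = ?c0" "D0 N x = ?b0" using True by (simp_all add: C0_def D0_def cd)
    show ?thesis
    proof (cases "k = l")
      case kl: True
      have crr: "corr k k c d / real N = (kD * ik k + kK4) * (1 / real N)"
        using True by (auto simp: corr_eq pair_form_def u1_def u0_def ik_def)
      have cov: "Cov N x k k = ?b1 * ik k + ?b0" by (simp add: Cov_def pair_form_def C1k C0x)
      have lam: "2 * response k k (Cov N x) = 2 * kE * ?c1 - 4 * kE * (?c1 * ik k) - 2 * kI5 * ?c1 - 2 * kE * ?c0
          + kD * (?b1 * ik k) + kD * ?b0 + kK4 * ?b1"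
        using response_diag[OF k(1) supp, of "C0 N x" "D0 N x", folded Cov_def] unfolding C1s
            unfolding C1k[of k] C0x C2z by simp
      show ?thesis
        unfolding kl[symmetric] half[of "response k k (Cov N x)"] lam cov unfolding cd fst_conv snd_conv crr
        by (rule cs.solves_diag_diag)
    next
      case kl: False
      have crr: "corr k l c d / real N = (kE * (ik k + ik l) + kI5) * (1 / real N)"
        using True kl by (auto simp: corr_eq pair_form_def u1_def u0_def ik_def)
      have cov: "Cov N x k l = ?c1 * (ik k + ik l) + ?c0"
        using kl by (simp add: Cov_def pair_form_def C1k C0x C2z distrib_left)
      have lam: "2 * response k l (Cov N x) = 2 * kA * (?c1 * (ik k + ik l) + ?c0) + 4 * kG * ?c1 - 4 * kG
          * (?c1 * (ik k + ik l))
          - 2 * kI3 * ?c1 - 4 * kG * ?c0 + kE * (?b1 * (ik k + ik l)) + 2 * kE * ?b0 + kI5 * ?b1"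
        using response_off[OF k kl supp, of "C0 N x" "D0 N x", folded Cov_def] unfolding C1s
            unfolding C1k[of k] C1k[of l] C0x C2z sum.neutral_const
        by argo
      show ?thesis
        unfolding half[of "response k l (Cov N x)"] lam cov unfolding cd fst_conv snd_conv crr
        by (rule cs.solves_off_diag)
    qed
  qed
qed

lemma depends_on_lin_form_power: "depends_on {1..n} (\<lambda>\<sigma>. lin_form N \<sigma> ^ r)"
  by (rule depends_on_power[OF depends_on_lin_form'])

lemma fresh_sub: "{1..n} \<subseteq> R" by (auto simp: R_def)

lemma W_sym: "W a b N r = W b a N r"
  by (simp add: W_def ov_def overlap_def Qpq_def mult.commute)

text \<open>The linear form only involves \<open>{1..n}\<close>, so a fresh replica in the other
  factor may be renamed. With the next two lemmas this makes \<open>W\<close> a pair form.\<close>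

lemma W_relabel1:
  assumes "a \<in> {1..n}" "b \<in> R - {1..n}" "b' \<in> R - {1..n}"
  shows "W a b N r = W a b' N r"
proof -
  define g where "g y y' = (1 / real N) * (\<Sum>i<N. of_int (y i) * of_int (y' i)) - q" for y y' :: "nat \<Rightarrow> int"
  have "ov N a c \<sigma> = g (\<sigma> a) (\<sigma> c)" if "c \<in> R - {1..n}" for c \<sigma>
    using that assms(1) by (auto simp: g_def ov_def overlap_def Qpq_def)
  then show ?thesis
    unfolding W_def nuN_def using assms
    by (simp add: ravg_relabel1[OF finite_R fresh_sub depends_on_lin_form_power sum_GS_weight assms(1-3), where
        h=g])
qed

lemma W_relabel2:
  assumes "b \<in> R - {1..n}" "c \<in> R - {1..n}" "b \<noteq> c" "b' \<in> R - {1..n}" "c' \<in> R - {1..n}" "b' \<noteq> c'"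
  shows "W b c N r = W b' c' N r"
proof -
  define g where "g y y' = (1 / real N) * (\<Sum>i<N. of_int (y i) * of_int (y' i)) - q" for y y' :: "nat \<Rightarrow> int"
  have "ov N b c \<sigma> = g (\<sigma> b) (\<sigma> c)" if "b \<noteq> c" for b c \<sigma>
    using that by (auto simp: g_def ov_def overlap_def Qpq_def)
  then show ?thesis
    unfolding W_def nuN_def using assms
    by (simp add: ravg_relabel2[OF finite_R fresh_sub depends_on_lin_form_power sum_GS_weight assms, where h=g])
qed

lemma W_relabel_diag:
  assumes "b \<in> R - {1..n}" "b' \<in> R - {1..n}"
  shows "W b b N r = W b' b' N r"
proof -
  define g where "g y = (1 / real N) * (\<Sum>i<N. of_int (y i) * of_int (y i)) - p" for y :: "nat \<Rightarrow> int"
  have "ov N b b \<sigma> = g (\<sigma> b)" for b \<sigma>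
    by (auto simp: g_def ov_def overlap_def Qpq_def)
  then show ?thesis
    unfolding W_def nuN_def using assms
    by (simp add: ravg_relabel_diag[OF finite_R fresh_sub depends_on_lin_form_power sum_GS_weight assms, where
        h=g])
qed

text \<open>Inclusion-exclusion with \<open>n + 1\<close> and \<open>n + 2\<close> as reference
  replicas: \<open>W2\<close>, \<open>W1\<close> and \<open>Wd\<close> are the components that turn
  \<open>W\<close> into a pair form.\<close>

definition W2 :: "nat \<Rightarrow> nat \<Rightarrow> nat \<Rightarrow> nat \<Rightarrow> real" where
  "W2 N r a b = (if a \<in> {1..n} \<and> b \<in> {1..n} \<and> a \<noteq> b
     then W a b N r - W a (n+1) N r - W b (n+1) N r + W (n+1) (n+2) N r else 0)"
definition W1 :: "nat \<Rightarrow> nat \<Rightarrow> nat \<Rightarrow> real" where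
  "W1 N r a = (if a \<in> {1..n} then W a (n+1) N r - W (n+1) (n+2) N r else 0)"
definition Wd :: "nat \<Rightarrow> nat \<Rightarrow> nat \<Rightarrow> real" where
  "Wd N r a = (if a \<in> {1..n} then W a a N r - W (n+1) (n+1) N r else 0)"

lemma supp_W: "supp_in {1..n} (W2 N r) (W1 N r) (Wd N r)"
  unfolding supp_in_def W2_def W1_def Wd_def by (auto simp: W_sym)

lemma W_pair_form:
  assumes "a \<in> R" "b \<in> R"
  shows "W a b N r = pair_form (W2 N r) (W1 N r) (W (n+1) (n+2) N r) (Wd N r) (W (n+1) (n+1) N r) a b"
proof -
  have f: "n+1 \<in> R - {1..n}" "n+2 \<in> R - {1..n}" "n+1 \<noteq> n+2" by (auto simp: R_def)
  consider "a = b" "a \<in> {1..n}" | "a = b" "a \<notin> {1..n}" | "a \<noteq> b" "a \<in> {1..n}" "b \<in> {1..n}"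
    | "a \<noteq> b" "a \<in> {1..n}" "b \<notin> {1..n}" | "a \<noteq> b" "a \<notin> {1..n}" "b \<in> {1..n}" | "a \<noteq> b" "a \<notin> {1..n}" "b \<notin> {1..n}"
        by blast
  then show ?thesis
  proof cases
    case 1 then show ?thesis by (simp add: pair_form_def Wd_def)
  next
    case 2 then show ?thesis using W_relabel_diag[of a "n+1"] assms f by (auto simp: pair_form_def Wd_def)
  next
    case 3 then show ?thesis by (simp add: pair_form_def W2_def W1_def)
  next
    case 4
    then have "W a b N r = W a (n+1) N r" using assms f by (intro W_relabel1) auto
    then show ?thesis using 4 by (auto simp: pair_form_def W2_def W1_def)
  next
    case 5
    then have "W b a N r = W b (n+1) N r" using assms f by (intro W_relabel1) auto
    then show ?thesis using 5 by (auto simp: pair_form_def W2_def W1_def W_sym[of a b])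
  next
    case 6
    then have "W a b N r = W (n+1) (n+2) N r" using assms f by (intro W_relabel2) auto
    then show ?thesis using 6 by (auto simp: pair_form_def W2_def W1_def)
  qed
qed

text \<open>The covariance of the Gaussian variable at \<open>(a,b)\<close> with the Gaussian linear
  form with coefficients \<open>\<gamma>\<close>.\<close>

definition Wcov :: "nat \<Rightarrow> nat \<Rightarrow> nat \<Rightarrow> real" where
  "Wcov N a b = (\<Sum>x\<in>pairs n. \<gamma> x * Cov N x a b)"

lemma response_cong: "(\<And>a b. a \<in> R \<Longrightarrow> b \<in> R \<Longrightarrow> w a b = w' a b) \<Longrightarrow> response k l w = response k l w'"
  unfolding response_def by (intro sum.cong refl) simp

lemma response_diff: "response k l (\<lambda>a b. w a b - c * w' a b) = response k l w - c * response k l w'"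
proof -
  have "response k l (\<lambda>a b. w a b - c * w' a b)
     = (\<Sum>a\<in>R. \<Sum>b\<in>R. fresh_coeff a b * (corr k l a b * w a b) - c * (fresh_coeff a b * (corr k l a b * w' a b)))"
    unfolding response_def by (intro sum.cong refl) (simp add: algebra_simps)
  then show ?thesis by (simp add: sum_subtractf sum_distrib_left response_def)
qed

lemma response_sum: "response k l (\<lambda>a b. \<Sum>x\<in>I. c x * w x a b) = (\<Sum>x\<in>I. c x * response k l (w x))"
proof -
  have "response k l (\<lambda>a b. \<Sum>x\<in>I. c x * w x a b)
      = (\<Sum>a\<in>R. \<Sum>b\<in>R. \<Sum>x\<in>I. c x * (fresh_coeff a b * (corr k l a b * w x a b)))"
    unfolding response_def by (intro sum.cong refl) (simp only: sum_distrib_left mult.left_commute[of _ "c _"])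
  also have "\<dots> = (\<Sum>a\<in>R. \<Sum>x\<in>I. \<Sum>b\<in>R. c x * (fresh_coeff a b * (corr k l a b * w x a b)))"
    by (intro sum.cong refl sum.swap)
  also have "\<dots> = (\<Sum>x\<in>I. \<Sum>a\<in>R. \<Sum>b\<in>R. c x * (fresh_coeff a b * (corr k l a b * w x a b)))"
    by (rule sum.swap)
  finally show ?thesis by (simp add: response_def sum_distrib_left)
qed

text \<open>The correlations and the predicted values solve the system with the same right-hand
  side, one up to an error and the other exactly. Their difference is a pair form solving the
  homogeneous system up to this error, and \<open>stability\<close> bounds it.\<close>

theorem linear_response:
  "\<exists>C. \<forall>N>0. \<forall>k\<in>A. \<forall>l\<in>A. \<bar>W k l N r - real r * V N (r - 1) * Wcov N k l\<bar> \<le> C * (1 / sqrt (real N)) ^ (r+2)"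
proof -
  let ?res = "\<lambda>N k l. W k l N r - (\<Sum>a\<in>R. \<Sum>b\<in>R. fresh_coeff a b * \<beta>\<^sup>2 * corr k l a b * W a b N r)
     - real r / real N * ((\<Sum>x\<in>pairs n. \<gamma> x * corr k l (fst x) (snd x)) * V N (r - 1))"
  have "\<forall>x\<in>A\<times>A. \<exists>C. \<forall>N>0. \<bar>?res N (fst x) (snd x)\<bar> \<le> C * (1 / sqrt (real N)) ^ (r+2)"
    proof
    fix x assume "x \<in> A \<times> A"
    then show "\<exists>C. \<forall>N>0. \<bar>?res N (fst x) (snd x)\<bar> \<le> C * (1 / sqrt (real N)) ^ (r+2)"
      by (intro cavity_equation) auto
  qed
  from bchoice[OF this] obtain C where
    C: "\<forall>x\<in>A\<times>A. \<forall>N>0. \<bar>?res N (fst x) (snd x)\<bar> \<le> C x * (1 / sqrt (real N)) ^ (r+2)" by blast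
  \<comment> \<open>One constant for all pairs of \<open>A\<close>, since \<open>stability\<close>
    asks for a uniform error.\<close>
  define K where "K = (\<Sum>x\<in>A\<times>A. \<bar>C x\<bar>)"
  have K: "\<bar>?res N k l\<bar> \<le> K * (1 / sqrt (real N)) ^ (r+2)" if "N > 0" "k \<in> A" "l \<in> A" for N k l
  proof -
    have "\<bar>C (k,l)\<bar> \<le> K" unfolding K_def using that by (intro member_le_sum) auto
    then have "C (k,l) \<le> K" by linarith
    then have "C (k,l) * (1 / sqrt (real N)) ^ (r+2) \<le> K * (1 / sqrt (real N)) ^ (r+2)"
        by (rule mult_right_mono) simp
    moreover have "\<bar>?res N (fst (k,l)) (snd (k,l))\<bar> \<le> C (k,l) * (1 / sqrt (real N)) ^ (r+2)"
      using C that by blast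
    ultimately show ?thesis unfolding fst_conv snd_conv by linarith
  qed
  have "\<bar>W k l N r - real r * V N (r - 1) * Wcov N k l\<bar> \<le> 50 * (real n + 4) ^ 2 * K * (1 / sqrt (real N)) ^ (r+2)"
    if N: "N > 0" and kl: "k \<in> A" "l \<in> A" for N k l
  proof -
    define v where "v = real r * V N (r - 1)"
    define T2 where "T2 a b = W2 N r a b - v * (\<Sum>x\<in>pairs n. \<gamma> x * C2 N x a b)" for a b
    define T1 where "T1 a = W1 N r a - v * (\<Sum>x\<in>pairs n. \<gamma> x * C1 N x a)" for a
    define T0 where "T0 = W (n+1) (n+2) N r - v * (\<Sum>x\<in>pairs n. \<gamma> x * C0 N x)"
    define S1 where "S1 a = Wd N r a - v * (\<Sum>x\<in>pairs n. \<gamma> x * D1 N x a)" for a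
    define S0 where "S0 = W (n+1) (n+1) N r - v * (\<Sum>x\<in>pairs n. \<gamma> x * D0 N x)"
    have e: "W a b N r - v * Wcov N a b = pair_form T2 T1 T0 S1 S0 a b" if "a \<in> R" "b \<in> R" for a b
      unfolding W_pair_form[OF that] Wcov_def Cov_def pair_form_sum pair_form_diff T2_def[abs_def]
          T1_def[abs_def] T0_def S1_def[abs_def] S0_def ..
    have supp: "supp_in {1..n} T2 T1 S1"
      unfolding T2_def[abs_def] T1_def[abs_def] S1_def[abs_def] by (intro supp_in_diff supp_W supp_in_sum supp_Cov)
    have "\<bar>pair_form T2 T1 T0 S1 S0 k l\<bar> \<le> 50 * (real n + 4) ^ 2 * (K * (1 / sqrt (real N)) ^ (r+2))"
    proof (rule stability[OF supp _ kl])
      fix k l assume kl: "k \<in> A" "l \<in> A"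
      then have klR: "k \<in> R" "l \<in> R" using A_sub_R by auto
      have "response k l (pair_form T2 T1 T0 S1 S0) = response k l (\<lambda>a b. W a b N r - v * Wcov N a b)"
        by (rule response_cong) (simp add: e)
      also have "\<dots> = response k l (\<lambda>a b. W a b N r) - v * (\<Sum>x\<in>pairs n. \<gamma> x * response k l (Cov N x))"
        unfolding response_diff Wcov_def response_sum ..
      finally have L: "\<beta>\<^sup>2 * response k l (pair_form T2 T1 T0 S1 S0)
        = \<beta>\<^sup>2 * response k l (\<lambda>a b. W a b N r) - v * (\<Sum>x\<in>pairs n. \<gamma> x * (\<beta>\<^sup>2 * response k l (Cov N x)))"
        by (simp add: right_diff_distrib sum_distrib_left mult_ac)
      have "Wcov N k l = (\<Sum>x\<in>pairs n. \<gamma> x * (\<beta>\<^sup>2 * response k l (Cov N x))) + (\<Sum>x\<in>pairs n. \<gamma> x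
          * corr k l (fst x) (snd x)) / real N"
      proof -
        have "Wcov N k l = (\<Sum>x\<in>pairs n. \<gamma> x * (\<beta>\<^sup>2 * response k l (Cov N x)) + \<gamma> x
            * corr k l (fst x) (snd x) / real N)"
          unfolding Wcov_def using Cov_solves[OF N kl] by (intro sum.cong refl) (simp add: distrib_left)
        then show ?thesis by (simp add: sum.distrib sum_divide_distrib)
      qed
      then have "pair_form T2 T1 T0 S1 S0 k l - \<beta>\<^sup>2 * response k l (pair_form T2 T1 T0 S1 S0)
        = W k l N r - \<beta>\<^sup>2 * response k l (\<lambda>a b. W a b N r) - v * ((\<Sum>x\<in>pairs n. \<gamma> x
            * corr k l (fst x) (snd x)) / real N)"
        unfolding L e[OF klR, symmetric] by (simp add: distrib_left)
      also have "\<beta>\<^sup>2 * response k l (\<lambda>a b. W a b N r)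
          = (\<Sum>a\<in>R. \<Sum>b\<in>R. fresh_coeff a b * \<beta>\<^sup>2 * corr k l a b * W a b N r)"
        unfolding response_def by (simp add: sum_distrib_left mult_ac)
      also have "v * ((\<Sum>x\<in>pairs n. \<gamma> x * corr k l (fst x) (snd x)) / real N)
        = real r / real N * ((\<Sum>x\<in>pairs n. \<gamma> x * corr k l (fst x) (snd x)) * V N (r - 1))"
        by (simp add: v_def)
      finally show "\<bar>pair_form T2 T1 T0 S1 S0 k l - \<beta>\<^sup>2 * response k l (pair_form T2 T1 T0 S1 S0)\<bar>
          \<le> K * (1 / sqrt (real N)) ^ (r+2)"
        using K[OF N kl] by simp
    qed
    moreover have "k \<in> R" "l \<in> R" using kl A_sub_R by auto
    ultimately show ?thesis using e[of k l] by (simp add: v_def mult.assoc)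
  qed
  then show ?thesis by blast
qed

end

section \<open>Gaussian moments and polarization\<close>

text \<open>The moments of a centred Gaussian of variance \<open>v\<close>, defined by the recursion
  that \<open>V\<close> satisfies approximately; in this form \<open>v = 0\<close> is
  included.\<close>

fun gauss_moment :: "nat \<Rightarrow> real \<Rightarrow> real" where
  "gauss_moment 0 v = 1"
| "gauss_moment (Suc 0) v = 0"
| "gauss_moment (Suc (Suc r)) v = real (r + 1) * v * gauss_moment r v"

lemma gauss_moment_even: "0 < v \<Longrightarrow> gauss_moment (2 * k) v = fact (2 * k) / ((2 / v) ^ k * fact k)"
proof -
  assume v: "0 < v"
  have "gauss_moment (2 * k) v * (2 ^ k * fact k) = fact (2 * k) * v ^ k"
  proof (induction k)
    case 0
    show ?case by simp
  next
    case (Suc k)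
    have "gauss_moment (2 * Suc k) v * (2 ^ Suc k * fact (Suc k))
        = real (2 * k + 1) * v * (2 * real (Suc k)) * (gauss_moment (2 * k) v * (2 ^ k * fact k))"
      by (simp add: mult_ac)
    also have "\<dots> = fact (2 * Suc k) * v ^ Suc k"
      unfolding Suc by (simp add: algebra_simps)
    finally show ?case .
  qed
  then show ?thesis using v by (simp add: power_divide field_simps)
qed

lemma gauss_moment_odd: "gauss_moment (2 * k + 1) v = 0"
  by (induction k) auto

lemma gauss_moment_zero: "gauss_moment r 0 = 0 ^ r"
  by (induction r "0::real" rule: gauss_moment.induct) auto

lemma normal_moment:
  assumes "0 < v"
  shows "has_bochner_integral lborel (\<lambda>x. normal_density 0 (sqrt v) x * x ^ r) (gauss_moment r v)"
proof (cases "even r")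
  case True
  then obtain k where r: "r = 2 * k" by (elim evenE)
  show ?thesis using normal_moment_even[of "sqrt v" 0 k] assms unfolding r gauss_moment_even[OF assms] by simp
next
  case False
  then obtain k where r: "r = 2 * k + 1" by (elim oddE)
  show ?thesis using normal_moment_odd[of "sqrt v" 0 k] assms unfolding r gauss_moment_odd by simp
qed

lemma has_bochner_integral_gaussian_power:
  fixes X :: "'a \<Rightarrow> real"
  assumes M: "prob_space M" and X [measurable]: "X \<in> borel_measurable M" and v: "0 \<le> v"
    and d: "distr M borel X = (if v = 0 then return borel 0 else density lborel (normal_density 0 (sqrt v)))"
  shows "has_bochner_integral M (\<lambda>x. X x ^ r) (gauss_moment r v)"
proof (cases "v = 0")
  case True
  interpret prob_space M by fact
  have "AE y in distr M borel X. y = 0" unfolding d using True by (simp add: AE_return)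
  then have ae: "AE x in M. X x = 0" by (simp add: AE_distr_iff)
  have "has_bochner_integral M (\<lambda>x. 0 ^ r :: real) (0 ^ r)"
    using has_bochner_integral_integrable[OF integrable_const[of "0 ^ r :: real"]] by (simp add: prob_space)
  then show ?thesis unfolding True gauss_moment_zero
    by (rule has_bochner_integral_cong_AE[THEN iffD1, rotated 3]) (use ae in auto)
next
  case False
  then have v0: "0 < v" using v by simp
  have d: "distr M borel X = density lborel (normal_density 0 (sqrt v))" using d False by simp
  note nm = normal_moment[OF v0, of r]
  have "integrable (distr M borel X) (\<lambda>x. x ^ r)"
    unfolding d using nm by (subst integrable_density) (auto simp: has_bochner_integral_iff)
  then have 1: "integrable M (\<lambda>x. X x ^ r)" by (simp add: integrable_distr_eq)
  have "integral\<^sup>L M (\<lambda>x. X x ^ r) = integral\<^sup>L (distr M borel X) (\<lambda>x. x ^ r)"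
    by (simp add: integral_distr)
  also have "\<dots> = gauss_moment r v"
    unfolding d using nm by (subst integral_density) (auto simp: has_bochner_integral_iff)
  finally show ?thesis using 1 by (simp add: has_bochner_integral_iff)
qed

section \<open>From the linear system to the moments of one linear form\<close>

context GS_form
begin

definition var :: "nat \<Rightarrow> real" where
  "var N = (\<Sum>x\<in>pairs n. \<Sum>y\<in>pairs n. \<gamma> x * \<gamma> y * eta_cov S \<beta> h D p q N x y)"

lemma var_eq: "var N = (\<Sum>x\<in>pairs n. \<gamma> x * Wcov N (fst x) (snd x))"
  unfolding var_def Wcov_def sum_distrib_left mult.assoc eta_cov_eq ..

lemma eta_cov_scaling: "eta_cov S \<beta> h D p q N x y = eta_cov S \<beta> h D p q 1 x y / real N"
proof -
  have 1: "A2sq S \<beta> h D p q N = A2sq S \<beta> h D p q 1 / real N" "A1sq S \<beta> h D p q N = A1sq S \<beta> h D p q 1 / real N"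
    "B1sq S \<beta> h D p q N = B1sq S \<beta> h D p q 1 / real N" "C1sq S \<beta> h D p q N = C1sq S \<beta> h D p q 1 / real N"
    by (simp_all add: A2sq_def A1sq_def B1sq_def C1sq_def)
  have 2: "a * (b / real N) = a * b / real N" "1 / (c * real N) * a = 1 / (c * real 1) * a / real N" for a b c
      by simp_all
  have "A0sq S \<beta> h D p q N = A0sq S \<beta> h D p q 1 / real N" "B0sq S \<beta> h D p q N = B0sq S \<beta> h D p q 1 / real N"
    "C0sq S \<beta> h D p q N = C0sq S \<beta> h D p q 1 / real N"
    unfolding A0sq_def B0sq_def C0sq_def 1 add_divide_distrib 2(1) 2(2)[of "cM S \<beta> h D p q"] by (rule refl)+
  note 3 = this 1
  show ?thesis unfolding eta_cov_def 3 by (simp add: Let_def split_def add_divide_distrib)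
qed

lemma var_scaling: "var N = var 1 / real N"
  unfolding var_def sum_divide_distrib by (intro sum.cong refl) (simp add: eta_cov_scaling[of N])

lemma V_Suc: "V N (Suc r) = (\<Sum>x\<in>pairs n. \<gamma> x * W (fst x) (snd x) N r)"
proof -
  have "V N (Suc r) = nuN N R (\<lambda>\<sigma>. \<Sum>x\<in>pairs n. \<gamma> x * (ov N (fst x) (snd x) \<sigma> * lin_form N \<sigma> ^ r))"
    unfolding V_def power_Suc by (subst lin_form_def) (simp only: sum_distrib_right mult.assoc)
  then show ?thesis by (simp add: nuN_sum nuN_cmult W_def)
qed

text \<open>Combine \<open>linear_response\<close> over the pairs with weights
  \<open>\<gamma>\<close>: the weighted sum of \<open>Wcov\<close> is the variance.\<close>

lemma V_recursion:
  "\<exists>C. \<forall>N>0. \<bar>V N (Suc r) - real r * V N (r - 1) * var N\<bar> \<le> C * (1 / sqrt (real N)) ^ (r+2)"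
proof -
  obtain C where C: "\<And>N k l. N > 0 \<Longrightarrow> k \<in> A \<Longrightarrow> l \<in> A
      \<Longrightarrow> \<bar>W k l N r - real r * V N (r - 1) * Wcov N k l\<bar> \<le> C * (1 / sqrt (real N)) ^ (r+2)"
    using linear_response[of r] by blast
  have "\<bar>V N (Suc r) - real r * V N (r - 1) * var N\<bar> \<le> (\<Sum>x\<in>pairs n. \<bar>\<gamma> x\<bar>) * C * (1 / sqrt (real N)) ^ (r+2)"
    if N: "N > 0" for N
  proof -
    let ?d = "\<lambda>x. W (fst x) (snd x) N r - real r * V N (r - 1) * Wcov N (fst x) (snd x)"
    have "V N (Suc r) - real r * V N (r - 1) * var N = (\<Sum>x\<in>pairs n. \<gamma> x * ?d x)"
      unfolding V_Suc var_eq sum_distrib_left sum_subtractf[symmetric]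
      by (intro sum.cong refl) (simp add: right_diff_distrib)
    then have "\<bar>V N (Suc r) - real r * V N (r - 1) * var N\<bar> \<le> (\<Sum>x\<in>pairs n. \<bar>\<gamma> x\<bar> * \<bar>?d x\<bar>)"
      by (simp add: abs_mult[symmetric])
    also have "\<dots> \<le> (\<Sum>x\<in>pairs n. \<bar>\<gamma> x\<bar> * (C * (1 / sqrt (real N)) ^ (r+2)))"
      by (intro sum_mono mult_left_mono C N pairs_mem) auto
    finally show ?thesis by (simp only: sum_distrib_right mult.assoc)
  qed
  then show ?thesis by blast
qed

text \<open>One step of the recursion multiplies the earlier error by \<open>var N\<close>, which is
  of order \<open>1 / real N\<close>. This matches the rise of the exponent by two.\<close>

lemma V_gauss_moment: "\<exists>C. \<forall>N>0. \<bar>V N r - gauss_moment r (var N)\<bar> \<le> C * (1 / sqrt (real N)) ^ (r+1)"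
proof (induction r rule: less_induct)
  case (less r)
  consider "r = 0" | "r = 1" | r' where "r = Suc (Suc r')"
    by (metis One_nat_def not0_implies_Suc)
  then show ?case
  proof cases
    case 1
    then show ?thesis by (intro exI[of _ 0]) (simp add: V_def nuN_const)
  next
    case 2
    \<comment> \<open>For the first moment the main term of the recursion carries the factor
      zero.\<close>
    then show ?thesis using V_recursion[of 0] by simp
  next
    case 3
    obtain C where C0: "\<forall>N>0. \<bar>V N (Suc (Suc r')) - real (Suc r') * V N (Suc r' - 1) * var N\<bar>
        \<le> C * (1 / sqrt (real N)) ^ (Suc r' + 2)"
      using V_recursion[of "Suc r'"] by blast
    have e: "Suc r' + 2 = r' + 3" "real (Suc r') = real (r' + 1)" by simp_all
    have C: "\<bar>V N r - real (r' + 1) * V N r' * var N\<bar> \<le> C * (1 / sqrt (real N)) ^ (r'+3)" if "N > 0" for N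
      using C0[rule_format, OF that] unfolding 3 e diff_Suc_1 .
    obtain C' where C': "\<And>N. N > 0 \<Longrightarrow> \<bar>V N r' - gauss_moment r' (var N)\<bar> \<le> C' * (1 / sqrt (real N)) ^ (r'+1)"
      using less[of r'] unfolding 3 by (meson lessI less_SucI)
    have "\<bar>V N r - gauss_moment r (var N)\<bar> \<le> (C + real (r' + 1) * \<bar>var 1\<bar> * C') * (1 / sqrt (real N)) ^ (r + 1)"
      if N: "N > 0" for N
    proof -
      have v: "\<bar>var N\<bar> = \<bar>var 1\<bar> * (1 / sqrt (real N)) ^ 2"
        using var_scaling[of N] N by (simp add: power_divide abs_mult)
      have "V N r - gauss_moment r (var N) = (V N r - real (r' + 1) * V N r' * var N) + real (r' + 1) * var N
          * (V N r' - gauss_moment r' (var N))"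
        unfolding 3 gauss_moment.simps by (simp add: algebra_simps)
      then have h1: "\<bar>V N r - gauss_moment r (var N)\<bar> \<le> \<bar>V N r - real (r' + 1) * V N r' * var N\<bar>
          + \<bar>real (r' + 1) * var N * (V N r' - gauss_moment r' (var N))\<bar>" by (metis abs_triangle_ineq)
      have h2: "\<bar>real (r' + 1) * var N * (V N r' - gauss_moment r' (var N))\<bar>
          \<le> real (r' + 1) * (\<bar>var 1\<bar> * (1 / sqrt (real N)) ^ 2) * (C' * (1 / sqrt (real N)) ^ (r'+1))"
        unfolding abs_mult v by (intro mult_mono C'[OF N]) auto
      have h3: "real (r' + 1) * (\<bar>var 1\<bar> * (1 / sqrt (real N)) ^ 2) * (C' * (1 / sqrt (real N)) ^ (r'+1))
          = real (r' + 1) * \<bar>var 1\<bar> * C' * (1 / sqrt (real N)) ^ (r + 1)"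
        by (simp add: 3 power2_eq_square mult_ac)
      have h4: "(1 / sqrt (real N)) ^ (r'+3) = (1 / sqrt (real N)) ^ (r + 1)"
        by (rule arg_cong[where f="\<lambda>k. (1 / sqrt (real N)) ^ k"]) (simp add: 3)
      have "\<bar>V N r - gauss_moment r (var N)\<bar> \<le> C * (1 / sqrt (real N)) ^ (r'+3)
          + real (r' + 1) * (\<bar>var 1\<bar> * (1 / sqrt (real N)) ^ 2) * (C' * (1 / sqrt (real N)) ^ (r'+1))"
        by (rule order_trans[OF h1 add_mono[OF C[OF N] h2]])
      then show ?thesis unfolding h3 h4 distrib_right .
    qed
    then show ?thesis by blast
  qed
qed

text \<open>The moments only converge, but \<open>var\<close> is exactly proportional to \<open>1 / N\<close>, so its sign can be read off in
  the limit.\<close>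

lemma var_nonneg: "0 \<le> var N"
proof -
  obtain C where C: "\<And>N. N > 0 \<Longrightarrow> \<bar>V N 2 - gauss_moment 2 (var N)\<bar> \<le> C * (1 / sqrt (real N)) ^ (2+1)"
    using V_gauss_moment[of 2] by blast
  have "- C * (1 / sqrt (real N)) \<le> var 1" if N: "N \<ge> 1" for N
  proof -
    have "0 \<le> V N 2" unfolding V_def by (rule nuN_nonneg) auto
    moreover have "gauss_moment 2 (var N) = var N" by (simp add: numeral_2_eq_2)
    ultimately have "- (C * (1 / sqrt (real N)) ^ 3) \<le> var N" using C[of N] N by simp
    then have "- (C * (1 / sqrt (real N)) ^ 3) * real N \<le> var N * real N" by (rule mult_right_mono) simp
    moreover have "var N * real N = var 1" using var_scaling[of N] N by simp
    moreover have "(1 / sqrt (real N)) ^ 3 * real N = 1 / sqrt (real N)"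
      using N by (simp add: power3_eq_cube power_divide)
    ultimately show ?thesis unfolding minus_mult_left mult.assoc by simp
  qed
  then have "\<exists>N0. \<forall>N\<ge>N0. - C * (1 / sqrt (real N)) \<le> var 1" by blast
  moreover have "(\<lambda>N. - C * (1 / sqrt (real N))) \<longlonglongrightarrow> - C * 0"
    by (intro tendsto_mult tendsto_const) real_asymp
  ultimately have "- C * 0 \<le> var 1" by (intro LIMSEQ_le_const2)
  then have "0 \<le> var 1" by simp
  then show ?thesis unfolding var_scaling[of N] by (rule divide_nonneg_nonneg) simp
qed

lemma moment_convergence:
  "\<exists>C. \<forall>N>0. \<bar>nuN N {1..n} (\<lambda>\<sigma>. (\<Sum>x\<in>pairs n. \<gamma> x * ov N (fst x) (snd x) \<sigma>) ^ r) - gauss_moment r (var N)\<bar>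
     \<le> C * (1 / sqrt (real N)) ^ (r+1)"
  using V_gauss_moment[of r] unfolding V_def nuN_marginal[OF finite_R fresh_sub depends_on_lin_form_power]
      unfolding lin_form_def .

end

text \<open>With \<open>p t\<close> the polynomial in \<open>t\<close>, the combination \<open>2 ^ (s+1) * p t - p (2 * t)\<close> has no term of degree
  \<open>s + 1\<close>.\<close>

lemma coefficient_extraction:
  fixes P :: "('b \<Rightarrow> real) \<Rightarrow> bool" and G :: "nat \<Rightarrow> 'b \<Rightarrow> real"
  assumes add: "\<And>F F'. P F \<Longrightarrow> P F' \<Longrightarrow> P (\<lambda>v. F v + F' v)" and cmult: "\<And>c F. P F \<Longrightarrow> P (\<lambda>v. c * F v)"
    and poly: "\<And>t. P (\<lambda>v. \<Sum>i\<le>s. t ^ i * G i v)" and "i \<le> s"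
  shows "P (G i)"
  using poly \<open>i \<le> s\<close>
proof (induction s arbitrary: G i)
  case 0
  then show ?case using "0.prems"(1)[of 1] by (simp add: eta_contract_eq)
next
  case (Suc s)
  have sum: "P (\<lambda>v. \<Sum>i\<in>I. F i v)" if "finite I" "\<And>i. i \<in> I \<Longrightarrow> P (F i)" for F I
    using that
  proof (induction I rule: finite_induct)
    case empty
    show ?case using cmult[OF Suc.prems(1)[of 0], of 0] by simp
  next
    case (insert a I)
    then show ?case using add[of "F a" "\<lambda>v. \<Sum>i\<in>I. F i v"] by simp
  qed
  have "P (\<lambda>v. \<Sum>i\<le>s. t ^ i * ((2 ^ Suc s - 2 ^ i) * G i v))" for t :: real
  proof -
    have "(\<Sum>i\<le>s. t ^ i * ((2 ^ Suc s - 2 ^ i) * G i v))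
       = 2 ^ Suc s * (\<Sum>i\<le>Suc s. t ^ i * G i v) + (-1) * (\<Sum>i\<le>Suc s. (2 * t) ^ i * G i v)" for v
    proof -
      have "2 ^ Suc s * (\<Sum>i\<le>Suc s. t ^ i * G i v) + (-1) * (\<Sum>i\<le>Suc s. (2 * t) ^ i * G i v)
         = (\<Sum>i\<le>Suc s. t ^ i * ((2 ^ Suc s - 2 ^ i) * G i v))"
        unfolding sum_distrib_left sum.distrib[symmetric]
        by (intro sum.cong refl) (simp only: power_mult_distrib, argo)
      then show ?thesis by simp
    qed
    then show ?thesis using add[OF cmult[OF Suc.prems(1)] cmult[OF Suc.prems(1)], of "2 ^ Suc s" t "-1" "2 * t"]
        by presburger
  qed
  from Suc.IH[of "\<lambda>i v. (2 ^ Suc s - 2 ^ i) * G i v", OF this]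
  have "P (\<lambda>v. (2 ^ Suc s - 2 ^ i) * G i v)" if "i \<le> s" for i using that by simp
  from cmult[OF this, of _ "1 / (2 ^ Suc s - 2 ^ i)" for i]
  have low: "P (G i)" if "i \<le> s" for i
  proof -
    have "(2::real) ^ i < 2 ^ Suc s" using that by (intro power_strict_increasing) auto
    then have "(2::real) ^ Suc s - 2 ^ i \<noteq> 0" by simp
    then have "1 / (2 ^ Suc s - 2 ^ i) * ((2 ^ Suc s - 2 ^ i) * G i v) = G i v" for v by simp
    then show ?thesis using cmult[OF \<open>\<And>i. i \<le> s \<Longrightarrow> P (\<lambda>v. (2 ^ Suc s - 2 ^ i) * G i v)\<close>[OF that], of "1 / (2 ^ Suc s - 2 ^ i)"]
      by simp
  qed
  show ?case
  proof (cases "i = Suc s")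
    case True
    have "P (\<lambda>v. (\<Sum>i\<le>Suc s. 1 ^ i * G i v) + (-1) * (\<Sum>i\<le>s. G i v))"
      by (intro add cmult Suc.prems(1) sum low) auto
    then show ?thesis unfolding True by (simp add: eta_contract_eq)
  next
    case False
    then show ?thesis using low Suc.prems(2) by simp
  qed
qed

text \<open>Factors are split off one at a time: shifting the coefficient of \<open>v j\<close> by
  \<open>t\<close> and expanding binomially gives a polynomial in \<open>t\<close>, whose
  coefficient at \<open>t ^ e j\<close> contains \<open>v j ^ e j\<close>. \<open>P\<close> only has
  to be closed under linear combinations, as an error estimate of fixed order is.\<close>

lemma polarization:
  fixes P :: "(('i \<Rightarrow> real) \<Rightarrow> real) \<Rightarrow> bool"
  assumes I: "finite I"
    and add: "\<And>F F'. P F \<Longrightarrow> P F' \<Longrightarrow> P (\<lambda>v. F v + F' v)" and cmult: "\<And>c F. P F \<Longrightarrow> P (\<lambda>v. c * F v)"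
    and powers: "\<And>\<gamma>. P (\<lambda>v. (\<Sum>i\<in>I. \<gamma> i * v i) ^ (\<Sum>i\<in>I. e i))"
  shows "P (\<lambda>v. \<Prod>i\<in>I. v i ^ e i)"
proof -
  have "P (\<lambda>v. (\<Prod>i\<in>J. v i ^ e i) * (\<Sum>i\<in>I. \<gamma> i * v i) ^ r)"
    if "finite J" "J \<subseteq> I" "sum e J + r = sum e I" for J \<gamma> r
    using that
  proof (induction J arbitrary: \<gamma> r rule: finite_induct)
    case empty
    then show ?case using powers[of \<gamma>] by simp
  next
    case (insert j J)
    \<comment> \<open>The exponent to be extracted is borrowed from the power of the linear form, so
      the total degree is unchanged.\<close>
    define s where "s = e j + r"
    define G where "G k v = (\<Prod>i\<in>J. v i ^ e i) * (real (s choose k) * v j ^ k * (\<Sum>i\<in>I. \<gamma> i * v i) ^ (s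
        - k))" for k and v :: "'i \<Rightarrow> real"
    have poly: "P (\<lambda>v. \<Sum>k\<le>s. t ^ k * G k v)" for t
    proof -
      let ?\<gamma> = "\<lambda>i. \<gamma> i + (if i = j then t else 0)"
      have "(\<Prod>i\<in>J. v i ^ e i) * (\<Sum>i\<in>I. ?\<gamma> i * v i) ^ s = (\<Sum>k\<le>s. t ^ k * G k v)" for v
      proof -
        have "(\<Sum>i\<in>I. ?\<gamma> i * v i) = (\<Sum>i\<in>I. \<gamma> i * v i + (if i = j then t * v i else 0))"
          by (intro sum.cong) (auto simp: distrib_right)
        also have "\<dots> = t * v j + (\<Sum>i\<in>I. \<gamma> i * v i)"
          using I insert.prems(1) by (simp add: sum.distrib)
        finally have "(\<Sum>i\<in>I. ?\<gamma> i * v i) = t * v j + (\<Sum>i\<in>I. \<gamma> i * v i)" .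
        then show ?thesis unfolding G_def
          by (simp only: binomial_ring sum_distrib_left power_mult_distrib) (simp only: mult_ac)
      qed
      moreover have "P (\<lambda>v. (\<Prod>i\<in>J. v i ^ e i) * (\<Sum>i\<in>I. ?\<gamma> i * v i) ^ s)"
        using insert by (intro insert.IH) (auto simp: s_def)
      ultimately show ?thesis by simp
    qed
    have "P (G (e j))"
      by (rule coefficient_extraction[where P=P and s=s
          and G=G]) (fact add, fact cmult, fact poly, simp add: s_def)
    from cmult[OF this, of "1 / real (s choose e j)"] show ?case
      using insert.hyps by (simp add: G_def s_def mult_ac)
  qed
  from this[OF I order_refl, of 0] show ?thesis by simp
qed

context GS_rep
begin

theorem mixed_moments:
  "\<exists>C. \<forall>N\<ge>2. \<forall>(M :: 'a measure) \<eta>. centered_gaussian_family M (pairs n) \<eta> (eta_cov S \<beta> h D p q N) \<longrightarrow>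
     integrable M (\<lambda>x. \<Prod>i\<in>pairs n. \<eta> i x ^ m i) \<and>
     \<bar>nuN N {1..n} (\<lambda>\<sigma>. \<Prod>i\<in>pairs n. ov N (fst i) (snd i) \<sigma> ^ m i) - (\<integral>x. (\<Prod>i\<in>pairs n. \<eta> i x ^ m i) \<partial>M)\<bar>
       \<le> C * (1 / sqrt (real N)) ^ (sum m (pairs n) + 1)"
proof -
  let ?e = "\<lambda>N. (1 / sqrt (real N)) ^ (sum m (pairs n) + 1)"
  \<comment> \<open>Integrability belongs to \<open>P\<close> because the integrals of two functions
    can be split only with it. The constant is chosen before \<open>N\<close>, \<open>M\<close> and
    \<open>\<eta>\<close>.\<close>
  define P where "P F \<longleftrightarrow> (\<exists>C. \<forall>N\<ge>2. \<forall>(M :: 'a measure) \<eta>. centered_gaussian_family M (pairs n) \<eta> (eta_cov S \<beta> h D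
      p q N) \<longrightarrow>
     integrable M (\<lambda>x. F (\<lambda>i. \<eta> i x)) \<and>
     \<bar>nuN N {1..n} (\<lambda>\<sigma>. F (\<lambda>i. ov N (fst i) (snd i) \<sigma>)) - (\<integral>x. F (\<lambda>i. \<eta> i x) \<partial>M)\<bar> \<le> C * ?e N)"
    for F :: "(nat \<times> nat \<Rightarrow> real) \<Rightarrow> real"
  have "P (\<lambda>v. \<Prod>i\<in>pairs n. v i ^ m i)"
  proof (rule polarization[OF finite_pairs])
    fix F F' assume "P F" "P F'"
    then obtain C C' where
      C: "\<And>N (M :: 'a measure) \<eta>. N \<ge> 2 \<Longrightarrow> centered_gaussian_family M (pairs n) \<eta> (eta_cov S \<beta> h D p q N) \<Longrightarrow>
        integrable M (\<lambda>x. F (\<lambda>i. \<eta> i x)) \<and>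
        \<bar>nuN N {1..n} (\<lambda>\<sigma>. F (\<lambda>i. ov N (fst i) (snd i) \<sigma>)) - (\<integral>x. F (\<lambda>i. \<eta> i x) \<partial>M)\<bar> \<le> C * ?e N"
      and C': "\<And>N (M :: 'a measure) \<eta>. N \<ge> 2 \<Longrightarrow> centered_gaussian_family M (pairs n) \<eta> (eta_cov S \<beta> h D p q N) \<Longrightarrow>
        integrable M (\<lambda>x. F' (\<lambda>i. \<eta> i x)) \<and>
        \<bar>nuN N {1..n} (\<lambda>\<sigma>. F' (\<lambda>i. ov N (fst i) (snd i) \<sigma>)) - (\<integral>x. F' (\<lambda>i. \<eta> i x) \<partial>M)\<bar> \<le> C' * ?e N"
      unfolding P_def by blast
    show "P (\<lambda>v. F v + F' v)" unfolding P_def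
    proof (intro exI[of _ "C + C'"] allI impI)
      fix N \<eta> and M :: "'a measure"
      assume a: "2 \<le> N" "centered_gaussian_family M (pairs n) \<eta> (eta_cov S \<beta> h D p q N)"
      show "integrable M (\<lambda>x. F (\<lambda>i. \<eta> i x) + F' (\<lambda>i. \<eta> i x)) \<and>
        \<bar>nuN N {1..n} (\<lambda>\<sigma>. F (\<lambda>i. ov N (fst i) (snd i) \<sigma>) + F' (\<lambda>i. ov N (fst i) (snd i) \<sigma>))
          - (\<integral>x. F (\<lambda>i. \<eta> i x) + F' (\<lambda>i. \<eta> i x) \<partial>M)\<bar> \<le> (C + C') * ?e N"
        using C[OF a] C'[OF a] unfolding nuN_add[OF finite_atLeastAtMost] distrib_right
        by (simp only: Bochner_Integration.integral_add Bochner_Integration.integrable_add simp_thms) linarith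
    qed
  next
    fix c F assume "P F"
    then obtain C where
      C: "\<And>N (M :: 'a measure) \<eta>. N \<ge> 2 \<Longrightarrow> centered_gaussian_family M (pairs n) \<eta> (eta_cov S \<beta> h D p q N) \<Longrightarrow>
        integrable M (\<lambda>x. F (\<lambda>i. \<eta> i x)) \<and>
        \<bar>nuN N {1..n} (\<lambda>\<sigma>. F (\<lambda>i. ov N (fst i) (snd i) \<sigma>)) - (\<integral>x. F (\<lambda>i. \<eta> i x) \<partial>M)\<bar> \<le> C * ?e N"
      unfolding P_def by blast
    show "P (\<lambda>v. c * F v)" unfolding P_def
    proof (intro exI[of _ "\<bar>c\<bar> * C"] allI impI)
      fix N \<eta> and M :: "'a measure"
      assume a: "2 \<le> N" "centered_gaussian_family M (pairs n) \<eta> (eta_cov S \<beta> h D p q N)"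
      from C[OF a] have "\<bar>c\<bar> * \<bar>nuN N {1..n} (\<lambda>\<sigma>. F (\<lambda>i. ov N (fst i) (snd i) \<sigma>)) - (\<integral>x. F (\<lambda>i. \<eta> i x) \<partial>M)\<bar>
          \<le> \<bar>c\<bar> * (C * ?e N)"
        by (intro mult_left_mono) auto
      then show "integrable M (\<lambda>x. c * F (\<lambda>i. \<eta> i x)) \<and>
        \<bar>nuN N {1..n} (\<lambda>\<sigma>. c * F (\<lambda>i. ov N (fst i) (snd i) \<sigma>)) - (\<integral>x. c * F (\<lambda>i. \<eta> i x) \<partial>M)\<bar> \<le> \<bar>c\<bar> * C * ?e N"
        using C[OF a] by (simp add: nuN_cmult abs_mult mult.assoc flip: right_diff_distrib)
    qed
  next
    fix \<gamma> :: "nat \<times> nat \<Rightarrow> real"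
    interpret GS_form S \<beta> h D p q n \<gamma> by unfold_locales
    obtain C where C: "\<And>N. N > 0 \<Longrightarrow> \<bar>nuN N {1..n} (\<lambda>\<sigma>. (\<Sum>x\<in>pairs n. \<gamma> x * ov N (fst x) (snd x) \<sigma>) ^ sum m (pairs n))
        - gauss_moment (sum m (pairs n)) (var N)\<bar> \<le> C * ?e N"
      using moment_convergence[of "sum m (pairs n)"] by blast
    show "P (\<lambda>v. (\<Sum>i\<in>pairs n. \<gamma> i * v i) ^ sum m (pairs n))" unfolding P_def
    proof (intro exI[of _ C] allI impI)
      fix N \<eta> and M :: "'a measure"
      assume N: "2 \<le> N" and f: "centered_gaussian_family M (pairs n) \<eta> (eta_cov S \<beta> h D p q N)"
      have "has_bochner_integral M (\<lambda>x. (\<Sum>i\<in>pairs n. \<gamma> i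
          * \<eta> i x) ^ sum m (pairs n)) (gauss_moment (sum m (pairs n)) (var N))"
      proof (rule has_bochner_integral_gaussian_power)
        show "prob_space M" using f by (simp add: centered_gaussian_family_def)
        show "(\<lambda>x. \<Sum>i\<in>pairs n. \<gamma> i * \<eta> i x) \<in> borel_measurable M"
          using f unfolding centered_gaussian_family_def
              by (intro borel_measurable_sum borel_measurable_times borel_measurable_const) blast
        show "0 \<le> var N" by (rule var_nonneg)
        show "distr M borel (\<lambda>x. \<Sum>i\<in>pairs n. \<gamma> i * \<eta> i x)
          = (if var N = 0 then return borel 0 else density lborel (normal_density 0 (sqrt (var N))))"
          using f unfolding centered_gaussian_family_def Let_def var_def by blast
      qed
      then show "integrable M (\<lambda>x. (\<Sum>i\<in>pairs n. \<gamma> i * \<eta> i x) ^ sum m (pairs n)) \<and>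
        \<bar>nuN N {1..n} (\<lambda>\<sigma>. (\<Sum>i\<in>pairs n. \<gamma> i * ov N (fst i) (snd i) \<sigma>) ^ sum m (pairs n))
           - (\<integral>x. (\<Sum>i\<in>pairs n. \<gamma> i * \<eta> i x) ^ sum m (pairs n) \<partial>M)\<bar> \<le> C * ?e N"
        using C[of N] N by (simp add: has_bochner_integral_iff)
    qed
  qed
  then show ?thesis unfolding P_def .
qed

end

theorem theorem1p3:
  fixes S :: nat and h D :: real
  assumes "S \<ge> 1" and "h \<ge> 0"
  shows "\<exists>\<beta>'>0. \<forall>\<beta>. 0 < \<beta> \<and> \<beta> < \<beta>' \<longrightarrow>
    (\<forall>p q. pq_fixed_point S \<beta> h D p q \<longrightarrow>
    (\<forall>n::nat. n \<ge> 1 \<longrightarrow> (\<forall>m :: nat \<times> nat \<Rightarrow> nat.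
      \<exists>C. \<forall>N::nat. N \<ge> 2 \<longrightarrow>
        (\<forall>(M :: 'a measure) (\<eta> :: nat \<times> nat \<Rightarrow> 'a \<Rightarrow> real).
          centered_gaussian_family M (pairs n) \<eta> (eta_cov S \<beta> h D p q N) \<longrightarrow>
          \<bar>nu S \<beta> h D N n
              (\<lambda>\<sigma>. \<Prod>(k,l)\<in>pairs n. (overlap N \<sigma> k l - Qpq p q k l) ^ m (k,l))
           - (\<integral>x. (\<Prod>kl\<in>pairs n. \<eta> kl x ^ m kl) \<partial>M)\<bar>
          \<le> C * real N powr (- (real (\<Sum>kl\<in>pairs n. m kl) + 1) / 2)))))"
proof -
  \<comment> \<open>The three summands yield \<open>\<beta> \<le> 1\<close> and the two smallness
    conditions. \<open>Kmom\<close> depends on \<open>S\<close> alone and is thus available before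
    \<open>\<beta>\<close>; the absolute value makes \<open>1 \<le> K\<close> immediate.\<close>
  define K where "K = 1 + 2 * \<bar>GS.Kmom S\<bar> + 100 * real S ^ 4"
  have K: "1 \<le> K" unfolding K_def by simp
  show ?thesis
  proof (rule exI[of _ "1 / K"], intro conjI allI impI)
    show "0 < 1 / K" using K by simp
    fix \<beta> p q :: real and n :: nat and m :: "nat \<times> nat \<Rightarrow> nat"
    assume b: "0 < \<beta> \<and> \<beta> < 1 / K" and pq: "pq_fixed_point S \<beta> h D p q"
    have bK: "\<beta> * K \<le> 1" using b K by (simp add: field_simps)
    have "\<beta> * 1 \<le> \<beta> * K" using K b by (intro mult_left_mono) auto
    then have b1: "\<beta> \<le> 1" using bK by simp
    \<comment> \<open>The threshold limits \<open>\<beta>\<close> while the smallness conditions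
      concern its square.\<close>
    then have b2: "\<beta>\<^sup>2 \<le> \<beta>" using b by (simp add: power2_eq_square mult_left_le)
    have "\<beta>\<^sup>2 * K \<le> \<beta> * K" using b2 K by (intro mult_right_mono) auto
    then have sm: "\<beta>\<^sup>2 * K \<le> 1" using bK by linarith
    have "0 \<le> real S ^ 4" by simp
    then have "2 * GS.Kmom S \<le> K" "100 * real S ^ 4 \<le> K" unfolding K_def by linarith+
    then have "\<beta>\<^sup>2 * (2 * GS.Kmom S) \<le> \<beta>\<^sup>2 * K" "\<beta>\<^sup>2 * (100 * real S ^ 4) \<le> \<beta>\<^sup>2 * K"
      by (auto intro: mult_left_mono)
    then have small: "\<beta>\<^sup>2 * GS.Kmom S \<le> 1 / 2" "\<beta>\<^sup>2 * real S ^ 4 \<le> 1 / 100" using sm by simp_all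
    interpret GS_rep S \<beta> h D p q n
      using b b1 pq small by unfold_locales auto
    obtain C where C: "\<And>N (M :: 'a measure) \<eta>. N \<ge> 2
        \<Longrightarrow> centered_gaussian_family M (pairs n) \<eta> (eta_cov S \<beta> h D p q N) \<Longrightarrow>
       \<bar>nuN N {1..n} (\<lambda>\<sigma>. \<Prod>i\<in>pairs n. ov N (fst i) (snd i) \<sigma> ^ m i) - (\<integral>x. (\<Prod>i\<in>pairs n. \<eta> i x ^ m i) \<partial>M)\<bar>
       \<le> C * (1 / sqrt (real N)) ^ (sum m (pairs n) + 1)"
      using mixed_moments[of m] by blast
    show "\<exists>C. \<forall>N::nat. N \<ge> 2 \<longrightarrow>
        (\<forall>(M :: 'a measure) (\<eta> :: nat \<times> nat \<Rightarrow> 'a \<Rightarrow> real).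
          centered_gaussian_family M (pairs n) \<eta> (eta_cov S \<beta> h D p q N) \<longrightarrow>
          \<bar>nu S \<beta> h D N n
              (\<lambda>\<sigma>. \<Prod>(k,l)\<in>pairs n. (overlap N \<sigma> k l - Qpq p q k l) ^ m (k,l))
           - (\<integral>x. (\<Prod>kl\<in>pairs n. \<eta> kl x ^ m kl) \<partial>M)\<bar>
          \<le> C * real N powr (- (real (\<Sum>kl\<in>pairs n. m kl) + 1) / 2))"
    proof (intro exI[of _ C] allI impI)
      fix N :: nat and M :: "'a measure" and \<eta>
      assume N: "2 \<le> N" and f: "centered_gaussian_family M (pairs n) \<eta> (eta_cov S \<beta> h D p q N)"
      have "1 / sqrt (real N) = real N powr (- (1 / 2))"
        using N by (simp add: powr_minus_divide powr_half_sqrt)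
      then have "(1 / sqrt (real N)) ^ (sum m (pairs n) + 1)
          = (real N powr (- (1 / 2))) powr real (sum m (pairs n) + 1)"
        using N by (simp only: powr_realpow powr_gt_zero)
      also have "\<dots> = real N powr (- (real (\<Sum>kl\<in>pairs n. m kl) + 1) / 2)"
        unfolding powr_powr by (rule arg_cong[where f="\<lambda>x. real N powr x"]) (simp add: field_simps)
      finally show "\<bar>nu S \<beta> h D N n
              (\<lambda>\<sigma>. \<Prod>(k,l)\<in>pairs n. (overlap N \<sigma> k l - Qpq p q k l) ^ m (k,l))
           - (\<integral>x. (\<Prod>kl\<in>pairs n. \<eta> kl x ^ m kl) \<partial>M)\<bar>
          \<le> C * real N powr (- (real (\<Sum>kl\<in>pairs n. m kl) + 1) / 2)"
        using C[OF N f] by (simp only: nu_eq_nuN split_def ov_def prod.collapse)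
    qed
  qed
qed

end
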